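(* Consider the two left $\mathcal{O}_q(\mathrm{SU}_3)$-covariant first-order almost complex structures $\Omega^1_q(\mathrm{F}_3)=\Omega^{(1,0)}\oplus\Omega^{(0,1)}$ corresponding to the decompositions $V^1=V^{(1,0)}\oplus V^{(0,1)}$ of the cotangent space given by (I) $V^{(1,0)}=\mathrm{span}\{e_{\alpha_1},e_{\alpha_2},e_{\alpha_1+\alpha_2}\}$, $V^{(0,1)}=\mathrm{span}\{f_{\alpha_1},f_{\alpha_2},f_{\alpha_1+\alpha_2}\}$; (II) $V^{(1,0)}=\mathrm{span}\{e_{\alpha_1},f_{\alpha_2},e_{\alpha_1+\alpha_2}\}$, $V^{(0,1)}=\mathrm{span}\{f_{\alpha_1},e_{\alpha_2},f_{\alpha_1+\alpha_2}\}$. Each of them extends to a factorisable almost complex structure on $\Omega^\bullet_q(\mathrm{F}_3)$.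
   Context: An almost complex structure for a $*$-differential calculus $\Omega^\bullet$ over $B$ is a $\mathbb{Z}_{\ge0}^2$-algebra grading $\Omega^{(\bullet,\bullet)}$ of $\Omega^\bullet$ with $\Omega^k=\bigoplus_{a+b=k}\Omega^{(a,b)}$ and $(\Omega^{(a,b)})^*=\Omega^{(b,a)}$. It is factorisable if the multiplication maps $\Omega^{(a,0)}\otimes_B\Omega^{(0,b)}\to\Omega^{(a,b)}$ and $\Omega^{(0,b)}\otimes_B\Omega^{(a,0)}\to\Omega^{(a,b)}$ are isomorphisms for all $a,b$. A first-order almost complex structure is a $B$-bimodule decomposition $\Omega^1=\Omega^{(1,0)}\oplus\Omega^{(0,1)}$ with $(\Omega^{(1,0)})^*=\Omega^{(0,1)}$; an almost complex structure extends it if its degree $(1,0)$ and $(0,1)$ parts are the given ones. Let $q\in\mathbb{R}\setminus\{-1,0,1\}$. Let $\Delta^+=\{\alpha_1,\alpha_2,\alpha_1+\alpha_2\}$ be the positive roots of $\mathfrak{sl}_3$, with Cartan matrix $a_{11}=a_{22}=2$, $a_{12}=a_{21}=-1$. $U_q(\mathfrak{sl}_3)$ is the complex algebra generated by $E_i,F_i,K_i^{\pm1}$ ($i=1,2$) with $K_iK_j=K_jK_i$, $K_iE_j=q^{a_{ij}}E_jK_i$, $K_iF_j=q^{-a_{ij}}F_jK_i$, $[E_i,F_j]=\delta_{ij}\frac{K_i-K_i^{-1}}{q-q^{-1}}$, and $E_i^2E_j-(q+q^{-1})E_iE_jE_i+E_jE_i^2=0$, $F_i^2F_j-(q+q^{-1})F_iF_jF_i+F_jF_i^2=0$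 for $i\ne j$. It is a Hopf $*$-algebra with $\Delta(E_i)=E_i\otimes K_i+1\otimes E_i$, $\Delta(F_i)=F_i\otimes1+K_i^{-1}\otimes F_i$, $\Delta(K_i)=K_i\otimes K_i$, $\varepsilon(E_i)=\varepsilon(F_i)=0$, $\varepsilon(K_i)=1$, $E_i^*=K_iF_i$, $F_i^*=E_iK_i^{-1}$, $K_i^*=K_i$. $A:=\mathcal{O}_q(\mathrm{SU}_3)$ is the Hopf subalgebra of the Hopf dual of $U_q(\mathfrak{sl}_3)$ generated by $u_{ij}$ ($1\le i,j\le3$), where $\Delta(u_{ij})=\sum_a u_{ia}\otimes u_{aj}$ and the only nonzero pairings of the $u_{ij}$ with the generators are $\langle E_1,u_{21}\rangle=\langle E_2,u_{32}\rangle=\langle F_1,u_{12}\rangle=\langle F_2,u_{23}\rangle=1$, $\langle K_i^{\pm1},u_{jj}\rangle=q^{\pm(\delta_{i,j-1}-\delta_{ij})}$. It is a Hopf $*$-algebra with $u_{ij}^*=S(u_{ji})$. Put $X\triangleright a:=a_{(1)}\langle X,a_{(2)}\rangle$. Then $B:=\mathcal{O}_q(\mathrm{F}_3):=\{b\in A: K_i^{\pm1}\triangleright b=b,\ i=1,2\}$. Put $E_{\alpha_i}:=E_i$, $E_{\alpha_1+\alpha_2}:=E_2E_1-q^{-1}E_1E_2$, $F_\gamma:=E_\gamma^*$, and $T:=\mathrm{span}_{\mathbb{C}}\{E_\gamma,F_\gamma:\gamma\in\Delta^+\}$. $T$ defines the left $A$-covariant $*$-first-order differential calculus $\Omega^1_q(\mathrm{SU}_3)=A\otimes\Lambda^1$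 over $A$: $\Lambda^1:=A^+/\{y\in A^+:X(y)=0\ \forall X\in T\}$ (with $A^+=\ker\varepsilon$) is a right $A$-module with basis $\{e_\gamma,f_\gamma\}$ dual to $\{E_\gamma,F_\gamma\}$, the bimodule structure is $a(b\otimes v)c=abc_{(1)}\otimes vc_{(2)}$, and $\mathrm{d}a=\sum_\gamma (E_\gamma\triangleright a)\otimes e_\gamma+(F_\gamma\triangleright a)\otimes f_\gamma$. $\Omega^1_q(\mathrm{F}_3)$ is its restriction to $B$ (the $B$-sub-bimodule generated by $\mathrm{d}b$, $b\in B$). Its cotangent space is $V^1:=B^+/\{y\in B^+:X(y)=0\ \forall X\in T\}\cong\Omega^1_q(\mathrm{F}_3)/B^+\Omega^1_q(\mathrm{F}_3)$, identified with $\Lambda^1$ via $[b]\mapsto[b]$; a decomposition of $V^1$ into right $B$-submodules and left $\pi_B(A)$-subcomodules ($\pi_B(A)=A/B^+A$) corresponds to the bimodule decomposition with $\Omega^{(i,j)}=A\square_{\pi_B(A)}V^{(i,j)}$ inside $\Omega^1_q(\mathrm{F}_3)=A\square_{\pi_B(A)}V^1$. $\Omega^\bullet_q(\mathrm{F}_3)$ is the maximal prolongation of $\Omega^1_q(\mathrm{F}_3)$: the quotient of the tensor algebra of the $B$-bimodule $\Omega^1_q(\mathrm{F}_3)$ by the two-sided ideal generated by all $\sum_i\mathrm{d}b_i\otimes\mathrm{d}c_i$ with $\sum_ib_i\,\mathrm{d}c_i=0$; it is a $*$-differential calculus, i.e. $*$ extends with $(\omega\wedge\eta)^*=(-1)^{kl}\eta^*\wedge\omega^*$,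 $\mathrm{d}(\omega^* )=(\mathrm{d}\omega)^*$. *)

theory Defs
  imports
    "HOL-Algebra.QuotRing"
    "HOL-Algebra.Generated_Groups"
    "HOL-Algebra.Free_Abelian_Groups"
    "HOL-Library.Function_Algebras"
    "HOL-Library.Product_Plus"
    "HOL-Library.Poly_Mapping"
    Complex_Main
begin

section \<open>Free algebras\<close>

datatype 'x fmon = FMon (letters: "'x list")

instantiation fmon :: (type) monoid_add
begin
definition zero_fmon :: "'a fmon" where "zero_fmon = FMon []"
definition plus_fmon :: "'a fmon \<Rightarrow> 'a fmon \<Rightarrow> 'a fmon"
  where "plus_fmon v w = FMon (letters v @ letters w)"
instance by standard (auto simp: zero_fmon_def plus_fmon_def)
end

text \<open>With the convolution product of \<^typ>\<open>'a \<Rightarrow>\<^sub>0 'b\<close>, finitely supported functions on the free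
  monoid form the free associative algebra. The free algebra on a set \<open>S\<close> of letters:\<close>

definition free_alg :: "'x set \<Rightarrow> ('x fmon \<Rightarrow>\<^sub>0 'k::ring_1) ring" where
  "free_alg S = \<lparr>carrier = {p. \<forall>w\<in>Poly_Mapping.keys p. set (letters w) \<subseteq> S},
     monoid.mult = (*), one = 1, ring.zero = 0, add = (+)\<rparr>"

definition letter :: "'x \<Rightarrow> 'x fmon \<Rightarrow>\<^sub>0 'k::ring_1" where
  "letter x = Poly_Mapping.single (FMon [x]) 1"

definition scal :: "'k \<Rightarrow> 'w::monoid_add \<Rightarrow>\<^sub>0 'k::ring_1" where
  "scal c = Poly_Mapping.single 0 c"

definition lin_extend ::
    "('k \<Rightarrow> 'k) \<Rightarrow> ('x list \<Rightarrow> ('w::monoid_add \<Rightarrow>\<^sub>0 'k)) \<Rightarrow> ('x fmon \<Rightarrow>\<^sub>0 'k::ring_1) \<Rightarrow> ('w \<Rightarrow>\<^sub>0 'k)" where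
  "lin_extend h f p =
     (\<Sum>w\<in>Poly_Mapping.keys p. scal (h (Poly_Mapping.lookup p w)) * f (letters w))"

section \<open>The Hopf $*$-algebra $U_q(\mathfrak{sl}_3)$\<close>

datatype smpl = One | Two

primrec num :: "smpl \<Rightarrow> nat" where
  "num One = 1"
| "num Two = 2"

definition cartan :: "smpl \<Rightarrow> smpl \<Rightarrow> int" where
  "cartan i j = (if i = j then 2 else -1)"

text \<open>\<open>gKi i\<close> stands for $K_i^{-1}$.\<close>

datatype gen = gE smpl | gF smpl | gK smpl | gKi smpl

type_synonym ufree = "gen fmon \<Rightarrow>\<^sub>0 complex"

abbreviation qc :: "real \<Rightarrow> int \<Rightarrow> ufree" where
  "qc q n \<equiv> scal (complex_of_real (q powi n))"

abbreviation UE :: "smpl \<Rightarrow> ufree" where "UE i \<equiv> letter (gE i)"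
abbreviation UF :: "smpl \<Rightarrow> ufree" where "UF i \<equiv> letter (gF i)"
abbreviation UK :: "smpl \<Rightarrow> ufree" where "UK i \<equiv> letter (gK i)"
abbreviation UKi :: "smpl \<Rightarrow> ufree" where "UKi i \<equiv> letter (gKi i)"

definition Uq_rels :: "real \<Rightarrow> ufree set" where
  "Uq_rels q =
     (\<Union>i. {UK i * UKi i - 1, UKi i * UK i - 1})
   \<union> (\<Union>i j. {UK i * UK j - UK j * UK i,
             UK i * UE j - qc q (cartan i j) * UE j * UK i,
             UK i * UF j - qc q (- cartan i j) * UF j * UK i,
             (UE i * UF j - UF j * UE i)
               - (if i = j then scal (complex_of_real (1 / (q - inverse q))) * (UK i - UKi i) else 0)})
   \<union> (\<Union>(i, j) \<in> {(i, j). i \<noteq> j}.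
            {UE i * UE i * UE j - scal (complex_of_real (q + inverse q)) * UE i * UE j * UE i + UE j * UE i * UE i,
             UF i * UF i * UF j - scal (complex_of_real (q + inverse q)) * UF i * UF j * UF i + UF j * UF i * UF i})"

text \<open>$U_q(\mathfrak{sl}_3)$ is the quotient of \<^typ>\<open>ufree\<close> by this two-sided ideal. The structure
  maps below are given on representatives, i.e.\ on the free algebra.\<close>

definition Uq_ideal :: "real \<Rightarrow> ufree set" where
  "Uq_ideal q = Idl\<^bsub>free_alg UNIV\<^esub> (Uq_rels q)"

primrec coprod_gen :: "gen \<Rightarrow> (gen fmon \<times> gen fmon \<Rightarrow>\<^sub>0 complex)" where
  "coprod_gen (gE i) = Poly_Mapping.single (FMon [gE i], FMon [gK i]) 1
                     + Poly_Mapping.single (0, FMon [gE i]) 1"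
| "coprod_gen (gF i) = Poly_Mapping.single (FMon [gF i], 0) 1
                     + Poly_Mapping.single (FMon [gKi i], FMon [gF i]) 1"
| "coprod_gen (gK i) = Poly_Mapping.single (FMon [gK i], FMon [gK i]) 1"
| "coprod_gen (gKi i) = Poly_Mapping.single (FMon [gKi i], FMon [gKi i]) 1"

definition Ucoprod :: "ufree \<Rightarrow> (gen fmon \<times> gen fmon \<Rightarrow>\<^sub>0 complex)" where
  "Ucoprod = lin_extend id (\<lambda>l. prod_list (map coprod_gen l))"

primrec counit_gen :: "gen \<Rightarrow> complex" where
  "counit_gen (gE i) = 0"
| "counit_gen (gF i) = 0"
| "counit_gen (gK i) = 1"
| "counit_gen (gKi i) = 1"

definition Ucounit :: "ufree \<Rightarrow> complex" where
  "Ucounit X = (\<Sum>w\<in>Poly_Mapping.keys X. Poly_Mapping.lookup X w * prod_list (map counit_gen (letters w)))"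

text \<open>The antipode is forced by the coproduct, e.g.\ $S(E_i)K_i + E_i = 0$.\<close>

primrec antipode_gen :: "gen \<Rightarrow> ufree" where
  "antipode_gen (gE i) = - (UE i * UKi i)"
| "antipode_gen (gF i) = - (UK i * UF i)"
| "antipode_gen (gK i) = UKi i"
| "antipode_gen (gKi i) = UK i"

definition Uantipode :: "ufree \<Rightarrow> ufree" where
  "Uantipode = lin_extend id (\<lambda>l. prod_list (map antipode_gen (rev l)))"

primrec star_gen :: "gen \<Rightarrow> ufree" where
  "star_gen (gE i) = UK i * UF i"
| "star_gen (gF i) = UE i * UKi i"
| "star_gen (gK i) = UK i"
| "star_gen (gKi i) = UKi i"

definition Ustar :: "ufree \<Rightarrow> ufree" where
  "Ustar = lin_extend cnj (\<lambda>l. prod_list (map star_gen (rev l)))"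

section \<open>The Hopf dual and $\mathcal{O}_q(\mathrm{SU}_3)$\<close>

text \<open>Linear functionals on $U_q(\mathfrak{sl}_3)$ are the linear functionals on the free algebra that
  vanish on the defining ideal; the pairing $\langle X, a\rangle$ is \<open>a X\<close>.\<close>

type_synonym ufun = "ufree \<Rightarrow> complex"

definition fscale :: "complex \<Rightarrow> ('a \<Rightarrow> complex) \<Rightarrow> 'a \<Rightarrow> complex" where
  "fscale c f = (\<lambda>x. c * f x)"

abbreviation cspan :: "('a \<Rightarrow> complex) set \<Rightarrow> ('a \<Rightarrow> complex) set" where
  "cspan \<equiv> module.span fscale"

definition Uq_dual :: "real \<Rightarrow> ufun set" where
  "Uq_dual q = {a. (\<forall>X Y. a (X + Y) = a X + a Y) \<and> (\<forall>c X. a (scal c * X) = c * a X) \<and>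
                   (\<forall>X\<in>Uq_ideal q. a X = 0)}"

text \<open>Tensor products of spaces of functionals are realised as spaces of functions of two variables,
  \<open>a \<otimes> b\<close> being the function \<open>(X, Y) \<mapsto> a X * b Y\<close>.\<close>

definition tens :: "('a \<Rightarrow> complex) \<Rightarrow> ('b \<Rightarrow> complex) \<Rightarrow> 'a \<times> 'b \<Rightarrow> complex" where
  "tens a b = (\<lambda>(X, Y). a X * b Y)"

definition tensor_space :: "('a \<Rightarrow> complex) set \<Rightarrow> ('b \<Rightarrow> complex) set \<Rightarrow> ('a \<times> 'b \<Rightarrow> complex) set" where
  "tensor_space P Q = cspan {tens a b |a b. a \<in> P \<and> b \<in> Q}"

definition coprod :: "ufun \<Rightarrow> ufree \<times> ufree \<Rightarrow> complex" where
  "coprod a = (\<lambda>(X, Y). a (X * Y))"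

definition conv :: "ufun \<Rightarrow> ufun \<Rightarrow> ufun" (infixl \<open>\<star>\<close> 70) where
  "a \<star> b = (\<lambda>X. \<Sum>(v, w)\<in>Poly_Mapping.keys (Ucoprod X).
      Poly_Mapping.lookup (Ucoprod X) (v, w) * a (Poly_Mapping.single v 1) * b (Poly_Mapping.single w 1))"

definition antipode :: "ufun \<Rightarrow> ufun" where
  "antipode a = (\<lambda>X. a (Uantipode X))"

definition Hopf_dual :: "real \<Rightarrow> ufun set" where
  "Hopf_dual q = {a \<in> Uq_dual q. coprod a \<in> tensor_space (Uq_dual q) (Uq_dual q)}"

definition Hopf_subalgebra :: "real \<Rightarrow> ufun set \<Rightarrow> bool" where
  "Hopf_subalgebra q H \<longleftrightarrow> H \<subseteq> Hopf_dual q \<and> Ucounit \<in> H \<and>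
     (\<forall>a\<in>H. \<forall>b\<in>H. a + b \<in> H \<and> a \<star> b \<in> H) \<and> (\<forall>c. \<forall>a\<in>H. fscale c a \<in> H) \<and>
     (\<forall>a\<in>H. antipode a \<in> H \<and> coprod a \<in> tensor_space H H)"

primrec u_gen :: "real \<Rightarrow> gen \<Rightarrow> nat \<Rightarrow> nat \<Rightarrow> complex" where
  "u_gen q (gE k) i j = (if i = num k + 1 \<and> j = num k then 1 else 0)"
| "u_gen q (gF k) i j = (if i = num k \<and> j = num k + 1 then 1 else 0)"
| "u_gen q (gK k) i j = (if i = j then complex_of_real (q powi (of_bool (num k + 1 = j) - of_bool (num k = j))) else 0)"
| "u_gen q (gKi k) i j = (if i = j then complex_of_real (q powi (- (of_bool (num k + 1 = j) - of_bool (num k = j)))) else 0)"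

primrec u_word :: "real \<Rightarrow> gen list \<Rightarrow> nat \<Rightarrow> nat \<Rightarrow> complex" where
  "u_word q [] i j = (if i = j then 1 else 0)"
| "u_word q (x # l) i j = (\<Sum>a\<in>{1..3}. u_gen q x i a * u_word q l a j)"

text \<open>$\Delta(u_{ij}) = \sum_a u_{ia}\otimes u_{aj}$ says that $u_{ij}$ is evaluated on a word of generators
  by matrix multiplication.\<close>

definition u :: "real \<Rightarrow> nat \<Rightarrow> nat \<Rightarrow> ufun" where
  "u q i j X = (\<Sum>w\<in>Poly_Mapping.keys X. Poly_Mapping.lookup X w * u_word q (letters w) i j)"

definition OSU3 :: "real \<Rightarrow> ufun set" where
  "OSU3 q = \<Inter> {H. Hopf_subalgebra q H \<and> (\<forall>i\<in>{1..3}. \<forall>j\<in>{1..3}. u q i j \<in> H)}"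

definition OSU3_star :: "real \<Rightarrow> ufun \<Rightarrow> ufun" where
  "OSU3_star q = (THE s. s \<in> extensional (OSU3 q) \<and> s \<in> OSU3 q \<rightarrow> OSU3 q \<and>
     (\<forall>a\<in>OSU3 q. \<forall>b\<in>OSU3 q. s (a + b) = s a + s b \<and> s (a \<star> b) = s b \<star> s a) \<and>
     (\<forall>c. \<forall>a\<in>OSU3 q. s (fscale c a) = fscale (cnj c) (s a)) \<and>
     (\<forall>a\<in>OSU3 q. s (s a) = a) \<and>
     (\<forall>i\<in>{1..3}. \<forall>j\<in>{1..3}. s (u q i j) = antipode (u q j i)))"

definition OSU3_aug :: "real \<Rightarrow> ufun set" where
  "OSU3_aug q = {a \<in> OSU3 q. a 1 = 0}"

definition lacts :: "ufree \<Rightarrow> ufun \<Rightarrow> ufun" (infixr \<open>\<rhd>\<close> 75) where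
  "X \<rhd> a = (\<lambda>Y. a (Y * X))"

section \<open>The quantum full flag manifold\<close>

definition OF3 :: "real \<Rightarrow> ufun set" where
  "OF3 q = {b \<in> OSU3 q. \<forall>i. UK i \<rhd> b = b \<and> UKi i \<rhd> b = b}"

definition OF3_aug :: "real \<Rightarrow> ufun set" where
  "OF3_aug q = {b \<in> OF3 q. b 1 = 0}"

definition OF3_ring :: "real \<Rightarrow> ufun ring" where
  "OF3_ring q = \<lparr>carrier = OF3 q, monoid.mult = (\<star>), one = Ucounit, ring.zero = 0, add = (+)\<rparr>"

datatype proot = R1 | R2 | R12

text \<open>\<open>ec \<gamma>\<close> and \<open>fc \<gamma>\<close> label both the tangent vectors $E_\gamma$, $F_\gamma$ and the dual basis
  $e_\gamma$, $f_\gamma$ of $\Lambda^1$.\<close>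

datatype cot = ec proot | fc proot

instance cot :: finite
proof
  have p: "(UNIV :: proot set) = {R1, R2, R12}" using proot.exhaust by blast
  have "(UNIV :: cot set) = range ec \<union> range fc" using cot.exhaust by blast
  moreover have "finite (UNIV :: proot set)" unfolding p by simp
  ultimately show "finite (UNIV :: cot set)" by (metis finite_Un finite_imageI)
qed

primrec Eroot :: "real \<Rightarrow> proot \<Rightarrow> ufree" where
  "Eroot q R1 = UE One"
| "Eroot q R2 = UE Two"
| "Eroot q R12 = UE Two * UE One - qc q (-1) * UE One * UE Two"

primrec tvec :: "real \<Rightarrow> cot \<Rightarrow> ufree" where
  "tvec q (ec \<gamma>) = Eroot q \<gamma>"
| "tvec q (fc \<gamma>) = Ustar (Eroot q \<gamma>)"

text \<open>Elements of $\Lambda^1 = A^+/\{y \mid X(y) = 0\ \forall X\in T\}$ are written in the basis dual to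
  \<^const>\<open>tvec\<close>, so that the class of \<open>y\<close> has coordinates \<open>y (tvec q \<gamma>)\<close>. Accordingly an element
  $\sum_\gamma \omega_\gamma\otimes e_\gamma$ of $A\otimes\Lambda^1$ is the coordinate function \<open>\<omega>\<close>.\<close>

type_synonym form1 = "cot \<Rightarrow> ufun"

definition coords :: "real \<Rightarrow> ufun \<Rightarrow> cot \<Rightarrow> complex" where
  "coords q y = (\<lambda>\<gamma>. y (tvec q \<gamma>))"

definition bvec :: "cot \<Rightarrow> cot \<Rightarrow> complex" where
  "bvec \<gamma> = (\<lambda>\<delta>. if \<delta> = \<gamma> then 1 else 0)"

text \<open>$[y]c = [yc]$; the choice of the representative is immaterial.\<close>

definition Lam_ract :: "real \<Rightarrow> (cot \<Rightarrow> complex) \<Rightarrow> ufun \<Rightarrow> cot \<Rightarrow> complex" where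
  "Lam_ract q v c = coords q ((SOME y. y \<in> OSU3_aug q \<and> coords q y = v) \<star> c)"

definition form_lact :: "ufun \<Rightarrow> form1 \<Rightarrow> form1" where
  "form_lact a \<omega> = (\<lambda>\<gamma>. a \<star> \<omega> \<gamma>)"

text \<open>$(b\otimes v)c = bc_{(1)}\otimes vc_{(2)}$, where $c_{(1)}\,m(c_{(2)})$ for a linear functional \<open>m\<close> is
  the function \<open>X \<mapsto> m (\<lambda>Y. c (X * Y))\<close>.\<close>

definition form_ract :: "real \<Rightarrow> form1 \<Rightarrow> ufun \<Rightarrow> form1" where
  "form_ract q \<omega> c = (\<lambda>\<delta>. \<Sum>\<gamma>\<in>UNIV. \<omega> \<gamma> \<star> (\<lambda>X. Lam_ract q (bvec \<gamma>) (\<lambda>Y. c (X * Y)) \<delta>))"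

definition form_d :: "real \<Rightarrow> ufun \<Rightarrow> form1" where
  "form_d q a = (\<lambda>\<gamma>. tvec q \<gamma> \<rhd> a)"

inductive_set Omega1_F3 :: "real \<Rightarrow> form1 set" for q where
  "b \<in> OF3 q \<Longrightarrow> form_d q b \<in> Omega1_F3 q"
| "\<omega> \<in> Omega1_F3 q \<Longrightarrow> \<eta> \<in> Omega1_F3 q \<Longrightarrow> \<omega> + \<eta> \<in> Omega1_F3 q"
| "b \<in> OF3 q \<Longrightarrow> \<omega> \<in> Omega1_F3 q \<Longrightarrow> form_lact b \<omega> \<in> Omega1_F3 q"
| "\<omega> \<in> Omega1_F3 q \<Longrightarrow> b \<in> OF3 q \<Longrightarrow> form_ract q \<omega> b \<in> Omega1_F3 q"

text \<open>$B^+A$, the kernel of $\pi_B : A \to \pi_B(A) = A/B^+A$.\<close>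

definition BpA :: "real \<Rightarrow> ufun set" where
  "BpA q = cspan {b \<star> a |b a. b \<in> OF3_aug q \<and> a \<in> OSU3 q}"

text \<open>The left coaction of $\pi_B(A)$ on $V^1$ is $[y]\mapsto \pi_B(y_{(1)})\otimes[y_{(2)}]$ for $y\in B^+$;
  \<open>V_coact q \<gamma> \<delta>\<close> represents the coefficient in $\pi_B(A)$ of the \<open>\<delta>\<close>-th basis vector in the coaction
  of the \<open>\<gamma>\<close>-th one, $\pi_B(y_{(1)})\,\langle X_\delta, y_{(2)}\rangle$.\<close>

definition V_coact :: "real \<Rightarrow> cot \<Rightarrow> cot \<Rightarrow> ufun" where
  "V_coact q \<gamma> \<delta> = tvec q \<delta> \<rhd> (SOME y. y \<in> OF3_aug q \<and> coords q y = bvec \<gamma>)"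

text \<open>The cotensor product $A\,\square_{\pi_B(A)} V$ for the span \<open>V\<close> of the basis vectors labelled by \<open>W\<close>:
  those $\omega\in A\otimes V$ whose images under the coactions of $A$ and of $V$ agree
  in $A\otimes\pi_B(A)\otimes V = (A\otimes A)/(A\otimes B^+A)\otimes V$.\<close>

definition cotensor :: "real \<Rightarrow> cot set \<Rightarrow> form1 set" where
  "cotensor q W = {\<omega>. (\<forall>\<gamma>. \<omega> \<gamma> \<in> OSU3 q) \<and> (\<forall>\<gamma>. \<gamma> \<notin> W \<longrightarrow> \<omega> \<gamma> = 0) \<and>
     (\<forall>\<delta>. coprod (\<omega> \<delta>) - (\<Sum>\<gamma>\<in>UNIV. tens (\<omega> \<gamma>) (V_coact q \<gamma> \<delta>)) \<in> tensor_space (OSU3 q) (BpA q))}"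

section \<open>Maximal prolongations\<close>

record ('b, 'm) fodc =
  base :: "'b ring"
  forms :: "'m set"
  lact :: "'b \<Rightarrow> 'm \<Rightarrow> 'm"
  ract :: "'m \<Rightarrow> 'b \<Rightarrow> 'm"
  diff :: "'b \<Rightarrow> 'm"

text \<open>The tensor algebra of the bimodule \<open>M = forms c\<close> over the ring \<open>B = base c\<close>, generated by \<open>B\<close> (letters
  \<^const>\<open>Inl\<close>) and \<open>M\<close> (letters \<^const>\<open>Inr\<close>) subject to the relations saying that \<open>B\<close> is mapped
  homomorphically and that the product of elements of \<open>B\<close> and \<open>M\<close> is the bimodule action. Its component
  $M^{\otimes_B k}$ is spanned by the words with exactly \<open>k\<close> letters from \<open>M\<close>; the component of
  degree \<open>0\<close> is \<open>B\<close>.\<close>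

abbreviation tensor_free :: "('b, 'm) fodc \<Rightarrow> (('b + 'm) fmon \<Rightarrow>\<^sub>0 int) ring" where
  "tensor_free c \<equiv> free_alg (carrier (base c) <+> forms c)"

definition tensor_rels :: "('b, 'm::ab_group_add) fodc \<Rightarrow> (('b + 'm) fmon \<Rightarrow>\<^sub>0 int) set" where
  "tensor_rels c =
     {letter (Inl \<one>\<^bsub>base c\<^esub>) - 1}
   \<union> {letter (Inl (x \<oplus>\<^bsub>base c\<^esub> y)) - (letter (Inl x) + letter (Inl y)) |x y.
        x \<in> carrier (base c) \<and> y \<in> carrier (base c)}
   \<union> {letter (Inl (x \<otimes>\<^bsub>base c\<^esub> y)) - letter (Inl x) * letter (Inl y) |x y.
        x \<in> carrier (base c) \<and> y \<in> carrier (base c)}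
   \<union> {letter (Inr (m + n)) - (letter (Inr m) + letter (Inr n)) |m n. m \<in> forms c \<and> n \<in> forms c}
   \<union> {letter (Inr (lact c x m)) - letter (Inl x) * letter (Inr m) |x m. x \<in> carrier (base c) \<and> m \<in> forms c}
   \<union> {letter (Inr (ract c m x)) - letter (Inr m) * letter (Inl x) |x m. x \<in> carrier (base c) \<and> m \<in> forms c}"

definition tensor_ideal :: "('b, 'm::ab_group_add) fodc \<Rightarrow> (('b + 'm) fmon \<Rightarrow>\<^sub>0 int) set" where
  "tensor_ideal c = Idl\<^bsub>tensor_free c\<^esub> (tensor_rels c)"

definition tensor_alg :: "('b, 'm::ab_group_add) fodc \<Rightarrow> (('b + 'm) fmon \<Rightarrow>\<^sub>0 int) set ring" where
  "tensor_alg c = tensor_free c Quot tensor_ideal c"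

definition tensor_class ::
    "('b, 'm::ab_group_add) fodc \<Rightarrow> (('b + 'm) fmon \<Rightarrow>\<^sub>0 int) \<Rightarrow> (('b + 'm) fmon \<Rightarrow>\<^sub>0 int) set" where
  "tensor_class c p = tensor_ideal c +>\<^bsub>tensor_free c\<^esub> p"

definition prolong_rels :: "('b, 'm::ab_group_add) fodc \<Rightarrow> (('b + 'm) fmon \<Rightarrow>\<^sub>0 int) set set" where
  "prolong_rels c =
     {finsum (tensor_alg c)
        (\<lambda>i. tensor_class c (letter (Inr (diff c (x i)))) \<otimes>\<^bsub>tensor_alg c\<^esub> tensor_class c (letter (Inr (diff c (y i)))))
        {..<n} |(n::nat) x y.
        (\<forall>i<n. x i \<in> carrier (base c) \<and> y i \<in> carrier (base c)) \<and>
        (\<Sum>i<n. lact c (x i) (diff c (y i))) = 0}"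

definition prolong_ideal :: "('b, 'm::ab_group_add) fodc \<Rightarrow> (('b + 'm) fmon \<Rightarrow>\<^sub>0 int) set set" where
  "prolong_ideal c = Idl\<^bsub>tensor_alg c\<^esub> (prolong_rels c)"

definition max_prol :: "('b, 'm::ab_group_add) fodc \<Rightarrow> (('b + 'm) fmon \<Rightarrow>\<^sub>0 int) set set ring" where
  "max_prol c = tensor_alg c Quot prolong_ideal c"

definition mp_class ::
    "('b, 'm::ab_group_add) fodc \<Rightarrow> (('b + 'm) fmon \<Rightarrow>\<^sub>0 int) \<Rightarrow> (('b + 'm) fmon \<Rightarrow>\<^sub>0 int) set set" where
  "mp_class c p = prolong_ideal c +>\<^bsub>tensor_alg c\<^esub> tensor_class c p"

definition mp0 :: "('b, 'm::ab_group_add) fodc \<Rightarrow> 'b \<Rightarrow> (('b + 'm) fmon \<Rightarrow>\<^sub>0 int) set set" where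
  "mp0 c x = mp_class c (letter (Inl x))"

definition mp1 :: "('b, 'm::ab_group_add) fodc \<Rightarrow> 'm \<Rightarrow> (('b + 'm) fmon \<Rightarrow>\<^sub>0 int) set set" where
  "mp1 c m = mp_class c (letter (Inr m))"

definition mp_deg :: "('b, 'm::ab_group_add) fodc \<Rightarrow> nat \<Rightarrow> (('b + 'm) fmon \<Rightarrow>\<^sub>0 int) set set set" where
  "mp_deg c k = mp_class c `
     {p \<in> carrier (tensor_free c). \<forall>w\<in>Poly_Mapping.keys p. length (filter (\<lambda>x. \<not> isl x) (letters w)) = k}"

text \<open>The $*$-structure of the maximal prolongation. Since it is generated by \<open>B\<close> and \<open>dB\<close>, these conditions
  determine it, and they imply $\mathrm{d}(\omega^*) = (\mathrm{d}\omega)^*$ in all degrees.\<close>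

definition mp_star :: "('b, 'm::ab_group_add) fodc \<Rightarrow> ('b \<Rightarrow> 'b) \<Rightarrow>
    (('b + 'm) fmon \<Rightarrow>\<^sub>0 int) set set \<Rightarrow> (('b + 'm) fmon \<Rightarrow>\<^sub>0 int) set set" where
  "mp_star c bstar = (THE s. s \<in> extensional (carrier (max_prol c)) \<and>
     s \<in> carrier (max_prol c) \<rightarrow> carrier (max_prol c) \<and>
     (\<forall>\<omega>\<in>carrier (max_prol c). \<forall>\<eta>\<in>carrier (max_prol c).
        s (\<omega> \<oplus>\<^bsub>max_prol c\<^esub> \<eta>) = s \<omega> \<oplus>\<^bsub>max_prol c\<^esub> s \<eta>) \<and>
     (\<forall>k l. \<forall>\<omega>\<in>mp_deg c k. \<forall>\<eta>\<in>mp_deg c l.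
        s (\<omega> \<otimes>\<^bsub>max_prol c\<^esub> \<eta>) = add_pow (max_prol c) ((-1) ^ (k * l) :: int) (s \<eta> \<otimes>\<^bsub>max_prol c\<^esub> s \<omega>)) \<and>
     (\<forall>x\<in>carrier (base c). s (mp0 c x) = mp0 c (bstar x) \<and>
        s (mp1 c (diff c x)) = mp1 c (diff c (bstar x))))"

section \<open>Almost complex structures\<close>

definition is_direct_sum :: "('a, 'z) ring_scheme \<Rightarrow> 'i set \<Rightarrow> ('i \<Rightarrow> 'a set) \<Rightarrow> 'a set \<Rightarrow> bool" where
  "is_direct_sum R I D P \<longleftrightarrow> (\<forall>i\<in>I. additive_subgroup (D i) R) \<and>
     bij_betw (\<lambda>x. finsum R x I) (Pi\<^sub>E I D) P"

text \<open>\<open>Om k\<close> is the component of degree \<open>k\<close>. Complex linearity of the components \<open>C (a, b)\<close> is automatic,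
  as the scalars lie in \<open>Om 0 = C (0, 0)\<close>.\<close>

definition almost_complex ::
    "('a, 'z) ring_scheme \<Rightarrow> (nat \<Rightarrow> 'a set) \<Rightarrow> ('a \<Rightarrow> 'a) \<Rightarrow> (nat \<times> nat \<Rightarrow> 'a set) \<Rightarrow> bool" where
  "almost_complex R Om star C \<longleftrightarrow>
     (\<forall>k. is_direct_sum R {(a, b). a + b = k} C (Om k)) \<and>
     \<one>\<^bsub>R\<^esub> \<in> C (0, 0) \<and>
     (\<forall>a b a' b'. \<forall>\<omega>\<in>C (a, b). \<forall>\<eta>\<in>C (a', b'). \<omega> \<otimes>\<^bsub>R\<^esub> \<eta> \<in> C (a + a', b + b')) \<and>
     (\<forall>a b. star ` C (a, b) = C (b, a))"

text \<open>The tensor product over a subring \<open>S\<close> of a right \<open>S\<close>-module \<open>P\<close> and a left \<open>S\<close>-module \<open>Q\<close> inside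
  the ring \<open>R\<close>.\<close>

definition bal_rels :: "('a, 'z) ring_scheme \<Rightarrow> 'a set \<Rightarrow> 'a set \<Rightarrow> 'a set \<Rightarrow> ('a \<times> 'a \<Rightarrow>\<^sub>0 int) set" where
  "bal_rels R S P Q =
     {frag_of (x \<oplus>\<^bsub>R\<^esub> x', y) - (frag_of (x, y) + frag_of (x', y)) |x x' y. x \<in> P \<and> x' \<in> P \<and> y \<in> Q}
   \<union> {frag_of (x, y \<oplus>\<^bsub>R\<^esub> y') - (frag_of (x, y) + frag_of (x, y')) |x y y'. x \<in> P \<and> y \<in> Q \<and> y' \<in> Q}
   \<union> {frag_of (x \<otimes>\<^bsub>R\<^esub> s, y) - frag_of (x, s \<otimes>\<^bsub>R\<^esub> y) |x s y. x \<in> P \<and> s \<in> S \<and> y \<in> Q}"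

definition bal_tensor ::
    "('a, 'z) ring_scheme \<Rightarrow> 'a set \<Rightarrow> 'a set \<Rightarrow> 'a set \<Rightarrow> ('a \<times> 'a \<Rightarrow>\<^sub>0 int) set monoid" where
  "bal_tensor R S P Q =
     free_Abelian_group (P \<times> Q) Mod generate (free_Abelian_group (P \<times> Q)) (bal_rels R S P Q)"

definition mult_map :: "('a, 'z) ring_scheme \<Rightarrow> ('a \<times> 'a \<Rightarrow>\<^sub>0 int) set \<Rightarrow> 'a" where
  "mult_map R t = the_elem
     ((\<lambda>z. finsum R (\<lambda>p. add_pow R (Poly_Mapping.lookup z p) (fst p \<otimes>\<^bsub>R\<^esub> snd p)) (Poly_Mapping.keys z)) ` t)"

definition factorisable :: "('a, 'z) ring_scheme \<Rightarrow> 'a set \<Rightarrow> (nat \<times> nat \<Rightarrow> 'a set) \<Rightarrow> bool" where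
  "factorisable R S C \<longleftrightarrow> (\<forall>a b.
     mult_map R \<in> iso (bal_tensor R S (C (a, 0)) (C (0, b))) ((add_monoid R)\<lparr>carrier := C (a, b)\<rparr>) \<and>
     mult_map R \<in> iso (bal_tensor R S (C (0, b)) (C (a, 0))) ((add_monoid R)\<lparr>carrier := C (a, b)\<rparr>))"

definition F3_fodc :: "real \<Rightarrow> (ufun, form1) fodc" where
  "F3_fodc q = \<lparr>base = OF3_ring q, forms = Omega1_F3 q, lact = form_lact, ract = form_ract q,
     diff = form_d q\<rparr>"

text \<open>The first-order structure determined by $V^{(1,0)}$, $V^{(0,1)}$, spanned by the basis vectors labelled by
  \<open>W10\<close> and \<open>W01\<close>, extends to a factorisable almost complex structure.\<close>

definition extends_to_factorisable :: "real \<Rightarrow> cot set \<Rightarrow> cot set \<Rightarrow> bool" where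
  "extends_to_factorisable q W10 W01 \<longleftrightarrow> (\<exists>C.
     almost_complex (max_prol (F3_fodc q)) (mp_deg (F3_fodc q)) (mp_star (F3_fodc q) (OSU3_star q)) C \<and>
     factorisable (max_prol (F3_fodc q)) (mp0 (F3_fodc q) ` OF3 q) C \<and>
     C (1, 0) = mp1 (F3_fodc q) ` cotensor q W10 \<and>
     C (0, 1) = mp1 (F3_fodc q) ` cotensor q W01)"

end

theory Submission
  imports Defs
begin

section \<open>Functionals on the free algebra\<close>

text \<open>All forms are written over A in the frame e_\<gamma>, f_\<gamma>. The algebra A is
  graded by weights under the K_i, B is its part of weight 0 (\<open>OF3_eq\<close>), and the
  one-forms of B are the combinations of letters e_d with coefficients of weight \<open>rt d\<close>
  (\<open>Omega1_eq\<close>, \<open>cotensor_eq\<close>). The grading is strong: 1 is a sum of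
  products x_i y_i with x_i of weight -l and y_i of weight l (\<open>strong\<close>). Inserting such
  sums between letters turns a formal expression a e_{d_1} ... e_{d_k} of total weight 0 into an
  element of the tensor algebra over B (\<open>LL\<close>).

  A letter moves past a coefficient by e_d a = \<Sum>_g \<open>Th d g a\<close> e_g, where
  \<open>Th\<close> is the right action of A up to a torus twist that is invisible on B. In this
  frame the relations of degree 2 in the maximal prolongation are governed by constants: their
  coefficient matrices are the solutions of 15 linear equations in 36 unknowns
  (\<open>RelF\<close>), and the solutions are stable under \<open>Th\<close>
  (\<open>RelF_stable\<close>). Relations satisfy the equations because differentiating \<Sum> b_k
  dc_k = 0 expresses the coefficients of \<Sum> db_k dc_k by second derivatives of the c_k
  (\<open>prolong_Leib\<close>), which obey the commutation and Serre relations of U_q(sl_3) on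
  elements of weight 0 (\<open>RelF_Xo\<close>). Conversely, 21 explicit elements of B have second
  derivatives at 1 that span the solutions (\<open>RelF_decomp\<close>), and the family a S(c_1),
  c_2 spreads these values at 1 over B (\<open>cop_family\<close>, \<open>LL_RelF\<close>).

  The resulting quadratic algebra is of exterior type. For a suitable order of the six letters,
  straightening reduces every word to ordered monomials without repetition
  (\<open>straighten\<close>), and the 64 ordered monomials are independent because explicit
  operators of left multiplication satisfy the relations (\<open>Lop_RelF\<close>,
  \<open>rho_NN\<close>). So the maximal prolongation is the direct sum, over the ordered monomials,
  of the weight spaces of their coefficients (\<open>normal_form\<close>, \<open>nf_mk\<close>).

  The order may begin with one letter from each pair e_\<gamma>, f_\<gamma>, chosen simultaneously
  for \<alpha>_1 and \<alpha>_1 + \<alpha>_2, since \<open>Th\<close> mixes only e_1 with e_12 and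
  f_1 with f_12. Counting the letters of the first and of the second half gives a bigrading
  (\<open>CC_eq\<close>, \<open>is_direct_sum_CC\<close>), and the star exchanges the two halves
  (\<open>Sta_CC\<close>). Since the normal form writes the first half on the left, multiplication
  from bidegrees (a,0) and (0,b) is an isomorphism; its inverse sends c e_S e_T to \<Sum>_i c e_S
  x_i \<otimes> y_i e_T (\<open>mult_map_CC\<close>). Exchanging the halves gives another admissible
  order, which yields the other tensor product (\<open>extends_WP\<close>).\<close>

datatype dual = Dual (ap: "gen list \<Rightarrow> complex")

lemma dual_eqI: "(\<And>w. ap a w = ap b w) \<Longrightarrow> a = b"
  by (cases a; cases b) auto

definition lsh :: "gen \<Rightarrow> dual \<Rightarrow> dual" where "lsh g a = Dual (\<lambda>w. ap a (g # w))"
definition rs :: "gen \<Rightarrow> dual \<Rightarrow> dual" where "rs g a = Dual (\<lambda>w. ap a (w @ [g]))"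

lemma ap_lsh [simp]: "ap (lsh g a) w = ap a (g # w)" by (simp add: lsh_def)
lemma ap_rs [simp]: "ap (rs g a) w = ap a (w @ [g])" by (simp add: rs_def)

text \<open>Multiplication is dual to the coproduct; a word is read letter by letter from the left.\<close>

fun mulw :: "gen list \<Rightarrow> dual \<Rightarrow> dual \<Rightarrow> complex" where
  "mulw [] a b = ap a [] * ap b []"
| "mulw (gE i # w) a b = mulw w (lsh (gE i) a) (lsh (gK i) b) + mulw w a (lsh (gE i) b)"
| "mulw (gF i # w) a b = mulw w (lsh (gF i) a) b + mulw w (lsh (gKi i) a) (lsh (gF i) b)"
| "mulw (gK i # w) a b = mulw w (lsh (gK i) a) (lsh (gK i) b)"
| "mulw (gKi i # w) a b = mulw w (lsh (gKi i) a) (lsh (gKi i) b)"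

instantiation dual :: "{zero, one, plus, minus, uminus, times}"
begin
definition zero_dual where "0 = Dual (\<lambda>w. 0)"
definition one_dual where "1 = Dual (\<lambda>w. prod_list (map counit_gen w))"
definition plus_dual where "a + b = Dual (\<lambda>w. ap a w + ap b w)"
definition minus_dual where "a - b = Dual (\<lambda>w. ap a w - ap b w)"
definition uminus_dual where "- a = Dual (\<lambda>w. - ap a w)"
definition times_dual where "a * b = Dual (\<lambda>w. mulw w a b)"
instance ..
end

definition scC :: "complex \<Rightarrow> dual \<Rightarrow> dual" (infixr \<open>*\<^sub>C\<close> 75) where
  "c *\<^sub>C a = Dual (\<lambda>w. c * ap a w)"

lemma ap_simps [simp]:
  "ap 0 w = 0" "ap 1 w = prod_list (map counit_gen w)" "ap (a + b) w = ap a w + ap b w"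
  "ap (a - b) w = ap a w - ap b w" "ap (- a) w = - ap a w" "ap (c *\<^sub>C a) w = c * ap a w"
  by (simp_all add: zero_dual_def one_dual_def plus_dual_def minus_dual_def uminus_dual_def scC_def)

lemma ap_times: "ap (a * b) w = mulw w a b"
  by (simp add: times_dual_def)

lemma ap_times_Nil [simp]: "ap (a * b) [] = ap a [] * ap b []"
  by (simp add: times_dual_def)

lemma lsh_lin [simp]:
  "lsh g 0 = 0" "lsh g (a + b) = lsh g a + lsh g b" "lsh g (a - b) = lsh g a - lsh g b"
  "lsh g (- a) = - lsh g a" "lsh g (c *\<^sub>C a) = c *\<^sub>C lsh g a"
  by (auto intro!: dual_eqI)

lemma rs_lin [simp]:
  "rs g 0 = 0" "rs g (a + b) = rs g a + rs g b" "rs g (a - b) = rs g a - rs g b"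
  "rs g (- a) = - rs g a" "rs g (c *\<^sub>C a) = c *\<^sub>C rs g a"
  by (auto intro!: dual_eqI)

lemma lsh_one [simp]:
  "lsh (gE i) 1 = 0" "lsh (gF i) 1 = 0" "lsh (gK i) 1 = 1" "lsh (gKi i) 1 = 1"
  by (auto intro!: dual_eqI)

lemma rs_one [simp]:
  "rs (gE i) 1 = 0" "rs (gF i) 1 = 0" "rs (gK i) 1 = 1" "rs (gKi i) 1 = 1"
  by (auto intro!: dual_eqI)

lemma lsh_rs: "lsh g (rs h a) = rs h (lsh g a)"
  by (auto intro!: dual_eqI)

lemma lsh_times:
  "lsh (gE i) (a * b) = lsh (gE i) a * lsh (gK i) b + a * lsh (gE i) b"
  "lsh (gF i) (a * b) = lsh (gF i) a * b + lsh (gKi i) a * lsh (gF i) b"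
  "lsh (gK i) (a * b) = lsh (gK i) a * lsh (gK i) b"
  "lsh (gKi i) (a * b) = lsh (gKi i) a * lsh (gKi i) b"
  by (auto intro!: dual_eqI simp: ap_times)

lemma gen_word_induct [case_names Nil E F K Ki]:
  assumes "P []" "\<And>i w. P w \<Longrightarrow> P (gE i # w)" "\<And>i w. P w \<Longrightarrow> P (gF i # w)"
    "\<And>i w. P w \<Longrightarrow> P (gK i # w)" "\<And>i w. P w \<Longrightarrow> P (gKi i # w)"
  shows "P w"
proof (induction w)
  case (Cons g w) then show ?case using assms by (cases g) auto
qed (rule assms)

lemma mulw_lin:
  "mulw w (a + a') b = mulw w a b + mulw w a' b" "mulw w a (b + b') = mulw w a b + mulw w a b'"
  "mulw w (c *\<^sub>C a) b = c * mulw w a b" "mulw w a (c *\<^sub>C b) = c * mulw w a b"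
  "mulw w 1 b = ap b w" "mulw w a 1 = ap a w"
  "mulw w 0 b = 0" "mulw w a 0 = 0"
  by (induction w arbitrary: a a' b b' rule: gen_word_induct) (auto simp: algebra_simps)

lemma dual_distrib:
  fixes a b c :: dual
  shows "(a + b) * c = a * c + b * c" "c * (a + b) = c * a + c * b"
  by (auto intro!: dual_eqI simp: ap_times mulw_lin)

lemma ap_Cons: "ap a (g # w) = ap (lsh g a) w" by simp

text \<open>Coassociativity on the generators, propagated through a word one letter at a time by
  \<open>lsh_times\<close>.\<close>

lemma dual_assoc: "((a :: dual) * b) * c = a * (b * c)"
proof (rule dual_eqI)
  fix w show "ap (a * b * c) w = ap (a * (b * c)) w"
  proof (induction w arbitrary: a b c rule: gen_word_induct)
    case (E i w) show ?case unfolding ap_Cons lsh_times by (simp add: E dual_distrib lsh_times)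
  next
    case (F i w) show ?case unfolding ap_Cons lsh_times by (simp add: F dual_distrib lsh_times)
  next
    case (K i w) show ?case unfolding ap_Cons lsh_times by (simp add: K)
  next
    case (Ki i w) show ?case unfolding ap_Cons lsh_times by (simp add: Ki)
  qed simp
qed

instance dual :: ring_1
proof
  fix a b c :: dual
  show "a + b + c = a + (b + c)" "a + b = b + a" "0 + a = a" "- a + a = 0" "a - b = a + - b"
    by (auto intro!: dual_eqI)
  show "1 * a = a" "a * 1 = a" by (auto intro!: dual_eqI simp del: ap_simps(2) simp: ap_times mulw_lin)
  show "a * b * c = a * (b * c)" by (rule dual_assoc)
  show "(a + b) * c = a * c + b * c" "a * (b + c) = a * b + a * c" by (rule dual_distrib)+
  have "ap (0::dual) [] \<noteq> ap 1 []" by simp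
  then show "(0::dual) \<noteq> 1" by metis
qed

lemma scC_simps [simp]:
  "(c *\<^sub>C a) * b = c *\<^sub>C (a * b)" "a * (c *\<^sub>C b) = c *\<^sub>C (a * b)" "c *\<^sub>C (d *\<^sub>C a) = (c * d) *\<^sub>C a"
  "1 *\<^sub>C a = a" "0 *\<^sub>C a = 0" "c *\<^sub>C 0 = 0" "c *\<^sub>C (- a) = - (c *\<^sub>C a)" "(- c) *\<^sub>C a = - (c *\<^sub>C a)"
  by (auto intro!: dual_eqI simp: ap_times mulw_lin)

lemma scC_distrib:
  "c *\<^sub>C (a + b) = c *\<^sub>C a + c *\<^sub>C b" "c *\<^sub>C (a - b) = c *\<^sub>C a - c *\<^sub>C b"
  "(c + d) *\<^sub>C a = c *\<^sub>C a + d *\<^sub>C a" "(c - d) *\<^sub>C a = c *\<^sub>C a - d *\<^sub>C a"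
  by (auto intro!: dual_eqI simp: algebra_simps)

lemma scC_sum: "c *\<^sub>C sum f A = (\<Sum>i\<in>A. c *\<^sub>C f i)"
  by (induction A rule: infinite_finite_induct) (auto simp: scC_distrib)

lemma scC_cancel: "c \<noteq> 0 \<Longrightarrow> c *\<^sub>C a = c *\<^sub>C b \<longleftrightarrow> a = b"
  by (metis scC_simps(3,4) left_inverse)

lemma scC_eq_0: "c *\<^sub>C a = 0 \<longleftrightarrow> c = 0 \<or> a = 0"
  by (metis scC_cancel scC_simps(5,6))

lemma scC_conv_mult: "c *\<^sub>C a = (c *\<^sub>C 1) * a" by simp

lemma rs_sum: "rs g (sum f A) = (\<Sum>i\<in>A. rs g (f i))"
  by (induction A rule: infinite_finite_induct) auto

lemma lsh_sum: "lsh g (sum f A) = (\<Sum>i\<in>A. lsh g (f i))"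
  by (induction A rule: infinite_finite_induct) auto

lemma ap_sum: "ap (sum f A) w = (\<Sum>i\<in>A. ap (f i) w)"
  by (induction A rule: infinite_finite_induct) auto

text \<open>The coproduct is an algebra map, so splitting off the last letter of a word obeys the
  same rules as splitting off the first.\<close>

lemma rs_times [simp]:
  "rs (gE i) (a * b) = rs (gE i) a * rs (gK i) b + a * rs (gE i) b"
  "rs (gF i) (a * b) = rs (gF i) a * b + rs (gKi i) a * rs (gF i) b"
  "rs (gK i) (a * b) = rs (gK i) a * rs (gK i) b"
  "rs (gKi i) (a * b) = rs (gKi i) a * rs (gKi i) b"
proof -
  have "\<forall>a b. mulw (w @ [gE i]) a b = ap (rs (gE i) a * rs (gK i) b + a * rs (gE i) b) w \<and>
     mulw (w @ [gF i]) a b = ap (rs (gF i) a * b + rs (gKi i) a * rs (gF i) b) w \<and>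
     mulw (w @ [gK i]) a b = ap (rs (gK i) a * rs (gK i) b) w \<and>
     mulw (w @ [gKi i]) a b = ap (rs (gKi i) a * rs (gKi i) b) w" for w
    by (induction w rule: gen_word_induct) (auto simp: ap_times lsh_rs algebra_simps)
  then show
    "rs (gE i) (a * b) = rs (gE i) a * rs (gK i) b + a * rs (gE i) b"
    "rs (gF i) (a * b) = rs (gF i) a * b + rs (gKi i) a * rs (gF i) b"
    "rs (gK i) (a * b) = rs (gK i) a * rs (gK i) b"
    "rs (gKi i) (a * b) = rs (gKi i) a * rs (gKi i) b"
    by (auto intro!: dual_eqI simp: ap_times)
qed

abbreviation Ea :: "smpl \<Rightarrow> dual \<Rightarrow> dual" where "Ea i \<equiv> rs (gE i)"
abbreviation Fa :: "smpl \<Rightarrow> dual \<Rightarrow> dual" where "Fa i \<equiv> rs (gF i)"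
abbreviation Ka :: "smpl \<Rightarrow> dual \<Rightarrow> dual" where "Ka i \<equiv> rs (gK i)"
abbreviation Kia :: "smpl \<Rightarrow> dual \<Rightarrow> dual" where "Kia i \<equiv> rs (gKi i)"

locale qparam =
  fixes q :: real
  assumes q_ne: "q \<notin> {-1, 0, 1}"
begin

section \<open>Functionals vanishing on the defining ideal\<close>

definition Q :: complex where "Q = complex_of_real q"

lemma Q_ne [simp]: "Q \<noteq> 0" "Q \<noteq> 1" "Q \<noteq> -1"
proof -
  have "complex_of_real q \<noteq> complex_of_real (-1)" using q_ne by (subst of_real_eq_iff) auto
  then show "Q \<noteq> -1" by (simp add: Q_def)
qed (use q_ne in \<open>auto simp: Q_def\<close>)

lemma cnj_Q [simp]: "cnj Q = Q" by (simp add: Q_def)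

lemma Q2_ne [simp]: "Q\<^sup>2 \<noteq> 1" "Q * Q \<noteq> 1"
  by (auto simp: power2_eq_1_iff simp flip: power2_eq_square)

lemma Q_powi_of_real: "complex_of_real (q powi n) = Q powi n"
  by (simp add: Q_def of_real_power_int)

text \<open>Absolute values separate the powers, since |q| is neither 0 nor 1. Distinct weights
  therefore have distinct eigenvalues of the K_i.\<close>

lemma Q_powi_inj: "Q powi m = Q powi n \<longleftrightarrow> m = n"
proof
  assume h: "Q powi m = Q powi n"
  have a: "\<bar>q\<bar> > 0" "\<bar>q\<bar> \<noteq> 1" using q_ne by (auto simp: abs_if split: if_splits)
  have "norm (Q powi m) = norm (Q powi n)" using h by simp
  then have "\<bar>q\<bar> powi m = \<bar>q\<bar> powi n" by (simp add: Q_def norm_power_int)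
  then have "\<bar>q\<bar> powr m = \<bar>q\<bar> powr n" using a by (simp add: powr_real_of_int')
  then show "m = n" using a by (simp add: powr_inj)
qed simp

definition kap :: complex where "kap = complex_of_real (1 / (q - inverse q))"
definition two :: complex where "two = complex_of_real (q + inverse q)"

lemma kap_eq: "kap = 1 / (Q - inverse Q)" and two_eq: "two = Q + inverse Q"
  by (simp_all add: kap_def two_def Q_def)

text \<open>The relations of U_q(sl_3) as operators on functionals through X \<rhd> a, so that
  products become compositions and no ideal has to be handled.\<close>

definition Rels :: "(dual \<Rightarrow> dual) set" where
  "Rels = (\<Union>i. {\<lambda>a. Ka i (Kia i a) - a, \<lambda>a. Kia i (Ka i a) - a}) \<union>
    (\<Union>i j. {\<lambda>a. Ka i (Ka j a) - Ka j (Ka i a),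
       \<lambda>a. Ka i (Ea j a) - (Q powi cartan i j) *\<^sub>C Ea j (Ka i a),
       \<lambda>a. Ka i (Fa j a) - (Q powi (- cartan i j)) *\<^sub>C Fa j (Ka i a),
       \<lambda>a. Ea i (Fa j a) - Fa j (Ea i a) - (if i = j then kap *\<^sub>C (Ka i a - Kia i a) else 0)}) \<union>
    (\<Union>(i, j)\<in>{(i, j). i \<noteq> j}.
      {\<lambda>a. Ea i (Ea i (Ea j a)) - two *\<^sub>C Ea i (Ea j (Ea i a)) + Ea j (Ea i (Ea i a)),
       \<lambda>a. Fa i (Fa i (Fa j a)) - two *\<^sub>C Fa i (Fa j (Fa i a)) + Fa j (Fa i (Fa i a))})"

definition REL :: "dual \<Rightarrow> bool" where "REL a \<longleftrightarrow> (\<forall>r\<in>Rels. r a = 0)"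

lemma Rels_lin: "r \<in> Rels \<Longrightarrow> r (a + b) = r a + r b" "r \<in> Rels \<Longrightarrow> r (c *\<^sub>C a) = c *\<^sub>C r a"
  unfolding Rels_def by (auto simp: scC_distrib algebra_simps)

lemma REL_iff:
  "REL a \<longleftrightarrow> (\<forall>i. Ka i (Kia i a) = a \<and> Kia i (Ka i a) = a) \<and>
    (\<forall>i j. Ka i (Ka j a) = Ka j (Ka i a) \<and>
      Ka i (Ea j a) = (Q powi cartan i j) *\<^sub>C Ea j (Ka i a) \<and>
      Ka i (Fa j a) = (Q powi (- cartan i j)) *\<^sub>C Fa j (Ka i a) \<and>
      Ea i (Fa j a) - Fa j (Ea i a) = (if i = j then kap *\<^sub>C (Ka i a - Kia i a) else 0) \<and>
      (i \<noteq> j \<longrightarrow>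
        Ea i (Ea i (Ea j a)) - two *\<^sub>C Ea i (Ea j (Ea i a)) + Ea j (Ea i (Ea i a)) = 0 \<and>
        Fa i (Fa i (Fa j a)) - two *\<^sub>C Fa i (Fa j (Fa i a)) + Fa j (Fa i (Fa i a)) = 0))"
  unfolding REL_def Rels_def by (simp add: ball_Un all_conj_distrib)

definition rsw :: "gen list \<Rightarrow> dual \<Rightarrow> dual" where "rsw w a = Dual (\<lambda>v. ap a (v @ w))"

lemma rsw_Nil [simp]: "rsw [] a = a" by (simp add: rsw_def)
lemma rsw_Cons [simp]: "rsw (g # w) a = rs g (rsw w a)" by (auto intro!: dual_eqI simp: rsw_def)
lemma rsw_rs: "rsw w (rs g a) = rsw (w @ [g]) a" by (auto intro!: dual_eqI simp: rsw_def)

text \<open>Quantifying over all shifts \<open>rsw w a\<close> makes a vanish on v r w for all words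
  v, w and all relations r, that is, on the whole two-sided ideal.\<close>

definition UU :: "dual set" where "UU = {a. \<forall>w. REL (rsw w a)}"

lemma UU_REL: "a \<in> UU \<Longrightarrow> REL a" unfolding UU_def by (metis mem_Collect_eq rsw_Nil)

lemma UU_rs [simp]: "a \<in> UU \<Longrightarrow> rs g a \<in> UU" unfolding UU_def by (simp add: rsw_rs)

lemma UUI: assumes "a \<in> Z" "\<And>z. z \<in> Z \<Longrightarrow> REL z" "\<And>z g. z \<in> Z \<Longrightarrow> rs g z \<in> Z" shows "a \<in> UU"
proof -
  have "rsw w a \<in> Z" for w by (induction w) (auto simp: assms)
  then show ?thesis by (auto simp: UU_def assms(2))
qed

lemma REL_add: "REL a \<Longrightarrow> REL b \<Longrightarrow> REL (a + b)" and REL_scale: "REL a \<Longrightarrow> REL (c *\<^sub>C a)"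
  by (auto simp: REL_def Rels_lin)

lemma UU_K:
  assumes "a \<in> UU"
  shows "Ka i (Kia i a) = a" "Kia i (Ka i a) = a" "Ka i (Ka j a) = Ka j (Ka i a)"
    "Ka i (Ea j a) = (Q powi cartan i j) *\<^sub>C Ea j (Ka i a)"
    "Ka i (Fa j a) = (Q powi (- cartan i j)) *\<^sub>C Fa j (Ka i a)"
    "Kia i (Ea j a) = (Q powi (- cartan i j)) *\<^sub>C Ea j (Kia i a)"
    "Kia i (Fa j a) = (Q powi cartan i j) *\<^sub>C Fa j (Kia i a)"
    "Kia i (Ka j a) = Ka j (Kia i a)" "Kia i (Kia j a) = Kia j (Kia i a)"
proof -
  have R: "REL b" if "b \<in> UU" for b using that by (rule UU_REL)
  have 1: "Ka i (Kia i b) = b" "Kia i (Ka i b) = b" if "b \<in> UU" for b i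
    using R[OF that] by (auto simp: REL_iff)
  have 2: "Ka i (Ka j b) = Ka j (Ka i b)" "Ka i (Ea j b) = (Q powi cartan i j) *\<^sub>C Ea j (Ka i b)"
    "Ka i (Fa j b) = (Q powi (- cartan i j)) *\<^sub>C Fa j (Ka i b)" if "b \<in> UU" for b i j
    using R[OF that] unfolding REL_iff by blast+
  show "Ka i (Kia i a) = a" "Kia i (Ka i a) = a" "Ka i (Ka j a) = Ka j (Ka i a)"
    "Ka i (Ea j a) = (Q powi cartan i j) *\<^sub>C Ea j (Ka i a)"
    "Ka i (Fa j a) = (Q powi (- cartan i j)) *\<^sub>C Fa j (Ka i a)"
    using 1 2 assms by auto
  have "Kia i (Ka i (Ea j (Kia i a))) = (Q powi cartan i j) *\<^sub>C Kia i (Ea j (Ka i (Kia i a)))"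
    using 2(2)[of "Kia i a" i j] assms by simp
  then have "Ea j (Kia i a) = (Q powi cartan i j) *\<^sub>C Kia i (Ea j a)" using 1 assms by simp
  then show "Kia i (Ea j a) = (Q powi (- cartan i j)) *\<^sub>C Ea j (Kia i a)"
    by (simp add: power_int_minus)
  have "Kia i (Ka i (Fa j (Kia i a))) = (Q powi (- cartan i j)) *\<^sub>C Kia i (Fa j (Ka i (Kia i a)))"
    using 2(3)[of "Kia i a" i j] assms by simp
  then have "Fa j (Kia i a) = (Q powi (- cartan i j)) *\<^sub>C Kia i (Fa j a)" using 1 assms by simp
  then show "Kia i (Fa j a) = (Q powi cartan i j) *\<^sub>C Fa j (Kia i a)"
    by (simp add: power_int_minus)
  have A: "Kia i (Ka j b) = Ka j (Kia i b)" if "b \<in> UU" for b i j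
    by (metis 1 2(1) UU_rs that)
  show "Kia i (Ka j a) = Ka j (Kia i a)" using A assms by auto
  show "Kia i (Kia j a) = Kia j (Kia i a)" by (metis 1 A UU_rs assms)
qed

lemma UU_EF:
  assumes "a \<in> UU"
  shows "Ea i (Fa i a) = Fa i (Ea i a) + kap *\<^sub>C (Ka i a - Kia i a)"
    "i \<noteq> j \<Longrightarrow> Ea i (Fa j a) = Fa j (Ea i a)"
proof -
  have *: "Ea i (Fa j a) - Fa j (Ea i a) = (if i = j then kap *\<^sub>C (Ka i a - Kia i a) else 0)" for i j
    using UU_REL[OF assms] unfolding REL_iff by blast
  show "Ea i (Fa i a) = Fa i (Ea i a) + kap *\<^sub>C (Ka i a - Kia i a)" using *[of i i] by (simp add: diff_eq_eq add.commute)
  show "i \<noteq> j \<Longrightarrow> Ea i (Fa j a) = Fa j (Ea i a)" using *[of i j] by simp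
qed

lemma UU_Serre:
  assumes "a \<in> UU" "i \<noteq> j"
  shows "Ea i (Ea i (Ea j a)) = two *\<^sub>C Ea i (Ea j (Ea i a)) - Ea j (Ea i (Ea i a))"
    "Fa i (Fa i (Fa j a)) = two *\<^sub>C Fa i (Fa j (Fa i a)) - Fa j (Fa i (Fa i a))"
proof -
  have *: "x = t - y" if "x - t + y = 0" for x t y :: dual
    using that by (simp add: algebra_simps eq_diff_eq)
  show "Ea i (Ea i (Ea j a)) = two *\<^sub>C Ea i (Ea j (Ea i a)) - Ea j (Ea i (Ea i a))"
    "Fa i (Fa i (Fa j a)) = two *\<^sub>C Fa i (Fa j (Fa i a)) - Fa j (Fa i (Fa i a))"
    using UU_REL[OF assms(1)] assms(2) unfolding REL_iff by (blast intro: *)+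
qed

text \<open>The Serre elements are skew-primitive modulo the relations of the K_i: in the expanded
  Leibniz rule all mixed terms cancel by the choice of the coefficient q + 1/q.\<close>

lemma Serre_times:
  assumes "a \<in> UU" "b \<in> UU" "i \<noteq> j"
  shows "Ea i (Ea i (Ea j (a * b))) - two *\<^sub>C Ea i (Ea j (Ea i (a * b))) + Ea j (Ea i (Ea i (a * b))) = 0"
    "Fa i (Fa i (Fa j (a * b))) - two *\<^sub>C Fa i (Fa j (Fa i (a * b))) + Fa j (Fa i (Fa i (a * b))) = 0"
proof -
  have c: "cartan i j = -1" "cartan j i = -1" "cartan i i = 2" "cartan j j = 2"
    using assms(3) by (auto simp: cartan_def)
  note K = UU_K(4-7) UU_K(3)[of _ j i] UU_K(9)[of _ j i] UU_Serre[OF _ assms(3)]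
  show "Ea i (Ea i (Ea j (a * b))) - two *\<^sub>C Ea i (Ea j (Ea i (a * b))) + Ea j (Ea i (Ea i (a * b))) = 0"
    using assms(1,2) by (simp add: K c distrib_left distrib_right)
      (rule dual_eqI, simp add: two_eq power_int_minus field_simps power2_eq_square)
  show "Fa i (Fa i (Fa j (a * b))) - two *\<^sub>C Fa i (Fa j (Fa i (a * b))) + Fa j (Fa i (Fa i (a * b))) = 0"
    using assms(1,2) by (simp add: K c distrib_left distrib_right)
      (rule dual_eqI, simp add: two_eq power_int_minus field_simps power2_eq_square)
qed

lemma REL_times: assumes "a \<in> UU" "b \<in> UU" shows "REL (a * b)"
proof -
  have "Ea i (Fa j (a * b)) - Fa j (Ea i (a * b)) = (if i = j then kap *\<^sub>C (Ka i (a * b) - Kia i (a * b)) else 0)" for i j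
  proof (cases "i = j")
    case True
    show ?thesis using assms True by (simp add: UU_K UU_EF(1) cartan_def scC_distrib algebra_simps power_int_minus)
  next
    case False
    show ?thesis using assms False by (simp add: UU_K UU_EF(2) cartan_def algebra_simps power_int_minus)
  qed
  moreover have "Ka i (Ka j (a * b)) = Ka j (Ka i (a * b))" "Ka i (Kia i (a * b)) = a * b" "Kia i (Ka i (a * b)) = a * b"
     "Ka i (Ea j (a * b)) = (Q powi cartan i j) *\<^sub>C Ea j (Ka i (a * b))"
     "Ka i (Fa j (a * b)) = (Q powi (- cartan i j)) *\<^sub>C Fa j (Ka i (a * b))" for i j
    using assms UU_K(3)[of a i j] UU_K(3)[of b i j] UU_K(8)[of a j i] by (simp_all add: UU_K(1,2,4,5) scC_distrib)
  ultimately show ?thesis unfolding REL_iff using Serre_times[OF assms] by blast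
qed

lemma REL_one: "REL 1" unfolding REL_iff by simp

inductive_set USpan :: "dual set \<Rightarrow> dual set" for S where
  base: "a \<in> S \<Longrightarrow> a \<in> USpan S"
| zero: "0 \<in> USpan S"
| add: "a \<in> USpan S \<Longrightarrow> b \<in> USpan S \<Longrightarrow> a + b \<in> USpan S"
| scale: "a \<in> USpan S \<Longrightarrow> c *\<^sub>C a \<in> USpan S"

lemma REL_zero: "REL 0" unfolding REL_iff by simp

text \<open>Membership in \<open>UU\<close> of a whole span that is closed under the action only has
  to be tested on the spanning set.\<close>

lemma USpan_UU:
  assumes "\<And>s. s \<in> S \<Longrightarrow> REL s" "\<And>s g. s \<in> S \<Longrightarrow> rs g s \<in> USpan S" "a \<in> USpan S"
  shows "a \<in> UU"
proof (rule UUI[OF assms(3)])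
  show "REL z" if "z \<in> USpan S" for z
    using that by induction (auto simp: assms REL_zero REL_add REL_scale)
  show "rs g z \<in> USpan S" if "z \<in> USpan S" for z g
    using that by induction (auto simp: assms intro: USpan.intros)
qed

lemma UU_lin [simp]:
  assumes "a \<in> UU" "b \<in> UU" shows "a + b \<in> UU" "c *\<^sub>C a \<in> UU" "a * b \<in> UU"
proof -
  have U: "x \<in> UU" if "x \<in> USpan UU" for x
    using that by (rule USpan_UU[rotated 2]) (simp_all add: UU_REL USpan.base)
  show "a + b \<in> UU" "c *\<^sub>C a \<in> UU"
    by (rule U, simp add: assms USpan.add USpan.scale USpan.base)+
  let ?S = "{a * b |a b. a \<in> UU \<and> b \<in> UU}"
  show "a * b \<in> UU"
  proof (rule USpan_UU[of ?S])
    show "a * b \<in> USpan ?S" using assms by (auto intro: USpan.base)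
    fix s assume "s \<in> ?S"
    then obtain x y where xy: "s = x * y" "x \<in> UU" "y \<in> UU" by auto
    show "REL s" using xy REL_times by simp
    fix g show "rs g s \<in> USpan ?S"
    proof (cases g)
      case (gE i)
      have "rs g s = Ea i x * Ka i y + x * Ea i y" using gE xy by simp
      moreover have "Ea i x * Ka i y \<in> ?S" "x * Ea i y \<in> ?S" using xy UU_rs by blast+
      ultimately show ?thesis by (simp add: USpan.base USpan.add)
    next
      case (gF i)
      have "rs g s = Fa i x * y + Kia i x * Fa i y" using gF xy by simp
      moreover have "Fa i x * y \<in> ?S" "Kia i x * Fa i y \<in> ?S" using xy UU_rs by blast+
      ultimately show ?thesis by (simp add: USpan.base USpan.add)
    next
      case (gK i)
      have "rs g s = Ka i x * Ka i y" using gK xy by simp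
      moreover have "Ka i x * Ka i y \<in> ?S" using xy UU_rs by blast
      ultimately show ?thesis by (simp add: USpan.base)
    next
      case (gKi i)
      have "rs g s = Kia i x * Kia i y" using gKi xy by simp
      moreover have "Kia i x * Kia i y \<in> ?S" using xy UU_rs by blast
      ultimately show ?thesis by (simp add: USpan.base)
    qed
  qed
qed

lemma UU_0 [simp]: "0 \<in> UU" "1 \<in> UU"
proof -
  show "1 \<in> UU"
  proof (rule USpan_UU[of "{1}"])
    fix s g assume "s \<in> {1::dual}" then show "rs g s \<in> USpan {1}" by (cases g) (auto intro: USpan.intros)
  qed (auto intro: USpan.intros REL_one)
  from UU_lin(2)[OF this this, of 0] show "0 \<in> UU" by simp
qed

lemma UU_diff [simp]: "a \<in> UU \<Longrightarrow> b \<in> UU \<Longrightarrow> a - b \<in> UU" "a \<in> UU \<Longrightarrow> - a \<in> UU"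
  using UU_lin(1)[of a "(-1) *\<^sub>C b"] UU_lin(2)[of a a "-1"] UU_lin(2)[of b b "-1"] by auto

lemma UU_sum: "(\<And>i. i \<in> I \<Longrightarrow> f i \<in> UU) \<Longrightarrow> sum f I \<in> UU"
  by (induction I rule: infinite_finite_induct) auto

end

context qparam
begin

section \<open>Matrix coefficients\<close>

datatype ix = i1 | i2 | i3

primrec nx :: "ix \<Rightarrow> nat" where "nx i1 = 1" | "nx i2 = 2" | "nx i3 = 3"

definition ud :: "ix \<Rightarrow> ix \<Rightarrow> dual" where "ud i j = Dual (\<lambda>w. u_word q w (nx i) (nx j))"

lemma sum13: "(\<Sum>a\<in>{1..3::nat}. f a) = f (nx i1) + f (nx i2) + f (nx i3)"
proof -
  have "{1..3::nat} = {1, 2, 3}" by auto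
  then show ?thesis by (simp add: add.assoc)
qed

lemma nx_eq [simp]: "nx i = nx j \<longleftrightarrow> i = j" by (cases i; cases j) auto

lemma ap_ud_Nil [simp]: "ap (ud i j) [] = (if i = j then 1 else 0)" by (simp add: ud_def)

lemma ap_ud_Cons: "ap (ud i j) (g # w) = u_gen q g (nx i) (nx i1) * ap (ud i1 j) w +
    u_gen q g (nx i) (nx i2) * ap (ud i2 j) w + u_gen q g (nx i) (nx i3) * ap (ud i3 j) w"
  unfolding ud_def by (simp only: dual.sel u_word.simps sum13)

lemma ap_ud_snoc: "ap (ud i j) (w @ [g]) = ap (ud i i1) w * u_gen q g (nx i1) (nx j) +
    ap (ud i i2) w * u_gen q g (nx i2) (nx j) + ap (ud i i3) w * u_gen q g (nx i3) (nx j)"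
proof (induction w arbitrary: i)
  case Nil
  show ?case by (cases i; cases j; simp add: ap_ud_Cons del: u_gen.simps nx.simps)
next
  case (Cons a w)
  show ?case unfolding append.simps ap_ud_Cons Cons by (simp only: algebra_simps)
qed

lemma u_gen_simps:
  "u_gen q (gE k) (nx i) (nx j) = (if (k = One \<and> i = i2 \<and> j = i1) \<or> (k = Two \<and> i = i3 \<and> j = i2) then 1 else 0)"
  "u_gen q (gF k) (nx i) (nx j) = (if (k = One \<and> i = i1 \<and> j = i2) \<or> (k = Two \<and> i = i2 \<and> j = i3) then 1 else 0)"
  "u_gen q (gK k) (nx i) (nx j) = (if i \<noteq> j then 0 else
     case (k, i) of (One, i1) \<Rightarrow> inverse Q | (One, i2) \<Rightarrow> Q | (Two, i2) \<Rightarrow> inverse Q | (Two, i3) \<Rightarrow> Q | _ \<Rightarrow> 1)"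
  "u_gen q (gKi k) (nx i) (nx j) = (if i \<noteq> j then 0 else
     case (k, i) of (One, i1) \<Rightarrow> Q | (One, i2) \<Rightarrow> inverse Q | (Two, i2) \<Rightarrow> Q | (Two, i3) \<Rightarrow> inverse Q | _ \<Rightarrow> 1)"
  by (cases k; cases i; cases j; simp add: Q_def power_int_minus)+

lemma rs_ud [simp]:
  "Ea One (ud i j) = (if j = i1 then ud i i2 else 0)" "Ea Two (ud i j) = (if j = i2 then ud i i3 else 0)"
  "Fa One (ud i j) = (if j = i2 then ud i i1 else 0)" "Fa Two (ud i j) = (if j = i3 then ud i i2 else 0)"
  "Ka One (ud i j) = (case j of i1 \<Rightarrow> inverse Q | i2 \<Rightarrow> Q | i3 \<Rightarrow> 1) *\<^sub>C ud i j"
  "Ka Two (ud i j) = (case j of i1 \<Rightarrow> 1 | i2 \<Rightarrow> inverse Q | i3 \<Rightarrow> Q) *\<^sub>C ud i j"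
  "Kia One (ud i j) = (case j of i1 \<Rightarrow> Q | i2 \<Rightarrow> inverse Q | i3 \<Rightarrow> 1) *\<^sub>C ud i j"
  "Kia Two (ud i j) = (case j of i1 \<Rightarrow> 1 | i2 \<Rightarrow> Q | i3 \<Rightarrow> inverse Q) *\<^sub>C ud i j"
  by (cases j; auto intro!: dual_eqI simp: ap_ud_snoc u_gen_simps simp del: u_gen.simps nx.simps)+

lemma lsh_ud [simp]:
  "lsh (gE One) (ud i j) = (if i = i2 then ud i1 j else 0)" "lsh (gE Two) (ud i j) = (if i = i3 then ud i2 j else 0)"
  "lsh (gF One) (ud i j) = (if i = i1 then ud i2 j else 0)" "lsh (gF Two) (ud i j) = (if i = i2 then ud i3 j else 0)"
  "lsh (gK One) (ud i j) = (case i of i1 \<Rightarrow> inverse Q | i2 \<Rightarrow> Q | i3 \<Rightarrow> 1) *\<^sub>C ud i j"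
  "lsh (gK Two) (ud i j) = (case i of i1 \<Rightarrow> 1 | i2 \<Rightarrow> inverse Q | i3 \<Rightarrow> Q) *\<^sub>C ud i j"
  "lsh (gKi One) (ud i j) = (case i of i1 \<Rightarrow> Q | i2 \<Rightarrow> inverse Q | i3 \<Rightarrow> 1) *\<^sub>C ud i j"
  "lsh (gKi Two) (ud i j) = (case i of i1 \<Rightarrow> 1 | i2 \<Rightarrow> Q | i3 \<Rightarrow> inverse Q) *\<^sub>C ud i j"
  by (cases i; auto intro!: dual_eqI simp: ap_ud_Cons u_gen_simps simp del: u_gen.simps nx.simps)+

section \<open>The antipode and its values on the matrix coefficients\<close>

primrec antig :: "gen \<Rightarrow> gen list" where
  "antig (gE i) = [gE i, gKi i]" | "antig (gF i) = [gK i, gF i]" | "antig (gK i) = [gKi i]" | "antig (gKi i) = [gK i]"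

primrec ants :: "gen \<Rightarrow> complex" where
  "ants (gE i) = -1" | "ants (gF i) = -1" | "ants (gK i) = 1" | "ants (gKi i) = 1"

definition Sd :: "dual \<Rightarrow> dual" where
  "Sd a = Dual (\<lambda>w. prod_list (map ants w) * ap a (concat (map antig (rev w))))"

lemma ap_Sd: "ap (Sd a) w = prod_list (map ants w) * ap a (concat (map antig (rev w)))"
  by (simp add: Sd_def)

lemma ap_Sd_Nil [simp]: "ap (Sd a) [] = ap a []" by (simp add: ap_Sd)

lemma Sd_lin [simp]: "Sd 0 = 0" "Sd (a + b) = Sd a + Sd b" "Sd (a - b) = Sd a - Sd b" "Sd (- a) = - Sd a"
  "Sd (c *\<^sub>C a) = c *\<^sub>C Sd a"
  by (auto intro!: dual_eqI simp: ap_Sd algebra_simps)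

lemma lsh_Sd: "lsh (gE i) (Sd a) = - Sd (Ea i (Kia i a))" "lsh (gF i) (Sd a) = - Sd (Ka i (Fa i a))"
  "lsh (gK i) (Sd a) = Sd (Kia i a)" "lsh (gKi i) (Sd a) = Sd (Ka i a)"
  by (auto intro!: dual_eqI simp: ap_Sd)

lemma rs_Sd: "Ea i (Sd a) = - Sd (lsh (gKi i) (lsh (gE i) a))" "Fa i (Sd a) = - Sd (lsh (gF i) (lsh (gK i) a))"
  "Ka i (Sd a) = Sd (lsh (gKi i) a)" "Kia i (Sd a) = Sd (lsh (gK i) a)"
  by (auto intro!: dual_eqI simp: ap_Sd)

lemma Sd_times: "a \<in> UU \<Longrightarrow> b \<in> UU \<Longrightarrow> Sd (a * b) = Sd b * Sd a"
proof (rule dual_eqI)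
  fix w assume "a \<in> UU" "b \<in> UU"
  then show "ap (Sd (a * b)) w = ap (Sd b * Sd a) w"
  proof (induction w arbitrary: a b rule: gen_word_induct)
    case (E i w) then show ?case unfolding ap_Cons lsh_times lsh_Sd by (simp add: E UU_K)
  next
    case (F i w) then show ?case unfolding ap_Cons lsh_times lsh_Sd by (simp add: F UU_K)
  next
    case (K i w) then show ?case unfolding ap_Cons lsh_times lsh_Sd by simp
  next
    case (Ki i w) then show ?case unfolding ap_Cons lsh_times lsh_Sd by simp
  qed simp
qed

lemma Sd_one [simp]: "Sd 1 = 1"
proof (rule dual_eqI)
  fix w show "ap (Sd 1) w = ap 1 w"
    by (induction w rule: gen_word_induct) (simp_all only: ap_Cons lsh_Sd rs_one rs_lin Sd_lin lsh_one minus_zero ap_Sd_Nil)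
qed

definition vd :: "ix \<Rightarrow> ix \<Rightarrow> dual" where "vd i j = Sd (ud i j)"

lemma ap_vd_Nil [simp]: "ap (vd i j) [] = (if i = j then 1 else 0)" by (simp add: vd_def)

lemma rs_vd [simp]:
  "Ea One (vd i j) = (if i = i2 then - (Q *\<^sub>C vd i1 j) else 0)" "Ea Two (vd i j) = (if i = i3 then - (Q *\<^sub>C vd i2 j) else 0)"
  "Fa One (vd i j) = (if i = i1 then - (inverse Q *\<^sub>C vd i2 j) else 0)" "Fa Two (vd i j) = (if i = i2 then - (inverse Q *\<^sub>C vd i3 j) else 0)"
  "Ka One (vd i j) = (case i of i1 \<Rightarrow> Q | i2 \<Rightarrow> inverse Q | i3 \<Rightarrow> 1) *\<^sub>C vd i j"
  "Ka Two (vd i j) = (case i of i1 \<Rightarrow> 1 | i2 \<Rightarrow> Q | i3 \<Rightarrow> inverse Q) *\<^sub>C vd i j"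
  "Kia One (vd i j) = (case i of i1 \<Rightarrow> inverse Q | i2 \<Rightarrow> Q | i3 \<Rightarrow> 1) *\<^sub>C vd i j"
  "Kia Two (vd i j) = (case i of i1 \<Rightarrow> 1 | i2 \<Rightarrow> inverse Q | i3 \<Rightarrow> Q) *\<^sub>C vd i j"
  by (cases i; simp add: vd_def rs_Sd)+

lemma lsh_vd [simp]:
  "lsh (gE One) (vd i j) = (if j = i1 then - (Q *\<^sub>C vd i i2) else 0)" "lsh (gE Two) (vd i j) = (if j = i2 then - (Q *\<^sub>C vd i i3) else 0)"
  "lsh (gF One) (vd i j) = (if j = i2 then - (inverse Q *\<^sub>C vd i i1) else 0)" "lsh (gF Two) (vd i j) = (if j = i3 then - (inverse Q *\<^sub>C vd i i2) else 0)"
  "lsh (gK One) (vd i j) = (case j of i1 \<Rightarrow> Q | i2 \<Rightarrow> inverse Q | i3 \<Rightarrow> 1) *\<^sub>C vd i j"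
  "lsh (gK Two) (vd i j) = (case j of i1 \<Rightarrow> 1 | i2 \<Rightarrow> Q | i3 \<Rightarrow> inverse Q) *\<^sub>C vd i j"
  "lsh (gKi One) (vd i j) = (case j of i1 \<Rightarrow> inverse Q | i2 \<Rightarrow> Q | i3 \<Rightarrow> 1) *\<^sub>C vd i j"
  "lsh (gKi Two) (vd i j) = (case j of i1 \<Rightarrow> 1 | i2 \<Rightarrow> inverse Q | i3 \<Rightarrow> Q) *\<^sub>C vd i j"
  by (cases j; simp add: vd_def lsh_Sd)+

lemma forall_smpl: "(\<forall>k. P k) \<longleftrightarrow> P One \<and> P Two" by (metis smpl.exhaust)

lemma dual_eq_iff: "a = b \<longleftrightarrow> (\<forall>w. ap a w = ap b w)" by (auto intro: dual_eqI)

lemma Q_inv_ne: "Q - inverse Q \<noteq> 0"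
  using Q2_ne(2) by (auto simp: field_simps)

lemma Q_kap: "kap * Q - kap * inverse Q = 1" "(Q * (Q * kap) - kap) / Q = 1" "(kap - Q * (Q * kap)) / Q = -1"
proof -
  have k: "kap * (Q - inverse Q) = 1" using Q_inv_ne by (simp add: kap_eq)
  then show 1: "kap * Q - kap * inverse Q = 1" by (simp add: algebra_simps)
  show "(Q * (Q * kap) - kap) / Q = 1" "(kap - Q * (Q * kap)) / Q = -1"
    using 1 by (simp_all add: field_simps)
qed

lemma REL_ud: "REL (ud i j)"
  unfolding REL_iff forall_smpl
  by (cases j; simp add: cartan_def power_int_minus)
     (simp_all add: scC_distrib flip: scC_distrib(3,4), simp_all add: power2_eq_square field_simps,
      simp_all add: Q_kap)

lemma REL_vd: "REL (vd i j)"
  unfolding REL_iff forall_smpl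
  by (cases i; simp add: cartan_def power_int_minus)
     (simp_all add: scC_distrib flip: scC_distrib(3,4), simp_all add: power2_eq_square field_simps,
      simp_all add: Q_kap)

lemma UU_ud [simp]: "ud i j \<in> UU"
proof (rule USpan_UU[of "range (ud i)"])
  fix s g assume "s \<in> range (ud i)"
  then obtain j where "s = ud i j" by auto
  then show "rs g s \<in> USpan (range (ud i))"
    by (cases g; cases "case g of gE k \<Rightarrow> k | gF k \<Rightarrow> k | gK k \<Rightarrow> k | gKi k \<Rightarrow> k")
       (auto simp: USpan.zero USpan.base USpan.scale)
qed (auto simp: REL_ud intro: USpan.base)

lemma UU_vd [simp]: "vd i j \<in> UU"
proof (rule USpan_UU[of "range (\<lambda>i. vd i j)"])
  fix s g assume "s \<in> range (\<lambda>i. vd i j)"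
  then obtain i where "s = vd i j" by auto
  then show "rs g s \<in> USpan (range (\<lambda>i. vd i j))"
    by (cases g; cases "case g of gE k \<Rightarrow> k | gF k \<Rightarrow> k | gK k \<Rightarrow> k | gKi k \<Rightarrow> k")
       (auto simp: USpan.zero USpan.base USpan.scale simp flip: scC_simps(8))
qed (auto simp: REL_vd intro: USpan.base)

section \<open>The algebra generated by the u_ij and their antipodes\<close>

inductive_set AA :: "dual set" where
  one: "1 \<in> AA"
| ud: "ud i j \<in> AA"
| vd: "vd i j \<in> AA"
| add: "a \<in> AA \<Longrightarrow> b \<in> AA \<Longrightarrow> a + b \<in> AA"
| scale: "a \<in> AA \<Longrightarrow> c *\<^sub>C a \<in> AA"
| mult: "a \<in> AA \<Longrightarrow> b \<in> AA \<Longrightarrow> a * b \<in> AA"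

lemma AA_UU [simp]: "a \<in> AA \<Longrightarrow> a \<in> UU"
  by (induction rule: AA.induct) auto

lemma AA_zero: "0 \<in> AA" using AA.scale[OF AA.one, of 0] by simp
lemma AA_uminus: "a \<in> AA \<Longrightarrow> - a \<in> AA" using AA.scale[of a "-1"] by simp
lemma AA_diff: "a \<in> AA \<Longrightarrow> b \<in> AA \<Longrightarrow> a - b \<in> AA"
  using AA.add[of a "- b"] AA_uminus by simp
lemma AA_sum: "(\<And>i. i \<in> I \<Longrightarrow> f i \<in> AA) \<Longrightarrow> sum f I \<in> AA"
  by (induction I rule: infinite_finite_induct) (auto simp: AA_zero AA.add)

lemmas AA_intros [simp, intro] = AA.intros AA_zero AA_uminus AA_diff

lemma AA_rs [simp, intro]: "a \<in> AA \<Longrightarrow> rs g a \<in> AA"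
proof (induction arbitrary: g rule: AA.induct)
  case one then show ?case by (cases g) auto
next
  case (ud i j) then show ?case
    by (cases g; cases "case g of gE k \<Rightarrow> k | gF k \<Rightarrow> k | gK k \<Rightarrow> k | gKi k \<Rightarrow> k") auto
next
  case (vd i j) then show ?case
    by (cases g; cases "case g of gE k \<Rightarrow> k | gF k \<Rightarrow> k | gK k \<Rightarrow> k | gKi k \<Rightarrow> k") auto
next
  case (mult a b) then show ?case by (cases g) auto
qed auto

primrec kp :: "ix \<Rightarrow> complex" where "kp i1 = 1" | "kp i2 = Q\<^sup>2" | "kp i3 = Q ^ 4"

lemma kp_ne [simp]: "kp i \<noteq> 0" by (cases i) auto

text \<open>The square of the antipode is diagonal on the u_ij, with the ratios of \<open>kp\<close>
  as eigenvalues. Hence \<open>AA\<close> is closed under the antipode.\<close>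

lemma Sd_vd: "Sd (vd i j) = (kp i / kp j) *\<^sub>C ud i j"
proof (rule dual_eqI)
  fix w show "ap (Sd (vd i j)) w = ap ((kp i / kp j) *\<^sub>C ud i j) w"
  proof (induction w arbitrary: i rule: gen_word_induct)
    case (E k w) then show ?case unfolding ap_Cons lsh_Sd by (cases k; cases i; simp del: ap_lsh; simp add: field_simps power2_eq_square power4_eq_xxxx)
  next
    case (F k w) then show ?case unfolding ap_Cons lsh_Sd by (cases k; cases i; simp del: ap_lsh; simp add: field_simps power2_eq_square power4_eq_xxxx)
  next
    case (K k w) then show ?case unfolding ap_Cons lsh_Sd by (cases k; cases i; simp del: ap_lsh; simp add: field_simps)
  next
    case (Ki k w) then show ?case unfolding ap_Cons lsh_Sd by (cases k; cases i; simp del: ap_lsh; simp add: field_simps)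
  qed auto
qed

lemma AA_Sd [simp, intro]: "a \<in> AA \<Longrightarrow> Sd a \<in> AA"
proof (induction rule: AA.induct)
  case (ud i j) then show ?case using AA.vd[of i j] by (simp add: vd_def)
qed (auto simp: Sd_vd Sd_times)

text \<open>Words are read off letter by letter. An identity with a constant in A is thereby reduced
  to invariance under left translation and one value at 1.\<close>

lemma lsh_invariant:
  assumes "\<And>i. lsh (gE i) a = 0" "\<And>i. lsh (gF i) a = 0" "\<And>i. lsh (gK i) a = a" "\<And>i. lsh (gKi i) a = a"
  shows "a = ap a [] *\<^sub>C 1"
proof (rule dual_eqI)
  fix w show "ap a w = ap (ap a [] *\<^sub>C 1) w"
    by (induction w rule: gen_word_induct) (simp_all add: ap_Cons[of a] assms del: ap_lsh)
qed

lemma all_smplI: "P One \<Longrightarrow> P Two \<Longrightarrow> P k" by (cases k) auto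

text \<open>A diagonal case of the antipode axiom. With \<open>ud_vd_sum\<close>, its analogue in
  the opposite order weighted by \<open>kp\<close>, it supplies the partitions of unity of weights
  \<open>wtx j\<close> and \<open>- wtx j\<close>.\<close>

lemma vd_ud_sum: "vd j i1 * ud i1 j + vd j i2 * ud i2 j + vd j i3 * ud i3 j = 1"
proof -
  let ?a = "vd j i1 * ud i1 j + vd j i2 * ud i2 j + vd j i3 * ud i3 j"
  have "?a = ap ?a [] *\<^sub>C 1"
    by (rule lsh_invariant; rule all_smplI; simp add: lsh_times; (rule dual_eqI, simp add: field_simps)?)
  then show ?thesis by (cases j) auto
qed

lemma ud_vd_sum: "ud i1 j * vd j i1 + Q\<^sup>2 *\<^sub>C (ud i2 j * vd j i2) + Q ^ 4 *\<^sub>C (ud i3 j * vd j i3) = kp j *\<^sub>C 1"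
proof -
  let ?a = "ud i1 j * vd j i1 + Q\<^sup>2 *\<^sub>C (ud i2 j * vd j i2) + Q ^ 4 *\<^sub>C (ud i3 j * vd j i3)"
  have "?a = ap ?a [] *\<^sub>C 1"
    by (rule lsh_invariant; rule all_smplI; simp add: lsh_times scC_distrib; (rule dual_eqI, simp add: field_simps power2_eq_square power4_eq_xxxx)?)
  then show ?thesis by (cases j) auto
qed

end

context qparam
begin

section \<open>Involution, weights and coproduct\<close>

primrec sgl :: "gen \<Rightarrow> gen" where
  "sgl (gE i) = gF i" | "sgl (gF i) = gE i" | "sgl (gK i) = gKi i" | "sgl (gKi i) = gK i"

text \<open>The substitution E_i to -q F_i, F_i to -F_i/q, K_i to its inverse keeps the order of
  products and reverses the coproduct, so \<open>sd\<close> is anti-multiplicative. The factors are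
  forced by u_ij^* = S(u_ji): for instance S(u_21) has the value -q at E_1, while u_12 has the value
  1 at F_1.\<close>

primrec sgc :: "gen \<Rightarrow> complex" where
  "sgc (gE i) = - Q" | "sgc (gF i) = - inverse Q" | "sgc (gK i) = 1" | "sgc (gKi i) = 1"

definition sd :: "dual \<Rightarrow> dual" where
  "sd a = Dual (\<lambda>w. cnj (prod_list (map sgc w) * ap a (map sgl w)))"

lemma ap_sd: "ap (sd a) w = cnj (prod_list (map sgc w) * ap a (map sgl w))" by (simp add: sd_def)

lemma sd_lin [simp]: "sd 0 = 0" "sd (a + b) = sd a + sd b" "sd (a - b) = sd a - sd b" "sd (- a) = - sd a"
  "sd (c *\<^sub>C a) = cnj c *\<^sub>C sd a"
  by (auto intro!: dual_eqI simp: ap_sd algebra_simps)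

lemma sd_sum: "sd (sum f I) = (\<Sum>i\<in>I. sd (f i))"
  by (induction I rule: infinite_finite_induct) auto

lemma lsh_sd: "lsh (gE i) (sd a) = - (Q *\<^sub>C sd (lsh (gF i) a))" "lsh (gF i) (sd a) = - (inverse Q *\<^sub>C sd (lsh (gE i) a))"
  "lsh (gK i) (sd a) = sd (lsh (gKi i) a)" "lsh (gKi i) (sd a) = sd (lsh (gK i) a)"
  by (auto intro!: dual_eqI simp: ap_sd)

lemma rs_sd: "Ea i (sd a) = - (Q *\<^sub>C sd (Fa i a))" "Fa i (sd a) = - (inverse Q *\<^sub>C sd (Ea i a))"
  "Ka i (sd a) = sd (Kia i a)" "Kia i (sd a) = sd (Ka i a)"
  by (auto intro!: dual_eqI simp: ap_sd)

lemma sd_sd [simp]: "sd (sd a) = a"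
proof (rule dual_eqI)
  fix w show "ap (sd (sd a)) w = ap a w"
  proof (induction w arbitrary: a rule: gen_word_induct)
    case Nil show ?case by (simp add: ap_sd)
  qed (simp_all add: ap_Cons lsh_sd del: ap_lsh)
qed

lemma sd_one [simp]: "sd 1 = 1"
proof (rule dual_eqI)
  fix w show "ap (sd 1) w = ap 1 w"
  proof (induction w rule: gen_word_induct)
    case Nil show ?case by (simp add: ap_sd)
  qed (simp_all only: ap_Cons lsh_sd lsh_one sd_lin scC_simps minus_zero)
qed

lemma sd_times [simp]: "sd (a * b) = sd b * sd a"
proof (rule dual_eqI)
  fix w show "ap (sd (a * b)) w = ap (sd b * sd a) w"
  proof (induction w arbitrary: a b rule: gen_word_induct)
    case Nil show ?case by (simp add: ap_sd)
  next
    case (E i w) then show ?case unfolding ap_Cons lsh_times lsh_sd by (simp add: algebra_simps)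
  next
    case (F i w) then show ?case unfolding ap_Cons lsh_times lsh_sd by (simp add: algebra_simps)
  next
    case (K i w) then show ?case unfolding ap_Cons lsh_times lsh_sd by simp
  next
    case (Ki i w) then show ?case unfolding ap_Cons lsh_times lsh_sd by simp
  qed
qed

lemma sd_ud [simp]: "sd (ud i j) = vd j i"
proof (rule dual_eqI)
  fix w show "ap (sd (ud i j)) w = ap (vd j i) w"
  proof (induction w arbitrary: i rule: gen_word_induct)
    case Nil show ?case by (auto simp add: ap_sd)
  next
    case (E k w) then show ?case unfolding ap_Cons lsh_sd by (cases k) simp_all
  next
    case (F k w) then show ?case unfolding ap_Cons lsh_sd by (cases k) simp_all
  next
    case (K k w) then show ?case unfolding ap_Cons lsh_sd by (cases k; cases i) simp_all
  next
    case (Ki k w) then show ?case unfolding ap_Cons lsh_sd by (cases k; cases i) simp_all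
  qed
qed

lemma sd_vd [simp]: "sd (vd i j) = ud j i"
  using sd_sd[of "ud j i"] by simp

lemma AA_sd [simp, intro]: "a \<in> AA \<Longrightarrow> sd a \<in> AA"
  by (induction rule: AA.induct) auto

text \<open>Weights for the action X \<rhd> a, under which B has weight 0. \<open>AwL\<close> is the
  analogue for left translation; the antipode exchanges the two with a sign.\<close>

definition Aw :: "int \<times> int \<Rightarrow> dual set" where
  "Aw l = {a \<in> AA. Ka One a = (Q powi fst l) *\<^sub>C a \<and> Ka Two a = (Q powi snd l) *\<^sub>C a}"

lemma AwD: "a \<in> Aw l \<Longrightarrow> a \<in> AA" "a \<in> Aw l \<Longrightarrow> Ka One a = (Q powi fst l) *\<^sub>C a"
  "a \<in> Aw l \<Longrightarrow> Ka Two a = (Q powi snd l) *\<^sub>C a"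
  by (auto simp: Aw_def)

lemma Aw_UU: "a \<in> Aw l \<Longrightarrow> a \<in> UU" by (simp add: AwD)

lemma Aw_Kia: assumes "a \<in> Aw l"
  shows "Kia One a = (Q powi (- fst l)) *\<^sub>C a" "Kia Two a = (Q powi (- snd l)) *\<^sub>C a"
proof -
  have "Kia One (Ka One a) = (Q powi fst l) *\<^sub>C Kia One a" "Kia Two (Ka Two a) = (Q powi snd l) *\<^sub>C Kia Two a"
    using AwD[OF assms] by simp_all
  then have "a = (Q powi fst l) *\<^sub>C Kia One a" "a = (Q powi snd l) *\<^sub>C Kia Two a"
    using UU_K(2)[OF Aw_UU[OF assms]] by simp_all
  then have "(Q powi (- fst l)) *\<^sub>C a = (Q powi (- fst l) * (Q powi fst l)) *\<^sub>C Kia One a"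
    "(Q powi (- snd l)) *\<^sub>C a = (Q powi (- snd l) * (Q powi snd l)) *\<^sub>C Kia Two a"
    by (metis scC_simps(3))+
  then show "Kia One a = (Q powi (- fst l)) *\<^sub>C a" "Kia Two a = (Q powi (- snd l)) *\<^sub>C a"
    by (simp_all add: power_int_minus)
qed

lemma Aw_0 [simp]: "0 \<in> Aw l" by (simp add: Aw_def)
lemma Aw_1 [simp]: "1 \<in> Aw 0" by (simp add: Aw_def)
lemma Aw_add: "a \<in> Aw l \<Longrightarrow> b \<in> Aw l \<Longrightarrow> a + b \<in> Aw l" by (auto simp: Aw_def scC_distrib)
lemma Aw_scale: "a \<in> Aw l \<Longrightarrow> c *\<^sub>C a \<in> Aw l" by (auto simp: Aw_def mult.commute)
lemma Aw_uminus: "a \<in> Aw l \<Longrightarrow> - a \<in> Aw l" by (auto simp: Aw_def)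
lemma Aw_diff: "a \<in> Aw l \<Longrightarrow> b \<in> Aw l \<Longrightarrow> a - b \<in> Aw l" by (auto simp: Aw_def scC_distrib)
lemma Aw_sum: "(\<And>i. i \<in> I \<Longrightarrow> f i \<in> Aw l) \<Longrightarrow> sum f I \<in> Aw l"
  by (induction I rule: infinite_finite_induct) (auto simp: Aw_add)

lemma Aw_mult: "a \<in> Aw l \<Longrightarrow> b \<in> Aw m \<Longrightarrow> a * b \<in> Aw (l + m)"
  by (auto simp: Aw_def power_int_add mult.commute)

lemma Aw_mult': "a \<in> Aw l \<Longrightarrow> b \<in> Aw m \<Longrightarrow> n = l + m \<Longrightarrow> a * b \<in> Aw n"
  using Aw_mult by simp

primrec al :: "smpl \<Rightarrow> int \<times> int" where "al One = (2, -1)" | "al Two = (-1, 2)"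

lemma Aw_Ea: "a \<in> Aw l \<Longrightarrow> n = l + al i \<Longrightarrow> Ea i a \<in> Aw n"
  and Aw_Fa: "a \<in> Aw l \<Longrightarrow> n = l - al i \<Longrightarrow> Fa i a \<in> Aw n"
  by (cases i; auto simp: Aw_def UU_K cartan_def power_int_add power_int_diff power_int_minus mult.commute divide_inverse)+

lemma Aw_Ka: "a \<in> Aw l \<Longrightarrow> Ka i a \<in> Aw l" "a \<in> Aw l \<Longrightarrow> Kia i a \<in> Aw l"
  using AwD(2,3) Aw_Kia Aw_scale by (cases i; metis)+

lemma Aw_sd: "a \<in> Aw l \<Longrightarrow> sd a \<in> Aw (- l)"
  by (auto simp: Aw_def[of "-l"] AwD rs_sd Aw_Kia cnj_Q simp flip: Q_powi_of_real)

primrec wtx :: "ix \<Rightarrow> int \<times> int" where "wtx i1 = (-1, 0)" | "wtx i2 = (1, -1)" | "wtx i3 = (0, 1)"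

lemma Aw_ud: "ud i j \<in> Aw (wtx j)" and Aw_vd: "vd i j \<in> Aw (- wtx i)"
  by (cases j; simp add: Aw_def power_int_minus) (cases i; simp add: Aw_def power_int_minus)

definition AwL :: "int \<times> int \<Rightarrow> dual set" where
  "AwL l = {a \<in> AA. lsh (gKi One) a = (Q powi (- fst l)) *\<^sub>C a \<and> lsh (gKi Two) a = (Q powi (- snd l)) *\<^sub>C a \<and>
     lsh (gK One) a = (Q powi fst l) *\<^sub>C a \<and> lsh (gK Two) a = (Q powi snd l) *\<^sub>C a}"

lemma Aw_Sd: "a \<in> AwL l \<Longrightarrow> Sd a \<in> Aw (- l)"
  by (auto simp: AwL_def Aw_def rs_Sd)

lemma AwL_mult: "a \<in> AwL l \<Longrightarrow> b \<in> AwL m \<Longrightarrow> a * b \<in> AwL (l + m)"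
  by (auto simp: AwL_def lsh_times power_int_add power_int_diff power_int_minus divide_inverse mult.commute)

lemma AwL_ud: "ud i j \<in> AwL (wtx i)" and AwL_vd: "vd i j \<in> AwL (- wtx j)"
  by (cases i; simp add: AwL_def power_int_minus) (cases j; simp add: AwL_def power_int_minus)

section \<open>Coproducts as finite sums of tensors\<close>

definition lshw :: "gen list \<Rightarrow> dual \<Rightarrow> dual" where "lshw v a = Dual (\<lambda>w. ap a (v @ w))"

lemma lshw_Nil [simp]: "lshw [] a = a" by (simp add: lshw_def)
lemma lshw_Cons [simp]: "lshw (g # v) a = lshw v (lsh g a)" by (auto intro!: dual_eqI simp: lshw_def)
lemma lshw_add: "lshw v (a + b) = lshw v a + lshw v b" by (auto intro!: dual_eqI simp: lshw_def)

lemma lshw_zero [simp]: "lshw v 0 = 0" by (auto intro!: dual_eqI simp: lshw_def)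

lemma lshw_mult:
  assumes "\<And>v. lshw v a = (\<Sum>k\<in>I. ap (l k) v *\<^sub>C r k)" "\<And>v. lshw v b = (\<Sum>m\<in>J. ap (l' m) v *\<^sub>C r' m)"
  shows "lshw v (a * b) = (\<Sum>k\<in>I. \<Sum>m\<in>J. ap (l k * l' m) v *\<^sub>C (r k * r' m))"
  using assms
proof (induction v arbitrary: a b l l' rule: gen_word_induct)
  case Nil
  from Nil(1)[of "[]"] Nil(2)[of "[]"] show ?case by (simp add: sum_product mult.commute)
next
  have sh: "\<And>v. lshw v (lsh g a) = (\<Sum>k\<in>I. ap (lsh g (l k)) v *\<^sub>C r k)" if "\<And>v. lshw v a = (\<Sum>k\<in>I. ap (l k) v *\<^sub>C r k)"
    for g a and I :: "'k set" and l r
    using that[of "g # _"] by simp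
  {
    case (E i w)
    show ?case
      unfolding lshw_Cons lsh_times lshw_add ap_Cons
      by (simp add: E.IH[OF sh[OF E.prems(1)] sh[OF E.prems(2)]] E.IH[OF E.prems(1) sh[OF E.prems(2)]]
          scC_distrib flip: sum.distrib del: ap_lsh)
  next
    case (F i w)
    show ?case
      unfolding lshw_Cons lsh_times lshw_add ap_Cons
      by (simp add: F.IH[OF sh[OF F.prems(1)] sh[OF F.prems(2)]] F.IH[OF sh[OF F.prems(1)] F.prems(2)]
          scC_distrib flip: sum.distrib del: ap_lsh)
  next
    case (K i w)
    show ?case
      unfolding lshw_Cons lsh_times lshw_add ap_Cons
      by (simp add: K.IH[OF sh[OF K.prems(1)] sh[OF K.prems(2)]] del: ap_lsh)
  next
    case (Ki i w)
    show ?case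
      unfolding lshw_Cons lsh_times lshw_add ap_Cons
      by (simp add: Ki.IH[OF sh[OF Ki.prems(1)] sh[OF Ki.prems(2)]] del: ap_lsh)
  }
qed

text \<open>The coproduct of a is a sum of l_k \<otimes> r_k. Only the first leg is evaluated, at
  words v, so that operators can still be applied to the second leg.\<close>

definition cop :: "dual set \<Rightarrow> dual set \<Rightarrow> dual \<Rightarrow> bool" where
  "cop P R a \<longleftrightarrow> (\<exists>(n::nat) l r. (\<forall>k<n. l k \<in> P \<and> r k \<in> R) \<and> (\<forall>v. lshw v a = (\<Sum>k<n. ap (l k) v *\<^sub>C r k)))"

lemma copI:
  assumes "finite I" "\<And>k. k \<in> I \<Longrightarrow> l k \<in> P \<and> r k \<in> R" "\<And>v. lshw v a = (\<Sum>k\<in>I. ap (l k) v *\<^sub>C r k)"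
  shows "cop P R a"
proof -
  obtain h where h: "bij_betw h {0..<card I} I" using ex_bij_betw_nat_finite[OF assms(1)] by blast
  have "(\<Sum>k\<in>I. ap (l k) v *\<^sub>C r k) = (\<Sum>k<card I. ap (l (h k)) v *\<^sub>C r (h k))" for v
    using sum.reindex_bij_betw[OF h, of "\<lambda>k. ap (l k) v *\<^sub>C r k"] by (simp add: lessThan_atLeast0)
  moreover have "h k \<in> I" if "k < card I" for k using h that by (auto simp: bij_betw_def)
  ultimately show ?thesis unfolding cop_def using assms(2,3)
    by (intro exI[of _ "card I"] exI[of _ "l \<circ> h"] exI[of _ "r \<circ> h"]) auto
qed

lemma cop_add: assumes "cop P R a" "cop P R b" shows "cop P R (a + b)"
proof -
  from assms(1) obtain n l r where h1: "\<forall>k<n::nat. l k \<in> P \<and> r k \<in> R" "\<And>v. lshw v a = (\<Sum>k<n. ap (l k) v *\<^sub>C r k)"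
    unfolding cop_def by blast
  from assms(2) obtain n' l' r' where h2:
    "\<forall>k<n'::nat. l' k \<in> P \<and> r' k \<in> R" "\<And>v. lshw v b = (\<Sum>k<n'. ap (l' k) v *\<^sub>C r' k)"
    unfolding cop_def by blast
  note h = h1 h2
  show ?thesis
    by (rule copI[of "{..<n} <+> {..<n'}" "case_sum l l'" _ "case_sum r r'"])
       (use h in \<open>auto simp: lshw_add sum.Plus\<close>)
qed

lemma cop_scale: assumes "cop P R a" "\<And>r. r \<in> R \<Longrightarrow> c *\<^sub>C r \<in> R" shows "cop P R (c *\<^sub>C a)"
proof -
  from assms obtain n l r where h: "\<forall>k<n::nat. l k \<in> P \<and> r k \<in> R" "\<And>v. lshw v a = (\<Sum>k<n. ap (l k) v *\<^sub>C r k)"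
    unfolding cop_def by blast
  have "lshw v (c *\<^sub>C a) = c *\<^sub>C lshw v a" for v by (auto intro!: dual_eqI simp: lshw_def)
  then show ?thesis
    by (intro copI[of "{..<n}" l _ "\<lambda>k. c *\<^sub>C r k"])
       (use h assms(2) in \<open>auto simp: scC_sum mult.commute\<close>)
qed

lemma cop_mult:
  assumes "cop P R a" "cop P' R' b" "\<And>x y. x \<in> P \<Longrightarrow> y \<in> P' \<Longrightarrow> x * y \<in> P''" "\<And>x y. x \<in> R \<Longrightarrow> y \<in> R' \<Longrightarrow> x * y \<in> R''"
  shows "cop P'' R'' (a * b)"
proof -
  from assms(1) obtain n l r where h1: "\<forall>k<n::nat. l k \<in> P \<and> r k \<in> R" "\<And>v. lshw v a = (\<Sum>k<n. ap (l k) v *\<^sub>C r k)"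
    unfolding cop_def by blast
  from assms(2) obtain n' l' r' where h2:
    "\<forall>k<n'::nat. l' k \<in> P' \<and> r' k \<in> R'" "\<And>v. lshw v b = (\<Sum>k<n'. ap (l' k) v *\<^sub>C r' k)"
    unfolding cop_def by blast
  note h = h1 h2
  show ?thesis
    by (rule copI[of "{..<n} \<times> {..<n'}" "\<lambda>(k, m). l k * l' m" _ "\<lambda>(k, m). r k * r' m"])
       (use h assms(3,4) in \<open>auto simp: lshw_mult[OF h(2,4)] sum.cartesian_product intro!: sum.cong\<close>)
qed

lemma cop_mono: "cop P R a \<Longrightarrow> P \<subseteq> P' \<Longrightarrow> R \<subseteq> R' \<Longrightarrow> cop P' R' a"
  unfolding cop_def by blast

lemma lshw_ud: "lshw v (ud i j) = (\<Sum>k\<in>{i1, i2, i3}. ap (ud i k) v *\<^sub>C ud k j)"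
proof (induction v arbitrary: i rule: gen_word_induct)
  case Nil show ?case by (cases i) simp_all
next
  case (E k w) show ?case unfolding lshw_Cons ap_Cons by (cases k; cases i) (simp_all add: E del: ap_lsh)
next
  case (F k w) show ?case unfolding lshw_Cons ap_Cons by (cases k; cases i) (simp_all add: F del: ap_lsh)
next
  have *: "lshw v (c *\<^sub>C a) = c *\<^sub>C lshw v a" for c v a by (auto intro!: dual_eqI simp: lshw_def)
  { case (K k w) show ?case unfolding lshw_Cons ap_Cons by (cases k; cases i) (simp_all add: K * scC_distrib del: ap_lsh)
  next
    case (Ki k w) show ?case unfolding lshw_Cons ap_Cons by (cases k; cases i) (simp_all add: Ki * scC_distrib del: ap_lsh) }
qed

lemma lshw_vd: "lshw v (vd i j) = (\<Sum>k\<in>{i1, i2, i3}. ap (vd k j) v *\<^sub>C vd i k)"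
proof (induction v arbitrary: j rule: gen_word_induct)
  have *: "lshw v (c *\<^sub>C a) = c *\<^sub>C lshw v a" "lshw v (- a) = - lshw v a" for c v a by (auto intro!: dual_eqI simp: lshw_def)
  { case Nil show ?case by (cases j) simp_all
  next
    case (E k w) show ?case unfolding lshw_Cons ap_Cons by (cases k; cases j) (simp_all add: E * scC_distrib del: ap_lsh)
  next
    case (F k w) show ?case unfolding lshw_Cons ap_Cons by (cases k; cases j) (simp_all add: F * scC_distrib del: ap_lsh)
  next
    case (K k w) show ?case unfolding lshw_Cons ap_Cons by (cases k; cases j) (simp_all add: K * scC_distrib del: ap_lsh)
  next
    case (Ki k w) show ?case unfolding lshw_Cons ap_Cons by (cases k; cases j) (simp_all add: Ki * scC_distrib del: ap_lsh) }
qed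

lemma cop_ud: "cop (AwL (wtx i)) (Aw (wtx j)) (ud i j)"
  by (rule copI[OF _ _ lshw_ud]) (auto simp: Aw_ud AwL_ud)

lemma cop_vd: "cop (AwL (- wtx j)) (Aw (- wtx i)) (vd i j)"
  by (rule copI[OF _ _ lshw_vd]) (auto simp: Aw_vd AwL_vd)

lemma cop_one: "cop (AwL 0) (Aw 0) 1"
proof -
  have "lshw v 1 = ap 1 v *\<^sub>C 1" for v by (auto intro!: dual_eqI simp: lshw_def)
  then show ?thesis by (intro copI[of "{()}" "\<lambda>_. 1" _ "\<lambda>_. 1"]) (auto simp: AwL_def simp del: ap_simps(2))
qed

text \<open>Carries weight and coproduct condition together, so that sums and products stay inside;
  \<open>Aw_HM\<close> shows that it is the whole weight space.\<close>

inductive_set HM :: "(int \<times> int) \<Rightarrow> dual set" for l where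
  "a \<in> Aw l \<Longrightarrow> cop AA (Aw l) a \<Longrightarrow> a \<in> HM l"

lemma HM_mult: "a \<in> HM l \<Longrightarrow> b \<in> HM m \<Longrightarrow> a * b \<in> HM (l + m)"
  by (auto simp: HM.simps Aw_mult elim!: cop_mult)

lemma HM_add: "a \<in> HM l \<Longrightarrow> b \<in> HM l \<Longrightarrow> a + b \<in> HM l"
  by (auto simp: HM.simps Aw_add cop_add)

lemma HM_scale: "a \<in> HM l \<Longrightarrow> c *\<^sub>C a \<in> HM l"
  by (auto simp: HM.simps Aw_scale cop_scale)

lemma HM_0: "0 \<in> HM l"
  by (auto simp: HM.simps intro!: copI[of "{} :: nat set"])

text \<open>Eigenvectors for distinct characters: subtracting from K_i its eigenvalue at m removes
  the term m and leaves a relation over fewer weights.\<close>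

lemma weights_independent:
  assumes "finite L" "\<And>l. l \<in> L \<Longrightarrow> b l \<in> Aw l" "(\<Sum>l\<in>L. b l) = 0" "l \<in> L"
  shows "b l = 0"
  using assms
proof (induction L arbitrary: b l rule: finite_induct)
  case (insert m L)
  have d: "b l = 0" if l: "l \<in> L" for l
  proof -
    have ne: "l \<noteq> m" using l insert by auto
    have e: "(Q powi f l - Q powi f m) *\<^sub>C b l = 0"
      if X: "\<And>l a. a \<in> Aw l \<Longrightarrow> Ka k a = (Q powi f l) *\<^sub>C a" for k :: smpl and f
    proof -
      have s: "b m + (\<Sum>l\<in>L. b l) = 0" using insert by simp
      then have "Ka k (b m + (\<Sum>l\<in>L. b l)) - (Q powi f m) *\<^sub>C (b m + (\<Sum>l\<in>L. b l)) = 0" by simp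
      moreover have "(\<Sum>l\<in>L. Ka k (b l)) = (\<Sum>l\<in>L. (Q powi f l) *\<^sub>C b l)" by (rule sum.cong) (use insert X in auto)
      ultimately have "(\<Sum>l\<in>L. (Q powi f l - Q powi f m) *\<^sub>C b l) = 0"
        using X[of "b m" m] insert(4)[of m] by (simp add: rs_sum scC_distrib scC_sum sum_subtractf)
      then show ?thesis using insert(3)[of "\<lambda>l. (Q powi f l - Q powi f m) *\<^sub>C b l" l] insert(4) l Aw_scale by auto
    qed
    from e[of One fst] e[of Two snd] AwD(2,3) ne show ?thesis
      by (auto simp: scC_eq_0 Q_powi_inj prod_eq_iff)
  qed
  then have "(\<Sum>l\<in>L. b l) = 0" by simp
  then have "b m = 0" using insert.prems(2) insert.hyps by simp
  then show ?case using d[of l] insert.prems(3) by blast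
qed auto

lemma AA_decomp: "a \<in> AA \<Longrightarrow> \<exists>f L. finite L \<and> (\<forall>l. f l \<in> HM l) \<and> (\<forall>l. l \<notin> L \<longrightarrow> f l = 0) \<and> a = (\<Sum>l\<in>L. f l)"
proof -
  let ?D = "\<lambda>a. \<exists>f L. finite L \<and> (\<forall>l. f l \<in> HM l) \<and> (\<forall>l. l \<notin> L \<longrightarrow> f l = 0) \<and> a = (\<Sum>l\<in>L. f l)"
  have hone: "?D a" if "a \<in> HM m" for a m
    using that by (intro exI[of _ "\<lambda>l. if l = m then a else 0"] exI[of _ "{m}"]) (auto simp: HM_0)
  have hadd: "?D (a + b)" if ab: "?D a" "?D b" for a b
  proof -
    from ab obtain f L g M where h: "finite L" "\<forall>l. f l \<in> HM l" "\<forall>l. l \<notin> L \<longrightarrow> f l = 0" "a = (\<Sum>l\<in>L. f l)"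
      "finite M" "\<forall>l. g l \<in> HM l" "\<forall>l. l \<notin> M \<longrightarrow> g l = 0" "b = (\<Sum>l\<in>M. g l)" by blast
    have "a = (\<Sum>l\<in>L\<union>M. f l)" "b = (\<Sum>l\<in>L\<union>M. g l)"
      unfolding h(4,8) by (rule sum.mono_neutral_left; use h in auto)+
    then show ?thesis using h
      by (intro exI[of _ "\<lambda>l. f l + g l"] exI[of _ "L \<union> M"]) (auto simp: HM_add sum.distrib)
  qed
  have sm: "?D (sum h I)" if "finite I" "\<And>i. i \<in> I \<Longrightarrow> ?D (h i)" for h and I :: "'z set"
    using that
  proof (induction I rule: finite_induct)
    case empty show ?case using hone[OF HM_0] by simp
  next
    case (insert x F) then show ?case using hadd[of "h x" "sum h F"] by simp
  qed
  assume "a \<in> AA"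
  then show ?thesis
  proof (induction rule: AA.induct)
    case one show ?case using cop_mono[OF cop_one, of AA "Aw 0"]
      by (intro hone[of _ 0]) (auto simp: HM.simps AwL_def)
  next
    case (ud i j) show ?case using cop_mono[OF cop_ud[of i j], of AA "Aw (wtx j)"]
      by (intro hone[of _ "wtx j"]) (auto simp: HM.simps Aw_ud AwL_def)
  next
    case (vd i j) show ?case using cop_mono[OF cop_vd[of j i], of AA "Aw (- wtx i)"]
      by (intro hone[of _ "- wtx i"]) (auto simp: HM.simps Aw_vd AwL_def)
  next
    case (add a b) then show ?case using hadd[of a b] by blast
  next
    case (scale a c)
    then obtain f L where h: "finite L" "\<forall>l. f l \<in> HM l" and a: "a = (\<Sum>l\<in>L. f l)" by blast
    show ?case unfolding a unfolding scC_sum by (rule sm[OF h(1)], rule hone, rule HM_scale[OF h(2)[rule_format]])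
  next
    case (mult a b)
    then obtain f L g M where h: "finite L" "\<forall>l. f l \<in> HM l" "a = (\<Sum>l\<in>L. f l)"
      "finite M" "\<forall>l. g l \<in> HM l" "b = (\<Sum>l\<in>M. g l)" by blast
    show ?case unfolding h(3,6) sum_product
      by (rule sm[OF h(1)], rule sm[OF h(4)], rule hone, rule HM_mult[OF h(2)[rule_format] h(5)[rule_format]])
  qed
qed

text \<open>By independence of weights, an element of weight m equals the component of weight m in
  any decomposition from \<open>AA_decomp\<close>, and that component has its coproduct in A
  \<otimes> A^m.\<close>

lemma Aw_HM: assumes "a \<in> Aw m" shows "a \<in> HM m"
proof -
  obtain f L where h: "finite L" "\<forall>l. f l \<in> HM l" "\<forall>l. l \<notin> L \<longrightarrow> f l = 0" "a = (\<Sum>l\<in>L. f l)"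
    using AA_decomp[OF AwD(1)[OF assms]] by blast
  have s: "a = (\<Sum>l\<in>insert m L. f l)" unfolding h(4) by (rule sum.mono_neutral_left) (use h in auto)
  have "(\<Sum>l\<in>insert m L. f l - (if l = m then a else 0)) = 0"
    using s h(1) by (simp add: sum_subtractf)
  moreover have "f l - (if l = m then a else 0) \<in> Aw l" for l
    using h(2)[rule_format, of l] assms by (cases "l = m") (auto elim!: HM.cases intro: Aw_diff)
  ultimately have "f m - (if m = m then a else 0) = 0"
    using h(1) by (intro weights_independent[of "insert m L" "\<lambda>l. f l - (if l = m then a else 0)" m]) (simp_all only: finite_insert insertI1)
  then have "f m - a = 0" by simp
  then show ?thesis using h(2) by (metis eq_iff_diff_eq_0)
qed

lemma cop_Aw: "a \<in> Aw l \<Longrightarrow> cop AA (Aw l) a" using Aw_HM by (auto simp: HM.simps)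

lemma cop_AA: assumes "a \<in> AA" shows "cop AA AA a"
proof -
  obtain f L where h: "finite L" "\<forall>l. f l \<in> HM l" "a = (\<Sum>l\<in>L. f l)" using AA_decomp[OF assms] by blast
  have "cop AA AA (\<Sum>l\<in>L. f l)" using h(1)
  proof (induction L rule: finite_induct)
    case empty show ?case by (auto intro!: copI[of "{} :: nat set"])
  next
    case (insert l L)
    have "cop AA (Aw l) (f l)" using h(2)[rule_format, of l] by (cases rule: HM.cases)
    then have "cop AA AA (f l)" by (rule cop_mono) (auto simp: AwD)
    with insert show ?case by (simp add: cop_add)
  qed
  then show ?thesis by (simp add: h)
qed

text \<open>A partition of unity witnessing that the weight spaces of weights -l and l multiply onto
  B. It plays the role of a dual basis of A^l over B.\<close>

definition strong :: "int \<times> int \<Rightarrow> (dual \<times> dual) list \<Rightarrow> bool" where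
  "strong l xs \<longleftrightarrow> (\<forall>(x, y)\<in>set xs. x \<in> Aw (- l) \<and> y \<in> Aw l) \<and> (\<Sum>(x, y)\<leftarrow>xs. x * y) = 1"

lemma strong_0: "strong 0 [(1, 1)]" by (simp add: strong_def)

lemma strong_wtx: "strong (wtx j) [(vd j i1, ud i1 j), (vd j i2, ud i2 j), (vd j i3, ud i3 j)]"
  using vd_ud_sum[of j] by (simp add: strong_def Aw_ud Aw_vd algebra_simps)

lemma strong_wtx_minus: "strong (- wtx j) [((1 / kp j) *\<^sub>C ud i1 j, vd j i1), ((Q\<^sup>2 / kp j) *\<^sub>C ud i2 j, vd j i2), ((Q ^ 4 / kp j) *\<^sub>C ud i3 j, vd j i3)]"
  using arg_cong[OF ud_vd_sum[of j], of "\<lambda>a. (1 / kp j) *\<^sub>C a"]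
  by (simp add: strong_def Aw_ud Aw_vd Aw_scale scC_distrib algebra_simps)

text \<open>Nest one partition inside the other: the sum of x' x y y' collapses from the
  inside.\<close>

lemma strong_add: assumes "strong l xs" "strong m ys"
  shows "strong (l + m) [(x' * x, y * y'). (x', y') \<leftarrow> ys, (x, y) \<leftarrow> xs]"
proof -
  have X: "(\<Sum>(x, y)\<leftarrow>xs. (x' * x) * (y * y')) = x' * y'" for x' y'
  proof -
    have "(\<Sum>(x, y)\<leftarrow>xs. (x' * x) * (y * y')) = x' * (\<Sum>(x, y)\<leftarrow>xs. x * y) * y'"
      by (induction xs) (auto simp: algebra_simps)
    then show ?thesis using assms by (simp add: strong_def)
  qed
  have "(\<Sum>(x, y)\<leftarrow>[(x' * x, y * y'). (x', y') \<leftarrow> ys, (x, y) \<leftarrow> xs]. x * y) = (\<Sum>(x', y')\<leftarrow>ys. (\<Sum>(x, y)\<leftarrow>xs. (x' * x) * (y * y')))"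
    by (induction ys) (auto simp: comp_def case_prod_unfold)
  also have "\<dots> = 1" using assms X by (simp add: strong_def)
  finally show ?thesis using assms
    by (auto simp: strong_def add.commute intro!: Aw_mult' split: prod.splits)
qed

end

context qparam
begin

section \<open>Tangent vectors and the quadratic relations\<close>

primrec rte :: "proot \<Rightarrow> int \<times> int" where "rte R1 = (2, -1)" | "rte R2 = (-1, 2)" | "rte R12 = (1, 1)"
primrec rt :: "cot \<Rightarrow> int \<times> int" where "rt (ec r) = rte r" | "rt (fc r) = - rte r"

primrec XoE :: "proot \<Rightarrow> dual \<Rightarrow> dual" where
  "XoE R1 a = Ea One a"
| "XoE R2 a = Ea Two a"
| "XoE R12 a = Ea Two (Ea One a) - inverse Q *\<^sub>C Ea One (Ea Two a)"

primrec XoF :: "proot \<Rightarrow> dual \<Rightarrow> dual" where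
  "XoF R1 a = Ka One (Fa One a)"
| "XoF R2 a = Ka Two (Fa Two a)"
| "XoF R12 a = Ka One (Fa One (Ka Two (Fa Two a))) - inverse Q *\<^sub>C Ka Two (Fa Two (Ka One (Fa One a)))"

primrec Xo :: "cot \<Rightarrow> dual \<Rightarrow> dual" where "Xo (ec r) a = XoE r a" | "Xo (fc r) a = XoF r a"

text \<open>The right action of \<open>A\<close> on $\Lambda^1$ composed with a torus-valued twist that is trivial
  on \<open>B\<close>: only the twisted action preserves the span of the quadratic relations.\<close>

fun Th :: "cot \<Rightarrow> cot \<Rightarrow> dual \<Rightarrow> dual" where
  "Th (ec R1) (ec R1) a = Kia Two a"
| "Th (ec R1) (ec R12) a = (1 - inverse Q ^ 2) *\<^sub>C Ea Two (Kia Two a)"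
| "Th (fc R1) (fc R1) a = Kia Two a"
| "Th (fc R1) (fc R12) a = ((Q - inverse Q) * inverse Q ^ 2) *\<^sub>C Fa Two a"
| "Th d g a = (if d = g then a else 0)"

text \<open>The torus elements split off from the right action: the action of A on the frame is
  \<open>Th\<close> composed with \<open>TT\<close>, and \<open>TT\<close> is the identity on weight
  0.\<close>

primrec TTr :: "proot \<Rightarrow> dual \<Rightarrow> dual" where
  "TTr R1 a = Ka One (Ka Two a)" | "TTr R2 a = Ka Two a" | "TTr R12 a = Ka One (Ka Two a)"
primrec TT :: "cot \<Rightarrow> dual \<Rightarrow> dual" where "TT (ec r) a = TTr r a" | "TT (fc r) a = TTr r a"

primrec twr :: "proot \<Rightarrow> int \<times> int \<Rightarrow> int" where
  "twr R1 l = fst l + snd l" | "twr R2 l = snd l" | "twr R12 l = fst l + snd l"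
primrec tw :: "cot \<Rightarrow> int \<times> int \<Rightarrow> int" where "tw (ec r) l = twr r l" | "tw (fc r) l = twr r l"

text \<open>The inverse of the scalar by which \<open>TT g\<close> acts on elements of weight
  \<open>rt d\<close>; it enters when the twist is removed from second derivatives.\<close>

definition tq :: "cot \<Rightarrow> cot \<Rightarrow> complex" where "tq g d = Q powi (- tw g (rt d))"

lemma UNIV_cot: "(UNIV :: cot set) = {ec R1, ec R2, ec R12, fc R1, fc R2, fc R12}"
proof -
  have "x \<in> {ec R1, ec R2, ec R12, fc R1, fc R2, fc R12}" for x
  proof (cases x)
    case (ec r) then show ?thesis by (cases r) auto
  next
    case (fc r) then show ?thesis by (cases r) auto
  qed
  then show ?thesis by blast
qed

lemma sum_cot: "(\<Sum>d\<in>UNIV. f d) = f (ec R1) + f (ec R2) + f (ec R12) + f (fc R1) + f (fc R2) + f (fc R12)"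
  for f :: "cot \<Rightarrow> 'z::comm_monoid_add"
  unfolding UNIV_cot by (simp add: add.assoc)

lemma cot_cases: "(d = ec R1 \<Longrightarrow> P) \<Longrightarrow> (d = ec R2 \<Longrightarrow> P) \<Longrightarrow> (d = ec R12 \<Longrightarrow> P) \<Longrightarrow>
   (d = fc R1 \<Longrightarrow> P) \<Longrightarrow> (d = fc R2 \<Longrightarrow> P) \<Longrightarrow> (d = fc R12 \<Longrightarrow> P) \<Longrightarrow> P"
  using UNIV_I[of d] unfolding UNIV_cot by blast

lemma Aw_TT: "a \<in> Aw l \<Longrightarrow> TT g a = (Q powi tw g l) *\<^sub>C a"
  by (rule cot_cases[of g]) (simp_all add: AwD power_int_add mult.commute)

lemma UU_KK: "a \<in> UU \<Longrightarrow> Ka i (Ka j (Kia i a)) = Ka j a"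
  by (metis UU_K(1,8) UU_rs)

text \<open>The coproducts of the root vectors. The mixed terms in the coproducts of E_12 and F_12
  are the off-diagonal entries of \<open>Th\<close>.\<close>

lemma Leib: "b \<in> UU \<Longrightarrow> c \<in> UU \<Longrightarrow> Xo g (b * c) = b * Xo g c + (\<Sum>e\<in>UNIV. Xo e b * Th e g (TT g c))"
  by (rule cot_cases[of g]; simp add: sum_cot UU_K UU_KK cartan_def distrib_left distrib_right power_int_minus;
      rule dual_eqI; simp add: field_simps power2_eq_square)

lemma Th_lin [simp]: "Th d g 0 = 0" "Th d g (a + b) = Th d g a + Th d g b" "Th d g (- a) = - Th d g a"
  "Th d g (c *\<^sub>C a) = c *\<^sub>C Th d g a"
proof -
  show "Th d g 0 = 0" by (rule cot_cases[of d]; rule cot_cases[of g]; simp)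
  show "Th d g (a + b) = Th d g a + Th d g b" by (rule cot_cases[of d]; rule cot_cases[of g]; simp add: scC_distrib)
  show *: "Th d g (c *\<^sub>C a) = c *\<^sub>C Th d g a" for c
    by (rule cot_cases[of d]; rule cot_cases[of g]; simp add: mult.commute)
  show "Th d g (- a) = - Th d g a" using *[of "-1"] by simp
qed

lemma Th_sum: "Th d g (sum f I) = (\<Sum>i\<in>I. Th d g (f i))"
  by (induction I rule: infinite_finite_induct) auto

lemma Th_one: "Th d g 1 = (if d = g then 1 else 0)"
  by (rule cot_cases[of d]; rule cot_cases[of g]; simp)

text \<open>The rule e_d a = \<Sum> \<open>Th d g a\<close> e_g is consistent with products only if
  the matrix \<open>Th\<close> is multiplicative.\<close>

lemma Th_mult: "b \<in> UU \<Longrightarrow> c \<in> UU \<Longrightarrow> Th d g (b * c) = (\<Sum>e\<in>UNIV. Th d e b * Th e g c)"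
  by (rule cot_cases[of d]; rule cot_cases[of g]; simp add: sum_cot UU_K scC_distrib algebra_simps)

lemma Th_AA [simp]: "a \<in> AA \<Longrightarrow> Th d g a \<in> AA"
  by (rule cot_cases[of d]; rule cot_cases[of g]; simp)

lemma Th_UU [simp]: "a \<in> UU \<Longrightarrow> Th d g a \<in> UU"
  by (rule cot_cases[of d]; rule cot_cases[of g]; simp)

lemma Th_Aw: "a \<in> Aw l \<Longrightarrow> Th d g a \<in> Aw (l - rt d + rt g)"
  by (rule cot_cases[of d]; rule cot_cases[of g]; auto simp: Aw_Ka intro!: Aw_scale Aw_Ea Aw_Fa Aw_Ka)

lemma Xo_lin [simp]: "Xo d 0 = 0" "Xo d (a + b) = Xo d a + Xo d b" "Xo d (- a) = - Xo d a" "Xo d (c *\<^sub>C a) = c *\<^sub>C Xo d a"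
proof -
  show "Xo d 0 = 0" by (rule cot_cases[of d]; simp)
  show "Xo d (a + b) = Xo d a + Xo d b" by (rule cot_cases[of d]; simp add: scC_distrib algebra_simps)
  show *: "Xo d (c *\<^sub>C a) = c *\<^sub>C Xo d a" for c
    by (rule cot_cases[of d]; simp add: mult.commute scC_distrib)
  show "Xo d (- a) = - Xo d a" using *[of "-1"] by simp
qed

lemma Xo_sum: "Xo d (sum f I) = (\<Sum>i\<in>I. Xo d (f i))"
  by (induction I rule: infinite_finite_induct) auto

lemma Xo_AA [simp]: "a \<in> AA \<Longrightarrow> Xo d a \<in> AA" and Xo_UU [simp]: "a \<in> UU \<Longrightarrow> Xo d a \<in> UU"
  by (rule cot_cases[of d]; simp)+

lemma Xo_Aw: assumes a: "a \<in> Aw l" shows "Xo d a \<in> Aw (l + rt d)"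
proof -
  have E: "Ea i b \<in> Aw (m + al i)" "Ka i (Fa i b) \<in> Aw (m - al i)" if "b \<in> Aw m" for i b m
    using that by (auto intro: Aw_Ea Aw_Ka Aw_Fa)
  have w: "l + rte R1 + rte R2 = l + rte R12" "l + rte R2 + rte R1 = l + rte R12"
    "l - rte R1 - rte R2 = l - rte R12" "l - rte R2 - rte R1 = l - rte R12" "al One = rte R1" "al Two = rte R2"
    by (cases l; simp)+
  note e = E(1)[OF E(1)[OF a, of One], of Two] E(1)[OF E(1)[OF a, of Two], of One] 
     E(2)[OF E(2)[OF a, of One], of Two] E(2)[OF E(2)[OF a, of Two], of One]
  show ?thesis
    by (rule cot_cases[of d]; simp only: Xo.simps XoE.simps XoF.simps rt.simps diff_conv_add_uminus[symmetric])
       (use E[OF a, of One] E[OF a, of Two] e in \<open>auto simp only: w intro!: Aw_diff Aw_scale\<close>)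
qed

lemma Xo_one [simp]: "Xo d 1 = 0" by (rule cot_cases[of d]) simp_all

lemma lsh_Xo: "lsh g (Xo d a) = Xo d (lsh g a)" by (rule cot_cases[of d]) (simp_all add: lsh_rs)

lemma lshw_Xo: "lshw v (Xo d a) = Xo d (lshw v a)"
  by (induction v arbitrary: a) (simp_all add: lsh_Xo)

text \<open>Here f g d is the coefficient of e_g e_d. The 15 equations leave 21 of the 36
  coefficients free and describe the quadratic relations of the prolongation. The diagonal
  coefficients are unconstrained, so every square e_d e_d is a relation.\<close>

definition RelF :: "(cot \<Rightarrow> cot \<Rightarrow> dual) \<Rightarrow> bool" where
  "RelF f \<longleftrightarrow>
    f (ec R2) (ec R1) = Q *\<^sub>C f (ec R1) (ec R2) \<and>
    f (ec R12) (ec R1) = Q\<^sup>2 *\<^sub>C f (ec R1) (ec R12) \<and>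
    f (ec R2) (ec R12) = Q *\<^sub>C f (ec R12) (ec R2) \<and>
    f (fc R1) (fc R2) = Q *\<^sub>C f (fc R2) (fc R1) \<and>
    f (fc R1) (fc R12) = Q\<^sup>2 *\<^sub>C f (fc R12) (fc R1) \<and>
    f (fc R12) (fc R2) = Q *\<^sub>C f (fc R2) (fc R12) \<and>
    f (ec R1) (fc R2) = Q *\<^sub>C f (fc R2) (ec R1) \<and>
    f (ec R2) (fc R1) = Q *\<^sub>C f (fc R1) (ec R2) \<and>
    f (ec R1) (fc R12) = Q\<^sup>2 *\<^sub>C f (fc R12) (ec R1) \<and>
    f (ec R2) (fc R12) = Q *\<^sub>C f (fc R12) (ec R2) \<and>
    f (ec R12) (fc R1) = Q\<^sup>2 *\<^sub>C f (fc R1) (ec R12) \<and>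
    f (ec R12) (fc R2) = Q *\<^sub>C f (fc R2) (ec R12) \<and>
    f (ec R1) (fc R1) = f (fc R1) (ec R1) \<and>
    f (ec R2) (fc R2) = Q\<^sup>2 *\<^sub>C f (fc R2) (ec R2) \<and>
    f (ec R12) (fc R12) = Q\<^sup>2 *\<^sub>C f (fc R12) (ec R12) - (1 - inverse Q ^ 2) *\<^sub>C f (fc R1) (ec R1)
       + (Q - inverse Q) *\<^sub>C f (fc R2) (ec R2)"

lemma kap_Q: "Q * (Q * kap) = kap + Q" "Q * (Q * (kap * x)) = kap * x + Q * x"
proof -
  show 1: "Q * (Q * kap) = kap + Q" using Q_kap(1) by (simp add: field_simps)
  have "Q * (Q * (kap * x)) = Q * (Q * kap) * x" by simp
  then show "Q * (Q * (kap * x)) = kap * x + Q * x" by (simp only: 1 distrib_right)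
qed

text \<open>The tangent vectors satisfy the quadratic relations only up to the linear terms \<open>cr\<close>.\<close>

fun cr :: "cot \<Rightarrow> cot \<Rightarrow> dual \<Rightarrow> dual" where
  "cr (ec R2) (ec R1) c = Q *\<^sub>C Xo (ec R12) c"
| "cr (fc R1) (fc R2) c = Q *\<^sub>C Xo (fc R12) c"
| "cr (ec R1) (fc R12) c = Q *\<^sub>C Xo (fc R2) c"
| "cr (ec R2) (fc R12) c = - (inverse Q *\<^sub>C Xo (fc R1) c)"
| "cr (ec R12) (fc R1) c = (inverse Q ^ 2) *\<^sub>C Xo (ec R2) c"
| "cr (ec R12) (fc R2) c = - (inverse Q *\<^sub>C Xo (ec R1) c)"
| "cr _ _ c = 0"

text \<open>On an element of weight 0 the torus part of [E_i, F_i] vanishes, and the Serre relations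
  say that E_12 and F_12 q-commute with the simple root vectors. Corrected by \<open>tq\<close> and
  by the linear terms, these relations of U_q(sl_3) are the equations of
  \<open>RelF\<close>.\<close>

lemma RelF_Xo:
  assumes "c \<in> Aw 0" shows "RelF (\<lambda>g d. tq g d *\<^sub>C Xo g (Xo d c) - cr g d c)"
proof -
  have U: "c \<in> UU" and K: "Ka One c = c" "Ka Two c = c" "Kia One c = c" "Kia Two c = c"
    using assms AwD[OF assms] Aw_Kia[OF assms] by simp_all
  note S = UU_Serre[of _ One Two] UU_Serre[of _ Two One] UU_EF(1) UU_EF(2)[of _ One Two] UU_EF(2)[of _ Two One]
  show ?thesis unfolding RelF_def
    by (intro conjI; simp add: U K UU_K S tq_def cartan_def power_int_minus scC_distrib;
        rule dual_eqI; (simp add: two_eq power_int_minus field_simps power2_eq_square)?; (simp add: kap_Q algebra_simps)?)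
qed

text \<open>The quadratic relations form a submodule for the action on pairs of letters. Only E_2,
  F_2 and the K_i occur in \<open>Th\<close>, so the verification uses just their commutation
  relations.\<close>

lemma RelF_stable:
  assumes f: "RelF f" and x: "x \<in> UU"
  shows "RelF (\<lambda>g d. \<Sum>h\<in>UNIV. \<Sum>e\<in>UNIV. f h e * Th h g (Th e d x))"
  unfolding RelF_def sum_cot
  by (intro conjI; simp add: f[unfolded RelF_def] x UU_K UU_EF(1) cartan_def power_int_minus scC_distrib
         distrib_right distrib_left left_diff_distrib right_diff_distrib;
      rule dual_eqI; (simp add: power_int_minus field_simps power2_eq_square)?; (simp add: kap_Q algebra_simps)?)

lemma RelF_mult: "RelF f \<Longrightarrow> RelF (\<lambda>g d. a * f g d)"
  unfolding RelF_def by (simp add: distrib_left right_diff_distrib)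

lemma RelF_sum: assumes "\<And>i. i \<in> I \<Longrightarrow> RelF (f i)" shows "RelF (\<lambda>g d. \<Sum>i\<in>I. f i g d)"
proof -
  have *: "RelF (\<lambda>g d. 0)" "RelF f \<Longrightarrow> RelF g \<Longrightarrow> RelF (\<lambda>x y. f x y + g x y)" for f g
    unfolding RelF_def by (simp_all add: scC_distrib)
  show ?thesis using assms by (induction I rule: infinite_finite_induct) (simp_all add: *)
qed

text \<open>The correction \<open>cr\<close> consists of first derivatives, which cancel as soon as
  \<Sum> b_k dc_k = 0.\<close>

lemma RelF_Xo_sum:
  assumes "\<And>k. k \<in> I \<Longrightarrow> c k \<in> Aw 0" "\<And>f. (\<Sum>k\<in>I. b k * Xo f (c k)) = 0"
  shows "RelF (\<lambda>g d. \<Sum>k\<in>I. b k * (tq g d *\<^sub>C Xo g (Xo d (c k))))"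
proof -
  have z: "(\<Sum>k\<in>I. b k * cr g d (c k)) = 0" for g d
  proof -
    have 1: "(\<Sum>k\<in>I. b k * (x *\<^sub>C Xo f (c k))) = 0" "(\<Sum>k\<in>I. b k * (- (x *\<^sub>C Xo f (c k)))) = 0" for x f
      using assms(2)[of f] by (simp_all add: sum_negf flip: scC_sum)
    show ?thesis
      by (rule cot_cases[of g]; rule cot_cases[of d]; simp only: cr.simps 1 mult_zero_right sum.neutral_const)
  qed
  have "RelF (\<lambda>g d. \<Sum>k\<in>I. b k * (tq g d *\<^sub>C Xo g (Xo d (c k)) - cr g d (c k)))"
    by (rule RelF_sum) (simp add: RelF_mult RelF_Xo assms)
  then show ?thesis by (simp add: right_diff_distrib sum_subtractf z)
qed

primrec yi :: "proot \<Rightarrow> ix" where "yi R1 = i2" | "yi R2 = i3" | "yi R12 = i3"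
primrec yj :: "proot \<Rightarrow> ix" where "yj R1 = i1" | "yj R2 = i2" | "yj R12 = i1"
text \<open>Coordinate functions on the quantum flag manifold near the base point:
  \<open>yv d\<close> has left weight \<open>rt d\<close>, so among the tangent vectors only that of
  d has a non-zero value on it.\<close>

primrec yv :: "cot \<Rightarrow> dual" where
  "yv (ec r) = ud (yi r) (yj r) * vd (yj r) (yj r)" | "yv (fc r) = ud (yj r) (yi r) * vd (yi r) (yi r)"

lemma yv_props: "yv d \<in> Aw 0" "cop (AwL (rt d)) (Aw 0) (yv d)" "ap (yv d) [] = 0" "ap (Xo d (yv d)) [] \<noteq> 0"
proof -
  have "ud i k * vd k j \<in> Aw 0" for i j k by (rule Aw_mult'[OF Aw_ud Aw_vd]) simp
  then show "yv d \<in> Aw 0" by (cases d) simp_all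
  show "ap (yv d) [] = 0" by (rule cot_cases[of d]; simp)
  show "ap (Xo d (yv d)) [] \<noteq> 0" by (rule cot_cases[of d]; simp del: ap_rs)
  have "cop (AwL (wtx i - wtx j)) (Aw 0) (ud i k * vd k j)" for i j k
    by (rule cop_mult[OF cop_ud[of i k] cop_vd[of j k]])
       (use AwL_mult[of _ "wtx i" _ "- wtx j"] Aw_mult[of _ "wtx k" _ "- wtx k"] in auto)
  from this[of i3 i2] this[of i2 i1] this[of i3 i1] this[of i2 i3] this[of i1 i2] this[of i1 i3]
  show "cop (AwL (rt d)) (Aw 0) (yv d)"
    by (rule_tac cot_cases[of d]) simp_all
qed

text \<open>At the unit, left and right translation by K_i give the same value, so a non-zero value
  at 1 forces both weights to coincide. The vanishing of derivatives at 1 mostly comes from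
  here.\<close>

lemma Aw_left_weight:
  assumes "z \<in> Aw l" "lsh (gK One) z = (Q powi fst m) *\<^sub>C z" "lsh (gK Two) z = (Q powi snd m) *\<^sub>C z" "ap z [] \<noteq> 0"
  shows "l = m"
proof -
  have "ap (lsh (gK k) z) [] = ap (Ka k z) []" for k by simp
  then have "Q powi fst m * ap z [] = Q powi fst l * ap z []" "Q powi snd m * ap z [] = Q powi snd l * ap z []"
    using assms(2,3) AwD(2,3)[OF assms(1)] by (metis ap_simps(6))+
  then show ?thesis using assms(4) by (auto simp: Q_powi_inj prod_eq_iff)
qed

end

section \<open>The antipode axiom and second derivatives at the unit\<close>

context qparam
begin

lemma mulw_uminus: "mulw w (- a) b = - mulw w a b"
  using mulw_lin(3)[of w "-1" a b] by simp

text \<open>The sum of S(l_k) r_k depends only on the tensor \<Sum> l_k \<otimes> r_k: all shifts of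
  a vanishing tensor vanish, which feeds the induction over words.\<close>

lemma antipode_WD:
  assumes "\<And>v v'. (\<Sum>k\<in>I. ap (l k) v * ap (r k) v') = 0"
  shows "(\<Sum>k\<in>I. mulw w (Sd (l k)) (r k)) = 0"
  using assms
proof (induction w arbitrary: l r rule: gen_word_induct)
  case Nil from Nil[of "[]" "[]"] show ?case by simp
next
  case (E i w)
  have "(\<Sum>k\<in>I. mulw w (Sd (Ea i (Kia i (l k)))) (lsh (gK i) (r k))) = 0" "(\<Sum>k\<in>I. mulw w (Sd (l k)) (lsh (gE i) (r k))) = 0"
    by (rule E.IH; simp add: E.prems)+
  then show ?case by (simp add: lsh_Sd mulw_uminus sum.distrib sum_negf sum_subtractf)
next
  case (F i w)
  have "(\<Sum>k\<in>I. mulw w (Sd (Ka i (Fa i (l k)))) (r k)) = 0" "(\<Sum>k\<in>I. mulw w (Sd (Ka i (l k))) (lsh (gF i) (r k))) = 0"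
    by (rule F.IH; simp add: F.prems)+
  then show ?case by (simp add: lsh_Sd mulw_uminus sum.distrib sum_negf sum_subtractf)
next
  case (K i w)
  have "(\<Sum>k\<in>I. mulw w (Sd (Kia i (l k))) (lsh (gK i) (r k))) = 0" by (rule K.IH; simp add: K.prems)
  then show ?case by (simp add: lsh_Sd)
next
  case (Ki i w)
  have "(\<Sum>k\<in>I. mulw w (Sd (Ka i (l k))) (lsh (gKi i) (r k))) = 0" by (rule Ki.IH; simp add: Ki.prems)
  then show ?case by (simp add: lsh_Sd)
qed

lemma antipode_WD2:
  assumes "finite I" "\<And>v v'. (\<Sum>k\<in>I. ap (l k) v * ap (r k) v') = (\<Sum>k\<in>I. ap (l' k) v * ap (r' k) v')"
  shows "(\<Sum>k\<in>I. Sd (l k) * r k) = (\<Sum>k\<in>I. Sd (l' k) * r' k)"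
proof (rule dual_eqI)
  fix w
  let ?l = "case_sum l (\<lambda>k. - l' k)" and ?r = "case_sum r r'"
  have "(\<Sum>k\<in>I <+> I. mulw w (Sd (?l k)) (?r k)) = 0"
    by (rule antipode_WD) (simp add: sum.Plus assms sum_negf)
  then show "ap (\<Sum>k\<in>I. Sd (l k) * r k) w = ap (\<Sum>k\<in>I. Sd (l' k) * r' k) w"
    by (simp add: sum.Plus assms ap_sum ap_times mulw_uminus sum_negf)
qed

text \<open>The axiom S(z_1) z_2 = \<epsilon>(z), by invariance under left translation. The
  relations of the K_i reach z through its first legs l_k; this is what \<open>e1\<close>,
  \<open>e2\<close>, \<open>e3\<close> extract.\<close>

lemma antipode_sum:
  assumes I: "finite I" and U: "\<And>k. k \<in> I \<Longrightarrow> l k \<in> UU" and z: "\<And>v. lshw v z = (\<Sum>k\<in>I. ap (l k) v *\<^sub>C r k)"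
  shows "(\<Sum>k\<in>I. Sd (l k) * r k) = ap z [] *\<^sub>C 1"
proof -
  have H: "(\<Sum>k\<in>I. ap (l k) v * ap (r k) v') = ap z (v @ v')" for v v'
    using arg_cong[OF z[of v], of "\<lambda>a. ap a v'"] by (simp add: lshw_def ap_sum)
  let ?T = "\<Sum>k\<in>I. Sd (l k) * r k"
  have c: "(\<Sum>k\<in>I. ap (X (l k)) v * ap (r k) v') = (\<Sum>k\<in>I. ap (Y (l k)) v * ap (r k) v')"
    if "\<And>a. a \<in> UU \<Longrightarrow> X a = Y a" for X Y v v'
    by (rule sum.cong) (use that U in auto)
  have e1: "ap z (v @ [gE i, gKi i, gK i] @ v') = ap z (v @ [gE i] @ v')" for i v v'
    using c[of "\<lambda>a. Ea i (Kia i (Ka i a))" "Ea i" v v'] H[of "v @ [gE i, gKi i, gK i]" v'] H[of "v @ [gE i]" v']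
    by (simp add: UU_K)
  have e2: "ap z (v @ [gKi i, gK i] @ v') = ap z (v @ v')" for i v v'
    using c[of "\<lambda>a. Kia i (Ka i a)" "\<lambda>a. a" v v'] H[of "v @ [gKi i, gK i]" v'] H[of v v']
    by (simp add: UU_K)
  have e3: "ap z (v @ [gK i, gKi i] @ v') = ap z (v @ v')" for i v v'
    using c[of "\<lambda>a. Ka i (Kia i a)" "\<lambda>a. a" v v'] H[of "v @ [gK i, gKi i]" v'] H[of v v']
    by (simp add: UU_K)
  have "?T = ap ?T [] *\<^sub>C 1"
  proof (rule lsh_invariant)
    fix i
    have "(\<Sum>k\<in>I. Sd (Ea i (Kia i (l k))) * lsh (gK i) (r k)) = (\<Sum>k\<in>I. Sd (l k) * lsh (gE i) (r k))"
      by (rule antipode_WD2[OF I]) (use e1 in \<open>simp add: H\<close>)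
    then show "lsh (gE i) ?T = 0" by (simp add: lsh_sum lsh_times lsh_Sd sum.distrib sum_negf sum_subtractf)
    have "(\<Sum>k\<in>I. Sd (Ka i (Fa i (l k))) * r k) = (\<Sum>k\<in>I. Sd (Ka i (l k)) * lsh (gF i) (r k))"
      by (rule antipode_WD2[OF I]) (simp add: H)
    then show "lsh (gF i) ?T = 0" by (simp add: lsh_sum lsh_times lsh_Sd sum.distrib sum_negf sum_subtractf)
    have "(\<Sum>k\<in>I. Sd (Kia i (l k)) * lsh (gK i) (r k)) = (\<Sum>k\<in>I. Sd (l k) * r k)"
      by (rule antipode_WD2[OF I]) (use e2 in \<open>simp add: H\<close>)
    then show "lsh (gK i) ?T = ?T" by (simp add: lsh_sum lsh_times lsh_Sd)
    have "(\<Sum>k\<in>I. Sd (Ka i (l k)) * lsh (gKi i) (r k)) = (\<Sum>k\<in>I. Sd (l k) * r k)"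
      by (rule antipode_WD2[OF I]) (use e3 in \<open>simp add: H\<close>)
    then show "lsh (gKi i) ?T = ?T" by (simp add: lsh_sum lsh_times lsh_Sd)
  qed
  moreover have "ap ?T [] = ap z []" using H[of "[]" "[]"] by (simp add: ap_sum)
  ultimately show ?thesis by metis
qed

text \<open>Take b_k = a S(c_1) and r_k = c_2. The operators X act on the second leg only, so the
  antipode axiom gives a S(c_1) X(c_2) = a (Xc)(1). Values of derivatives at 1 thus become
  identities with an arbitrary coefficient a of weight l.\<close>

lemma cop_family:
  assumes "cop (AwL m) (Aw 0) c" "a \<in> Aw l"
  shows "\<exists>(n::nat) b r. (\<forall>k<n. b k \<in> Aw (l - m) \<and> r k \<in> Aw 0) \<and>
    (\<forall>f. (\<Sum>k<n. b k * Xo f (r k)) = ap (Xo f c) [] *\<^sub>C a) \<and>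
    (\<forall>g f. (\<Sum>k<n. b k * Xo g (Xo f (r k))) = ap (Xo g (Xo f c)) [] *\<^sub>C a)"
proof -
  obtain n x r where h: "\<And>k. k < (n::nat) \<Longrightarrow> x k \<in> AwL m \<and> r k \<in> Aw 0" "\<And>v. lshw v c = (\<Sum>k<n. ap (x k) v *\<^sub>C r k)"
    using assms(1) unfolding cop_def by blast
  have T: "(\<Sum>k<n. a * Sd (x k) * T (r k)) = ap (T c) [] *\<^sub>C a"
    if "\<And>v. lshw v (T c) = T (lshw v c)" "\<And>g (I :: nat set). T (sum g I) = (\<Sum>i\<in>I. T (g i))" "\<And>s b. T (s *\<^sub>C b) = s *\<^sub>C T b"
    for T :: "dual \<Rightarrow> dual"
  proof -
    have "(\<Sum>k<n. Sd (x k) * T (r k)) = ap (T c) [] *\<^sub>C 1"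
      by (rule antipode_sum) (use h in \<open>auto simp: that AwL_def\<close>)
    from arg_cong[OF this, of "\<lambda>y. a * y"] show ?thesis by (simp add: sum_distrib_left mult.assoc)
  qed
  have "\<forall>k<n. a * Sd (x k) \<in> Aw (l - m) \<and> r k \<in> Aw 0"
    using h(1) assms(2) by (auto intro!: Aw_mult'[OF _ Aw_Sd])
  moreover have "\<forall>f. (\<Sum>k<n. a * Sd (x k) * Xo f (r k)) = ap (Xo f c) [] *\<^sub>C a"
    by (intro allI T) (simp_all add: lshw_Xo Xo_sum)
  moreover have "\<forall>g f. (\<Sum>k<n. a * Sd (x k) * Xo g (Xo f (r k))) = ap (Xo g (Xo f c)) [] *\<^sub>C a"
    by (intro allI T) (simp_all add: lshw_Xo Xo_sum)
  ultimately show ?thesis by (intro exI[of _ n] exI[of _ "\<lambda>k. a * Sd (x k)"] exI[of _ r]) blast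
qed

definition VV :: "cot \<times> cot \<Rightarrow> cot \<Rightarrow> cot \<Rightarrow> complex" where
  "VV p g d = tq g d * ap (Xo g (Xo d (yv (fst p) * yv (snd p)))) []"

text \<open>One product of two coordinate functions for each of the 21 dimensions. The order within
  a pair matters, because first derivatives at 1 must vanish (\<open>Xo_P21\<close>): the product of
  the functions of e_1 and e_2 in this order has a non-zero derivative along E_12, from the
  off-diagonal entry of \<open>Th\<close>.\<close>

definition P21 :: "(cot \<times> cot) list" where
  "P21 = [(ec R1, ec R1), (ec R2, ec R2), (ec R12, ec R12), (fc R1, fc R1), (fc R2, fc R2), (fc R12, fc R12),
    (ec R2, ec R1), (ec R1, ec R12), (ec R12, ec R2), (fc R2, fc R1), (fc R12, fc R1), (fc R2, fc R12),
    (fc R2, ec R1), (fc R1, ec R2), (fc R12, ec R1), (fc R12, ec R2), (fc R1, ec R12), (fc R2, ec R12),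
    (ec R1, fc R1), (ec R2, fc R2), (ec R12, fc R12)]"

lemma yy_props:
  "yv g * yv d \<in> Aw 0" "cop (AwL (rt g + rt d)) (Aw 0) (yv g * yv d)"
proof -
  show "yv g * yv d \<in> Aw 0" using Aw_mult[OF yv_props(1)[of g] yv_props(1)[of d]] by simp
  show "cop (AwL (rt g + rt d)) (Aw 0) (yv g * yv d)"
    by (rule cop_mult[OF yv_props(2)[of g] yv_props(2)[of d]])
       (use AwL_mult[of _ "rt g" _ "rt d"] Aw_mult[of _ 0 _ 0] in auto)
qed

lemma cop_AwL: assumes "cop (AwL m) R c" shows "lsh (gK One) c = (Q powi fst m) *\<^sub>C c" "lsh (gK Two) c = (Q powi snd m) *\<^sub>C c"
proof -
  obtain n x r where h: "\<And>k. k < (n::nat) \<Longrightarrow> x k \<in> AwL m" "\<And>v. lshw v c = (\<Sum>k<n. ap (x k) v *\<^sub>C r k)"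
    using assms unfolding cop_def by blast
  have "ap (x k) [gK One] = Q powi fst m * ap (x k) []" "ap (x k) [gK Two] = Q powi snd m * ap (x k) []" if "k < n" for k
    using h(1)[OF that] unfolding AwL_def mem_Collect_eq by (metis ap_lsh ap_simps(6))+
  then show "lsh (gK One) c = (Q powi fst m) *\<^sub>C c" "lsh (gK Two) c = (Q powi snd m) *\<^sub>C c"
    using h(2)[of "[gK One]"] h(2)[of "[gK Two]"] h(2)[of "[]"] by (simp_all add: scC_sum)
qed

lemma Xo_yy_0: "rt g \<noteq> rt (fst p) + rt (snd p) \<Longrightarrow> ap (Xo g (yv (fst p) * yv (snd p))) [] = 0"
  and VV_0: "rt g + rt d \<noteq> rt (fst p) + rt (snd p) \<Longrightarrow> VV p g d = 0"
proof -
  note c = cop_AwL[OF yy_props(2)[of "fst p" "snd p"]]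
  have 1: "Xo g (yv (fst p) * yv (snd p)) \<in> Aw (rt g)" for g
    using Xo_Aw[OF yy_props(1), of g "fst p" "snd p"] by simp
  have 2: "Xo g (Xo d (yv (fst p) * yv (snd p))) \<in> Aw (rt g + rt d)"
    using Xo_Aw[OF 1, of g d] by (simp add: add.commute)
  show "rt g \<noteq> rt (fst p) + rt (snd p) \<Longrightarrow> ap (Xo g (yv (fst p) * yv (snd p))) [] = 0"
    using Aw_left_weight[OF 1, of g "rt (fst p) + rt (snd p)"] by (auto simp: lsh_Xo c)
  show "rt g + rt d \<noteq> rt (fst p) + rt (snd p) \<Longrightarrow> VV p g d = 0"
    using Aw_left_weight[OF 2, of "rt (fst p) + rt (snd p)"] by (auto simp: lsh_Xo c VV_def)
qed

lemma Xo_P21: "p \<in> set P21 \<Longrightarrow> ap (Xo g (yv (fst p) * yv (snd p))) [] = 0"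
  unfolding P21_def
  by (rule cot_cases[of g]; (simp only: list.set insert_iff empty_iff; elim disjE; (simp add: Xo_yy_0)?; (simp del: ap_rs)?))

lemma one_QQ_ne: "1 + Q * Q \<noteq> 0" "Q * Q + Q * (Q * (Q * Q)) \<noteq> 0"
proof -
  have "1 + Q * Q = complex_of_real (1 + q * q)" by (simp add: Q_def)
  moreover have "1 + q * q > 0" by (simp add: add_pos_nonneg)
  ultimately show "1 + Q * Q \<noteq> 0" by (simp del: of_real_add)
  then have "Q * Q * (1 + Q * Q) \<noteq> 0" by simp
  then show "Q * Q + Q * (Q * (Q * Q)) \<noteq> 0" by (simp add: algebra_simps)
qed

text \<open>The diagonal of a triangular system. The four zeros give triangularity in weight 0,
  where three pairs compete; elsewhere weights separate the pairs.\<close>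

lemma VV_vals:
  "VV (ec R1, ec R1) (ec R1) (ec R1) \<noteq> 0" "VV (ec R2, ec R2) (ec R2) (ec R2) \<noteq> 0"
  "VV (ec R12, ec R12) (ec R12) (ec R12) \<noteq> 0" "VV (fc R1, fc R1) (fc R1) (fc R1) \<noteq> 0"
  "VV (fc R2, fc R2) (fc R2) (fc R2) \<noteq> 0" "VV (fc R12, fc R12) (fc R12) (fc R12) \<noteq> 0"
  "VV (ec R2, ec R1) (ec R1) (ec R2) \<noteq> 0" "VV (ec R1, ec R12) (ec R1) (ec R12) \<noteq> 0"
  "VV (ec R12, ec R2) (ec R12) (ec R2) \<noteq> 0" "VV (fc R2, fc R1) (fc R2) (fc R1) \<noteq> 0"
  "VV (fc R12, fc R1) (fc R12) (fc R1) \<noteq> 0" "VV (fc R2, fc R12) (fc R2) (fc R12) \<noteq> 0"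
  "VV (fc R2, ec R1) (fc R2) (ec R1) \<noteq> 0" "VV (fc R1, ec R2) (fc R1) (ec R2) \<noteq> 0"
  "VV (fc R12, ec R1) (fc R12) (ec R1) \<noteq> 0" "VV (fc R12, ec R2) (fc R12) (ec R2) \<noteq> 0"
  "VV (fc R1, ec R12) (fc R1) (ec R12) \<noteq> 0" "VV (fc R2, ec R12) (fc R2) (ec R12) \<noteq> 0"
  "VV (ec R1, fc R1) (fc R1) (ec R1) \<noteq> 0" "VV (ec R2, fc R2) (fc R2) (ec R2) \<noteq> 0"
  "VV (ec R12, fc R12) (fc R12) (ec R12) \<noteq> 0"
  "VV (ec R1, fc R1) (fc R2) (ec R2) = 0" "VV (ec R2, fc R2) (fc R1) (ec R1) = 0"
  "VV (ec R12, fc R12) (fc R1) (ec R1) = 0" "VV (ec R12, fc R12) (fc R2) (ec R2) = 0"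
  by (simp_all add: VV_def tq_def power_int_minus del: ap_rs) (simp_all add: field_simps one_QQ_ne)

lemma RelF_eval: "RelF f \<Longrightarrow> RelF (\<lambda>g d. ap (f g d) [] *\<^sub>C 1)"
  unfolding RelF_def by (elim conjE, intro conjI; rule dual_eqI; simp; (simp add: algebra_simps)?)

lemma scC_one_eq: "c *\<^sub>C (1::dual) = d *\<^sub>C 1 \<longleftrightarrow> c = d"
  by (metis ap_simps(2,6) list.map(1) mult.right_neutral prod_list.Nil)

lemma RelF_VV: assumes "p \<in> set P21" shows "RelF (\<lambda>g d. VV p g d *\<^sub>C 1)"
proof -
  have "ap (cr g d (yv (fst p) * yv (snd p))) [] = 0" for g d
    by (rule cot_cases[of g]; rule cot_cases[of d]; simp only: cr.simps ap_simps Xo_P21[OF assms] mult_zero_right minus_zero)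
  then show ?thesis
    using RelF_eval[OF RelF_Xo[OF yy_props(1)[of "fst p" "snd p"]]] by (simp add: VV_def)
qed

text \<open>A solution of \<open>RelF\<close> is determined by 21 of its entries, in which the
  matrices \<open>VV p\<close> are triangular with non-zero diagonal, so the coefficients A_p can be
  solved for successively.\<close>

lemma RelF_decomp:
  assumes f: "RelF f" and w: "\<And>g d. f g d \<in> Aw (rt g + rt d)"
  shows "\<exists>A. (\<forall>p\<in>set P21. A p \<in> Aw (rt (fst p) + rt (snd p))) \<and>
    (\<forall>g d. f g d = (\<Sum>p\<in>set P21. VV p g d *\<^sub>C A p))"
proof -
  define A1 where "A1 = (1 / VV (ec R1, fc R1) (fc R1) (ec R1)) *\<^sub>C f (fc R1) (ec R1)"
  define A2 where "A2 = (1 / VV (ec R2, fc R2) (fc R2) (ec R2)) *\<^sub>C f (fc R2) (ec R2)"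
  define A3 where "A3 = (1 / VV (ec R12, fc R12) (fc R12) (ec R12)) *\<^sub>C (f (fc R12) (ec R12)
      - VV (ec R1, fc R1) (fc R12) (ec R12) *\<^sub>C A1 - VV (ec R2, fc R2) (fc R12) (ec R12) *\<^sub>C A2)"
  \<comment> \<open>Each coefficient is normalised by the entry of f at the pair itself, except that
    the product for (e_2, e_1) uses the entry at (e_1, e_2) and those for (e_\<gamma>, f_\<gamma>)
    use the entries at (f_\<gamma>, e_\<gamma>).\<close>
  define A where "A p = (if p = (ec R1, fc R1) then A1 else if p = (ec R2, fc R2) then A2 else if p = (ec R12, fc R12) then A3
     else if p = (ec R2, ec R1) then (1 / VV (ec R2, ec R1) (ec R1) (ec R2)) *\<^sub>C f (ec R1) (ec R2)
     else (1 / VV p (fst p) (snd p)) *\<^sub>C f (fst p) (snd p))" for p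
  have e: "f (fc R1) (ec R1) = VV (ec R1, fc R1) (fc R1) (ec R1) *\<^sub>C A1"
     "f (fc R2) (ec R2) = VV (ec R2, fc R2) (fc R2) (ec R2) *\<^sub>C A2"
     "f (fc R12) (ec R12) = VV (ec R12, fc R12) (fc R12) (ec R12) *\<^sub>C A3 + VV (ec R1, fc R1) (fc R12) (ec R12) *\<^sub>C A1
         + VV (ec R2, fc R2) (fc R12) (ec R12) *\<^sub>C A2"
    by (simp_all add: A1_def A2_def A3_def VV_vals)
  have w0: "f (fc R1) (ec R1) \<in> Aw 0" "f (fc R2) (ec R2) \<in> Aw 0" "f (fc R12) (ec R12) \<in> Aw 0"
    using w[of "fc R1" "ec R1"] w[of "fc R2" "ec R2"] w[of "fc R12" "ec R12"] by (simp_all add: zero_prod_def)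
  then have w3: "A1 \<in> Aw 0" "A2 \<in> Aw 0" "A3 \<in> Aw 0" by (auto simp: A1_def A2_def A3_def intro!: Aw_scale Aw_diff)
  have "A p \<in> Aw (rt (fst p) + rt (snd p))" for p
    using w3 w[of "ec R1" "ec R2"] w[of "fst p" "snd p"]
    by (auto simp: A_def zero_prod_def intro!: Aw_scale)
  moreover have "f g d = (\<Sum>p\<in>set P21. VV p g d *\<^sub>C A p)" for g d
  proof -
    have s: "(\<Sum>p\<in>set P21. VV p g d *\<^sub>C A p) = (\<Sum>p\<leftarrow>P21. VV p g d *\<^sub>C A p)"
      by (simp add: P21_def add.assoc)
    have R: "RelF (\<lambda>g d. VV p g d *\<^sub>C 1)" if "p \<in> set P21" for p using RelF_VV[OF that] .
    note R' = R[unfolded RelF_def scC_simps scC_distrib[symmetric] scC_one_eq mult_1_right]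
    note F = f[unfolded RelF_def]
    have m: "p \<in> set P21" if "p \<in> {(ec R1, ec R1), (ec R2, ec R2), (ec R12, ec R12), (fc R1, fc R1), (fc R2, fc R2), (fc R12, fc R12),
    (ec R2, ec R1), (ec R1, ec R12), (ec R12, ec R2), (fc R2, fc R1), (fc R12, fc R1), (fc R2, fc R12),
    (fc R2, ec R1), (fc R1, ec R2), (fc R12, ec R1), (fc R12, ec R2), (fc R1, ec R12), (fc R2, ec R12),
    (ec R1, fc R1), (ec R2, fc R2), (ec R12, fc R12)}" for p using that by (simp add: P21_def)
    show ?thesis unfolding s P21_def
      by (rule cot_cases[of g]; rule cot_cases[of d]; simp add: VV_0 A_def VV_vals F R' m e scC_distrib; (simp add: algebra_simps)?)
  qed
  ultimately show ?thesis by blast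
qed

end

section \<open>Evaluation on the free algebra\<close>

lemma pm_induct [case_names zero single add]:
  fixes p :: "'w \<Rightarrow>\<^sub>0 'k::comm_monoid_add"
  assumes "P 0" "\<And>w c. P (Poly_Mapping.single w c)" "\<And>x y. P x \<Longrightarrow> P y \<Longrightarrow> P (x + y)"
  shows "P p"
proof -
  have "P (\<Sum>k\<in>A. Poly_Mapping.single k (Poly_Mapping.lookup p k))" if "finite A" for A
    using that by (induction A rule: finite_induct) (auto simp: assms)
  moreover have "p = (\<Sum>k\<in>Poly_Mapping.keys p. Poly_Mapping.single k (Poly_Mapping.lookup p k))"
    by (rule poly_mapping_eqI) (auto simp: lookup_sum lookup_single when_def in_keys_iff)
  ultimately show ?thesis by (metis finite_keys)
qed

lemma sum_fun_apply: "(sum f I) x = (\<Sum>i\<in>I. f i x)" for f :: "'i \<Rightarrow> 'a \<Rightarrow> 'b::comm_monoid_add"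
  by (induction I rule: infinite_finite_induct) auto

definition lx :: "('w \<Rightarrow> 'k::comm_monoid_add \<Rightarrow> 'g::comm_monoid_add) \<Rightarrow> ('w \<Rightarrow>\<^sub>0 'k) \<Rightarrow> 'g" where
  "lx h p = (\<Sum>w\<in>Poly_Mapping.keys p. h w (Poly_Mapping.lookup p w))"

lemma lx_simps:
  assumes "\<And>w. h w 0 = 0" "\<And>w c d. h w (c + d) = h w c + h w d"
  shows "lx h 0 = 0" "lx h (x + y) = lx h x + lx h y" "lx h (Poly_Mapping.single w c) = h w c"
  using setsum_keys_plus_distrib[of h x y] assms by (auto simp: lx_def)

lemma scal_single: "scal c * Poly_Mapping.single w d = Poly_Mapping.single w (c * d)"
  by (simp add: scal_def mult_single)

lemma letters_add [simp]: "letters (v + w) = letters v @ letters w" "letters 0 = []"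
  by (simp_all add: plus_fmon_def zero_fmon_def)

definition ev :: "dual \<Rightarrow> ufun" where "ev a = lx (\<lambda>w c. c * ap a (letters w))"
definition dv :: "ufun \<Rightarrow> dual" where "dv f = Dual (\<lambda>l. f (Poly_Mapping.single (FMon l) 1))"

lemma ev_simps [simp]: "ev a 0 = 0" "ev a (X + Y) = ev a X + ev a Y"
  "ev a (Poly_Mapping.single w c) = c * ap a (letters w)"
  by (simp_all add: ev_def lx_simps algebra_simps)

lemma ev_scal [simp]: "ev a (scal c * X) = c * ev a X"
  by (induction X rule: pm_induct) (simp_all add: scal_single distrib_left)

lemma ev_neg [simp]: "ev a (- X) = - ev a X" "ev a (X - Y) = ev a X - ev a Y"
  by (metis add.inverse_unique ev_simps(1,2) right_minus, metis diff_add_cancel ev_simps(2) add_diff_cancel_right')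

lemma ev_1 [simp]: "ev a 1 = ap a []"
proof -
  have "(1 :: ufree) = Poly_Mapping.single 0 1" by simp
  show ?thesis by (subst \<open>1 = Poly_Mapping.single 0 1\<close>, simp only: ev_simps letters_add mult_1_left)
qed

lemma dv_ev [simp]: "dv (ev a) = a"
  by (rule dual_eqI) (simp add: dv_def)

lemma ev_inj [simp]: "ev a = ev b \<longleftrightarrow> a = b" by (metis dv_ev)

lemma ev_lin: "ev (a + b) = ev a + ev b" "ev (c *\<^sub>C a) = fscale c (ev a)" "ev 0 = 0" "ev (a - b) = ev a - ev b"
proof -
  have "ev (a + b) X = ev a X + ev b X" "ev (c *\<^sub>C a) X = c * ev a X" "ev 0 X = 0" "ev (a - b) X = ev a X - ev b X" for X
    by (induction X rule: pm_induct) (auto simp: algebra_simps)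
  then show "ev (a + b) = ev a + ev b" "ev (c *\<^sub>C a) = fscale c (ev a)" "ev 0 = 0" "ev (a - b) = ev a - ev b"
    by (auto simp: fun_eq_iff fscale_def)
qed

lemma ev_sum: "ev (sum f I) = (\<Sum>i\<in>I. ev (f i))"
  by (induction I rule: infinite_finite_induct) (auto simp: ev_lin)

definition act :: "ufree \<Rightarrow> dual \<Rightarrow> dual" where
  "act X a = Dual (\<lambda>v. ev a (Poly_Mapping.single (FMon v) 1 * X))"

lemma ap_act: "ap (act X a) v = ev a (Poly_Mapping.single (FMon v) 1 * X)" by (simp add: act_def)

lemma ev_act: "ev (act X a) Y = ev a (Y * X)"
proof (induction Y rule: pm_induct)
  case (single w c)
  have "Poly_Mapping.single w c * X = scal c * (Poly_Mapping.single (FMon (letters w)) 1 * X)"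
    by (simp add: scal_def mult_single flip: mult.assoc)
  then show ?case by (simp add: ap_act)
qed (simp_all add: distrib_right)

lemma lacts_ev: "X \<rhd> ev a = ev (act X a)" by (simp add: lacts_def ev_act fun_eq_iff)

lemma act_simps [simp]:
  "act (X + Y) a = act X a + act Y a" "act (X - Y) a = act X a - act Y a" "act (- X) a = - act X a" "act 0 a = 0" "act 1 a = a"
  "act (scal c * X) a = c *\<^sub>C act X a" "act (X * Y) a = act X (act Y a)" "act (letter g) a = rs g a"
proof -
  show "act (X + Y) a = act X a + act Y a" "act (X - Y) a = act X a - act Y a" "act (- X) a = - act X a" "act 0 a = 0"
    by (auto intro!: dual_eqI simp: ap_act distrib_left right_diff_distrib)
  show "act 1 a = a" by (rule dual_eqI) (simp only: ap_act mult_1_right, simp)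
  show "act (X * Y) a = act X (act Y a)" for X Y by (rule dual_eqI) (simp add: ap_act ev_act mult.assoc)
  show "act (letter g) a = rs g a" by (rule dual_eqI) (simp add: ap_act letter_def mult_single)
  have "Poly_Mapping.single (FMon v) 1 * (scal c * X) = scal c * (Poly_Mapping.single (FMon v) 1 * X)" for v
    by (simp add: scal_def mult_single flip: mult.assoc)
  then show "act (scal c * X) a = c *\<^sub>C act X a" by (auto intro!: dual_eqI simp: ap_act)
qed

lemma act_scal [simp]: "act (scal c) a = c *\<^sub>C a" using act_simps(6)[of c 1 a] by (simp only: mult_1_right act_simps)

definition LP :: "dual \<Rightarrow> dual \<Rightarrow> (gen fmon \<times> gen fmon \<Rightarrow>\<^sub>0 complex) \<Rightarrow> complex" where
  "LP a b = lx (\<lambda>vw c. c * ap a (letters (fst vw)) * ap b (letters (snd vw)))"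

lemma LP_simps [simp]: "LP a b 0 = 0" "LP a b (X + Y) = LP a b X + LP a b Y"
  "LP a b (Poly_Mapping.single vw c) = c * ap a (letters (fst vw)) * ap b (letters (snd vw))"
  by (simp_all add: LP_def lx_simps algebra_simps)

lemma LP_sum: "LP a b (sum f I) = (\<Sum>i\<in>I. LP a b (f i))"
  by (induction I rule: infinite_finite_induct) auto

lemma LP_scal: "LP a b (scal c * X) = c * LP a b X"
  by (induction X rule: pm_induct) (simp_all add: scal_single distrib_left)

lemma LP_shift:
  "LP a b (Poly_Mapping.single (FMon [g], FMon [h]) 1 * X) = LP (lsh g a) (lsh h b) X"
  "LP a b (Poly_Mapping.single (0, FMon [h]) 1 * X) = LP a (lsh h b) X"
  "LP a b (Poly_Mapping.single (FMon [g], 0) 1 * X) = LP (lsh g a) b X"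
  by (induction X rule: pm_induct) (simp_all add: mult_single distrib_left)

lemma LP_coprod: "LP a b (prod_list (map coprod_gen l)) = mulw l a b"
proof (induction l arbitrary: a b rule: gen_word_induct)
  case Nil
  have "(1 :: gen fmon \<times> gen fmon \<Rightarrow>\<^sub>0 complex) = Poly_Mapping.single 0 1" by simp
  show ?case unfolding list.map prod_list.Nil by (subst \<open>1 = Poly_Mapping.single 0 1\<close>, simp only: LP_simps, simp)
qed (simp_all add: distrib_right LP_shift)

lemma ev_conv: "ev a \<star> ev b = ev (a * b)"
proof
  fix X
  have "(ev a \<star> ev b) X = LP a b (Ucoprod X)"
    unfolding conv_def LP_def lx_def by (rule sum.cong) auto
  also have "\<dots> = ev (a * b) X"
    by (simp add: Ucoprod_def lin_extend_def LP_sum LP_scal LP_coprod ev_def lx_def ap_times)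
  finally show "(ev a \<star> ev b) X = ev (a * b) X" .
qed

lemma Ucounit_ev: "Ucounit = ev 1"
  by (rule ext) (simp add: Ucounit_def ev_def lx_def)

lemma fscale_module: "module fscale"
  by unfold_locales (auto simp: fscale_def fun_eq_iff algebra_simps)

section \<open>Functionals on the quotient U_q(sl_3)\<close>

context qparam
begin

lemma ev_antipode: "antipode (ev a) = ev (Sd a)"
proof
  fix X
  have *: "ev a (prod_list (map antipode_gen (rev w))) = ap (Sd a) w" for a w
  proof (induction w arbitrary: a)
    case (Cons g w)
    have "ev a (prod_list (map antipode_gen (rev (g # w)))) = ev (act (antipode_gen g) a) (prod_list (map antipode_gen (rev w)))"
      by (simp add: ev_act)
    also have "\<dots> = ap (Sd (act (antipode_gen g) a)) w" by (rule Cons)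
    also have "\<dots> = ap (Sd a) (g # w)" unfolding ap_Cons by (cases g) (simp_all add: lsh_Sd)
    finally show ?case .
  qed simp
  have s: "ev a (sum f I) = (\<Sum>i\<in>I. ev a (f i))" for f and I :: "gen fmon set"
    by (induction I rule: infinite_finite_induct) auto
  show "antipode (ev a) X = ev (Sd a) X"
    by (simp add: antipode_def Uantipode_def lin_extend_def s *) (simp add: ev_def lx_def)
qed

lemma UU_scale [simp]: "a \<in> UU \<Longrightarrow> c *\<^sub>C a \<in> UU" using UU_lin(2)[of a a] by simp

lemma act_UU: "a \<in> UU \<Longrightarrow> act X a \<in> UU"
proof (induction X arbitrary: a rule: pm_induct)
  case (single w c)
  have "act (Poly_Mapping.single w c) a = c *\<^sub>C rsw (letters w) a"
    by (rule dual_eqI) (simp add: ap_act mult_single rsw_def)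
  moreover have "rsw l a \<in> UU" for l using single by (induction l) auto
  ultimately show ?case by simp
qed auto

lemma act_Uq_rels: assumes "X \<in> Uq_rels q" "a \<in> UU" shows "act X a = 0"
  using assms(1) unfolding Uq_rels_def
proof (elim UnE UN_E)
  fix i assume "X \<in> {UK i * UKi i - 1, UKi i * UK i - 1}"
  then show ?thesis using assms(2) by (auto simp: UU_K)
next
  fix i j
  assume "X \<in> {UK i * UK j - UK j * UK i, UK i * UE j - qc q (cartan i j) * UE j * UK i,
             UK i * UF j - qc q (- cartan i j) * UF j * UK i,
             (UE i * UF j - UF j * UE i)
               - (if i = j then scal (complex_of_real (1 / (q - inverse q))) * (UK i - UKi i) else 0)}"
  moreover note UU_K(3)[OF assms(2), of i j]
  ultimately show ?thesis using UU_EF[OF assms(2), of i] UU_EF(2)[OF assms(2), of i j] UU_K(4,5)[OF assms(2), of i j]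
    by (cases "i = j") (auto simp: Q_def[symmetric] kap_eq)
next
  fix p :: "smpl \<times> smpl" assume p: "p \<in> {(i, j). i \<noteq> j}"
  obtain i j where ij: "p = (i, j)" by force
  assume "X \<in> (case p of (i, j) \<Rightarrow> {UE i * UE i * UE j - scal (complex_of_real (q + inverse q)) * UE i * UE j * UE i + UE j * UE i * UE i,
             UF i * UF i * UF j - scal (complex_of_real (q + inverse q)) * UF i * UF j * UF i + UF j * UF i * UF i})"
  then show ?thesis using UU_Serre[OF assms(2), of i j] p ij
    by (auto simp: Q_def[symmetric] two_eq)
qed
end

lemma free_alg_simps:
  "x \<otimes>\<^bsub>free_alg S\<^esub> y = x * y" "x \<oplus>\<^bsub>free_alg S\<^esub> y = x + y" "\<zero>\<^bsub>free_alg S\<^esub> = 0" "\<one>\<^bsub>free_alg S\<^esub> = 1"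
  "x \<in> carrier (free_alg S) \<longleftrightarrow> (\<forall>w\<in>Poly_Mapping.keys x. set (letters w) \<subseteq> S)"
  by (auto simp: free_alg_def)

lemma free_alg_closed:
  fixes x y :: "'x fmon \<Rightarrow>\<^sub>0 'k::ring_1"
  shows "x \<in> carrier (free_alg S) \<Longrightarrow> y \<in> carrier (free_alg S) \<Longrightarrow> x * y \<in> carrier (free_alg S)"
    "x \<in> carrier (free_alg S) \<Longrightarrow> y \<in> carrier (free_alg S) \<Longrightarrow> x + y \<in> carrier (free_alg S)"
    "x \<in> carrier (free_alg S) \<Longrightarrow> - x \<in> carrier (free_alg S)"
    "0 \<in> carrier (free_alg S)" "1 \<in> carrier (free_alg S)"
  using keys_mult[of x y] keys_add[of x y]
  by (fastforce simp: free_alg_simps(5) simp flip: single_one)+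

lemma free_alg_ring: "ring (free_alg S :: ('x fmon \<Rightarrow>\<^sub>0 'k::ring_1) ring)"
proof (rule ringI)
  show "abelian_group (free_alg S :: ('x fmon \<Rightarrow>\<^sub>0 'k) ring)"
  proof (rule abelian_groupI)
    fix x :: "'x fmon \<Rightarrow>\<^sub>0 'k" assume "x \<in> carrier (free_alg S)"
    then show "\<exists>y\<in>carrier (free_alg S). y \<oplus>\<^bsub>free_alg S\<^esub> x = \<zero>\<^bsub>free_alg S\<^esub>"
      by (intro bexI[of _ "- x"]) (simp_all add: free_alg_simps(1-4) free_alg_closed)
  qed (simp_all only: free_alg_simps(1-4) free_alg_closed add.assoc add_0_left, rule add.commute)
  show "Group.monoid (free_alg S :: ('x fmon \<Rightarrow>\<^sub>0 'k) ring)"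
    by (rule monoidI) (simp_all only: free_alg_simps(1-4) free_alg_closed mult.assoc mult_1_left mult_1_right)
qed (simp_all only: free_alg_simps(1-4) distrib_left distrib_right)

lemma free_alg_ideal:
  fixes J :: "('x fmon \<Rightarrow>\<^sub>0 'k::ring_1) set"
  assumes "J \<subseteq> carrier (free_alg S)" "0 \<in> J" "\<And>x y. x \<in> J \<Longrightarrow> y \<in> J \<Longrightarrow> x + y \<in> J" "\<And>x. x \<in> J \<Longrightarrow> - x \<in> J"
    "\<And>x y. x \<in> J \<Longrightarrow> y \<in> carrier (free_alg S) \<Longrightarrow> x * y \<in> J \<and> y * x \<in> J"
  shows "ideal J (free_alg S)"
proof (rule idealI[OF free_alg_ring])
  interpret ring "free_alg S :: ('x fmon \<Rightarrow>\<^sub>0 'k) ring" by (rule free_alg_ring)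
  have m: "\<ominus>\<^bsub>free_alg S\<^esub> x = - x" if "x \<in> J" for x
    using that assms(1,4) by (intro minus_equality) (auto simp: free_alg_simps(1-4))
  show "subgroup J (add_monoid (free_alg S))"
    using assms m by (intro group.subgroupI[OF a_group]) (auto simp: free_alg_simps(1-4) a_inv_def)
qed (use assms(5) in \<open>auto simp: free_alg_simps(1-4)\<close>)

section \<open>Identification of A and of its star\<close>

context qparam
begin

lemma ev_Uq_dual: assumes "a \<in> UU" shows "ev a \<in> Uq_dual q"
proof -
  let ?J = "{X. \<forall>Y Z. ev a (Y * X * Z) = 0}"
  have "ideal ?J (free_alg UNIV)"
  proof (rule free_alg_ideal)
    fix x y assume "x \<in> ?J"
    then show "x * y \<in> ?J \<and> y * x \<in> ?J"
    proof (intro conjI CollectI allI)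
      fix Y Z
      have "Y * (x * y) * Z = Y * x * (y * Z)" "Y * (y * x) * Z = (Y * y) * x * Z" by (simp_all add: mult.assoc)
      then show "ev a (Y * (x * y) * Z) = 0" "ev a (Y * (y * x) * Z) = 0" using \<open>x \<in> ?J\<close> by auto
    qed
  qed (auto simp: free_alg_simps distrib_left distrib_right)
  moreover have "Uq_rels q \<subseteq> ?J"
  proof (intro subsetI CollectI allI)
    fix X Y Z assume "X \<in> Uq_rels q"
    then have "act X (act Z a) = 0" using act_Uq_rels act_UU assms by blast
    then show "ev a (Y * X * Z) = 0" by (metis act_simps(7) ev_act ev_lin(3) mult.assoc zero_fun_apply)
  qed
  ultimately have "Uq_ideal q \<subseteq> ?J" unfolding Uq_ideal_def genideal_def by blast
  then have "ev a X = 0" if "X \<in> Uq_ideal q" for X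
    using that by (metis (mono_tags, lifting) mem_Collect_eq mult_1_left mult_1_right subsetD)
  then show ?thesis by (auto simp: Uq_dual_def)
qed

lemma cop_coprod: assumes "cop P R a"
  shows "\<exists>(n::nat) l r. (\<forall>k<n. l k \<in> P \<and> r k \<in> R) \<and> coprod (ev a) = (\<Sum>k<n. tens (ev (l k)) (ev (r k)))"
proof -
  obtain n l r where h: "\<forall>k<n::nat. l k \<in> P \<and> r k \<in> R" "\<And>v. lshw v a = (\<Sum>k<n. ap (l k) v *\<^sub>C r k)"
    using assms unfolding cop_def by blast
  have H: "ap a (v @ v') = (\<Sum>k<n. ap (l k) v * ap (r k) v')" for v v'
    using arg_cong[OF h(2)[of v], of "\<lambda>a. ap a v'"] by (simp add: lshw_def ap_sum)
  have "ev a (X * Y) = (\<Sum>k<n. ev (l k) X * ev (r k) Y)" for X Y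
  proof (induction X rule: pm_induct)
    case (single v c)
    show ?case
    proof (induction Y rule: pm_induct)
      case (single w d) show ?case by (simp add: mult_single H sum_distrib_left algebra_simps)
    qed (simp_all add: distrib_left sum.distrib)
  qed (simp_all add: distrib_right sum.distrib)
  then have "coprod (ev a) = (\<Sum>k<n. tens (ev (l k)) (ev (r k)))"
    by (auto simp: coprod_def tens_def fun_eq_iff sum_fun_apply split: prod.split)
  then show ?thesis using h(1) by blast
qed

lemma tensor_space_sum:
  assumes "\<And>k. k < (n::nat) \<Longrightarrow> l k \<in> P \<and> r k \<in> R" shows "(\<Sum>k<n. tens (l k) (r k)) \<in> tensor_space P R"
  unfolding tensor_space_def
  by (intro module.span_sum[OF fscale_module] module.span_base[OF fscale_module]) (use assms in auto)

lemma range_nx: "{1..3::nat} = range nx"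
proof -
  have "(UNIV :: ix set) = {i1, i2, i3}" using ix.exhaust by blast
  then have "range nx = nx ` {i1, i2, i3}" by (simp only:)
  then have "range nx = {1, 2, 3}" by simp
  moreover have "{1..3::nat} = {1, 2, 3}" by auto
  ultimately show ?thesis by simp
qed

lemma u_ev: "u q (nx i) (nx j) = ev (ud i j)"
  by (rule ext) (simp add: u_def ev_def lx_def ud_def)

text \<open>\<open>AA\<close> is closed under product, coproduct and antipode, hence a Hopf
  subalgebra. Conversely, a Hopf subalgebra with the u_ij contains their antipodes and so all of
  \<open>AA\<close>.\<close>

lemma OSU3_eq: "OSU3 q = ev ` AA"
proof
  have t: "coprod (ev a) \<in> tensor_space P P" if aP: "a \<in> AA" "ev ` AA \<subseteq> P" for a P
  proof -
    obtain n l r where "\<forall>k<n::nat. l k \<in> AA \<and> r k \<in> AA" "coprod (ev a) = (\<Sum>k<n. tens (ev (l k)) (ev (r k)))"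
      using cop_coprod[OF cop_AA[OF aP(1)]] by blast
    then show ?thesis using aP(2) by (auto intro!: tensor_space_sum)
  qed
  have sub: "ev ` AA \<subseteq> Uq_dual q" using ev_Uq_dual by auto
  have "Hopf_subalgebra q (ev ` AA)"
    unfolding Hopf_subalgebra_def Hopf_dual_def
    using t[of _ "ev ` AA"] t[OF _ sub] sub
    by (auto simp: Ucounit_ev ev_conv ev_antipode simp flip: ev_lin intro!: imageI)
  then show "OSU3 q \<subseteq> ev ` AA"
    unfolding OSU3_def range_nx by (auto simp: u_ev)
  have "ev a \<in> H" if "a \<in> AA" and H: "Hopf_subalgebra q H" "\<forall>i\<in>{1..3}. \<forall>j\<in>{1..3}. u q i j \<in> H" for a H
    using that(1)
  proof (induction rule: AA.induct)
    case (ud i j) show ?case using H(2)[unfolded range_nx] by (simp flip: u_ev)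
  next
    case (vd i j)
    have "ev (ud i j) \<in> H" using H(2)[unfolded range_nx] by (simp flip: u_ev)
    then show ?case using H(1) ev_antipode[of "ud i j"] unfolding Hopf_subalgebra_def vd_def by metis
  next
    case (add a b) then show ?case using H(1) unfolding Hopf_subalgebra_def ev_lin by blast
  next
    case (mult a b) then show ?case using H(1) unfolding Hopf_subalgebra_def ev_conv[symmetric] by blast
  next
    case (scale a c) then show ?case using H(1) unfolding Hopf_subalgebra_def ev_lin by blast
  next
    case one then show ?case using H(1) unfolding Hopf_subalgebra_def Ucounit_ev by blast
  qed
  then show "ev ` AA \<subseteq> OSU3 q" unfolding OSU3_def by blast
qed

text \<open>The defining conditions fix the star on the u_ij, by involutivity on the S(u_ij), and
  then on everything they generate.\<close>

lemma OSU3_star_ev: assumes "a \<in> AA" shows "OSU3_star q (ev a) = ev (sd a)"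
proof -
  let ?P = "\<lambda>s. s \<in> extensional (OSU3 q) \<and> s \<in> OSU3 q \<rightarrow> OSU3 q \<and>
     (\<forall>a\<in>OSU3 q. \<forall>b\<in>OSU3 q. s (a + b) = s a + s b \<and> s (a \<star> b) = s b \<star> s a) \<and>
     (\<forall>c. \<forall>a\<in>OSU3 q. s (fscale c a) = fscale (cnj c) (s a)) \<and>
     (\<forall>a\<in>OSU3 q. s (s a) = a) \<and>
     (\<forall>i\<in>{1..3}. \<forall>j\<in>{1..3}. s (u q i j) = antipode (u q j i))"
  define s0 where "s0 = restrict (\<lambda>f. ev (sd (dv f))) (OSU3 q)"
  have s0: "s0 (ev a) = ev (sd a)" if "a \<in> AA" for a using that by (simp add: s0_def OSU3_eq)
  have P0: "?P s0"
    unfolding OSU3_eq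
  proof (intro conjI)
    show "s0 \<in> extensional (ev ` AA)" by (simp add: s0_def OSU3_eq)
    show "\<forall>i\<in>{1..3}. \<forall>j\<in>{1..3}. s0 (u q i j) = antipode (u q j i)"
      unfolding range_nx by (auto simp: u_ev s0 ev_antipode vd_def[symmetric])
    show "\<forall>a\<in>ev ` AA. \<forall>b\<in>ev ` AA. s0 (a + b) = s0 a + s0 b \<and> s0 (a \<star> b) = s0 b \<star> s0 a"
      by (intro ballI; elim imageE; hypsubst) (simp only: ev_conv ev_lin(1)[symmetric] s0 AA.add AA.mult sd_lin sd_times simp_thms)
  qed (auto simp: s0 simp flip: ev_lin)
  have uni: "s = s0" if s: "?P s" for s
  proof -
    note s' = s[unfolded OSU3_eq]
    have M: "s (ev a + ev b) = s (ev a) + s (ev b)" "s (ev a \<star> ev b) = s (ev b) \<star> s (ev a)" "s (s (ev a)) = ev a"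
      "s (fscale c (ev a)) = fscale (cnj c) (s (ev a))" "\<exists>a'\<in>AA. s (ev a) = ev a'"
      if "a \<in> AA" "b \<in> AA" for a b c using s' that by (auto dest: funcset_mem)
    have U: "s (ev (ud i j)) = ev (vd j i)" for i j
    proof -
      have "s (u q (nx i) (nx j)) = antipode (u q (nx j) (nx i))" using s'[unfolded range_nx] by blast
      then show ?thesis by (simp only: u_ev ev_antipode vd_def)
    qed
    have "s (ev a) = ev (sd a)" if "a \<in> AA" for a
      using that
    proof (induction rule: AA.induct)
      case one
      obtain a' where a': "a' \<in> AA" "s (ev 1) = ev a'" using M(5)[OF AA.one AA.one] by blast
      \<comment> \<open>With a' = s(1) and s(a') = 1, anti-multiplicativity applied to 1 a' forces
        a' = 1.\<close>
      have "s (ev 1 \<star> ev a') = s (ev a') \<star> s (ev 1)" using a' by (intro M) auto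
      moreover have "s (ev a') = ev 1" using M(3)[OF AA.one AA.one] a' by simp
      ultimately have "ev 1 = ev 1 \<star> ev a'" using a' by (simp add: ev_conv)
      then show ?case using a' by (simp add: ev_conv)
    next
      case (vd i j)
      have "s (s (ev (ud j i))) = ev (ud j i)" by (rule M(3)) auto
      then show ?case by (simp add: U)
    next
      case (scale a c) then show ?case using M(4)[of a a c] by (simp only: ev_lin sd_lin)
    next
      case (mult a b) then show ?case using M(2)[of a b] by (simp add: ev_conv)
    next
      case (add a b)
      have "s (ev a + ev b) = s (ev a) + s (ev b)" using add by (intro M(1))
      then show ?case using add by (simp only: ev_lin sd_lin)
    next
      case (ud i j) show ?case by (simp add: U)
    qed
    then have "s (ev a) = s0 (ev a)" if "a \<in> AA" for a using that s0 by simp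
    then have "s x = s0 x" if "x \<in> OSU3 q" for x using that unfolding OSU3_eq by blast
    moreover have "s \<in> extensional (OSU3 q)" "s0 \<in> extensional (OSU3 q)" using s P0 by blast+
    ultimately show "s = s0" by (intro extensionalityI[of _ "OSU3 q"])
  qed
  have "OSU3_star q = s0" unfolding OSU3_star_def by (rule the_equality) (use P0 uni in blast)+
  then show ?thesis using s0 assms by simp
qed

lemma Ustar_add: "Ustar (X + Y) = Ustar X + Ustar Y" and Ustar_single: "Ustar (Poly_Mapping.single w c) = scal (cnj c) * prod_list (map star_gen (rev (letters w)))"
proof -
  have U: "Ustar = lx (\<lambda>w c. scal (cnj c) * prod_list (map star_gen (rev (letters w))))"
    by (rule ext) (simp add: Ustar_def lin_extend_def lx_def)
  then show "Ustar (X + Y) = Ustar X + Ustar Y" "Ustar (Poly_Mapping.single w c) = scal (cnj c) * prod_list (map star_gen (rev (letters w)))"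
    unfolding U by (subst lx_simps; simp add: scal_def single_add distrib_right)+
qed

lemma scal_1: "scal 1 = 1" by (simp add: scal_def)

lemma act_tvec: "act (tvec q d) a = Xo d a"
proof -
  have E: "Ustar (UE i) = UK i * UF i" for i
    by (simp add: letter_def[of "gE i"] Ustar_single scal_1)
  have "Eroot q R12 = Poly_Mapping.single (FMon [gE Two, gE One]) 1 + Poly_Mapping.single (FMon [gE One, gE Two]) (- inverse Q)"
    by (simp add: letter_def scal_def mult_single single_uminus Q_def zero_fmon_def plus_fmon_def power_int_minus)
  then have "Ustar (Eroot q R12) = UK One * UF One * (UK Two * UF Two) + scal (- inverse Q) * (UK Two * UF Two * (UK One * UF One))"
    by (simp only: Ustar_add Ustar_single) (simp add: scal_1)
  then show ?thesis
    by (rule_tac cot_cases[of d]) (simp_all add: E Q_powi_of_real power_int_minus del: Eroot.simps(3), simp add: Q_def)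
qed
end

context qparam
begin

section \<open>The first-order calculus\<close>

lemma OF3_eq: "OF3 q = ev ` Aw 0"
proof -
  have "(\<forall>i. UK i \<rhd> ev a = ev a \<and> UKi i \<rhd> ev a = ev a) \<longleftrightarrow> a \<in> Aw 0" if "a \<in> AA" for a
  proof -
    have "Kia i a = a" if "Ka i a = a" for i using UU_K(2)[of a i] \<open>a \<in> AA\<close> that by simp
    then show ?thesis using that by (auto simp: lacts_ev Aw_def forall_smpl)
  qed
  then have "OF3 q = ev ` {a \<in> AA. a \<in> Aw 0}" unfolding OF3_def OSU3_eq by blast
  moreover have "{a \<in> AA. a \<in> Aw 0} = Aw 0" using AwD(1) by blast
  ultimately show ?thesis by simp
qed

lemma coords_ev: "coords q (ev y) = (\<lambda>d. ap (Xo d y) [])"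
proof
  fix d show "coords q (ev y) d = ap (Xo d y) []"
    using ev_act[of "tvec q d" y 1] by (simp add: coords_def act_tvec)
qed

lemma rt_inj: "rt d = rt g \<Longrightarrow> d = g"
  by (rule cot_cases[of d]; rule cot_cases[of g]; simp)

lemma Xo_yv: assumes "f \<noteq> d" shows "ap (Xo f (yv d)) [] = 0"
proof -
  have "Xo f (yv d) \<in> Aw (rt f)" using Xo_Aw[OF yv_props(1), of f d] by simp
  from Aw_left_weight[OF this, of "rt d"] cop_AwL[OF yv_props(2)[of d]] rt_inj[of f d] assms
  show ?thesis by (auto simp: lsh_Xo)
qed

text \<open>Elements of B^+ dual to the tangent vectors; they show that the choices made in the
  definition of the calculus and of the coaction are possible.\<close>

definition yn :: "cot \<Rightarrow> dual" where "yn d = (1 / ap (Xo d (yv d)) []) *\<^sub>C yv d"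

lemma yn_props: "yn d \<in> Aw 0" "ap (yn d) [] = 0" "(\<lambda>f. ap (Xo f (yn d)) []) = bvec d" "cop (AwL (rt d)) (Aw 0) (yn d)"
proof -
  show "yn d \<in> Aw 0" "ap (yn d) [] = 0" using yv_props[of d] by (simp_all add: yn_def Aw_scale)
  show "cop (AwL (rt d)) (Aw 0) (yn d)" unfolding yn_def by (rule cop_scale[OF yv_props(2)]) (rule Aw_scale)
  show "(\<lambda>f. ap (Xo f (yn d)) []) = bvec d"
    using yv_props(4)[of d] Xo_yv[of _ d] by (auto simp: yn_def bvec_def fun_eq_iff)
qed

text \<open>The chosen representative z vanishes at 1, so the term z X(c) of the Leibniz rule drops
  and only the derivatives of z at 1 enter, whatever the choice.\<close>

lemma Lam_ract_ev: assumes "c \<in> AA" shows "Lam_ract q (bvec g) (ev c) d = ap (Th g d (TT d c)) []"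
proof -
  define y where "y = (SOME y. y \<in> OSU3_aug q \<and> coords q y = bvec g)"
  have "\<exists>y. y \<in> OSU3_aug q \<and> coords q y = bvec g"
    using yn_props[of g] by (intro exI[of _ "ev (yn g)"]) (auto simp: OSU3_aug_def OSU3_eq coords_ev AwD)
  then have "y \<in> OSU3_aug q \<and> coords q y = bvec g" unfolding y_def by (rule someI_ex)
  then obtain z where z: "y = ev z" "z \<in> AA" "ap z [] = 0" "(\<lambda>f. ap (Xo f z) []) = bvec g"
    by (auto simp: OSU3_aug_def OSU3_eq coords_ev)
  have "Lam_ract q (bvec g) (ev c) d = ap (Xo d (z * c)) []"
    unfolding Lam_ract_def y_def[symmetric] z(1) ev_conv coords_ev ..
  also have "\<dots> = (\<Sum>e\<in>UNIV. bvec g e * ap (Th e d (TT d c)) [])"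
    using z(2,3) assms by (simp add: Leib ap_sum flip: z(4))
  also have "\<dots> = (\<Sum>e\<in>UNIV. if e = g then ap (Th e d (TT d c)) [] else 0)" by (rule sum.cong) (auto simp: bvec_def)
  finally show ?thesis by simp
qed

definition lc :: "ufree \<Rightarrow> dual \<Rightarrow> dual" where "lc X c = Dual (\<lambda>v. ev c (X * Poly_Mapping.single (FMon v) 1))"

lemma ev_lc: "ev (lc X c) Y = ev c (X * Y)"
proof (induction Y rule: pm_induct)
  case (single w d)
  have "X * Poly_Mapping.single w d = scal d * (X * Poly_Mapping.single (FMon (letters w)) 1)"
  proof -
    have "Poly_Mapping.single w d = Poly_Mapping.single (FMon (letters w)) 1 * scal d" by (simp add: scal_def mult_single)
    moreover have "Y * scal d = scal d * Y" for Y :: ufree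
      by (induction Y rule: pm_induct) (simp_all add: scal_def mult_single distrib_left distrib_right mult.commute)
    ultimately show ?thesis by (metis mult.assoc)
  qed
  then show ?case by (simp add: lc_def)
qed (simp_all add: distrib_left)

lemma lc_lin: "lc X (a + b) = lc X a + lc X b" "lc X (c *\<^sub>C a) = c *\<^sub>C lc X a" "lc X 0 = 0" "lc X (rs g a) = rs g (lc X a)"
proof -
  have "ap (lc X (rs g a)) v = ap (rs g (lc X a)) v" for v
  proof -
    have "ev (rs g a) (X * Poly_Mapping.single (FMon v) 1) = ev a (X * (Poly_Mapping.single (FMon v) 1 * letter g))"
      using ev_act[of "letter g" a] by (simp add: mult.assoc)
    then show ?thesis by (simp add: lc_def letter_def mult_single plus_fmon_def)
  qed
  then show "lc X (rs g a) = rs g (lc X a)" by (rule dual_eqI)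
qed (auto intro!: dual_eqI simp: lc_def ev_lin fscale_def)

lemma lc_Th: "Th g d (TT d (lc X c)) = lc X (Th g d (TT d c))"
  by (rule cot_cases[of g]; rule cot_cases[of d]; simp add: lc_lin)

lemma lc_AA: assumes "c \<in> AA" shows "lc X c \<in> AA"
proof (induction X rule: pm_induct)
  case zero
  have "lc 0 c = 0" by (rule dual_eqI) (simp add: lc_def)
  then show ?case by simp
next
  case (single w d)
  obtain n l r where h: "\<forall>k<n::nat. l k \<in> AA \<and> r k \<in> AA" "\<And>v. lshw v c = (\<Sum>k<n. ap (l k) v *\<^sub>C r k)"
    using cop_AA[OF assms] unfolding cop_def by blast
  have "lc (Poly_Mapping.single w d) c = d *\<^sub>C lshw (letters w) c"
    by (rule dual_eqI) (simp add: lc_def mult_single lshw_def)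
  then show ?case using h by (auto intro!: AA_sum)
next
  case (add X Y)
  have "lc (X + Y) c = lc X c + lc Y c" by (rule dual_eqI) (simp add: lc_def distrib_right)
  with add show ?case by auto
qed

definition evf :: "(cot \<Rightarrow> dual) \<Rightarrow> form1" where "evf w = (\<lambda>d. ev (w d))"
definition mr :: "(cot \<Rightarrow> dual) \<Rightarrow> dual \<Rightarrow> cot \<Rightarrow> dual" where "mr w c = (\<lambda>d. \<Sum>g\<in>UNIV. w g * Th g d c)"
text \<open>A letter e_d carries the weight \<open>- rt d\<close>, so these coefficients make every
  summand of weight 0. By \<open>Omega1_eq\<close> they are exactly the one-forms over B.\<close>

definition MM :: "(cot \<Rightarrow> dual) set" where "MM = {w. \<forall>d. w d \<in> Aw (rt d)}"

lemma evf_inj [simp]: "evf w = evf w' \<longleftrightarrow> w = w'" by (auto simp: evf_def fun_eq_iff[of w] dest: fun_cong)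

lemma evf_add: "evf (\<lambda>d. w d + w' d) = evf w + evf w'" by (auto simp: evf_def fun_eq_iff ev_lin)
lemma evf_0: "evf (\<lambda>d. 0) = 0" by (auto simp: evf_def fun_eq_iff ev_lin)
lemma evf_sum: "evf (\<lambda>d. \<Sum>i\<in>I. w i d) = (\<Sum>i\<in>I. evf (w i))"
  by (induction I rule: infinite_finite_induct) (simp_all only: sum.infinite sum.empty evf_0 sum.insert evf_add not_False_eq_True simp_thms)

lemma form_lact_ev: "form_lact (ev b) (evf w) = evf (\<lambda>d. b * w d)"
  by (simp add: form_lact_def evf_def ev_conv)

lemma form_d_ev: "form_d q (ev b) = evf (\<lambda>d. Xo d b)"
  by (simp add: form_d_def evf_def lacts_ev act_tvec)

text \<open>An element of B has weight 0, so \<open>TT\<close> acts trivially on it and the twisted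
  action \<open>Th\<close> computes the actual bimodule structure.\<close>

lemma form_ract_ev: assumes "c \<in> Aw 0" shows "form_ract q (evf w) (ev c) = evf (mr w c)"
proof -
  have "(\<lambda>X. Lam_ract q (bvec g) (\<lambda>Y. ev c (X * Y)) d) = ev (Th g d c)" for g d
  proof
    fix X
    have "(\<lambda>Y. ev c (X * Y)) = ev (lc X c)" by (simp add: ev_lc fun_eq_iff)
    then have "Lam_ract q (bvec g) (\<lambda>Y. ev c (X * Y)) d = ap (lc X (Th g d (TT d c))) []"
      using Lam_ract_ev[OF lc_AA[OF AwD(1)[OF assms]], of g X d] by (simp add: lc_Th)
    also have "\<dots> = ev (Th g d (TT d c)) X"
      using ev_lc[of X "Th g d (TT d c)" 1] by simp
    also have "TT d c = c" using Aw_TT[OF assms, of d] by (rule_tac cot_cases[of d]) simp_all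
    finally show "Lam_ract q (bvec g) (\<lambda>Y. ev c (X * Y)) d = ev (Th g d c) X" .
  qed
  then show ?thesis by (simp add: form_ract_def evf_def mr_def ev_conv ev_sum)
qed

lemma MM_add: "w \<in> MM \<Longrightarrow> w' \<in> MM \<Longrightarrow> (\<lambda>d. w d + w' d) \<in> MM" by (auto simp: MM_def Aw_add)
lemma MM_0: "(\<lambda>d. 0) \<in> MM" by (auto simp: MM_def)
lemma MM_lact: "w \<in> MM \<Longrightarrow> b \<in> Aw 0 \<Longrightarrow> (\<lambda>d. b * w d) \<in> MM" by (auto simp: MM_def intro: Aw_mult')
lemma MM_d: "b \<in> Aw 0 \<Longrightarrow> (\<lambda>d. Xo d b) \<in> MM" using Xo_Aw[of b 0] by (auto simp: MM_def)
lemma MM_mr: "w \<in> MM \<Longrightarrow> b \<in> Aw 0 \<Longrightarrow> mr w b \<in> MM"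
  by (auto simp: MM_def mr_def intro!: Aw_sum Aw_mult'[OF _ Th_Aw])

lemma Omega1_sum: assumes "\<And>i. i \<in> I \<Longrightarrow> f i \<in> Omega1_F3 q" shows "sum f I \<in> Omega1_F3 q"
proof -
  have "form_d q (ev 1) \<in> Omega1_F3 q" by (rule Omega1_F3.intros) (simp add: OF3_eq)
  then have 0: "0 \<in> Omega1_F3 q" by (simp add: form_d_ev evf_0)
  show ?thesis using assms
    by (induction I rule: infinite_finite_induct) (auto simp: 0 intro: Omega1_F3.intros)
qed

text \<open>By \<open>cop_family\<close> for \<open>yn g\<close>, each summand w_g e_g is a
  combination of forms b dr over B.\<close>

lemma MM_span:
  assumes "w \<in> MM"
  shows "\<exists>(n::nat) b r. (\<forall>k<n. b k \<in> Aw 0 \<and> r k \<in> Aw 0) \<and> w = (\<lambda>d. \<Sum>k<n. b k * Xo d (r k))"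
proof -
  have "\<forall>g. \<exists>(n::nat) b r. (\<forall>k<n. b k \<in> Aw 0 \<and> r k \<in> Aw 0) \<and> (\<forall>d. (\<Sum>k<n. b k * Xo d (r k)) = bvec g d *\<^sub>C w g)"
  proof
    fix g
    have "w g \<in> Aw (rt g)" using assms by (simp add: MM_def)
    from cop_family[OF yn_props(4)[of g] this] fun_cong[OF yn_props(3)[of g]]
    show "\<exists>(n::nat) b r. (\<forall>k<n. b k \<in> Aw 0 \<and> r k \<in> Aw 0) \<and> (\<forall>d. (\<Sum>k<n. b k * Xo d (r k)) = bvec g d *\<^sub>C w g)"
      by simp blast
  qed
  then obtain n b r where h: "\<And>g k. k < (n g::nat) \<Longrightarrow> b g k \<in> Aw 0 \<and> r g k \<in> Aw 0"
    "\<And>g d. (\<Sum>k<n g. b g k * Xo d (r g k)) = bvec g d *\<^sub>C w g" by metis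
  let ?I = "SIGMA g:UNIV. {..<n g}"
  obtain \<phi> where \<phi>: "bij_betw \<phi> {0..<card ?I} ?I" using ex_bij_betw_nat_finite[of ?I] by auto
  have "w d = (\<Sum>k<card ?I. b (fst (\<phi> k)) (snd (\<phi> k)) * Xo d (r (fst (\<phi> k)) (snd (\<phi> k))))" for d
  proof -
    have "w d = (\<Sum>g\<in>UNIV. if g = d then w g else 0)" by simp
    also have "\<dots> = (\<Sum>g\<in>UNIV. bvec g d *\<^sub>C w g)" by (rule sum.cong) (auto simp: bvec_def)
    also have "\<dots> = (\<Sum>(g, k)\<in>?I. b g k * Xo d (r g k))" by (simp add: h(2)[symmetric] sum.Sigma)
    also have "\<dots> = (\<Sum>k<card ?I. b (fst (\<phi> k)) (snd (\<phi> k)) * Xo d (r (fst (\<phi> k)) (snd (\<phi> k))))"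
      using sum.reindex_bij_betw[OF \<phi>, of "\<lambda>(g, k). b g k * Xo d (r g k)"]
      by (simp add: lessThan_atLeast0 case_prod_unfold)
    finally show ?thesis .
  qed
  moreover have "snd (\<phi> k) < n (fst (\<phi> k))" if "k < card ?I" for k
    using bij_betwE[OF \<phi>] that by (auto simp: mem_Sigma_iff dest!: bspec[of _ _ k])
  ultimately show ?thesis using h(1)
    by (intro exI[of _ "card ?I"] exI[of _ "\<lambda>k. b (fst (\<phi> k)) (snd (\<phi> k))"] exI[of _ "\<lambda>k. r (fst (\<phi> k)) (snd (\<phi> k))"]) auto
qed

lemma Omega1_eq: "Omega1_F3 q = evf ` MM"
proof
  show "Omega1_F3 q \<subseteq> evf ` MM"
  proof
    fix w assume "w \<in> Omega1_F3 q"
    then show "w \<in> evf ` MM"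
    proof induction
      case (1 b) then show ?case by (auto simp: OF3_eq form_d_ev MM_d)
    next
      case (2 w v)
      then obtain x y where "w = evf x" "v = evf y" "x \<in> MM" "y \<in> MM" by blast
      then show ?case using MM_add[of x y] by (simp only: evf_add[symmetric]) blast
    next
      case (3 b w) then show ?case by (auto simp: OF3_eq form_lact_ev MM_lact)
    next
      case (4 w b) then show ?case by (auto simp: OF3_eq form_ract_ev MM_mr)
    qed
  qed
  show "evf ` MM \<subseteq> Omega1_F3 q"
  proof clarify
    fix w assume "w \<in> MM"
    then obtain n b r where h: "\<forall>k<n::nat. b k \<in> Aw 0 \<and> r k \<in> Aw 0" "w = (\<lambda>d. \<Sum>k<n. b k * Xo d (r k))"
      using MM_span by blast
    have "evf (\<lambda>d. b k * Xo d (r k)) \<in> Omega1_F3 q" if "k < n" for k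
      using h(1) that Omega1_F3.intros(3)[of "ev (b k)" q "form_d q (ev (r k))"] Omega1_F3.intros(1)[of "ev (r k)" q]
      by (simp add: OF3_eq form_d_ev form_lact_ev)
    then show "evf w \<in> Omega1_F3 q" unfolding h(2) evf_sum by (intro Omega1_sum) auto
  qed
qed

section \<open>Partitions of unity and the cotensor product\<close>

definition sl :: "int \<times> int \<Rightarrow> bool" where "sl l \<longleftrightarrow> (\<exists>xs. strong l xs)"

lemma sl_add: "sl l \<Longrightarrow> sl m \<Longrightarrow> sl (l + m)" unfolding sl_def using strong_add by blast
lemma sl_0: "sl 0" unfolding sl_def using strong_0 by blast
lemma sl_rt: "sl (rt d)"
proof -
  have "sl (wtx i)" "sl (- wtx i)" for i unfolding sl_def using strong_wtx strong_wtx_minus by blast+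
  then have s: "sl (wtx i + - wtx j)" for i j by (rule sl_add)
  show ?thesis using s[of i2 i1] s[of i3 i2] s[of i3 i1] s[of i1 i2] s[of i2 i3] s[of i1 i3]
    by (rule_tac cot_cases[of d]) simp_all
qed

definition XY :: "int \<times> int \<Rightarrow> (dual \<times> dual) list" where "XY l = (SOME xs. strong l xs)"

lemma XY: "sl l \<Longrightarrow> strong l (XY l)" unfolding XY_def sl_def by (rule someI_ex)

lemma XY_mem: "sl l \<Longrightarrow> (x, y) \<in> set (XY l) \<Longrightarrow> x \<in> Aw (- l) \<and> y \<in> Aw l"
  using XY[of l] by (auto simp: strong_def)

lemma XY_sum: "sl l \<Longrightarrow> (\<Sum>(x, y)\<leftarrow>XY l. x * y) = 1"
  using XY[of l] by (simp add: strong_def)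

text \<open>Write z = \<Sum> (z x_i) y_i with a partition of unity; the factors z x_i lie in B and
  vanish at 1.\<close>

lemma BpA_mem: assumes "z \<in> Aw l" "sl l" "ap z [] = 0" shows "ev z \<in> BpA q"
proof -
  let ?S = "{b \<star> a |b a. b \<in> OF3_aug q \<and> a \<in> OSU3 q}"
  have m: "ev (z * x * y) \<in> BpA q" if "(x, y) \<in> set (XY l)" for x y
  proof -
    have "z * x \<in> Aw 0" "y \<in> AA" using XY_mem[OF assms(2) that] assms(1) AwD(1)[of y l] by (auto intro: Aw_mult')
    then have "ev (z * x) \<star> ev y \<in> ?S"
      using assms(3) by (intro CollectI exI[of _ "ev (z * x)"] exI[of _ "ev y"]) (auto simp: OF3_aug_def OF3_eq OSU3_eq)
    then show ?thesis unfolding BpA_def by (simp add: ev_conv module.span_base[OF fscale_module])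
  qed
  have "ev (\<Sum>(x, y)\<leftarrow>xs. z * x * y) \<in> BpA q" if "set xs \<subseteq> set (XY l)" for xs
    using that
  proof (induction xs)
    case Nil show ?case unfolding BpA_def list.map sum_list.Nil ev_lin by (rule module.span_zero[OF fscale_module])
  next
    case (Cons p xs)
    then have "ev (z * fst p * snd p) \<in> BpA q" using m[of "fst p" "snd p"] by simp
    moreover have "ev (\<Sum>(x, y)\<leftarrow>xs. z * x * y) \<in> BpA q" using Cons by simp
    moreover have "(\<Sum>(x, y)\<leftarrow>p # xs. z * x * y) = z * fst p * snd p + (\<Sum>(x, y)\<leftarrow>xs. z * x * y)"
      by (simp add: case_prod_unfold)
    ultimately show ?case unfolding BpA_def by (simp only: ev_lin(1) module.span_add[OF fscale_module])
  qed
  moreover have "(\<Sum>(x, y)\<leftarrow>xs. z * x * y) = z * (\<Sum>(x, y)\<leftarrow>xs. x * y)" for xs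
    by (induction xs) (auto simp: algebra_simps)
  ultimately show ?thesis using XY_sum[OF assms(2)] by fastforce
qed

text \<open>Evaluation at K_i is multiplicative and agrees with the counit on B, so it is defined on
  A/B^+A and can detect weights there.\<close>

lemma BpA_K: assumes "b \<in> BpA q" shows "b (UK i) = 0"
proof -
  interpret module fscale by (rule fscale_module)
  have "subspace {b. b (UK i) = 0}" by (auto simp: subspace_def fscale_def)
  moreover have "{b \<star> a |b a. b \<in> OF3_aug q \<and> a \<in> OSU3 q} \<subseteq> {b. b (UK i) = 0}"
  proof clarify
    fix b a assume "b \<in> OF3_aug q" "a \<in> OSU3 q"
    then obtain b' a' where *: "b = ev b'" "b' \<in> Aw 0" "ap b' [] = 0" "a = ev a'" by (auto simp: OF3_aug_def OF3_eq OSU3_eq)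
    have "ev (b' * a') (UK i) = ap (Ka i (b' * a')) []" using ev_act[of "UK i" "b' * a'" 1] by simp
    also have "\<dots> = ap (Ka i b') [] * ap (Ka i a') []" by (simp del: ap_rs)
    also have "Ka i b' = b'" using AwD(2,3)[OF *(2)] by (cases i) simp_all
    finally show "(b \<star> a) (UK i) = 0" using * by (simp add: ev_conv)
  qed
  ultimately have "BpA q \<subseteq> {b. b (UK i) = 0}" unfolding BpA_def by (rule span_minimal[rotated])
  then show ?thesis using assms by blast
qed

lemma tensor_space_K: assumes "t \<in> tensor_space P (BpA q)" shows "t (X :: ufree, UK i) = 0"
proof -
  interpret module "fscale :: complex \<Rightarrow> (ufree \<times> ufree \<Rightarrow> complex) \<Rightarrow> _" by (rule fscale_module)
  have "subspace {t. t (X, UK i) = 0}" by (auto simp: subspace_def fscale_def)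
  moreover have "{tens a b |a b. a \<in> P \<and> b \<in> BpA q} \<subseteq> {t. t (X, UK i) = 0}" by (auto simp: tens_def BpA_K)
  ultimately have "tensor_space P (BpA q) \<subseteq> {t. t (X, UK i) = 0}" unfolding tensor_space_def by (rule span_minimal[rotated])
  then show ?thesis using assms by blast
qed

lemma V_coact_ev: "\<exists>z. \<forall>d. V_coact q g d = ev (z d) \<and> z d \<in> Aw (rt d) \<and> ap (z d) [] = bvec g d"
proof -
  define y where "y = (SOME y. y \<in> OF3_aug q \<and> coords q y = bvec g)"
  have "\<exists>y. y \<in> OF3_aug q \<and> coords q y = bvec g"
    using yn_props[of g] by (intro exI[of _ "ev (yn g)"]) (auto simp: OF3_aug_def OF3_eq coords_ev)
  then have "y \<in> OF3_aug q \<and> coords q y = bvec g" unfolding y_def by (rule someI_ex)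
  then obtain z where z: "y = ev z" "z \<in> Aw 0" "(\<lambda>f. ap (Xo f z) []) = bvec g"
    by (auto simp: OF3_aug_def OF3_eq coords_ev)
  then show ?thesis unfolding V_coact_def y_def[symmetric]
    using MM_d[OF z(2)] by (intro exI[of _ "\<lambda>d. Xo d z"]) (auto simp: lacts_ev act_tvec MM_def dest: fun_cong)
qed

text \<open>Evaluating the second leg at K_i shows that coefficients in the cotensor product have
  the right weights. Conversely, modulo B^+A an element of weight \<open>rt d\<close> is its value
  at 1 times any element of that weight with value 1, so both coactions agree on forms with
  coefficients in \<open>MM\<close>.\<close>

lemma cotensor_eq: "cotensor q W = evf ` {w \<in> MM. \<forall>d. d \<notin> W \<longrightarrow> w d = 0}"
proof -
  obtain z where z: "\<And>g d. V_coact q g d = ev (z g d)" "\<And>g d. z g d \<in> Aw (rt d)" "\<And>g d. ap (z g d) [] = bvec g d"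
    using V_coact_ev by metis
  have zK: "ev (z g d) (UK i) = (if g = d then Q powi (case i of One \<Rightarrow> fst (rt d) | Two \<Rightarrow> snd (rt d)) else 0)" for g d i
  proof -
    have "ev (z g d) (UK i) = ap (Ka i (z g d)) []" using ev_act[of "UK i" "z g d" 1] by simp
    then show ?thesis using AwD(2,3)[OF z(2)[of g d]] z(3)[of g d] by (cases i) (auto simp: bvec_def)
  qed
  show ?thesis
  proof
    show "cotensor q W \<subseteq> evf ` {w \<in> MM. \<forall>d. d \<notin> W \<longrightarrow> w d = 0}"
    proof
      fix w assume w: "w \<in> cotensor q W"
      define a where "a d = dv (w d)" for d
      have "w d \<in> ev ` AA" for d using w by (auto simp: cotensor_def OSU3_eq)
      then have a: "w d = ev (a d)" "a d \<in> AA" for d unfolding a_def by (metis dv_ev image_iff)+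
      have "a d \<in> Aw (rt d)" for d
      proof -
        have t: "coprod (ev (a d)) - (\<Sum>g\<in>UNIV. tens (ev (a g)) (ev (z g d))) \<in> tensor_space (OSU3 q) (BpA q)"
          using w unfolding cotensor_def mem_Collect_eq a(1) z(1) by blast
        \<comment> \<open>At K_i the elements of B^+A vanish, and the coaction matrix becomes the
          diagonal matrix of the weights.\<close>
        have "ev (Ka i (a d)) X = (Q powi (case i of One \<Rightarrow> fst (rt d) | Two \<Rightarrow> snd (rt d))) * ev (a d) X" for i X
          using tensor_space_K[OF t, of X i] ev_act[of "UK i" "a d" X]
          by (simp add: coprod_def tens_def sum_fun_apply zK if_distrib mult.commute cong: if_cong)
        then have "ev (Ka i (a d)) = ev ((Q powi (case i of One \<Rightarrow> fst (rt d) | Two \<Rightarrow> snd (rt d))) *\<^sub>C a d)" for i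
          by (simp add: ev_lin fscale_def fun_eq_iff)
        from this[of One] this[of Two] show ?thesis using a(2) by (simp add: Aw_def)
      qed
      moreover have "a d = 0" if "d \<notin> W" for d
        using w that a(1)[of d] ev_lin(3) ev_inj[of "a d" 0] by (auto simp: cotensor_def)
      moreover have "w = evf a" by (simp add: evf_def a(1) fun_eq_iff)
      ultimately show "w \<in> evf ` {w \<in> MM. \<forall>d. d \<notin> W \<longrightarrow> w d = 0}" by (auto simp: MM_def)
    qed
    show "evf ` {w \<in> MM. \<forall>d. d \<notin> W \<longrightarrow> w d = 0} \<subseteq> cotensor q W"
    proof clarify
      fix w assume w: "w \<in> MM" "\<forall>d. d \<notin> W \<longrightarrow> w d = 0"
      have wd: "w d \<in> Aw (rt d)" for d using w(1) by (simp add: MM_def)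
      have "coprod (ev (w d)) - (\<Sum>g\<in>UNIV. tens (ev (w g)) (ev (z g d))) \<in> tensor_space (OSU3 q) (BpA q)" for d
      proof -
        interpret module "fscale :: complex \<Rightarrow> (ufree \<times> ufree \<Rightarrow> complex) \<Rightarrow> _" by (rule fscale_module)
        have tb: "tens (ev l) (ev r) \<in> tensor_space (OSU3 q) (BpA q)" if "l \<in> AA" "r \<in> Aw (rt d)" "ap r [] = 0" for l r
          unfolding tensor_space_def
          by (rule span_base) (use that BpA_mem[OF that(2) sl_rt] OSU3_eq in auto)
        obtain n l r where h: "\<forall>k<n::nat. l k \<in> AA \<and> r k \<in> Aw (rt d)" "coprod (ev (w d)) = (\<Sum>k<n. tens (ev (l k)) (ev (r k)))"
          using cop_coprod[OF cop_Aw[OF wd]] by blast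
        \<comment> \<open>The comparison element of weight \<open>rt d\<close> with value 1 at
          1.\<close>
        define t where "t = z d d"
        have t: "t \<in> Aw (rt d)" "ap t [] = 1" using z by (simp_all add: t_def bvec_def)
        have wl: "ev (w d) X = (\<Sum>k<n. ap (r k) [] * ev (l k) X)" for X
          using fun_cong[OF h(2), of "(X, 1)"] by (simp add: coprod_def tens_def sum_fun_apply mult.commute)
        have "coprod (ev (w d)) - (\<Sum>g\<in>UNIV. tens (ev (w g)) (ev (z g d))) =
          (\<Sum>k<n. tens (ev (l k)) (ev (r k - ap (r k) [] *\<^sub>C t))) - (\<Sum>g\<in>UNIV. tens (ev (w g)) (ev (z g d - bvec g d *\<^sub>C t)))"
        proof
          fix XY :: "ufree \<times> ufree"
          obtain X Y where XY: "XY = (X, Y)" by force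
          have b: "(\<Sum>g\<in>UNIV. ev (w g) X * (bvec g d * ev t Y)) = ev (w d) X * ev t Y"
          proof -
            have "(\<Sum>g\<in>UNIV. ev (w g) X * (bvec g d * ev t Y)) = (\<Sum>g\<in>UNIV. if g = d then ev (w g) X * ev t Y else 0)"
              by (rule sum.cong) (auto simp: bvec_def)
            then show ?thesis by simp
          qed
          show "(coprod (ev (w d)) - (\<Sum>g\<in>UNIV. tens (ev (w g)) (ev (z g d)))) XY =
            ((\<Sum>k<n. tens (ev (l k)) (ev (r k - ap (r k) [] *\<^sub>C t))) - (\<Sum>g\<in>UNIV. tens (ev (w g)) (ev (z g d - bvec g d *\<^sub>C t)))) XY"
            unfolding h(2) XY
            by (simp add: sum_fun_apply tens_def ev_lin fscale_def right_diff_distrib sum_subtractf b)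
               (simp add: wl sum_distrib_right sum_distrib_left algebra_simps)
        qed
        also have "\<dots> \<in> tensor_space (OSU3 q) (BpA q)"
          unfolding tensor_space_def
        proof (intro span_diff span_sum; unfold tensor_space_def[symmetric])
          fix k assume "k \<in> {..<n}"
          then show "tens (ev (l k)) (ev (r k - ap (r k) [] *\<^sub>C t)) \<in> tensor_space (OSU3 q) (BpA q)"
            using h(1) t by (intro tb) (auto intro: Aw_diff Aw_scale)
        next
          fix g
          show "tens (ev (w g)) (ev (z g d - bvec g d *\<^sub>C t)) \<in> tensor_space (OSU3 q) (BpA q)"
            using z t AwD(1)[OF wd[of g]] by (intro tb) (auto intro: Aw_diff Aw_scale)
        qed
        finally show ?thesis .
      qed
      then show "evf w \<in> cotensor q W"
        unfolding cotensor_def z(1) using w(2) AwD(1)[OF wd] by (auto simp: evf_def OSU3_eq ev_lin(3))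
    qed
  qed
qed

section \<open>The involution on one-forms\<close>

primrec cc :: "cot \<Rightarrow> cot" where "cc (ec r) = fc r" | "cc (fc r) = ec r"
primrec mgr :: "proot \<Rightarrow> complex" where "mgr R1 = Q\<^sup>2" | "mgr R2 = Q ^ 3" | "mgr R12 = Q ^ 4"
primrec mg :: "cot \<Rightarrow> complex" where "mg (ec r) = - inverse (mgr r)" | "mg (fc r) = - mgr r"

text \<open>The involution $(a\,e_\gamma)^* = e_\gamma^*a^*$, where $e_\gamma^*$ and $f_\gamma^*$ are the
  multiples of $f_\gamma$ and $e_\gamma$ that make it commute with the differential.\<close>

definition ms :: "(cot \<Rightarrow> dual) \<Rightarrow> cot \<Rightarrow> dual" where
  "ms w = (\<lambda>d. \<Sum>g\<in>UNIV. mg g *\<^sub>C Th (cc g) d (sd (w g)))"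

lemma rt_cc: "rt (cc d) = - rt d" by (cases d) simp_all

lemma MM_ms: "w \<in> MM \<Longrightarrow> ms w \<in> MM"
proof -
  assume "w \<in> MM"
  then have "Th (cc g) d (sd (w g)) \<in> Aw (rt d)" for g d
    using Th_Aw[OF Aw_sd[of "w g" "rt g"], of "cc g" d] by (simp add: MM_def rt_cc)
  then show ?thesis by (auto simp: MM_def ms_def intro!: Aw_sum Aw_scale)
qed

lemma ms_add: "ms (\<lambda>d. w d + w' d) = (\<lambda>d. ms w d + ms w' d)"
  by (simp add: ms_def sum.distrib scC_distrib)

lemma ms_lact: assumes "w \<in> MM" "b \<in> AA" shows "ms (\<lambda>d. b * w d) = mr (ms w) (sd b)"
proof
  fix d
  have "w g \<in> AA" for g using assms(1) AwD(1)[of "w g" "rt g"] by (simp add: MM_def)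
  then have U: "sd (w g) \<in> UU" "sd b \<in> UU" for g using assms(2) by simp_all
  have "ms (\<lambda>d. b * w d) d = (\<Sum>g\<in>UNIV. \<Sum>e\<in>UNIV. mg g *\<^sub>C (Th (cc g) e (sd (w g)) * Th e d (sd b)))"
    by (simp add: ms_def Th_mult U scC_sum)
  also have "\<dots> = (\<Sum>e\<in>UNIV. \<Sum>g\<in>UNIV. mg g *\<^sub>C (Th (cc g) e (sd (w g)) * Th e d (sd b)))" by (rule sum.swap)
  finally show "ms (\<lambda>d. b * w d) d = mr (ms w) (sd b) d" by (simp add: mr_def ms_def sum_distrib_right)
qed

text \<open>The constants \<open>mgr\<close> are chosen for this identity: they collect the factors
  of \<open>rs_sd\<close>, those of the K_i inside F_\<gamma>, and those of the diagonal entries of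
  \<open>Th\<close>.\<close>

lemma ms_d: assumes "b \<in> Aw 0" shows "ms (\<lambda>d. Xo d b) = (\<lambda>d. Xo d (sd b))"
proof
  fix d
  have U: "b \<in> UU" and K: "Ka One b = b" "Ka Two b = b" "Kia One b = b" "Kia Two b = b"
    using assms AwD[OF assms] Aw_Kia[OF assms] by simp_all
  show "ms (\<lambda>d. Xo d b) d = Xo d (sd b)"
    by (rule cot_cases[of d]; simp add: ms_def sum_cot rs_sd U K UU_K cartan_def power_int_minus scC_distrib;
        rule dual_eqI; simp add: field_simps power2_eq_square power3_eq_cube power4_eq_xxxx)
qed

end

section \<open>The maximal prolongation as a quotient of a free ring\<close>

lemma quot_zero: assumes "ideal I R" "x \<in> carrier R" shows "I +>\<^bsub>R\<^esub> x = \<zero>\<^bsub>R Quot I\<^esub> \<longleftrightarrow> x \<in> I"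
proof -
  interpret ideal I R by fact
  show ?thesis using a_rcos_const a_rcos_self[OF assms(2)] by (auto simp: FactRing_def)
qed

lemma quot_carrier: "carrier (R Quot I) = (\<lambda>x. I +>\<^bsub>R\<^esub> x) ` carrier R"
  by (auto simp: FactRing_def A_RCOSETS_def')

text \<open>Two successive quotients by generated ideals can be tested in one ideal upstairs: one
  inclusion pulls the second ideal back, the other pushes the ideal of the union forward.\<close>

lemma double_quot:
  fixes R (structure)
  assumes R: "ring R" and S: "S \<subseteq> carrier R" "T \<subseteq> carrier R" and p: "p \<in> carrier R"
  defines "I \<equiv> Idl S" and "A \<equiv> R Quot Idl S"
  defines "P \<equiv> Idl\<^bsub>A\<^esub> ((\<lambda>x. I +> x) ` T)"
  shows "ideal P A" "ideal I R" "I +> p \<in> P \<longleftrightarrow> p \<in> Idl (S \<union> T)"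
proof -
  interpret ring R by fact
  show I: "ideal I R" unfolding I_def by (rule genideal_ideal[OF S(1)])
  interpret h: ring_hom_ring R A "(+>) I" using ideal.rcos_ring_hom_ring[OF I] unfolding A_def I_def .
  have T: "(\<lambda>x. I +> x) ` T \<subseteq> carrier A" using S(2) by auto
  show P: "ideal P A" unfolding P_def by (rule ring.genideal_ideal[OF h.S.ring_axioms T])
  have ST: "S \<union> T \<subseteq> carrier R" using S by blast
  interpret P: ideal P A by (rule P)
  show "I +> p \<in> P \<longleftrightarrow> p \<in> Idl (S \<union> T)"
  proof
    have J: "ideal {r \<in> carrier R. I +> r \<in> P} R" by (rule h.ideal_vimage[OF P])
    have "s \<in> I" if "s \<in> S" for s unfolding I_def using genideal_self[OF S(1)] that by blast
    then have "I +> s \<in> P" if "s \<in> S" for s using quot_zero[OF I, of s] that S(1) P.zero_closed by (auto simp: A_def I_def)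
    moreover have "I +> t \<in> P" if "t \<in> T" for t
      using ring.genideal_self[OF h.S.ring_axioms T] that unfolding P_def by blast
    ultimately have "S \<union> T \<subseteq> {r \<in> carrier R. I +> r \<in> P}" using S by auto
    from genideal_minimal[OF J this] show "p \<in> Idl (S \<union> T) \<Longrightarrow> I +> p \<in> P" by blast
  next
    assume "I +> p \<in> P"
    have J: "ideal (Idl (S \<union> T)) R" by (rule genideal_ideal[OF ST])
    interpret J: ideal "Idl (S \<union> T)" R by (rule J)
    have sub: "S \<union> T \<subseteq> Idl (S \<union> T)" by (rule genideal_self[OF ST])
    have IJ: "I \<subseteq> Idl (S \<union> T)" unfolding I_def by (rule genideal_minimal[OF J]) (use sub in auto)
    have "ideal ((+>) I ` (Idl (S \<union> T))) A" unfolding A_def I_def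
      by (rule ring_ideal_imp_quot_ideal[OF I[unfolded I_def] J])
    moreover have "(\<lambda>x. I +> x) ` T \<subseteq> (+>) I ` (Idl (S \<union> T))" using sub by auto
    ultimately have "P \<subseteq> (+>) I ` (Idl (S \<union> T))" unfolding P_def by (rule ring.genideal_minimal[OF h.S.ring_axioms])
    then obtain j where j: "j \<in> Idl (S \<union> T)" "I +> p = I +> j" using \<open>I +> p \<in> P\<close> by auto
    have jc: "j \<in> carrier R" using j by simp
    have "I +> (p \<ominus> j) = \<zero>\<^bsub>A\<^esub>"
      using p jc j(2) h.hom_add[of p "\<ominus> j"] h.S.r_neg[of "I +> j"] by (simp add: a_minus_def)
    then have "p \<ominus> j \<in> I" using quot_zero[OF I, of "p \<ominus> j"] p jc by (simp add: A_def I_def)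
    then have "(p \<ominus> j) \<oplus> j \<in> Idl (S \<union> T)" using IJ j J.a_closed by blast
    then show "p \<in> Idl (S \<union> T)" using p jc by (simp add: a_minus_def a_assoc l_neg)
  qed
qed

context qparam
begin

type_synonym fr = "(ufun + form1) fmon \<Rightarrow>\<^sub>0 int"

abbreviation "cF \<equiv> F3_fodc q"
abbreviation "FR \<equiv> tensor_free cF"
abbreviation "RR \<equiv> max_prol cF"
abbreviation mpc :: "fr \<Rightarrow> fr set set" where "mpc \<equiv> mp_class cF"

definition CF :: "fr set" where "CF = carrier FR"
definition LB :: "dual \<Rightarrow> fr" where "LB b = letter (Inl (ev b))"
definition LM :: "(cot \<Rightarrow> dual) \<Rightarrow> fr" where "LM w = letter (Inr (evf w))"
definition dd :: "dual \<Rightarrow> cot \<Rightarrow> dual" where "dd b = (\<lambda>d. Xo d b)"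

text \<open>The prolongation relations lifted to the free ring. Together with the bimodule relations
  \<open>TR\<close> they generate one ideal \<open>NN\<close>, whose quotient is the maximal
  prolongation.\<close>

definition PS :: "fr set" where
  "PS = {\<Sum>i<n. LM (dd (x i)) * LM (dd (y i)) |(n::nat) x y. (\<forall>i<n. x i \<in> Aw 0 \<and> y i \<in> Aw 0) \<and>
     (\<forall>d. (\<Sum>i<n. x i * Xo d (y i)) = 0)}"

definition TR :: "fr set" where
  "TR = {LB 1 - 1} \<union> {LB (x + y) - (LB x + LB y) |x y. x \<in> Aw 0 \<and> y \<in> Aw 0}
    \<union> {LB (x * y) - LB x * LB y |x y. x \<in> Aw 0 \<and> y \<in> Aw 0}
    \<union> {LM (\<lambda>d. m d + n d) - (LM m + LM n) |m n. m \<in> MM \<and> n \<in> MM}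
    \<union> {LM (\<lambda>d. x * m d) - LB x * LM m |x m. x \<in> Aw 0 \<and> m \<in> MM}
    \<union> {LM (mr m x) - LM m * LB x |x m. x \<in> Aw 0 \<and> m \<in> MM}"

definition NN :: "fr set" where "NN = Idl\<^bsub>FR\<^esub> (TR \<union> PS)"

lemma cF_simps: "carrier (base cF) = ev ` Aw 0" "forms cF = evf ` MM" "lact cF = form_lact" "ract cF = form_ract q"
  "diff cF = form_d q" "x \<otimes>\<^bsub>base cF\<^esub> y = x \<star> y" "x \<oplus>\<^bsub>base cF\<^esub> y = x + y" "\<one>\<^bsub>base cF\<^esub> = ev 1"
  by (simp_all add: F3_fodc_def OF3_ring_def OF3_eq Omega1_eq Ucounit_ev)

lemma TR_eq: "tensor_rels cF = TR"
proof -
  have "{letter (Inl (x + y)) - (letter (Inl x) + letter (Inl y)) |x y. x \<in> ev ` Aw 0 \<and> y \<in> ev ` Aw 0} =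
     {LB (x + y) - (LB x + LB y) |x y. x \<in> Aw 0 \<and> y \<in> Aw 0}"
    by (safe; (simp only: LB_def ev_lin(1)); blast)
  moreover have "{letter (Inl (x \<star> y)) - letter (Inl x) * letter (Inl y) |x y. x \<in> ev ` Aw 0 \<and> y \<in> ev ` Aw 0} =
     {LB (x * y) - LB x * LB y |x y. x \<in> Aw 0 \<and> y \<in> Aw 0}"
    by (safe; (simp only: LB_def ev_conv[symmetric]); blast)
  moreover have "{letter (Inr (m + n)) - (letter (Inr m) + letter (Inr n)) |m n. m \<in> evf ` MM \<and> n \<in> evf ` MM} =
     {LM (\<lambda>d. m d + n d) - (LM m + LM n) |m n. m \<in> MM \<and> n \<in> MM}"
    by (safe; (simp only: LM_def evf_add); blast)
  moreover have "{letter (Inr (form_lact x m)) - letter (Inl x) * letter (Inr m) |x m. x \<in> ev ` Aw 0 \<and> m \<in> evf ` MM} =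
     {LM (\<lambda>d. x * m d) - LB x * LM m |x m. x \<in> Aw 0 \<and> m \<in> MM}"
    by (safe; (simp only: LM_def LB_def form_lact_ev[symmetric]); blast)
  moreover have "{letter (Inr (form_ract q m x)) - letter (Inr m) * letter (Inl x) |x m. x \<in> ev ` Aw 0 \<and> m \<in> evf ` MM} =
     {LM (mr m x) - LM m * LB x |x m. x \<in> Aw 0 \<and> m \<in> MM}" (is "?L = ?R")
  proof -
    have "?L = {letter (Inr (form_ract q (evf m) (ev x))) - LM m * LB x |x m. x \<in> Aw 0 \<and> m \<in> MM}"
      by (safe; (simp only: LM_def LB_def); blast)
    also have "\<dots> = ?R" by (auto simp: form_ract_ev LM_def; metis form_ract_ev)
    finally show ?thesis .
  qed
  ultimately show ?thesis unfolding tensor_rels_def TR_def cF_simps by (simp only: LB_def)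
qed

lemma letter_CF: "letter x \<in> CF \<longleftrightarrow> x \<in> Inl ` ev ` Aw 0 \<union> Inr ` evf ` MM"
  unfolding CF_def free_alg_simps(5) cF_simps letter_def by (auto simp: Plus_def)

lemma CF_intros [simp, intro]:
  "b \<in> Aw 0 \<Longrightarrow> LB b \<in> CF" "w \<in> MM \<Longrightarrow> LM w \<in> CF" "0 \<in> CF" "1 \<in> CF"
  "p \<in> CF \<Longrightarrow> p' \<in> CF \<Longrightarrow> p + p' \<in> CF" "p \<in> CF \<Longrightarrow> p' \<in> CF \<Longrightarrow> p * p' \<in> CF" "p \<in> CF \<Longrightarrow> - p \<in> CF"
  "p \<in> CF \<Longrightarrow> p' \<in> CF \<Longrightarrow> p - p' \<in> CF"
proof -
  show "b \<in> Aw 0 \<Longrightarrow> LB b \<in> CF" "w \<in> MM \<Longrightarrow> LM w \<in> CF" unfolding LB_def LM_def letter_CF by blast+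
  show "0 \<in> CF" "1 \<in> CF" "p \<in> CF \<Longrightarrow> p' \<in> CF \<Longrightarrow> p + p' \<in> CF" "p \<in> CF \<Longrightarrow> p' \<in> CF \<Longrightarrow> p * p' \<in> CF" "p \<in> CF \<Longrightarrow> - p \<in> CF"
    unfolding CF_def by (rule free_alg_closed; assumption?)+
  then show "p \<in> CF \<Longrightarrow> p' \<in> CF \<Longrightarrow> p - p' \<in> CF"
    unfolding CF_def diff_conv_add_uminus by (intro free_alg_closed)
qed

lemma CF_sum: "(\<And>i. i \<in> I \<Longrightarrow> f i \<in> CF) \<Longrightarrow> sum f I \<in> CF"
  by (induction I rule: infinite_finite_induct) auto

lemma MM_dd [simp]: "b \<in> Aw 0 \<Longrightarrow> dd b \<in> MM" unfolding dd_def by (rule MM_d)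

lemma TR_CF: "TR \<subseteq> CF" and PS_CF: "PS \<subseteq> CF"
proof -
  show "TR \<subseteq> CF" unfolding TR_def using Aw_mult[of _ 0 _ 0] by (auto simp: MM_add MM_lact MM_mr Aw_add)
  show "PS \<subseteq> CF" unfolding PS_def by (auto intro!: CF_sum)
qed

lemma tensor_ideal_eq: "tensor_ideal cF = Idl\<^bsub>FR\<^esub> TR" by (simp add: tensor_ideal_def TR_eq)

lemma mp_setup: "ring FR" "TR \<subseteq> carrier FR" "PS \<subseteq> carrier FR"
  using free_alg_ring TR_CF PS_CF by (simp_all add: CF_def)

lemmas dq = double_quot[OF mp_setup]

lemma tc_hom: "ring_hom_ring FR (tensor_alg cF) (tensor_class cF)"
proof -
  have "ideal (tensor_ideal cF) FR" unfolding tensor_ideal_eq by (rule dq(2)[of 0]) (simp add: free_alg_closed)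
  from ideal.rcos_ring_hom_ring[OF this] show ?thesis unfolding tensor_alg_def tensor_class_def[abs_def] .
qed

lemma prolong_rels_eq: "prolong_rels cF = tensor_class cF ` PS"
proof -
  interpret h: ring_hom_ring FR "tensor_alg cF" "tensor_class cF" by (rule tc_hom)
  have e: "finsum (tensor_alg cF) (\<lambda>i. tensor_class cF (letter (Inr (diff cF (ev (x i))))) \<otimes>\<^bsub>tensor_alg cF\<^esub> tensor_class cF (letter (Inr (diff cF (ev (y i)))))) {..<n}
     = tensor_class cF (\<Sum>i<n. LM (dd (x i)) * LM (dd (y i)))"
    if "\<forall>i<n. x i \<in> Aw 0 \<and> y i \<in> Aw 0" for n :: nat and x y
    using that
  proof (induction n)
    case 0 show ?case using h.hom_zero by (simp add: free_alg_simps)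
  next
    case (Suc n)
    have c: "LM (dd (x i)) \<in> carrier FR" "LM (dd (y i)) \<in> carrier FR" if "i < Suc n" for i
      using Suc.prems that CF_intros(2) by (auto simp: CF_def[symmetric])
    have l: "letter (Inr (diff cF (ev b))) = LM (dd b)" for b by (simp add: cF_simps form_d_ev LM_def dd_def)
    have "(\<Sum>i<n. LM (dd (x i)) * LM (dd (y i))) \<in> CF" using Suc.prems by (intro CF_sum) auto
    then have s: "(\<Sum>i<n. LM (dd (x i)) * LM (dd (y i))) \<in> carrier FR" by (simp add: CF_def)
    have "tensor_class cF (LM (dd (x n)) * LM (dd (y n))) = tensor_class cF (LM (dd (x n))) \<otimes>\<^bsub>tensor_alg cF\<^esub> tensor_class cF (LM (dd (y n)))"
      using h.hom_mult[OF c(1)[of n] c(2)[of n]] by (simp add: free_alg_simps)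
    moreover have "tensor_class cF (LM (dd (x n)) * LM (dd (y n)) + (\<Sum>i<n. LM (dd (x i)) * LM (dd (y i)))) =
      tensor_class cF (LM (dd (x n)) * LM (dd (y n))) \<oplus>\<^bsub>tensor_alg cF\<^esub> tensor_class cF (\<Sum>i<n. LM (dd (x i)) * LM (dd (y i)))"
      using h.hom_add[OF h.R.m_closed[OF c(1)[of n] c(2)[of n]] s] by (simp add: free_alg_simps)
    ultimately show ?case
      using Suc c by (simp add: lessThan_Suc h.S.finsum_insert l Pi_def add.commute)
  qed
  have d: "(\<Sum>i<n. lact cF (ev (x i)) (diff cF (ev (y i)))) = 0 \<longleftrightarrow> (\<forall>d. (\<Sum>i<n. x i * Xo d (y i)) = 0)" for n x y
  proof -
    have 1: "(\<Sum>i<n. lact cF (ev (x i)) (diff cF (ev (y i)))) = evf (\<lambda>d. \<Sum>i<n. x i * Xo d (y i))"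
      by (simp only: cF_simps form_d_ev form_lact_ev evf_sum)
    have "evf (\<lambda>d. \<Sum>i<n. x i * Xo d (y i)) = 0 \<longleftrightarrow> (\<lambda>d. \<Sum>i<n. x i * Xo d (y i)) = (\<lambda>d. 0)"
      unfolding evf_0[symmetric] evf_inj ..
    then show ?thesis unfolding 1 by (simp only: fun_eq_iff[of "\<lambda>d. \<Sum>i<n. x i * Xo d (y i)"])
  qed
  show ?thesis
  proof
    show "prolong_rels cF \<subseteq> tensor_class cF ` PS"
    proof
      fix t assume "t \<in> prolong_rels cF"
      then obtain n x y where t: "t = finsum (tensor_alg cF) (\<lambda>i. tensor_class cF (letter (Inr (diff cF (x i)))) \<otimes>\<^bsub>tensor_alg cF\<^esub> tensor_class cF (letter (Inr (diff cF (y i))))) {..<n}"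
        and xy: "\<forall>i<n::nat. x i \<in> ev ` Aw 0 \<and> y i \<in> ev ` Aw 0" and z: "(\<Sum>i<n. lact cF (x i) (diff cF (y i))) = 0"
        unfolding prolong_rels_def cF_simps(1) by blast
      have e1: "x i = ev (dv (x i)) \<and> y i = ev (dv (y i)) \<and> dv (x i) \<in> Aw 0 \<and> dv (y i) \<in> Aw 0" if "i < n" for i
        using xy that by (metis dv_ev image_iff)
      have "t = finsum (tensor_alg cF) (\<lambda>i. tensor_class cF (letter (Inr (diff cF (ev (dv (x i)))))) \<otimes>\<^bsub>tensor_alg cF\<^esub> tensor_class cF (letter (Inr (diff cF (ev (dv (y i))))))) {..<n}"
        unfolding t
      proof (rule h.S.finsum_cong')
        have "letter (Inr (diff cF (ev (dv (x i))))) \<in> carrier FR" "letter (Inr (diff cF (ev (dv (y i))))) \<in> carrier FR" if "i < n" for i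
          using e1[OF that] unfolding cF_simps(5) form_d_ev dd_def[symmetric] LM_def[symmetric] CF_def[symmetric] by (intro CF_intros MM_dd; blast)+
        then show "(\<lambda>i. tensor_class cF (letter (Inr (diff cF (ev (dv (x i)))))) \<otimes>\<^bsub>tensor_alg cF\<^esub> tensor_class cF (letter (Inr (diff cF (ev (dv (y i))))))) \<in> {..<n} \<rightarrow> carrier (tensor_alg cF)"
          by auto
      qed (use e1 in auto)
      also have "\<dots> = tensor_class cF (\<Sum>i<n. LM (dd (dv (x i))) * LM (dd (dv (y i))))" by (rule e) (use e1 in blast)
      finally have 1: "t = tensor_class cF (\<Sum>i<n. LM (dd (dv (x i))) * LM (dd (dv (y i))))" .
      have "(\<Sum>i<n. lact cF (x i) (diff cF (y i))) = (\<Sum>i<n. lact cF (ev (dv (x i))) (diff cF (ev (dv (y i)))))"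
        by (rule sum.cong) (use e1 in auto)
      then have "(\<Sum>i<n. lact cF (ev (dv (x i))) (diff cF (ev (dv (y i))))) = 0" using z by simp
      then have "\<forall>d. (\<Sum>i<n. dv (x i) * Xo d (dv (y i))) = 0" by (rule d[THEN iffD1])
      then show "t \<in> tensor_class cF ` PS" using e1 unfolding 1 PS_def
        by (intro imageI CollectI exI[of _ n] exI[of _ "\<lambda>i. dv (x i)"] exI[of _ "\<lambda>i. dv (y i)"]) blast
    qed
    show "tensor_class cF ` PS \<subseteq> prolong_rels cF"
    proof clarify
      fix p assume "p \<in> PS"
      then obtain n x y where p: "p = (\<Sum>i<n. LM (dd (x i)) * LM (dd (y i)))" "\<forall>i<n::nat. x i \<in> Aw 0 \<and> y i \<in> Aw 0"
        "\<forall>d. (\<Sum>i<n. x i * Xo d (y i)) = 0" unfolding PS_def by blast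
      show "tensor_class cF p \<in> prolong_rels cF"
        unfolding prolong_rels_def p(1) e[OF p(2), symmetric] cF_simps(1)
        using p(2) d[THEN iffD2, OF p(3)]
        by (intro CollectI exI[of _ n] exI[of _ "\<lambda>i. ev (x i)"] exI[of _ "\<lambda>i. ev (y i)"]) auto
    qed
  qed
qed

lemma prolong_ideal_eq: "prolong_ideal cF = Idl\<^bsub>tensor_alg cF\<^esub> (tensor_class cF ` PS)"
  by (simp add: prolong_ideal_def prolong_rels_eq)

lemma mpc_hom: "ring_hom_ring FR RR mpc"
proof -
  interpret h: ring_hom_ring FR "tensor_alg cF" "tensor_class cF" by (rule tc_hom)
  have "ideal (prolong_ideal cF) (tensor_alg cF)"
    using dq(1)[of 0] unfolding prolong_ideal_eq tensor_alg_def tensor_class_def[abs_def] tensor_ideal_eq by (simp add: free_alg_closed)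
  from ideal.rcos_ring_hom[OF this] have "(\<lambda>p. prolong_ideal cF +>\<^bsub>tensor_alg cF\<^esub> tensor_class cF p) \<in> ring_hom FR RR"
    using ring_hom_trans[OF h.homh] unfolding max_prol_def comp_def by blast
  then show ?thesis
    using ideal.quotient_is_ring[OF \<open>ideal (prolong_ideal cF) (tensor_alg cF)\<close>]
    by (intro ring_hom_ringI2) (simp_all add: free_alg_ring max_prol_def mp_class_def[abs_def])
qed

lemma mpc_zero: assumes "p \<in> CF" shows "mpc p = \<zero>\<^bsub>RR\<^esub> \<longleftrightarrow> p \<in> NN"
proof -
  interpret h: ring_hom_ring FR "tensor_alg cF" "tensor_class cF" by (rule tc_hom)
  have pc: "p \<in> carrier FR" using assms by (simp add: CF_def)
  have i: "ideal (prolong_ideal cF) (tensor_alg cF)"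
    using dq(1)[OF pc] unfolding prolong_ideal_eq tensor_alg_def tensor_class_def[abs_def] tensor_ideal_eq .
  have "mpc p = \<zero>\<^bsub>RR\<^esub> \<longleftrightarrow> tensor_class cF p \<in> prolong_ideal cF"
    unfolding mp_class_def max_prol_def by (rule quot_zero[OF i]) (use pc in simp)
  also have "\<dots> \<longleftrightarrow> p \<in> NN"
    using dq(3)[OF pc] unfolding prolong_ideal_eq tensor_alg_def tensor_class_def[abs_def] tensor_ideal_eq NN_def .
  finally show ?thesis .
qed

lemma carrier_RR: "carrier RR = mpc ` CF"
  unfolding max_prol_def quot_carrier tensor_alg_def mp_class_def[abs_def] tensor_class_def[abs_def] CF_def by (simp add: image_image)

lemma NN_ideal: "ideal NN FR" unfolding NN_def by (rule ring.genideal_ideal) (use mp_setup in auto)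

lemma NN_CF: "p \<in> NN \<Longrightarrow> p \<in> CF" using ideal.Icarr[OF NN_ideal] by (simp add: CF_def)

lemma NN_closed: "0 \<in> NN" "p \<in> NN \<Longrightarrow> p' \<in> NN \<Longrightarrow> p + p' \<in> NN" "p \<in> NN \<Longrightarrow> - p \<in> NN"
  "p \<in> NN \<Longrightarrow> r \<in> CF \<Longrightarrow> r * p \<in> NN" "p \<in> NN \<Longrightarrow> r \<in> CF \<Longrightarrow> p * r \<in> NN"
proof -
  interpret ideal NN FR by (rule NN_ideal)
  show "0 \<in> NN" using additive_subgroup.zero_closed[OF is_additive_subgroup] by (simp add: free_alg_simps)
  show "p \<in> NN \<Longrightarrow> p' \<in> NN \<Longrightarrow> p + p' \<in> NN" using additive_subgroup.a_closed[OF is_additive_subgroup, of p p'] by (simp add: free_alg_simps(1-4))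
  show l: "p \<in> NN \<Longrightarrow> r \<in> CF \<Longrightarrow> r * p \<in> NN" for r using I_l_closed[of p r] by (simp add: free_alg_simps(1-4) CF_def)
  show "p \<in> NN \<Longrightarrow> r \<in> CF \<Longrightarrow> p * r \<in> NN" using I_r_closed[of p r] by (simp add: free_alg_simps(1-4) CF_def)
  show "p \<in> NN \<Longrightarrow> - p \<in> NN" using l[of "-1"] by simp
qed

lemma NN_minimal:
  assumes "J \<subseteq> CF" "0 \<in> J" "\<And>x y. x \<in> J \<Longrightarrow> y \<in> J \<Longrightarrow> x + y \<in> J" "\<And>x. x \<in> J \<Longrightarrow> - x \<in> J"
    "\<And>x y. x \<in> J \<Longrightarrow> y \<in> CF \<Longrightarrow> x * y \<in> J \<and> y * x \<in> J" "TR \<subseteq> J" "PS \<subseteq> J"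
  shows "NN \<subseteq> J"
proof -
  have "ideal J FR" by (rule free_alg_ideal) (use assms in \<open>auto simp: CF_def\<close>)
  then show ?thesis unfolding NN_def using assms(6,7) by (intro ring.genideal_minimal[OF mp_setup(1)]) auto
qed

text \<open>Equality in the maximal prolongation, with membership in the free ring built in so that
  chains need no side conditions.\<close>

definition eqv :: "fr \<Rightarrow> fr \<Rightarrow> bool" (infix \<open>\<doteq>\<close> 50) where
  "p \<doteq> p' \<longleftrightarrow> p \<in> CF \<and> p' \<in> CF \<and> p - p' \<in> NN"

lemma eqv_mpc: "p \<doteq> p' \<longleftrightarrow> p \<in> CF \<and> p' \<in> CF \<and> mpc p = mpc p'"
proof -
  interpret h: ring_hom_ring FR RR mpc by (rule mpc_hom)
  have "mpc p = mpc p' \<longleftrightarrow> p - p' \<in> NN" if "p \<in> CF" "p' \<in> CF"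
  proof -
    have c: "p' \<in> carrier FR" "p - p' \<in> carrier FR" using that CF_intros(8)[OF that] by (simp_all add: CF_def)
    have "mpc p = mpc (p - p') \<oplus>\<^bsub>RR\<^esub> mpc p'" using h.hom_add[OF c(2,1)] by (simp add: free_alg_simps(1-4))
    then have "mpc p = mpc p' \<longleftrightarrow> mpc (p - p') = \<zero>\<^bsub>RR\<^esub>"
      using h.S.add.r_cancel_one'[of "mpc p'" "mpc (p - p')"] c h.hom_closed by (metis h.S.add.r_cancel_one)
    then show ?thesis using mpc_zero[of "p - p'"] that by auto
  qed
  then show ?thesis by (auto simp: eqv_def)
qed

lemma eqv_refl [simp, intro]: "p \<in> CF \<Longrightarrow> p \<doteq> p" by (simp add: eqv_mpc)
lemma eqv_sym: "p \<doteq> p' \<Longrightarrow> p' \<doteq> p" by (simp add: eqv_mpc)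
lemma eqv_trans [trans]: "p \<doteq> p' \<Longrightarrow> p' \<doteq> p'' \<Longrightarrow> p \<doteq> p''" by (simp add: eqv_mpc)
lemma eqv_CF: "p \<doteq> p' \<Longrightarrow> p \<in> CF" "p \<doteq> p' \<Longrightarrow> p' \<in> CF" by (simp_all add: eqv_mpc)

lemma eqv_add: "p \<doteq> p' \<Longrightarrow> r \<doteq> r' \<Longrightarrow> p + r \<doteq> p' + r'"
  unfolding eqv_def using NN_closed(2)[of "p - p'" "r - r'"] by (auto simp: algebra_simps)

lemma eqv_mult: assumes "p \<doteq> p'" "r \<doteq> r'" shows "p * r \<doteq> p' * r'"
proof -
  have "p * r - p' * r' = (p - p') * r + p' * (r - r')" by (simp add: algebra_simps)
  then show ?thesis using assms NN_closed(2)[OF NN_closed(5)[of "p - p'" r] NN_closed(4)[of "r - r'" p']]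
    by (auto simp: eqv_def)
qed

lemma eqv_sum: "(\<And>i. i \<in> I \<Longrightarrow> f i \<doteq> g i) \<Longrightarrow> sum f I \<doteq> sum g I"
  by (induction I rule: infinite_finite_induct) (auto simp: eqv_add)

lemma eqv_LB: "LB 1 \<doteq> 1" "x \<in> Aw 0 \<Longrightarrow> y \<in> Aw 0 \<Longrightarrow> LB (x + y) \<doteq> LB x + LB y"
  "x \<in> Aw 0 \<Longrightarrow> y \<in> Aw 0 \<Longrightarrow> LB (x * y) \<doteq> LB x * LB y"
  and eqv_LM: "m \<in> MM \<Longrightarrow> n \<in> MM \<Longrightarrow> LM (\<lambda>d. m d + n d) \<doteq> LM m + LM n"
  "x \<in> Aw 0 \<Longrightarrow> m \<in> MM \<Longrightarrow> LM (\<lambda>d. x * m d) \<doteq> LB x * LM m"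
  "x \<in> Aw 0 \<Longrightarrow> m \<in> MM \<Longrightarrow> LM (mr m x) \<doteq> LM m * LB x"
proof -
  have T: "TR \<subseteq> NN" unfolding NN_def using ring.genideal_self[OF mp_setup(1), of "TR \<union> PS"] mp_setup(2,3) by blast
  have M: "p - p' \<in> TR \<Longrightarrow> p \<in> CF \<Longrightarrow> p' \<in> CF \<Longrightarrow> p \<doteq> p'" for p p' unfolding eqv_def using T by blast
  show "LB 1 \<doteq> 1" by (rule M) (auto simp: TR_def)
  show "LB (x + y) \<doteq> LB x + LB y" if "x \<in> Aw 0" "y \<in> Aw 0"
    by (rule M, use that in \<open>unfold TR_def, blast\<close>) (use that Aw_add in auto)
  show "LB (x * y) \<doteq> LB x * LB y" if "x \<in> Aw 0" "y \<in> Aw 0"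
    by (rule M, use that in \<open>unfold TR_def, blast\<close>) (use that Aw_mult[of _ 0 _ 0] in auto)
  show "LM (\<lambda>d. m d + n d) \<doteq> LM m + LM n" if "m \<in> MM" "n \<in> MM"
    by (rule M, use that in \<open>unfold TR_def, blast\<close>) (use that MM_add in auto)
  show "LM (\<lambda>d. x * m d) \<doteq> LB x * LM m" if "x \<in> Aw 0" "m \<in> MM"
    by (rule M, use that in \<open>unfold TR_def, blast\<close>) (use that MM_lact in auto)
  show "LM (mr m x) \<doteq> LM m * LB x" if "x \<in> Aw 0" "m \<in> MM"
    by (rule M, use that in \<open>unfold TR_def, blast\<close>) (use that MM_mr in auto)
qed

lemma PS_NN: "PS \<subseteq> NN"
  unfolding NN_def using ring.genideal_self[OF mp_setup(1), of "TR \<union> PS"] mp_setup(2,3) by blast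

end

context qparam
begin

section \<open>Lifting words in the cotangent basis\<close>

definition wtw :: "cot list \<Rightarrow> int \<times> int" where "wtw w = sum_list (map rt w)"

lemma wtw_simps [simp]: "wtw [] = 0" "wtw (d # w) = rt d + wtw w" "wtw (v @ w) = wtw v + wtw w"
  by (simp_all add: wtw_def)

lemma sl_wtw: "sl (wtw w)" by (induction w) (auto simp: sl_0 sl_rt sl_add)

definition nX :: "int \<times> int \<Rightarrow> nat" where "nX l = length (XY l)"
definition Xl :: "int \<times> int \<Rightarrow> nat \<Rightarrow> dual" where "Xl l i = fst (XY l ! i)"
definition Yl :: "int \<times> int \<Rightarrow> nat \<Rightarrow> dual" where "Yl l i = snd (XY l ! i)"

lemma Xl: "sl l \<Longrightarrow> i < nX l \<Longrightarrow> Xl l i \<in> Aw (- l)" and Yl: "sl l \<Longrightarrow> i < nX l \<Longrightarrow> Yl l i \<in> Aw l"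
  using XY_mem[of l "fst (XY l ! i)" "snd (XY l ! i)"] by (simp_all add: nX_def Xl_def Yl_def)

lemma XlYl: "sl l \<Longrightarrow> (\<Sum>i<nX l. Xl l i * Yl l i) = 1"
  using XY_sum[of l] by (simp add: sum_list_sum_nth nX_def Xl_def Yl_def case_prod_unfold lessThan_atLeast0)

text \<open>The form a e_d x with its coefficients moved to the left.\<close>

definition me :: "dual \<Rightarrow> cot \<Rightarrow> dual \<Rightarrow> cot \<Rightarrow> dual" where "me a d x = (\<lambda>g. a * Th d g x)"

lemma me_MM: "a \<in> Aw (rt d + l) \<Longrightarrow> x \<in> Aw (- l) \<Longrightarrow> me a d x \<in> MM"
  unfolding MM_def me_def by (auto intro!: Aw_mult'[OF _ Th_Aw])

text \<open>\<open>LL a [d\<^sub>1, \<dots>, d\<^sub>k]\<close> represents $a\,e_{d_1}\cdots e_{d_k}$, of total weight \<open>0\<close>: factors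
  \<open>1 = \<Sum> x\<^sub>i y\<^sub>i\<close> are inserted between the letters to make every factor lie in \<open>\<Omega>\<^sup>1\<close>.\<close>

primrec LL :: "dual \<Rightarrow> cot list \<Rightarrow> fr" where
  "LL a [] = LB a"
| "LL a (d # w) = (\<Sum>i<nX (wtw w). LM (me a d (Xl (wtw w) i)) * LL (Yl (wtw w) i) w)"

lemma me_MM': "a \<in> Aw (wtw (d # w)) \<Longrightarrow> i < nX (wtw w) \<Longrightarrow> me a d (Xl (wtw w) i) \<in> MM"
  by (rule me_MM[OF _ Xl[OF sl_wtw]]) auto

lemma LL_CF [simp, intro]: "a \<in> Aw (wtw w) \<Longrightarrow> LL a w \<in> CF"
proof (induction w arbitrary: a)
  case (Cons d w)
  then show ?case using me_MM'[OF Cons.prems] Yl[OF sl_wtw, of _ w] by (auto intro!: CF_sum)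
qed auto

lemma LL_add: "a \<in> Aw (wtw w) \<Longrightarrow> b \<in> Aw (wtw w) \<Longrightarrow> LL (a + b) w \<doteq> LL a w + LL b w"
proof (cases w)
  case (Cons d v)
  assume ab: "a \<in> Aw (wtw w)" "b \<in> Aw (wtw w)"
  have "LL (a + b) w \<doteq> (\<Sum>i<nX (wtw v). (LM (me a d (Xl (wtw v) i)) + LM (me b d (Xl (wtw v) i))) * LL (Yl (wtw v) i) v)"
    unfolding Cons LL.simps
  proof (intro eqv_sum eqv_mult)
    fix i assume "i \<in> {..<nX (wtw v)}"
    then have i: "i < nX (wtw v)" by simp
    show "LM (me (a + b) d (Xl (wtw v) i)) \<doteq> LM (me a d (Xl (wtw v) i)) + LM (me b d (Xl (wtw v) i))"
      using eqv_LM(1)[OF me_MM'[of a d v i] me_MM'[of b d v i]] ab i Cons by (simp add: me_def distrib_right)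
    show "LL (Yl (wtw v) i) v \<doteq> LL (Yl (wtw v) i) v" using Yl[OF sl_wtw i] by blast
  qed
  also have "\<dots> = LL a w + LL b w" by (simp add: Cons distrib_right sum.distrib)
  finally show ?thesis .
qed (simp add: eqv_LB)

lemma LL_lact: "b \<in> Aw 0 \<Longrightarrow> a \<in> Aw (wtw w) \<Longrightarrow> LL (b * a) w \<doteq> LB b * LL a w"
proof (cases w)
  case (Cons d v)
  assume ab: "b \<in> Aw 0" "a \<in> Aw (wtw w)"
  have "LL (b * a) w \<doteq> (\<Sum>i<nX (wtw v). (LB b * LM (me a d (Xl (wtw v) i))) * LL (Yl (wtw v) i) v)"
    unfolding Cons LL.simps
  proof (intro eqv_sum eqv_mult)
    fix i assume "i \<in> {..<nX (wtw v)}"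
    then have i: "i < nX (wtw v)" by simp
    show "LM (me (b * a) d (Xl (wtw v) i)) \<doteq> LB b * LM (me a d (Xl (wtw v) i))"
      using eqv_LM(2)[OF ab(1) me_MM'[of a d v i]] ab i Cons by (simp add: me_def mult.assoc)
    show "LL (Yl (wtw v) i) v \<doteq> LL (Yl (wtw v) i) v" using Yl[OF sl_wtw i] by blast
  qed
  also have "\<dots> = LB b * LL a w" by (simp add: Cons sum_distrib_left mult.assoc)
  finally show ?thesis .
qed (simp add: eqv_LB)

lemma eqv_double: "p \<doteq> p + p \<Longrightarrow> p \<doteq> 0"
  unfolding eqv_def using NN_closed(3)[of "p - (p + p)"] by auto

lemma LL_zero: "LL 0 w \<doteq> 0"
  using LL_add[of 0 w 0] eqv_double[of "LL 0 w"] by simp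

lemma LL_sum: "(\<And>i. i \<in> I \<Longrightarrow> f i \<in> Aw (wtw w)) \<Longrightarrow> LL (sum f I) w \<doteq> (\<Sum>i\<in>I. LL (f i) w)"
proof (induction I rule: infinite_finite_induct)
  case (insert x F)
  have "LL (f x + sum f F) w \<doteq> LL (f x) w + LL (sum f F) w" using insert by (intro LL_add) (auto intro: Aw_sum)
  also have "\<dots> \<doteq> LL (f x) w + (\<Sum>i\<in>F. LL (f i) w)" using insert by (intro eqv_add) auto
  finally show ?case using insert by simp
qed (auto simp: LL_zero)

lemma LL_scale: "a \<in> Aw (wtw w) \<Longrightarrow> LL (c *\<^sub>C a) w \<doteq> LB (c *\<^sub>C 1) * LL a w"
  using LL_lact[of "c *\<^sub>C 1" a w] by (simp add: Aw_scale)

lemma LM_sum: "(\<And>i. i \<in> I \<Longrightarrow> f i \<in> MM) \<Longrightarrow> LM (\<lambda>d. \<Sum>i\<in>I. f i d) \<doteq> (\<Sum>i\<in>I. LM (f i))"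
proof -
  have z: "LM (\<lambda>d. 0) \<doteq> 0" using eqv_LM(1)[OF MM_0 MM_0] eqv_double by simp
  assume "\<And>i. i \<in> I \<Longrightarrow> f i \<in> MM"
  then show ?thesis
  proof (induction I rule: infinite_finite_induct)
    case (insert x F)
    have m: "(\<lambda>d. \<Sum>i\<in>F. f i d) \<in> MM" using insert by (auto simp: MM_def intro!: Aw_sum)
    have "LM (\<lambda>d. f x d + (\<Sum>i\<in>F. f i d)) \<doteq> LM (f x) + LM (\<lambda>d. \<Sum>i\<in>F. f i d)"
      using insert m by (intro eqv_LM) auto
    also have "\<dots> \<doteq> LM (f x) + (\<Sum>i\<in>F. LM (f i))" using insert by (intro eqv_add) auto
    finally show ?case using insert by simp
  qed (use z in auto)
qed

lemma Th_term_Aw: "m \<in> MM \<Longrightarrow> a \<in> Aw l \<Longrightarrow> m d * Th d g a \<in> Aw (rt g + l)"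
  by (rule Aw_mult'[OF _ Th_Aw]) (auto simp: MM_def)

text \<open>In the frame this is (m_d e_d) a = m_d \<Sum>_g \<open>Th d g a\<close> e_g. Over B the
  coefficient a cannot be moved by itself, but each a x_i lies in B and can be absorbed into m;
  afterwards the partition of unity is summed up again.\<close>

lemma LM_LL:
  assumes m: "m \<in> MM" and a: "a \<in> Aw (wtw w)"
  shows "LM m * LL a w \<doteq> (\<Sum>d\<in>UNIV. \<Sum>g\<in>UNIV. LL (m d * Th d g a) (g # w))"
proof -
  let ?l = "wtw w"
  note s = sl_wtw[of w]
  have c: "m d * Th d g a \<in> Aw (rt g + ?l)" for d g using Th_term_Aw[OF m a] .
  have ax: "a * Xl ?l i \<in> Aw 0" if "i < nX ?l" for i by (rule Aw_mult'[OF a Xl[OF s that]]) simp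
  have M: "me (m d * Th d g a) g (Xl ?l i) \<in> MM" if "i < nX ?l" for d g i
    by (rule me_MM[OF c Xl[OF s that]])
  have 1: "(\<Sum>d\<in>UNIV. \<Sum>g\<in>UNIV. LM (me (m d * Th d g a) g (Xl ?l i))) \<doteq> LM m * LB (a * Xl ?l i)" if i: "i < nX ?l" for i
  proof -
    have "LM (\<lambda>h. \<Sum>p\<in>UNIV. me (m (fst p) * Th (fst p) (snd p) a) (snd p) (Xl ?l i) h) \<doteq>
       (\<Sum>p\<in>UNIV. LM (me (m (fst p) * Th (fst p) (snd p) a) (snd p) (Xl ?l i)))"
      by (rule LM_sum) (rule M[OF i])
    moreover have "(\<lambda>h. \<Sum>p\<in>UNIV. me (m (fst p) * Th (fst p) (snd p) a) (snd p) (Xl ?l i) h) = mr m (a * Xl ?l i)"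
    proof
      fix h
      have "(\<Sum>p\<in>UNIV. me (m (fst p) * Th (fst p) (snd p) a) (snd p) (Xl ?l i) h) =
          (\<Sum>d\<in>UNIV. \<Sum>g\<in>UNIV. m d * Th d g a * Th g h (Xl ?l i))"
        by (simp add: sum.cartesian_product me_def case_prod_unfold)
      also have "\<dots> = mr m (a * Xl ?l i) h"
        using Aw_UU[OF a] Aw_UU[OF Xl[OF s i]] by (simp add: mr_def Th_mult sum_distrib_left mult.assoc)
      finally show "(\<Sum>p\<in>UNIV. me (m (fst p) * Th (fst p) (snd p) a) (snd p) (Xl ?l i) h) = mr m (a * Xl ?l i) h" .
    qed
    moreover have "(\<Sum>p\<in>UNIV. LM (me (m (fst p) * Th (fst p) (snd p) a) (snd p) (Xl ?l i))) =
        (\<Sum>d\<in>UNIV. \<Sum>g\<in>UNIV. LM (me (m d * Th d g a) g (Xl ?l i)))"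
      by (simp add: sum.cartesian_product case_prod_unfold)
    ultimately have "LM (mr m (a * Xl ?l i)) \<doteq> (\<Sum>d\<in>UNIV. \<Sum>g\<in>UNIV. LM (me (m d * Th d g a) g (Xl ?l i)))" by simp
    then show ?thesis using eqv_LM(3)[OF ax[OF i] m] eqv_trans eqv_sym by blast
  qed
  have "(\<Sum>d\<in>UNIV. \<Sum>g\<in>UNIV. LL (m d * Th d g a) (g # w)) =
     (\<Sum>i<nX ?l. (\<Sum>d\<in>UNIV. \<Sum>g\<in>UNIV. LM (me (m d * Th d g a) g (Xl ?l i))) * LL (Yl ?l i) w)"
  proof -
    have "(\<Sum>d\<in>UNIV. \<Sum>g\<in>UNIV. LL (m d * Th d g a) (g # w)) =
      (\<Sum>d\<in>UNIV. \<Sum>i<nX ?l. \<Sum>g\<in>UNIV. LM (me (m d * Th d g a) g (Xl ?l i)) * LL (Yl ?l i) w)"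
      unfolding LL.simps by (rule sum.cong[OF refl], rule sum.swap)
    also have "\<dots> = (\<Sum>i<nX ?l. \<Sum>d\<in>UNIV. \<Sum>g\<in>UNIV. LM (me (m d * Th d g a) g (Xl ?l i)) * LL (Yl ?l i) w)" by (rule sum.swap)
    finally show ?thesis by (simp add: sum_distrib_right)
  qed
  also have "\<dots> \<doteq> (\<Sum>i<nX ?l. (LM m * LB (a * Xl ?l i)) * LL (Yl ?l i) w)"
    by (intro eqv_sum eqv_mult 1) (auto intro: Yl[OF s])
  also have "\<dots> \<doteq> (\<Sum>i<nX ?l. LM m * LL (a * Xl ?l i * Yl ?l i) w)"
    unfolding mult.assoc[of "LM m"]
    using m ax Yl[OF s] by (intro eqv_sum eqv_mult eqv_sym[OF LL_lact]) auto
  also have "\<dots> = LM m * (\<Sum>i<nX ?l. LL (a * Xl ?l i * Yl ?l i) w)" by (simp add: sum_distrib_left)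
  also have "\<dots> \<doteq> LM m * LL (\<Sum>i<nX ?l. a * Xl ?l i * Yl ?l i) w"
    using m Aw_mult[OF ax Yl[OF s]] by (intro eqv_mult eqv_sym[OF LL_sum]) auto
  also have "(\<Sum>i<nX ?l. a * Xl ?l i * Yl ?l i) = a" using XlYl[OF s] by (simp add: mult.assoc flip: sum_distrib_left)
  finally show ?thesis by (rule eqv_sym)
qed

lemma LL_one: "LL 1 [] \<doteq> 1" by (simp add: eqv_LB)

lemma LM_LL1: assumes "m \<in> MM" shows "LM m \<doteq> (\<Sum>d\<in>UNIV. LL (m d) [d])"
proof -
  have "LM m * 1 \<doteq> LM m * LL 1 []" using assms eqv_sym[OF LL_one] by (intro eqv_mult) auto
  also have "\<dots> \<doteq> (\<Sum>d\<in>UNIV. \<Sum>g\<in>UNIV. LL (m d * Th d g 1) [g])" by (rule LM_LL[OF assms]) simp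
  also have "\<dots> \<doteq> (\<Sum>d\<in>UNIV. \<Sum>g\<in>UNIV. if g = d then LL (m d) [d] else 0)"
  proof (intro eqv_sum)
    fix d g
    show "LL (m d * Th d g 1) [g] \<doteq> (if g = d then LL (m d) [d] else 0)"
      using assms LL_CF[of "m d" "[d]"] LL_zero[of "[g]"] by (cases "g = d") (auto simp: Th_one MM_def simp del: LL.simps)
  qed
  finally show ?thesis by simp
qed

lemma LM_LM_LL2:
  assumes "m \<in> MM" "n \<in> MM"
  shows "LM m * LM n \<doteq> (\<Sum>g\<in>UNIV. \<Sum>h\<in>UNIV. LL (\<Sum>e\<in>UNIV. m e * Th e g (n h)) [g, h])"
proof -
  have n: "n h \<in> Aw (wtw [h])" for h using assms by (simp add: MM_def)
  have c: "m e * Th e g (n h) \<in> Aw (wtw [g, h])" for e g h using Th_term_Aw[OF assms(1) n, of e g h] by simp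
  have "LM m * LM n \<doteq> LM m * (\<Sum>h\<in>UNIV. LL (n h) [h])" using assms LM_LL1 by (intro eqv_mult) auto
  also have "\<dots> = (\<Sum>h\<in>UNIV. LM m * LL (n h) [h])" by (simp only: sum_distrib_left)
  also have "\<dots> \<doteq> (\<Sum>h\<in>UNIV. \<Sum>e\<in>UNIV. \<Sum>g\<in>UNIV. LL (m e * Th e g (n h)) [g, h])"
    by (intro eqv_sum LM_LL assms n)
  also have "\<dots> = (\<Sum>h\<in>UNIV. \<Sum>g\<in>UNIV. \<Sum>e\<in>UNIV. LL (m e * Th e g (n h)) [g, h])" by (rule sum.cong[OF refl], rule sum.swap)
  also have "\<dots> = (\<Sum>g\<in>UNIV. \<Sum>h\<in>UNIV. \<Sum>e\<in>UNIV. LL (m e * Th e g (n h)) [g, h])" by (rule sum.swap)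
  also have "\<dots> \<doteq> (\<Sum>g\<in>UNIV. \<Sum>h\<in>UNIV. LL (\<Sum>e\<in>UNIV. m e * Th e g (n h)) [g, h])"
    using c by (intro eqv_sum eqv_sym[OF LL_sum]) auto
  finally show ?thesis .
qed

text \<open>Differentiate \<Sum> b_k X_d(r_k) = 0 along X_g. The left side is the coefficient of e_g
  e_d in \<Sum> db_k dr_k, so that coefficient is a second derivative with opposite sign;
  \<open>tq\<close> undoes the scalar of \<open>TT g\<close>.\<close>

lemma prolong_Leib:
  assumes b: "\<And>k. k < (n::nat) \<Longrightarrow> b k \<in> Aw 0" and r: "\<And>k. k < n \<Longrightarrow> r k \<in> Aw 0" and z: "\<And>d. (\<Sum>k<n. b k * Xo d (r k)) = 0"
  shows "(\<Sum>k<n. \<Sum>e\<in>UNIV. Xo e (b k) * Th e g (Xo d (r k))) = - (\<Sum>k<n. b k * (tq g d *\<^sub>C Xo g (Xo d (r k))))"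
proof -
  have X: "Xo d (r k) \<in> Aw (rt d)" if "k < n" for k using Xo_Aw[OF r[OF that], of d] by simp
  have t: "TT g (Xo d (r k)) = (Q powi tw g (rt d)) *\<^sub>C Xo d (r k)" if "k < n" for k by (rule Aw_TT[OF X[OF that]])
  have "0 = Xo g (\<Sum>k<n. b k * Xo d (r k))" by (simp add: z)
  also have "\<dots> = (\<Sum>k<n. b k * Xo g (Xo d (r k)) + (\<Sum>e\<in>UNIV. Xo e (b k) * Th e g (TT g (Xo d (r k)))))"
    unfolding Xo_sum by (rule sum.cong[OF refl], rule Leib) (auto intro: Aw_UU[OF b] Aw_UU[OF X])
  also have "\<dots> = (\<Sum>k<n. b k * Xo g (Xo d (r k)) + (Q powi tw g (rt d)) *\<^sub>C (\<Sum>e\<in>UNIV. Xo e (b k) * Th e g (Xo d (r k))))"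
    by (rule sum.cong) (auto simp: t scC_sum)
  finally have "(Q powi tw g (rt d)) *\<^sub>C (\<Sum>k<n. \<Sum>e\<in>UNIV. Xo e (b k) * Th e g (Xo d (r k))) = - (\<Sum>k<n. b k * Xo g (Xo d (r k)))"
    by (simp add: sum.distrib scC_sum eq_neg_iff_add_eq_0 add.commute)
  from arg_cong[OF this, of "\<lambda>x. tq g d *\<^sub>C x"] show ?thesis
    by (simp add: tq_def power_int_minus scC_sum)
qed

lemma LL_uminus: "a \<in> Aw (wtw w) \<Longrightarrow> LL (- a) w \<doteq> - LL a w"
proof -
  assume a: "a \<in> Aw (wtw w)"
  have "LL (- a) w + LL a w \<doteq> LL (- a + a) w" using a by (intro eqv_sym[OF LL_add]) (auto simp: Aw_uminus)
  also have "\<dots> \<doteq> 0" by (simp add: LL_zero)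
  finally show ?thesis using a unfolding eqv_def by (auto simp: Aw_uminus)
qed

text \<open>Split f along the matrices \<open>VV p\<close>. For each p, \<open>cop_family\<close>
  gives b_k and r_k with \<Sum> b_k dr_k = 0, because first derivatives at 1 vanish on the product
  for p; the relation \<Sum> db_k dr_k is then minus the required element.\<close>

lemma LL_RelF:
  assumes f: "RelF f" and w: "\<And>g d. f g d \<in> Aw (rt g + rt d)"
  shows "(\<Sum>g\<in>UNIV. \<Sum>d\<in>UNIV. LL (f g d) [g, d]) \<doteq> 0"
proof -
  obtain A where A: "\<And>p. p \<in> set P21 \<Longrightarrow> A p \<in> Aw (rt (fst p) + rt (snd p))"
    "\<And>g d. f g d = (\<Sum>p\<in>set P21. VV p g d *\<^sub>C A p)" using RelF_decomp[OF f w] by blast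
  \<comment> \<open>Where the weights disagree the constant \<open>VV p g d\<close> is 0, so the
    product is homogeneous in every case.\<close>
  have V: "VV p g d *\<^sub>C A p \<in> Aw (wtw [g, d])" if "p \<in> set P21" for p g d
    using A(1)[OF that] VV_0[of g d p] by (cases "rt g + rt d = rt (fst p) + rt (snd p)") (auto simp: Aw_scale)
  have one: "(\<Sum>g\<in>UNIV. \<Sum>d\<in>UNIV. LL (VV p g d *\<^sub>C A p) [g, d]) \<doteq> 0" if p: "p \<in> set P21" for p
  proof -
    obtain n b r where h: "\<And>k. k < (n::nat) \<Longrightarrow> b k \<in> Aw 0" "\<And>k. k < n \<Longrightarrow> r k \<in> Aw 0"
      "\<And>f. (\<Sum>k<n. b k * Xo f (r k)) = ap (Xo f (yv (fst p) * yv (snd p))) [] *\<^sub>C A p"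
      "\<And>g f. (\<Sum>k<n. b k * Xo g (Xo f (r k))) = ap (Xo g (Xo f (yv (fst p) * yv (snd p)))) [] *\<^sub>C A p"
      using cop_family[OF yy_props(2)[of "fst p" "snd p"] A(1)[OF p]] unfolding diff_self by blast
    have z: "(\<Sum>k<n. b k * Xo f (r k)) = 0" for f by (simp add: h(3) Xo_P21[OF p])
    have v: "(\<Sum>k<n. b k * (tq g d *\<^sub>C Xo g (Xo d (r k)))) = VV p g d *\<^sub>C A p" for g d
      using h(4)[of g d] by (simp add: VV_def flip: scC_sum)
    have c: "Xo e (b k) * Th e g (Xo d (r k)) \<in> Aw (wtw [g, d])" if "k < n" for k e g d
      using Th_term_Aw[OF MM_d[OF h(1)[OF that]] Xo_Aw[OF h(2)[OF that], of d], of e g] by simp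
    have "(\<Sum>k<n. LM (dd (b k)) * LM (dd (r k))) \<doteq> (\<Sum>k<n. \<Sum>g\<in>UNIV. \<Sum>d\<in>UNIV. LL (\<Sum>e\<in>UNIV. Xo e (b k) * Th e g (Xo d (r k))) [g, d])"
      using LM_LM_LL2[of "dd (b _)" "dd (r _)"] h(1,2) by (intro eqv_sum) (auto simp: dd_def[abs_def] MM_d simp del: LL.simps)
    also have "\<dots> = (\<Sum>g\<in>UNIV. \<Sum>k<n. \<Sum>d\<in>UNIV. LL (\<Sum>e\<in>UNIV. Xo e (b k) * Th e g (Xo d (r k))) [g, d])" by (rule sum.swap)
    also have "\<dots> = (\<Sum>g\<in>UNIV. \<Sum>d\<in>UNIV. \<Sum>k<n. LL (\<Sum>e\<in>UNIV. Xo e (b k) * Th e g (Xo d (r k))) [g, d])"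
      by (rule sum.cong[OF refl], rule sum.swap)
    also have "\<dots> \<doteq> (\<Sum>g\<in>UNIV. \<Sum>d\<in>UNIV. LL (\<Sum>k<n. \<Sum>e\<in>UNIV. Xo e (b k) * Th e g (Xo d (r k))) [g, d])"
      using c by (intro eqv_sum eqv_sym[OF LL_sum] Aw_sum) auto
    also have "\<dots> = (\<Sum>g\<in>UNIV. \<Sum>d\<in>UNIV. LL (- (VV p g d *\<^sub>C A p)) [g, d])"
      by (simp only: prolong_Leib[OF h(1,2) z] v)
    also have "\<dots> \<doteq> (\<Sum>g\<in>UNIV. \<Sum>d\<in>UNIV. - LL (VV p g d *\<^sub>C A p) [g, d])"
      using V[OF p] by (intro eqv_sum LL_uminus)
    also have "\<dots> = - (\<Sum>g\<in>UNIV. \<Sum>d\<in>UNIV. LL (VV p g d *\<^sub>C A p) [g, d])" by (simp only: sum_negf)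
    finally have e: "(\<Sum>k<n. LM (dd (b k)) * LM (dd (r k))) \<doteq> - (\<Sum>g\<in>UNIV. \<Sum>d\<in>UNIV. LL (VV p g d *\<^sub>C A p) [g, d])" .
    have "(\<Sum>k<n. LM (dd (b k)) * LM (dd (r k))) \<in> PS" unfolding PS_def using h(1,2) z by blast
    then have "(\<Sum>k<n. LM (dd (b k)) * LM (dd (r k))) \<in> NN" using PS_NN by blast
    with e show ?thesis unfolding eqv_def
      using NN_closed(2)[of "(\<Sum>k<n. LM (dd (b k)) * LM (dd (r k))) - - (\<Sum>g\<in>UNIV. \<Sum>d\<in>UNIV. LL (VV p g d *\<^sub>C A p) [g, d])" "- (\<Sum>k<n. LM (dd (b k)) * LM (dd (r k)))"]
        NN_closed(3) CF_intros(7)[of "- (\<Sum>g\<in>UNIV. \<Sum>d\<in>UNIV. LL (VV p g d *\<^sub>C A p) [g, d])"]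
      by (simp del: LL.simps)
  qed
  have "(\<Sum>g\<in>UNIV. \<Sum>d\<in>UNIV. LL (f g d) [g, d]) \<doteq> (\<Sum>g\<in>UNIV. \<Sum>d\<in>UNIV. \<Sum>p\<in>set P21. LL (VV p g d *\<^sub>C A p) [g, d])"
    unfolding A(2) using V by (intro eqv_sum LL_sum) auto
  also have "\<dots> = (\<Sum>g\<in>UNIV. \<Sum>p\<in>set P21. \<Sum>d\<in>UNIV. LL (VV p g d *\<^sub>C A p) [g, d])" by (rule sum.cong[OF refl], rule sum.swap)
  also have "\<dots> = (\<Sum>p\<in>set P21. \<Sum>g\<in>UNIV. \<Sum>d\<in>UNIV. LL (VV p g d *\<^sub>C A p) [g, d])" by (rule sum.swap)
  also have "\<dots> \<doteq> (\<Sum>p\<in>set P21. 0)" by (intro eqv_sum one)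
  finally show ?thesis by simp
qed

end

section \<open>Quadratic relations inside longer words\<close>

context qparam
begin

lemma sum_pair: "(\<Sum>g\<in>(UNIV::cot set). \<Sum>d\<in>(UNIV::cot set). f g d) = (\<Sum>p\<in>UNIV. f (fst p) (snd p))"
  by (simp add: sum.cartesian_product case_prod_unfold)

text \<open>The element a e_g e_d x with x moved to the front: multiplicativity of \<open>Th\<close>
  merges the inserted factors into x_i y_i, whose sum is 1.\<close>

lemma LM_pair:
  assumes a: "a \<in> Aw (rt g + rt d + l)" and l: "sl l" and x: "x \<in> Aw (- l)"
  shows "(\<Sum>i<nX (rt d + l). LM (me a g (Xl (rt d + l) i)) * LM (me (Yl (rt d + l) i) d x)) \<doteq>
    (\<Sum>g'\<in>UNIV. \<Sum>h\<in>UNIV. LL (a * Th g g' (Th d h x)) [g', h])"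
proof -
  let ?L = "rt d + l"
  have s: "sl ?L" by (rule sl_add[OF sl_rt l])
  have X: "Xl ?L i \<in> Aw (- ?L)" "Yl ?L i \<in> Aw ?L" if "i < nX ?L" for i using Xl[OF s that] Yl[OF s that] .
  have m: "me a g (Xl ?L i) \<in> MM" "me (Yl ?L i) d x \<in> MM" if "i < nX ?L" for i
    using me_MM[OF _ X(1)[OF that], of a g] me_MM[OF X(2)[OF that] x] a by (simp_all add: add.assoc)
  have e: "(\<Sum>e\<in>UNIV. me a g (Xl ?L i) e * Th e g' (me (Yl ?L i) d x h)) = a * Th g g' (Xl ?L i * Yl ?L i * Th d h x)" if "i < nX ?L" for i g' h
    using Aw_UU[OF X(1)[OF that]] Aw_UU[OF X(2)[OF that]] Aw_UU[OF x]
    by (simp add: me_def Th_mult sum_distrib_left mult.assoc)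
  have c: "a * Th g g' (Xl ?L i * Yl ?L i * Th d h x) \<in> Aw (wtw [g', h])" if "i < nX ?L" for i g' h
    unfolding e[OF that, symmetric]
    using Th_term_Aw[OF m(1)[OF that], of "me (Yl ?L i) d x h" "rt h"] m(2)[OF that]
    by (auto simp: MM_def intro!: Aw_sum)
  have "(\<Sum>i<nX ?L. LM (me a g (Xl ?L i)) * LM (me (Yl ?L i) d x)) \<doteq>
    (\<Sum>i<nX ?L. \<Sum>g'\<in>UNIV. \<Sum>h\<in>UNIV. LL (a * Th g g' (Xl ?L i * Yl ?L i * Th d h x)) [g', h])"
  proof (rule eqv_sum)
    fix i assume "i \<in> {..<nX ?L}"
    then have i: "i < nX ?L" by simp
    show "LM (me a g (Xl ?L i)) * LM (me (Yl ?L i) d x) \<doteq>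
       (\<Sum>g'\<in>UNIV. \<Sum>h\<in>UNIV. LL (a * Th g g' (Xl ?L i * Yl ?L i * Th d h x)) [g', h])"
      using LM_LM_LL2[OF m(1)[OF i] m(2)[OF i]] unfolding e[OF i] .
  qed
  also have "\<dots> = (\<Sum>g'\<in>UNIV. \<Sum>i<nX ?L. \<Sum>h\<in>UNIV. LL (a * Th g g' (Xl ?L i * Yl ?L i * Th d h x)) [g', h])" by (rule sum.swap)
  also have "\<dots> = (\<Sum>g'\<in>UNIV. \<Sum>h\<in>UNIV. \<Sum>i<nX ?L. LL (a * Th g g' (Xl ?L i * Yl ?L i * Th d h x)) [g', h])"
    by (rule sum.cong[OF refl], rule sum.swap)
  also have "\<dots> \<doteq> (\<Sum>g'\<in>UNIV. \<Sum>h\<in>UNIV. LL (\<Sum>i<nX ?L. a * Th g g' (Xl ?L i * Yl ?L i * Th d h x)) [g', h])"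
    using c by (intro eqv_sum eqv_sym[OF LL_sum]) auto
  also have "(\<lambda>g' h. \<Sum>i<nX ?L. a * Th g g' (Xl ?L i * Yl ?L i * Th d h x)) = (\<lambda>g' h. a * Th g g' (Th d h x))"
    using XlYl[OF s] by (intro ext) (simp flip: sum_distrib_left sum_distrib_right Th_sum)
  finally show ?thesis .
qed

lemma mr_scal: "mr m (c *\<^sub>C 1) = (\<lambda>d. c *\<^sub>C m d)"
  by (simp add: mr_def Th_one if_distrib[of "\<lambda>x. _ * x"] if_distrib[of "\<lambda>x. _ *\<^sub>C x"] cong: if_cong)

lemma LL_Cons_scale:
  assumes a: "a \<in> Aw (wtw (e # w))"
  shows "LL (c *\<^sub>C a) (e # w) \<doteq> (\<Sum>i<nX (wtw w). LM (me a e (Xl (wtw w) i)) * LL (c *\<^sub>C Yl (wtw w) i) w)"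
  unfolding LL.simps
proof (rule eqv_sum)
  fix i assume "i \<in> {..<nX (wtw w)}"
  then have i: "i < nX (wtw w)" by simp
  have Y: "Yl (wtw w) i \<in> Aw (wtw w)" by (rule Yl[OF sl_wtw i])
  have m: "me a e (Xl (wtw w) i) \<in> MM" by (rule me_MM'[OF a i])
  have 1: "c *\<^sub>C 1 \<in> Aw 0" by (simp add: Aw_scale)
  have "me (c *\<^sub>C a) e (Xl (wtw w) i) = mr (me a e (Xl (wtw w) i)) (c *\<^sub>C 1)" by (simp add: mr_scal me_def)
  then have "LM (me (c *\<^sub>C a) e (Xl (wtw w) i)) * LL (Yl (wtw w) i) w \<doteq> LM (me a e (Xl (wtw w) i)) * LB (c *\<^sub>C 1) * LL (Yl (wtw w) i) w"
    using eqv_LM(3)[OF 1 m] Y by (intro eqv_mult) auto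
  also have "\<dots> \<doteq> LM (me a e (Xl (wtw w) i)) * LL (c *\<^sub>C Yl (wtw w) i) w"
    unfolding mult.assoc using m eqv_sym[OF LL_scale[OF Y, of c]] by (intro eqv_mult) auto
  finally show "LM (me (c *\<^sub>C a) e (Xl (wtw w) i)) * LL (Yl (wtw w) i) w \<doteq> LM (me a e (Xl (wtw w) i)) * LL (c *\<^sub>C Yl (wtw w) i) w" .
qed

text \<open>At the front of a word, the next inserted factor is pulled through both letters of the
  relation; by \<open>RelF_stable\<close> the outcome is again a relation, covered by
  \<open>LL_RelF\<close>. Letters before the relation are peeled off one at a time.\<close>

lemma LL_word_rel:
  fixes u v :: "cot list"
  assumes R: "RelF (\<lambda>g d. c g d *\<^sub>C 1)" and W: "\<And>g d. c g d \<noteq> 0 \<Longrightarrow> rt g + rt d = \<mu>"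
    and a: "a \<in> Aw (wtw u + \<mu> + wtw v)" and \<mu>: "sl \<mu>"
  shows "(\<Sum>g\<in>UNIV. \<Sum>d\<in>UNIV. LL (c g d *\<^sub>C a) (u @ g # d # v)) \<doteq> 0"
  using a
proof (induction u arbitrary: a)
  case Nil
  let ?l = "wtw v"
  note s = sl_wtw[of v]
  have X: "Xl ?l j \<in> Aw (- ?l)" "Yl ?l j \<in> Aw ?l" if "j < nX ?l" for j using Xl[OF s that] Yl[OF s that] .
  \<comment> \<open>The product c(g,d) a e_g e_d x_j, with all coefficients moved to the
    front.\<close>
  define F where "F j g d = (\<Sum>g'\<in>UNIV. \<Sum>h\<in>UNIV. LL (c g d *\<^sub>C (a * Th g g' (Th d h (Xl ?l j)))) [g', h])" for j g d
  have t: "c g d *\<^sub>C (a * Th g g' (Th d h (Xl ?l j))) \<in> Aw (rt g' + rt h)" if "j < nX ?l" for j g d g' h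
  proof (cases "c g d = 0")
    case False
    have "a * Th g g' (Th d h (Xl ?l j)) \<in> Aw (rt g' + rt h)"
      by (rule Aw_mult'[OF Nil Th_Aw[OF Th_Aw[OF X(1)[OF that]]]]) (simp add: W[OF False, symmetric])
    then show ?thesis by (rule Aw_scale)
  qed simp
  have FC: "F j g d \<in> CF" if "j < nX ?l" for j g d
    unfolding F_def using t[OF that] by (intro CF_sum LL_CF) auto
  have E: "LL (c g d *\<^sub>C a) (g # d # v) \<doteq> (\<Sum>j<nX ?l. F j g d * LL (Yl ?l j) v)" for g d
  proof (cases "c g d = 0")
    case True
    have "F j g d \<doteq> (\<Sum>g'\<in>(UNIV::cot set). \<Sum>h\<in>(UNIV::cot set). 0)" for j
      unfolding F_def using True LL_zero by (intro eqv_sum) (simp del: LL.simps)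
    then have "(\<Sum>j<nX ?l. F j g d * LL (Yl ?l j) v) \<doteq> (\<Sum>j<nX ?l. 0 * LL (Yl ?l j) v)"
      using X by (intro eqv_sum eqv_mult) auto
    then have 1: "(\<Sum>j<nX ?l. F j g d * LL (Yl ?l j) v) \<doteq> 0" by simp
    have "LL (c g d *\<^sub>C a) (g # d # v) \<doteq> 0" using LL_zero[of "g # d # v"] True by (simp del: LL.simps)
    from eqv_trans[OF this eqv_sym[OF 1]] show ?thesis .
  next
    case False
    have a': "c g d *\<^sub>C a \<in> Aw (rt g + rt d + ?l)" using Nil W[OF False] by (simp add: Aw_scale)
    have "LL (c g d *\<^sub>C a) (g # d # v) =
      (\<Sum>i<nX (rt d + ?l). \<Sum>j<nX ?l. (LM (me (c g d *\<^sub>C a) g (Xl (rt d + ?l) i)) * LM (me (Yl (rt d + ?l) i) d (Xl ?l j))) * LL (Yl ?l j) v)"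
      by (simp add: sum_distrib_left mult.assoc)
    also have "\<dots> = (\<Sum>j<nX ?l. (\<Sum>i<nX (rt d + ?l). LM (me (c g d *\<^sub>C a) g (Xl (rt d + ?l) i)) * LM (me (Yl (rt d + ?l) i) d (Xl ?l j))) * LL (Yl ?l j) v)"
      unfolding sum_distrib_right by (rule sum.swap)
    also have "\<dots> \<doteq> (\<Sum>j<nX ?l. F j g d * LL (Yl ?l j) v)"
      unfolding F_def using LM_pair[OF a' s X(1)] X by (intro eqv_sum eqv_mult) (auto simp del: LL.simps)
    finally show ?thesis .
  qed
  have z: "(\<Sum>g\<in>UNIV. \<Sum>d\<in>UNIV. F j g d) \<doteq> 0" if j: "j < nX ?l" for j
  proof -
    \<comment> \<open>The coefficient matrix of the relation after x_j has acted on both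
      letters.\<close>
    define f where "f g' h = (\<Sum>g\<in>UNIV. \<Sum>d\<in>UNIV. c g d *\<^sub>C (a * Th g g' (Th d h (Xl ?l j))))" for g' h
    have "f = (\<lambda>g' h. a * (\<Sum>g\<in>UNIV. \<Sum>d\<in>UNIV. (c g d *\<^sub>C 1) * Th g g' (Th d h (Xl ?l j))))"
      by (intro ext) (simp add: f_def sum_distrib_left)
    then have "RelF f" using RelF_mult[OF RelF_stable[OF R Aw_UU[OF X(1)[OF j]]]] by simp
    moreover have "f g' h \<in> Aw (rt g' + rt h)" for g' h unfolding f_def using t[OF j] by (intro Aw_sum) auto
    ultimately have 0: "(\<Sum>g'\<in>UNIV. \<Sum>h\<in>UNIV. LL (f g' h) [g', h]) \<doteq> 0" by (rule LL_RelF)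
    have "(\<Sum>g\<in>UNIV. \<Sum>d\<in>UNIV. F j g d) = (\<Sum>p\<in>UNIV. \<Sum>p'\<in>UNIV. LL (c (fst p) (snd p) *\<^sub>C (a * Th (fst p) (fst p') (Th (snd p) (snd p') (Xl ?l j)))) [fst p', snd p'])"
      unfolding F_def by (simp only: sum_pair)
    also have "\<dots> = (\<Sum>p'\<in>UNIV. \<Sum>p\<in>UNIV. LL (c (fst p) (snd p) *\<^sub>C (a * Th (fst p) (fst p') (Th (snd p) (snd p') (Xl ?l j)))) [fst p', snd p'])"
      by (rule sum.swap)
    also have "\<dots> \<doteq> (\<Sum>p'\<in>UNIV. LL (\<Sum>p\<in>UNIV. c (fst p) (snd p) *\<^sub>C (a * Th (fst p) (fst p') (Th (snd p) (snd p') (Xl ?l j)))) [fst p', snd p'])"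
      using t[OF j] by (intro eqv_sum eqv_sym[OF LL_sum]) auto
    also have "\<dots> = (\<Sum>g'\<in>UNIV. \<Sum>h\<in>UNIV. LL (f g' h) [g', h])"
      unfolding f_def by (simp only: sum_pair)
    also note 0
    finally show ?thesis .
  qed
  have "(\<Sum>g\<in>UNIV. \<Sum>d\<in>UNIV. LL (c g d *\<^sub>C a) ([] @ g # d # v)) \<doteq> (\<Sum>g\<in>UNIV. \<Sum>d\<in>UNIV. \<Sum>j<nX ?l. F j g d * LL (Yl ?l j) v)"
    unfolding append_Nil by (intro eqv_sum E)
  also have "\<dots> = (\<Sum>g\<in>UNIV. \<Sum>j<nX ?l. \<Sum>d\<in>UNIV. F j g d * LL (Yl ?l j) v)" by (rule sum.cong[OF refl], rule sum.swap)
  also have "\<dots> = (\<Sum>j<nX ?l. \<Sum>g\<in>UNIV. \<Sum>d\<in>UNIV. F j g d * LL (Yl ?l j) v)" by (rule sum.swap)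
  also have "\<dots> = (\<Sum>j<nX ?l. (\<Sum>g\<in>UNIV. \<Sum>d\<in>UNIV. F j g d) * LL (Yl ?l j) v)" by (simp only: sum_distrib_right)
  also have "\<dots> \<doteq> (\<Sum>j<nX ?l. 0 * LL (Yl ?l j) v)" using z X by (intro eqv_sum eqv_mult) auto
  finally show ?case by simp
next
  case (Cons e u)
  define L where "L = wtw u + \<mu> + wtw v"
  have s: "sl L" unfolding L_def by (intro sl_add sl_wtw \<mu>)
  have a: "a \<in> Aw (rt e + L)" using Cons.prems by (simp add: L_def add.assoc)
  have m: "me a e (Xl L i) \<in> MM" if "i < nX L" for i by (rule me_MM[OF a Xl[OF s that]])
  have E: "LL (c g d *\<^sub>C a) (e # u @ g # d # v) \<doteq> (\<Sum>i<nX L. LM (me a e (Xl L i)) * LL (c g d *\<^sub>C Yl L i) (u @ g # d # v))" for g d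
  proof (cases "c g d = 0")
    case True
    have "(\<Sum>i<nX L. LM (me a e (Xl L i)) * LL (c g d *\<^sub>C Yl L i) (u @ g # d # v)) \<doteq> (\<Sum>i<nX L. LM (me a e (Xl L i)) * 0)"
      using m True LL_zero by (intro eqv_sum eqv_mult) (auto simp del: LL.simps)
    then have 1: "(\<Sum>i<nX L. LM (me a e (Xl L i)) * LL (c g d *\<^sub>C Yl L i) (u @ g # d # v)) \<doteq> 0" by simp
    have "LL (c g d *\<^sub>C a) (e # u @ g # d # v) \<doteq> 0" using LL_zero[of "e # u @ g # d # v"] True by (simp del: LL.simps)
    from eqv_trans[OF this eqv_sym[OF 1]] show ?thesis .
  next
    case False
    have w: "wtw (u @ g # d # v) = L" using W[OF False] by (simp add: L_def algebra_simps)
    show ?thesis using LL_Cons_scale[of a e "u @ g # d # v" "c g d"] a unfolding wtw_simps(2) w by blast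
  qed
  have "(\<Sum>g\<in>UNIV. \<Sum>d\<in>UNIV. LL (c g d *\<^sub>C a) ((e # u) @ g # d # v)) \<doteq>
    (\<Sum>g\<in>UNIV. \<Sum>d\<in>UNIV. \<Sum>i<nX L. LM (me a e (Xl L i)) * LL (c g d *\<^sub>C Yl L i) (u @ g # d # v))"
    unfolding append_Cons by (intro eqv_sum E)
  also have "\<dots> = (\<Sum>g\<in>UNIV. \<Sum>i<nX L. \<Sum>d\<in>UNIV. LM (me a e (Xl L i)) * LL (c g d *\<^sub>C Yl L i) (u @ g # d # v))"
    by (rule sum.cong[OF refl], rule sum.swap)
  also have "\<dots> = (\<Sum>i<nX L. \<Sum>g\<in>UNIV. \<Sum>d\<in>UNIV. LM (me a e (Xl L i)) * LL (c g d *\<^sub>C Yl L i) (u @ g # d # v))" by (rule sum.swap)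
  also have "\<dots> = (\<Sum>i<nX L. LM (me a e (Xl L i)) * (\<Sum>g\<in>UNIV. \<Sum>d\<in>UNIV. LL (c g d *\<^sub>C Yl L i) (u @ g # d # v)))"
    by (simp only: sum_distrib_left)
  also have "\<dots> \<doteq> (\<Sum>i<nX L. LM (me a e (Xl L i)) * 0)"
    using m Yl[OF s] Cons.IH[of "Yl L _"] by (intro eqv_sum eqv_mult) (auto simp: L_def simp del: LL.simps)
  finally show ?case by simp
qed
end

section \<open>A representation on ordered monomials\<close>

type_synonym st = "bool \<times> bool \<times> bool \<times> bool \<times> bool \<times> bool"

text \<open>The four orderings that are needed put one of \<open>e\<^sub>i\<close>, \<open>f\<^sub>i\<close> into the first and the other into the second
  half of an ordered monomial \<open>x\<^sub>1 x\<^sub>2 x\<^sub>3 y\<^sub>1 y\<^sub>2 y\<^sub>3\<close>, simultaneously for the roots \<open>\<alpha>\<^sub>1\<close> and \<open>\<alpha>\<^sub>1 + \<alpha>\<^sub>2\<close>.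
  A state \<open>(a\<^sub>1, a\<^sub>2, a\<^sub>3, b\<^sub>1, b\<^sub>2, b\<^sub>3)\<close> records which letters occur.\<close>

locale qord = qparam +
  fixes s1 s2 :: bool
begin

definition x1 :: cot where "x1 = (if s1 then ec R1 else fc R1)"
definition x2 :: cot where "x2 = (if s2 then ec R2 else fc R2)"
definition x3 :: cot where "x3 = (if s1 then ec R12 else fc R12)"
definition y1 :: cot where "y1 = (if s1 then fc R1 else ec R1)"
definition y2 :: cot where "y2 = (if s2 then fc R2 else ec R2)"
definition y3 :: cot where "y3 = (if s1 then fc R12 else ec R12)"
lemmas ltr_defs = x1_def x2_def x3_def y1_def y2_def y3_def

text \<open>Antisymmetrised in \<open>cm\<close>, these are the exponents of q in the equations of
  \<open>RelF\<close>; one table serves all four orders.\<close>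

fun sx1 :: "cot \<Rightarrow> cot \<Rightarrow> int" where
  "sx1 (ec R1) (ec R2) = 1" | "sx1 (ec R1) (ec R12) = 2" | "sx1 (ec R12) (ec R2) = 1"
| "sx1 (fc R2) (fc R1) = 1" | "sx1 (fc R12) (fc R1) = 2" | "sx1 (fc R2) (fc R12) = 1"
| "sx1 (fc R2) (ec R2) = 2" | "sx1 (fc R12) (ec R12) = 2" | "sx1 (fc R2) (ec R1) = 1"
| "sx1 (fc R1) (ec R2) = 1" | "sx1 (fc R12) (ec R1) = 2" | "sx1 (fc R12) (ec R2) = 1"
| "sx1 (fc R1) (ec R12) = 2" | "sx1 (fc R2) (ec R12) = 1" | "sx1 _ _ = 0"

text \<open>The relations read \<open>d g = cm d g \<cdot> g d\<close>, except that \<open>y\<^sub>i x\<^sub>i\<close> has the further term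
  \<open>k\<^sub>i x\<^sub>3 y\<^sub>3\<close> for \<open>i = 1, 2\<close>.\<close>

definition cm :: "cot \<Rightarrow> cot \<Rightarrow> complex" where "cm d g = - (Q powi (sx1 d g - sx1 g d))"
definition k1 :: complex where "k1 = (if s1 then 1 else - (inverse Q ^ 2)) * (1 - inverse Q ^ 2)"
text \<open>Like \<open>k1\<close>, this comes from the only equation of \<open>RelF\<close> with
  four terms; the powers of q arise from turning the products of e_\<gamma> and f_\<gamma> into the
  chosen order.\<close>

definition k2 :: complex where
  "k2 = (if s2 then (if s1 then -1 else inverse Q ^ 2) else (if s1 then - (inverse Q ^ 2) else inverse Q ^ 4)) * (Q - inverse Q)"

definition pw :: "bool \<Rightarrow> complex \<Rightarrow> complex" where "pw b c = (if b then c else 1)"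

text \<open>Left multiplication by the letter d in the algebra spanned by ordered monomials: the
  value at s is the coefficient of the monomial s in the product. The factors \<open>pw\<close>
  arise from moving d to its place, the second summands from the terms k_i x_3 y_3.\<close>

definition Lop :: "cot \<Rightarrow> (st \<Rightarrow> dual) \<Rightarrow> st \<Rightarrow> dual" where
  "Lop d \<xi> = (\<lambda>(a1, a2, a3, b1, b2, b3).
    if d = x1 then (if a1 then \<xi> (False, a2, a3, b1, b2, b3) else 0)
    else if d = x2 then (if a2 then pw a1 (cm x2 x1) *\<^sub>C \<xi> (a1, False, a3, b1, b2, b3) else 0)
    else if d = x3 then (if a3 then (pw a1 (cm x3 x1) * pw a2 (cm x3 x2)) *\<^sub>C \<xi> (a1, a2, False, b1, b2, b3) else 0)
    else if d = y1 then
      (if b1 then (pw a1 (cm y1 x1) * pw a2 (cm y1 x2) * pw a3 (cm y1 x3)) *\<^sub>C \<xi> (a1, a2, a3, False, b2, b3) else 0) +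
      (if \<not> a1 \<and> a3 \<and> b3 then (k1 * pw a2 (cm y3 x2 * cm x3 x2) * pw b1 (cm y3 y1) * pw b2 (cm y3 y2)) *\<^sub>C \<xi> (True, a2, False, b1, b2, False) else 0)
    else if d = y2 then
      (if b2 then (pw a1 (cm y2 x1) * pw a2 (cm y2 x2) * pw a3 (cm y2 x3) * pw b1 (cm y2 y1)) *\<^sub>C \<xi> (a1, a2, a3, b1, False, b3) else 0) +
      (if \<not> a2 \<and> a3 \<and> b3 then (pw a1 (cm y2 x1) * k2 * pw b1 (cm y3 y1) * pw b2 (cm y3 y2)) *\<^sub>C \<xi> (a1, True, False, b1, b2, False) else 0)
    else
      (if b3 then (pw a1 (cm y3 x1) * pw a2 (cm y3 x2) * pw a3 (cm y3 x3) * pw b1 (cm y3 y1) * pw b2 (cm y3 y2)) *\<^sub>C \<xi> (a1, a2, a3, b1, b2, False) else 0))"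

lemma ltr_distinct: "distinct [x1, x2, x3, y1, y2, y3]" by (simp add: ltr_defs)

lemma ltr_ne [simp]:
  "x1 \<noteq> x2" "x1 \<noteq> x3" "x1 \<noteq> y1" "x1 \<noteq> y2" "x1 \<noteq> y3" "x2 \<noteq> x3" "x2 \<noteq> y1" "x2 \<noteq> y2" "x2 \<noteq> y3"
  "x3 \<noteq> y1" "x3 \<noteq> y2" "x3 \<noteq> y3" "y1 \<noteq> y2" "y1 \<noteq> y3" "y2 \<noteq> y3"
  "x2 \<noteq> x1" "x3 \<noteq> x1" "y1 \<noteq> x1" "y2 \<noteq> x1" "y3 \<noteq> x1" "x3 \<noteq> x2" "y1 \<noteq> x2" "y2 \<noteq> x2" "y3 \<noteq> x2"
  "y1 \<noteq> x3" "y2 \<noteq> x3" "y3 \<noteq> x3" "y2 \<noteq> y1" "y3 \<noteq> y1" "y3 \<noteq> y2"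
  using ltr_distinct by auto

lemma ltr_cases: "(d = x1 \<Longrightarrow> P) \<Longrightarrow> (d = x2 \<Longrightarrow> P) \<Longrightarrow> (d = x3 \<Longrightarrow> P) \<Longrightarrow> (d = y1 \<Longrightarrow> P) \<Longrightarrow> (d = y2 \<Longrightarrow> P) \<Longrightarrow> (d = y3 \<Longrightarrow> P) \<Longrightarrow> P"
  unfolding ltr_defs by (rule cot_cases[of d]; cases s1; cases s2; simp)

lemma UNIV_ltr: "(UNIV :: cot set) = {x1, x2, x3, y1, y2, y3}"
  using ltr_cases by blast

lemma sum_ltr: "(\<Sum>d\<in>UNIV. f d) = f x1 + f x2 + f x3 + f y1 + f y2 + f y3" for f :: "cot \<Rightarrow> 'z::comm_monoid_add"
  unfolding UNIV_ltr by (simp add: add.assoc)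

lemma Lop_map:
  assumes "\<And>a b. T (a + b) = T a + T b" "\<And>c a. T (c *\<^sub>C a) = c *\<^sub>C T a"
  shows "T (Lop d \<xi> s) = Lop d (\<lambda>s. T (\<xi> s)) s"
proof -
  have "T 0 = 0" using assms(2)[of 0 0] by simp
  then show ?thesis unfolding Lop_def case_prod_unfold Let_def using assms by (auto split: if_splits)
qed

lemma Lop_add: "Lop d (\<lambda>s. \<xi> s + \<eta> s) s = Lop d \<xi> s + Lop d \<eta> s"
  unfolding Lop_def case_prod_unfold by (auto simp: scC_distrib)

lemma Lop_0 [simp]: "Lop d (\<lambda>s. 0) s = 0" unfolding Lop_def case_prod_unfold by auto

lemma Lop_sum: "Lop d (\<lambda>s. \<Sum>i\<in>I. \<xi> i s) s = (\<Sum>i\<in>I. Lop d (\<xi> i) s)"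
  by (induction I rule: infinite_finite_induct) (simp_all add: Lop_add)

lemma Lop_scale: "Lop d (\<lambda>s. c *\<^sub>C \<xi> s) s = c *\<^sub>C Lop d \<xi> s"
  using Lop_map[of "\<lambda>a. c *\<^sub>C a" d \<xi> s] by (simp add: scC_distrib mult.commute)

lemma Lop_mult: "Lop d (\<lambda>s. a * \<xi> s) s = a * Lop d \<xi> s"
  using Lop_map[of "\<lambda>b. a * b" d \<xi> s] by (simp add: distrib_left)

lemma Lop_Th: "Th h g (Lop d \<xi> s) = Lop d (\<lambda>s. Th h g (\<xi> s)) s"
  by (rule Lop_map) simp_all

lemma Lop_UU: "(\<And>s. \<xi> s \<in> UU) \<Longrightarrow> Lop d \<xi> s \<in> UU"
  unfolding Lop_def case_prod_unfold by auto

text \<open>A finite verification on all 64 monomials that the operators \<open>Lop\<close> satisfy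
  the quadratic relations; it takes the place of a confluence argument. There is one such lemma for
  each order.\<close>

lemma Lop_RelF_TT:
  assumes s: "s1" "s2" and R: "\<And>s. RelF (\<lambda>f g. \<zeta> f g s)"
  shows "(\<Sum>f\<in>UNIV. \<Sum>g\<in>UNIV. Lop f (Lop g (\<zeta> f g)) s) = 0"
proof -
  obtain a1 a2 a3 b1 b2 b3 where st: "s = (a1, a2, a3, b1, b2, b3)" by (cases s) auto
  note e = R[unfolded RelF_def]
  have power6: "Q ^ 6 = Q * (Q * (Q * (Q * (Q * Q))))" by (simp add: eval_nat_numeral)
  have l: "x1 = ec R1" "x2 = ec R2" "x3 = ec R12" "y1 = fc R1" "y2 = fc R2" "y3 = fc R12" "k1 = 1 - inverse Q ^ 2" "k2 = -1 * (Q - inverse Q)"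
    unfolding ltr_defs k1_def k2_def using s by simp_all
  show ?thesis unfolding st sum_cot
    by (cases a1; cases a2; cases a3; cases b1; cases b2; cases b3;
        simp add: Lop_def[unfolded l] pw_def cm_def power_int_minus;
        (simp add: e scC_distrib)?; ((rule dual_eqI)?, simp add: field_simps power2_eq_square power4_eq_xxxx power6)?)
qed

lemma Lop_RelF_TF:
  assumes s: "s1" "\<not> s2" and R: "\<And>s. RelF (\<lambda>f g. \<zeta> f g s)"
  shows "(\<Sum>f\<in>UNIV. \<Sum>g\<in>UNIV. Lop f (Lop g (\<zeta> f g)) s) = 0"
proof -
  obtain a1 a2 a3 b1 b2 b3 where st: "s = (a1, a2, a3, b1, b2, b3)" by (cases s) auto
  note e = R[unfolded RelF_def]
  have power6: "Q ^ 6 = Q * (Q * (Q * (Q * (Q * Q))))" by (simp add: eval_nat_numeral)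
  have l: "x1 = ec R1" "x2 = fc R2" "x3 = ec R12" "y1 = fc R1" "y2 = ec R2" "y3 = fc R12" "k1 = 1 - inverse Q ^ 2" "k2 = - (inverse Q ^ 2) * (Q - inverse Q)"
    unfolding ltr_defs k1_def k2_def using s by simp_all
  show ?thesis unfolding st sum_cot
    by (cases a1; cases a2; cases a3; cases b1; cases b2; cases b3;
        simp add: Lop_def[unfolded l] pw_def cm_def power_int_minus;
        (simp add: e scC_distrib)?; ((rule dual_eqI)?, simp add: field_simps power2_eq_square power4_eq_xxxx power6)?)
qed

lemma Lop_RelF_FT:
  assumes s: "\<not> s1" "s2" and R: "\<And>s. RelF (\<lambda>f g. \<zeta> f g s)"
  shows "(\<Sum>f\<in>UNIV. \<Sum>g\<in>UNIV. Lop f (Lop g (\<zeta> f g)) s) = 0"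
proof -
  obtain a1 a2 a3 b1 b2 b3 where st: "s = (a1, a2, a3, b1, b2, b3)" by (cases s) auto
  note e = R[unfolded RelF_def]
  have power6: "Q ^ 6 = Q * (Q * (Q * (Q * (Q * Q))))" by (simp add: eval_nat_numeral)
  have l: "x1 = fc R1" "x2 = ec R2" "x3 = fc R12" "y1 = ec R1" "y2 = fc R2" "y3 = ec R12" "k1 = - (inverse Q ^ 2) * (1 - inverse Q ^ 2)" "k2 = inverse Q ^ 2 * (Q - inverse Q)"
    unfolding ltr_defs k1_def k2_def using s by simp_all
  show ?thesis unfolding st sum_cot
    by (cases a1; cases a2; cases a3; cases b1; cases b2; cases b3;
        simp add: Lop_def[unfolded l] pw_def cm_def power_int_minus;
        (simp add: e scC_distrib)?; ((rule dual_eqI)?, simp add: field_simps power2_eq_square power4_eq_xxxx power6)?)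
qed

lemma Lop_RelF_FF:
  assumes s: "\<not> s1" "\<not> s2" and R: "\<And>s. RelF (\<lambda>f g. \<zeta> f g s)"
  shows "(\<Sum>f\<in>UNIV. \<Sum>g\<in>UNIV. Lop f (Lop g (\<zeta> f g)) s) = 0"
proof -
  obtain a1 a2 a3 b1 b2 b3 where st: "s = (a1, a2, a3, b1, b2, b3)" by (cases s) auto
  note e = R[unfolded RelF_def]
  have power6: "Q ^ 6 = Q * (Q * (Q * (Q * (Q * Q))))" by (simp add: eval_nat_numeral)
  have l: "x1 = fc R1" "x2 = fc R2" "x3 = fc R12" "y1 = ec R1" "y2 = ec R2" "y3 = ec R12" "k1 = - (inverse Q ^ 2) * (1 - inverse Q ^ 2)" "k2 = inverse Q ^ 4 * (Q - inverse Q)"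
    unfolding ltr_defs k1_def k2_def using s by simp_all
  show ?thesis unfolding st sum_cot
    by (cases a1; cases a2; cases a3; cases b1; cases b2; cases b3;
        simp add: Lop_def[unfolded l] pw_def cm_def power_int_minus;
        (simp add: e scC_distrib)?; ((rule dual_eqI)?, simp add: field_simps power2_eq_square power4_eq_xxxx power6)?)
qed

lemma Lop_RelF: "(\<And>s. RelF (\<lambda>f g. \<zeta> f g s)) \<Longrightarrow> (\<Sum>f\<in>UNIV. \<Sum>g\<in>UNIV. Lop f (Lop g (\<zeta> f g)) s) = 0"
  using Lop_RelF_TT Lop_RelF_TF Lop_RelF_FT Lop_RelF_FF by (cases s1; cases s2) blast+
end

section \<open>The representation of the free ring\<close>

context qord
begin

declare split_paired_All [simp del]

lemma Lop_fun: "Lop d (\<lambda>s. a * \<xi> s) = (\<lambda>s. a * Lop d \<xi> s)" "Lop d (\<lambda>s. \<Sum>i\<in>I. \<eta> i s) = (\<lambda>s. \<Sum>i\<in>I. Lop d (\<eta> i) s)"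
  by (auto simp: fun_eq_iff Lop_mult Lop_sum)

text \<open>The letter e_d acting on combinations of monomials with coefficients in A: each
  coefficient is first passed through \<open>Th\<close>, then the letter multiplies the
  monomial.\<close>

definition rhoV :: "cot \<Rightarrow> (st \<Rightarrow> dual) \<Rightarrow> st \<Rightarrow> dual" where
  "rhoV d \<xi> s = (\<Sum>g\<in>UNIV. Lop g (\<lambda>s. Th d g (\<xi> s)) s)"

lemma rhoV_add: "rhoV d (\<lambda>s. \<xi> s + \<eta> s) s = rhoV d \<xi> s + rhoV d \<eta> s"
  by (simp add: rhoV_def Lop_add sum.distrib)

lemma rhoV_0 [simp]: "rhoV d (\<lambda>s. 0) s = 0" by (simp add: rhoV_def)

lemma rhoV_sum: "rhoV d (\<lambda>s. \<Sum>i\<in>I. \<xi> i s) s = (\<Sum>i\<in>I. rhoV d (\<xi> i) s)"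
  by (induction I rule: infinite_finite_induct) (simp_all add: rhoV_add)

lemma rhoV_scale: "rhoV d (\<lambda>s. c *\<^sub>C \<xi> s) s = c *\<^sub>C rhoV d \<xi> s"
  by (simp add: rhoV_def Lop_scale scC_sum)

lemma rhoV_mult:
  assumes "a \<in> UU" "\<And>s. \<xi> s \<in> UU"
  shows "rhoV d (\<lambda>s. a * \<xi> s) s = (\<Sum>e\<in>UNIV. Th d e a * rhoV e \<xi> s)"
proof -
  have "rhoV d (\<lambda>s. a * \<xi> s) s = (\<Sum>g\<in>UNIV. \<Sum>e\<in>UNIV. Th d e a * Lop g (\<lambda>s. Th e g (\<xi> s)) s)"
    by (simp add: rhoV_def Th_mult[OF assms] Lop_sum Lop_mult)
  also have "\<dots> = (\<Sum>e\<in>UNIV. \<Sum>g\<in>UNIV. Th d e a * Lop g (\<lambda>s. Th e g (\<xi> s)) s)" by (rule sum.swap)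
  finally show ?thesis by (simp add: rhoV_def sum_distrib_left)
qed

lemma rhoV_UU: "(\<And>s. \<xi> s \<in> UU) \<Longrightarrow> rhoV d \<xi> s \<in> UU"
  unfolding rhoV_def by (intro UU_sum Lop_UU Th_UU)

text \<open>Collect all factors \<open>Th\<close> first. By \<open>RelF_stable\<close> they turn f
  into another solution of the equations, to which \<open>Lop_RelF\<close> applies.\<close>

lemma rhoV_RelF:
  assumes f: "RelF f" and x: "\<And>s. \<xi> s \<in> UU"
  shows "(\<Sum>e\<in>UNIV. \<Sum>d\<in>UNIV. f e d * rhoV e (rhoV d \<xi>) s) = 0"
proof -
  have 1: "rhoV e (rhoV d \<xi>) s = (\<Sum>p\<in>UNIV. Lop (fst p) (Lop (snd p) (\<lambda>s. Th e (fst p) (Th d (snd p) (\<xi> s)))) s)" for e d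
    by (simp add: rhoV_def[abs_def] Th_sum Lop_sum Lop_Th sum_pair)
  have "(\<Sum>e\<in>UNIV. \<Sum>d\<in>UNIV. f e d * rhoV e (rhoV d \<xi>) s) =
     (\<Sum>p'\<in>UNIV. \<Sum>p\<in>UNIV. Lop (fst p) (Lop (snd p) (\<lambda>s. f (fst p') (snd p') * Th (fst p') (fst p) (Th (snd p') (snd p) (\<xi> s)))) s)"
    by (simp add: sum_pair 1 sum_distrib_left Lop_fun)
  also have "\<dots> = (\<Sum>p\<in>UNIV. \<Sum>p'\<in>UNIV. Lop (fst p) (Lop (snd p) (\<lambda>s. f (fst p') (snd p') * Th (fst p') (fst p) (Th (snd p') (snd p) (\<xi> s)))) s)"
    by (rule sum.swap)
  also have "\<dots> = (\<Sum>g\<in>UNIV. \<Sum>h\<in>UNIV. Lop g (Lop h (\<lambda>s. \<Sum>e\<in>UNIV. \<Sum>d\<in>UNIV. f e d * Th e g (Th d h (\<xi> s)))) s)"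
    by (simp add: sum_pair Lop_fun)
  also have "\<dots> = 0" by (rule Lop_RelF) (rule RelF_stable[OF f x])
  finally show ?thesis .
qed

primrec rl :: "ufun + form1 \<Rightarrow> (st \<Rightarrow> dual) \<Rightarrow> st \<Rightarrow> dual" where
  "rl (Inl b) \<xi> = (\<lambda>s. dv b * \<xi> s)"
| "rl (Inr w) \<xi> = (\<lambda>s. \<Sum>d\<in>UNIV. dv (w d) * rhoV d \<xi> s)"

lemma rl_add: "rl x (\<lambda>s. \<xi> s + \<eta> s) = (\<lambda>s. rl x \<xi> s + rl x \<eta> s)"
  by (cases x) (auto simp: distrib_left rhoV_add sum.distrib)

lemma rl_scale: "rl x (\<lambda>s. c *\<^sub>C \<xi> s) = (\<lambda>s. c *\<^sub>C rl x \<xi> s)"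
  by (cases x) (auto simp: rhoV_scale scC_sum)

lemma foldr_rl_add: "foldr rl w (\<lambda>s. \<xi> s + \<eta> s) = (\<lambda>s. foldr rl w \<xi> s + foldr rl w \<eta> s)"
  by (induction w) (auto simp: rl_add)

lemma foldr_rl_scale: "foldr rl w (\<lambda>s. c *\<^sub>C \<xi> s) = (\<lambda>s. c *\<^sub>C foldr rl w \<xi> s)"
  by (induction w) (auto simp: rl_scale)

definition rho :: "fr \<Rightarrow> (st \<Rightarrow> dual) \<Rightarrow> st \<Rightarrow> dual" where
  "rho p \<xi> s = lx (\<lambda>w c. of_int c *\<^sub>C foldr rl (letters w) \<xi> s) p"

lemma rho_simps: "rho 0 \<xi> s = 0" "rho (p + p') \<xi> s = rho p \<xi> s + rho p' \<xi> s"
  "rho (Poly_Mapping.single w c) \<xi> s = of_int c *\<^sub>C foldr rl (letters w) \<xi> s"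
  unfolding rho_def by (subst lx_simps; simp add: scC_distrib)+

lemma rho_neg: "rho (- p) \<xi> s = - rho p \<xi> s" "rho (p - p') \<xi> s = rho p \<xi> s - rho p' \<xi> s"
proof -
  show 1: "rho (- p) \<xi> s = - rho p \<xi> s" for p using rho_simps(2)[of p "- p" \<xi> s] by (simp add: rho_simps(1) eq_neg_iff_add_eq_0 add.commute)
  show "rho (p - p') \<xi> s = rho p \<xi> s - rho p' \<xi> s" using rho_simps(2)[of p "- p'" \<xi> s] by (simp add: 1)
qed

lemma rho_sum: "rho (sum f I) \<xi> s = (\<Sum>i\<in>I. rho (f i) \<xi> s)"
  by (induction I rule: infinite_finite_induct) (auto simp: rho_simps)

lemma rho_letter: "rho (letter x) \<xi> = rl x \<xi>" by (rule ext) (simp add: letter_def rho_simps)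
lemma rho_1: "rho 1 \<xi> = \<xi>"
proof
  fix s
  have "(1 :: fr) = Poly_Mapping.single 0 1" by simp
  show "rho 1 \<xi> s = \<xi> s" by (subst \<open>1 = Poly_Mapping.single 0 1\<close>, simp only: rho_simps, simp)
qed

lemma rho_add_arg: "rho p (\<lambda>s. \<xi> s + \<eta> s) s = rho p \<xi> s + rho p \<eta> s"
  by (induction p rule: pm_induct) (auto simp: rho_simps foldr_rl_add scC_distrib algebra_simps)

lemma rho_scale_arg: "rho p (\<lambda>s. c *\<^sub>C \<xi> s) s = c *\<^sub>C rho p \<xi> s"
  by (induction p rule: pm_induct) (auto simp: rho_simps foldr_rl_scale scC_distrib mult.commute)

lemma rho_0_arg: "rho p (\<lambda>s. 0) s = 0" using rho_scale_arg[of p 0 "\<lambda>s. 0" s] by simp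

lemma rho_sum_arg: "rho p (\<lambda>s. \<Sum>i\<in>I. \<xi> i s) s = (\<Sum>i\<in>I. rho p (\<xi> i) s)"
  by (induction I rule: infinite_finite_induct) (simp_all add: rho_add_arg rho_0_arg)

lemma rho_mult: "rho (p * p') \<xi> s = rho p (rho p' \<xi>) s"
proof (induction p' arbitrary: s rule: pm_induct)
  case zero
  have "rho 0 \<xi> = (\<lambda>s. 0)" by (simp add: rho_simps fun_eq_iff)
  then show ?case by (simp add: rho_simps rho_0_arg)
next
  case (single w c)
  have e: "rho (Poly_Mapping.single w c) \<xi> = (\<lambda>s. of_int c *\<^sub>C foldr rl (letters w) \<xi> s)" by (simp add: rho_simps fun_eq_iff)
  show ?case
  proof (induction p rule: pm_induct)
    case (single v d) show ?case unfolding e by (simp add: mult_single rho_simps foldr_rl_scale)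
  qed (simp_all add: rho_simps distrib_right)
next
  case (add x y)
  have "rho (x + y) \<xi> = (\<lambda>s. rho x \<xi> s + rho y \<xi> s)" by (simp add: rho_simps fun_eq_iff)
  then show ?case by (simp add: distrib_left rho_simps add rho_add_arg)
qed

lemma rho_LB: "rho (LB b) \<xi> s = b * \<xi> s" by (simp add: LB_def rho_letter)
lemma rho_LM: "rho (LM m) \<xi> s = (\<Sum>d\<in>UNIV. m d * rhoV d \<xi> s)" by (simp add: LM_def rho_letter evf_def)

lemma rho_UU: assumes p: "p \<in> CF" and x: "\<And>s. \<xi> s \<in> UU" shows "rho p \<xi> s \<in> UU"
proof -
  have r: "rl l \<eta> s \<in> UU" if "l \<in> Inl ` ev ` Aw 0 \<union> Inr ` evf ` MM" "\<And>s. \<eta> s \<in> UU" for l \<eta> s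
    using that(1)
  proof
    assume "l \<in> Inl ` ev ` Aw 0"
    then obtain b where "l = Inl (ev b)" "b \<in> Aw 0" by blast
    then show ?thesis using that(2)[of s] Aw_UU[of b 0] by simp
  next
    assume "l \<in> Inr ` evf ` MM"
    then obtain m where m: "l = Inr (evf m)" "m \<in> MM" by auto
    then have "m d \<in> UU" for d using Aw_UU[of "m d" "rt d"] by (simp add: MM_def)
    moreover have "rhoV d \<eta> s \<in> UU" for d by (rule rhoV_UU) (rule that(2))
    ultimately show ?thesis using m by (auto simp: evf_def intro!: UU_sum)
  qed
  have w: "foldr rl v \<xi> s \<in> UU" if "set v \<subseteq> Inl ` ev ` Aw 0 \<union> Inr ` evf ` MM" for v s
    using that by (induction v arbitrary: s) (auto intro!: r x)
  have "set (letters v) \<subseteq> Inl ` ev ` Aw 0 \<union> Inr ` evf ` MM" if "v \<in> Poly_Mapping.keys p" for v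
    using p that unfolding CF_def free_alg_simps(5) cF_simps Plus_def by blast
  then show ?thesis unfolding rho_def lx_def using w by (intro UU_sum UU_scale) auto
qed

text \<open>By \<open>prolong_Leib\<close> the coefficients of \<Sum> db_i dc_i are minus second
  derivatives, and these solve \<open>RelF\<close> by \<open>RelF_Xo_sum\<close>.\<close>

lemma rho_PS: assumes p: "p \<in> PS" and x: "\<And>s. \<xi> s \<in> UU" shows "rho p \<xi> s = 0"
proof -
  from p obtain n b c where p: "p = (\<Sum>i<n. LM (dd (b i)) * LM (dd (c i)))" and b: "\<And>i. i < (n::nat) \<Longrightarrow> b i \<in> Aw 0"
    and c: "\<And>i. i < n \<Longrightarrow> c i \<in> Aw 0" and z: "\<And>d. (\<Sum>i<n. b i * Xo d (c i)) = 0" unfolding PS_def by blast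
  define f where "f e d = (\<Sum>i<n. b i * (tq e d *\<^sub>C Xo e (Xo d (c i))))" for e d
  have "RelF f" unfolding f_def[abs_def] by (rule RelF_Xo_sum) (use c z in auto)
  have U: "Xo d (c i) \<in> UU" if "i < n" for i d using Aw_UU[OF c[OF that]] by simp
  have one: "rho (LM (dd (b i)) * LM (dd (c i))) \<xi> s =
     (\<Sum>e\<in>UNIV. \<Sum>d\<in>UNIV. (\<Sum>h\<in>UNIV. Xo h (b i) * Th h e (Xo d (c i))) * rhoV e (rhoV d \<xi>) s)" if i: "i < n" for i
  proof -
    have "rho (LM (dd (b i)) * LM (dd (c i))) \<xi> s = (\<Sum>h\<in>UNIV. Xo h (b i) * rhoV h (\<lambda>s. \<Sum>d\<in>UNIV. Xo d (c i) * rhoV d \<xi> s) s)"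
      by (simp add: rho_mult rho_LM[abs_def] dd_def)
    also have "\<dots> = (\<Sum>h\<in>UNIV. \<Sum>d\<in>UNIV. \<Sum>e\<in>UNIV. Xo h (b i) * Th h e (Xo d (c i)) * rhoV e (rhoV d \<xi>) s)"
      by (simp add: rhoV_sum rhoV_mult[OF U[OF i] rhoV_UU[OF x]] sum_distrib_left mult.assoc)
    also have "\<dots> = (\<Sum>h\<in>UNIV. \<Sum>p\<in>UNIV. Xo h (b i) * Th h (snd p) (Xo (fst p) (c i)) * rhoV (snd p) (rhoV (fst p) \<xi>) s)"
      by (simp only: sum_pair)
    also have "\<dots> = (\<Sum>p\<in>UNIV. \<Sum>h\<in>UNIV. Xo h (b i) * Th h (snd p) (Xo (fst p) (c i)) * rhoV (snd p) (rhoV (fst p) \<xi>) s)"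
      by (rule sum.swap)
    also have "\<dots> = (\<Sum>d\<in>UNIV. \<Sum>e\<in>UNIV. (\<Sum>h\<in>UNIV. Xo h (b i) * Th h e (Xo d (c i))) * rhoV e (rhoV d \<xi>) s)"
      by (simp only: sum_pair sum_distrib_right[symmetric])
    also have "\<dots> = (\<Sum>e\<in>UNIV. \<Sum>d\<in>UNIV. (\<Sum>h\<in>UNIV. Xo h (b i) * Th h e (Xo d (c i))) * rhoV e (rhoV d \<xi>) s)"
      by (rule sum.swap)
    finally show ?thesis .
  qed
  have "rho p \<xi> s = (\<Sum>i<n. \<Sum>q\<in>UNIV. (\<Sum>h\<in>UNIV. Xo h (b i) * Th h (fst q) (Xo (snd q) (c i))) * rhoV (fst q) (rhoV (snd q) \<xi>) s)"
    unfolding p rho_sum by (rule sum.cong) (auto simp: one sum_pair)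
  also have "\<dots> = (\<Sum>q\<in>UNIV. \<Sum>i<n. (\<Sum>h\<in>UNIV. Xo h (b i) * Th h (fst q) (Xo (snd q) (c i))) * rhoV (fst q) (rhoV (snd q) \<xi>) s)"
    by (rule sum.swap)
  also have "\<dots> = (\<Sum>q\<in>UNIV. - f (fst q) (snd q) * rhoV (fst q) (rhoV (snd q) \<xi>) s)"
    unfolding f_def by (simp only: prolong_Leib[OF b c z, symmetric] sum_distrib_right)
  also have "\<dots> = - (\<Sum>q\<in>UNIV. f (fst q) (snd q) * rhoV (fst q) (rhoV (snd q) \<xi>) s)" by (simp add: sum_negf)
  also have "\<dots> = 0" using rhoV_RelF[OF \<open>RelF f\<close> x] by (simp add: sum_pair)
  finally show ?thesis .
qed

text \<open>The representation descends to the maximal prolongation. Vectors have entries in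
  \<open>UU\<close>, where \<open>Th\<close> is multiplicative.\<close>

lemma rho_NN: assumes "p \<in> NN" "\<And>s. \<xi> s \<in> UU" shows "rho p \<xi> s = 0"
proof -
  let ?J = "{p \<in> CF. \<forall>\<xi>. (\<forall>s. \<xi> s \<in> UU) \<longrightarrow> (\<forall>s. rho p \<xi> s = 0)}"
  have "NN \<subseteq> ?J"
  proof (rule NN_minimal)
    fix x y assume x: "x \<in> ?J" and y: "y \<in> CF"
    have "rho (x * y) \<xi> s = 0 \<and> rho (y * x) \<xi> s = 0" if "\<forall>s. \<xi> s \<in> UU" for \<xi> s
    proof
      have "\<forall>s. rho y \<xi> s \<in> UU" using rho_UU[OF y] that by blast
      then show "rho (x * y) \<xi> s = 0" using x unfolding rho_mult by blast
      have "rho x \<xi> = (\<lambda>s. 0)" using x that by (simp add: fun_eq_iff)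
      then show "rho (y * x) \<xi> s = 0" by (simp add: rho_mult rho_0_arg)
    qed
    then show "x * y \<in> ?J \<and> y * x \<in> ?J" using x y by auto
  next
    show "TR \<subseteq> ?J"
    proof
      fix t assume t: "t \<in> TR"
      have "rho t \<xi> s = 0" if \<xi>: "\<And>s. \<xi> s \<in> UU" for \<xi> s
        using t unfolding TR_def
      proof (elim UnE)
        assume "t \<in> {LB 1 - 1}" then show ?thesis by (simp add: rho_neg rho_LB rho_1)
      next
        assume "t \<in> {LM (mr m x) - LM m * LB x |x m. x \<in> Aw 0 \<and> m \<in> MM}"
        then obtain x m where t: "t = LM (mr m x) - LM m * LB x" "x \<in> Aw 0" "m \<in> MM" by blast
        have "(\<Sum>d\<in>UNIV. mr m x d * rhoV d \<xi> s) = (\<Sum>d\<in>UNIV. \<Sum>g\<in>UNIV. m g * Th g d x * rhoV d \<xi> s)"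
          by (simp add: mr_def sum_distrib_right)
        also have "\<dots> = (\<Sum>g\<in>UNIV. \<Sum>d\<in>UNIV. m g * Th g d x * rhoV d \<xi> s)" by (rule sum.swap)
        finally show ?thesis
          using t(2) by (simp add: t(1) rho_neg rho_LM rho_mult rho_LB[abs_def] rhoV_mult[OF Aw_UU \<xi>] sum_distrib_left mult.assoc)
      qed (auto simp: rho_neg rho_simps rho_mult rho_LB rho_LM distrib_right sum.distrib sum_distrib_left mult.assoc)
      then show "t \<in> ?J" using t TR_CF by auto
    qed
    show "PS \<subseteq> ?J" using rho_PS PS_CF by auto
  qed (auto simp: rho_simps rho_neg)
  then show ?thesis using assms by blast
qed

lemma rho_eqv: "p \<doteq> p' \<Longrightarrow> (\<And>s. \<xi> s \<in> UU) \<Longrightarrow> rho p \<xi> s = rho p' \<xi> s"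
  unfolding eqv_def using rho_NN[of "p - p'" \<xi> s] by (auto simp: rho_neg)

abbreviation rhoW :: "cot list \<Rightarrow> (st \<Rightarrow> dual) \<Rightarrow> st \<Rightarrow> dual" where "rhoW w \<equiv> foldr rhoV w"

lemma rhoW_UU: "(\<And>s. \<xi> s \<in> UU) \<Longrightarrow> rhoW w \<xi> s \<in> UU"
  by (induction w arbitrary: s) (auto intro: rhoV_UU)

text \<open>The inserted factors recombine to 1, so the lift acts like the formal expression it
  stands for.\<close>

lemma rho_LL: assumes "a \<in> Aw (wtw w)" "\<And>s. \<xi> s \<in> UU" shows "rho (LL a w) \<xi> s = a * rhoW w \<xi> s"
  using assms(1)
proof (induction w arbitrary: a s)
  case (Cons d w)
  let ?l = "wtw w"
  note sl = sl_wtw[of w]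
  have U: "Yl ?l i \<in> UU" "Xl ?l i \<in> UU" if "i < nX ?l" for i using Aw_UU Xl[OF sl that] Yl[OF sl that] by blast+
  have IH: "rho (LL (Yl ?l i) w) \<xi> = (\<lambda>s. Yl ?l i * rhoW w \<xi> s)" if "i < nX ?l" for i
    using Cons.IH[OF Yl[OF sl that]] by (simp add: fun_eq_iff)
  have "rho (LL a (d # w)) \<xi> s = (\<Sum>i<nX ?l. a * rhoV d (\<lambda>s. Xl ?l i * (Yl ?l i * rhoW w \<xi> s)) s)"
    unfolding LL.simps rho_sum
  proof (rule sum.cong[OF refl])
    fix i assume "i \<in> {..<nX ?l}"
    then have i: "i < nX ?l" by simp
    have y: "Yl ?l i * rhoW w \<xi> s \<in> UU" for s using U(1)[OF i] rhoW_UU[of \<xi> w s] assms(2) by simp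
    show "rho (LM (me a d (Xl ?l i)) * LL (Yl ?l i) w) \<xi> s = a * rhoV d (\<lambda>s. Xl ?l i * (Yl ?l i * rhoW w \<xi> s)) s"
      by (simp add: rho_mult IH[OF i] rho_LM me_def rhoV_mult[OF U(2)[OF i] y] sum_distrib_left mult.assoc)
  qed
  also have "\<dots> = a * rhoV d (\<lambda>s. (\<Sum>i<nX ?l. Xl ?l i * Yl ?l i) * rhoW w \<xi> s) s"
    by (simp add: rhoV_sum sum_distrib_right sum_distrib_left mult.assoc)
  finally show ?case by (simp add: XlYl[OF sl])
qed (simp add: rho_LB)
end

context qord
begin

section \<open>Straightening and normal forms\<close>

definition e0 :: st where "e0 = (False, False, False, False, False, False)"
definition ds :: "st \<Rightarrow> dual \<Rightarrow> st \<Rightarrow> dual" where "ds s a = (\<lambda>s'. if s' = s then a else 0)"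

definition wd :: "st \<Rightarrow> cot list" where
  "wd = (\<lambda>(a1, a2, a3, b1, b2, b3). (if a1 then [x1] else []) @ (if a2 then [x2] else []) @ (if a3 then [x3] else []) @
     (if b1 then [y1] else []) @ (if b2 then [y2] else []) @ (if b3 then [y3] else []))"

lemma ds_UU: "a \<in> UU \<Longrightarrow> ds s a s' \<in> UU" by (simp add: ds_def)

lemma Lop_ds:
  "Lop x1 (ds (False, a2, a3, b1, b2, b3) c) = ds (True, a2, a3, b1, b2, b3) c"
  "Lop x2 (ds (False, False, a3, b1, b2, b3) c) = ds (False, True, a3, b1, b2, b3) c"
  "Lop x3 (ds (False, False, False, b1, b2, b3) c) = ds (False, False, True, b1, b2, b3) c"
  "Lop y1 (ds (False, False, False, False, b2, b3) c) = ds (False, False, False, True, b2, b3) c"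
  "Lop y2 (ds (False, False, False, False, False, b3) c) = ds (False, False, False, False, True, b3) c"
  "Lop y3 (ds (False, False, False, False, False, False) c) = ds (False, False, False, False, False, True) c"
  by (rule ext, auto simp: Lop_def ds_def pw_def case_prod_unfold prod_eq_iff)+

lemma foldr_Lop_wd: "foldr Lop (wd s) (ds e0 c) = ds s c"
proof -
  obtain a1 a2 a3 b1 b2 b3 where s: "s = (a1, a2, a3, b1, b2, b3)" by (cases s) auto
  show ?thesis unfolding s wd_def e0_def
    by (cases a1; cases a2; cases a3; cases b1; cases b2; cases b3; simp add: Lop_ds)
qed

text \<open>The matrix \<open>Th\<close> of a scalar is a multiple of the identity, so on vectors
  with scalar entries the twisted operator is plain left multiplication.\<close>

lemma rhoV_scalar: assumes "\<And>s. \<xi> s = ap (\<xi> s) [] *\<^sub>C 1" shows "rhoV d \<xi> = Lop d \<xi>" "Lop d \<xi> s = ap (Lop d \<xi> s) [] *\<^sub>C 1"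
proof -
  have T: "Th d g (\<xi> s) = (if g = d then \<xi> s else 0)" for g s
    by (subst (1 2) assms) (simp add: Th_one)
  have "rhoV d \<xi> s = (\<Sum>g\<in>UNIV. if g = d then Lop d \<xi> s else 0)" for s
    unfolding rhoV_def T by (rule sum.cong) auto
  then show "rhoV d \<xi> = Lop d \<xi>" by (simp add: fun_eq_iff)
  have "ap (Lop d \<xi> s) [] *\<^sub>C 1 = Lop d (\<lambda>s. ap (\<xi> s) [] *\<^sub>C 1) s"
    by (rule Lop_map[of "\<lambda>a. ap a [] *\<^sub>C 1"]) (simp_all add: scC_distrib)
  then show "Lop d \<xi> s = ap (Lop d \<xi> s) [] *\<^sub>C 1" by (simp flip: assms)
qed

lemma rhoW_scalar: "rhoW w (ds e0 1) = foldr Lop w (ds e0 1) \<and> (\<forall>s. rhoW w (ds e0 1) s = ap (rhoW w (ds e0 1) s) [] *\<^sub>C 1)"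
proof (induction w)
  case Nil show ?case by (simp add: ds_def)
next
  case (Cons d w)
  then have "\<And>s. rhoW w (ds e0 1) s = ap (rhoW w (ds e0 1) s) [] *\<^sub>C 1" by blast
  from rhoV_scalar[OF this, of d] Cons show ?case by simp
qed

text \<open>The coefficient of the ordered monomial s in the word w. It is read off from the
  representation, hence does not depend on an order of rewriting steps.\<close>

definition cf :: "cot list \<Rightarrow> st \<Rightarrow> complex" where "cf w s = ap (rhoW w (ds e0 1) s) []"

lemma rhoW_cf: "rhoW w (ds e0 1) s = cf w s *\<^sub>C 1" using rhoW_scalar[of w] unfolding cf_def by blast

lemma cf_wd: "cf (wd s) s' = (if s' = s then 1 else 0)"
  using rhoW_scalar[of "wd s"] foldr_Lop_wd[of s 1] by (simp add: cf_def ds_def)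

lemma rhoV_fun: "rhoV d (\<lambda>s. \<xi> s + \<eta> s) = (\<lambda>s. rhoV d \<xi> s + rhoV d \<eta> s)" "rhoV d (\<lambda>s. 0) = (\<lambda>s. 0)"
  "rhoV d (\<lambda>s. c *\<^sub>C \<xi> s) = (\<lambda>s. c *\<^sub>C rhoV d \<xi> s)"
  by (rule ext, simp add: rhoV_add rhoV_scale)+

lemma rhoW_add: "rhoW w (\<lambda>s. \<xi> s + \<eta> s) = (\<lambda>s. rhoW w \<xi> s + rhoW w \<eta> s)"
  by (induction w) (simp_all add: rhoV_fun)

lemma rhoW_0: "rhoW w (\<lambda>s. 0) = (\<lambda>s. 0)"
  by (induction w) (simp_all add: rhoV_fun)

lemma rhoW_sum: "rhoW w (\<lambda>s. \<Sum>i\<in>I. \<xi> i s) = (\<lambda>s. \<Sum>i\<in>I. rhoW w (\<xi> i) s)"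
  by (induction I rule: infinite_finite_induct) (simp_all add: rhoW_add rhoW_0)

lemma rhoW_scale: "rhoW w (\<lambda>s. c *\<^sub>C \<xi> s) = (\<lambda>s. c *\<^sub>C rhoW w \<xi> s)"
  by (induction w) (simp_all add: rhoV_fun)

lemma rhoW_rel:
  fixes u v :: "cot list"
  assumes R: "RelF (\<lambda>g d. c g d *\<^sub>C 1)" and x: "\<And>s. \<xi> s \<in> UU"
  shows "(\<Sum>g\<in>UNIV. \<Sum>d\<in>UNIV. c g d *\<^sub>C rhoW (u @ g # d # v) \<xi> s) = 0"
proof -
  have "(\<Sum>g\<in>UNIV. \<Sum>d\<in>UNIV. c g d *\<^sub>C rhoV g (rhoV d (rhoW v \<xi>)) s) = 0" for s
    using rhoV_RelF[OF R, of "rhoW v \<xi>" s] rhoW_UU[OF x] by simp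
  then have "rhoW u (\<lambda>s. \<Sum>p\<in>UNIV. c (fst p) (snd p) *\<^sub>C rhoV (fst p) (rhoV (snd p) (rhoW v \<xi>)) s) = (\<lambda>s. 0)"
    by (simp add: sum_pair rhoW_0)
  then have "(\<Sum>p\<in>UNIV. c (fst p) (snd p) *\<^sub>C rhoW u (rhoV (fst p) (rhoV (snd p) (rhoW v \<xi>))) s) = 0"
    unfolding rhoW_sum rhoW_scale by (rule fun_cong)
  then show ?thesis by (simp add: sum_pair)
qed

lemma rt_y: "rt y1 = - rt x1" "rt y2 = - rt x2" "rt y3 = - rt x3"
  unfolding ltr_defs by auto

definition WP :: "cot set" where "WP = {x1, x2, x3}"
definition bp :: "st \<Rightarrow> nat" where "bp = (\<lambda>(a1, a2, a3, b1, b2, b3). of_bool a1 + of_bool a2 + of_bool a3)"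
definition bm :: "st \<Rightarrow> nat" where "bm = (\<lambda>(a1, a2, a3, b1, b2, b3). of_bool b1 + of_bool b2 + of_bool b3)"

text \<open>Every term of \<open>Lop\<close> refers to a state whose weight and bidegree differ from
  those of s by exactly the letter d. This one case analysis serves weights, bidegrees and
  membership in weight spaces.\<close>

lemma Lop_closed:
  assumes K: "0 \<in> K" "\<And>a b. a \<in> K \<Longrightarrow> b \<in> K \<Longrightarrow> a + b \<in> K" "\<And>c a. a \<in> K \<Longrightarrow> c *\<^sub>C a \<in> K"
    and Z: "\<And>s'. wtw (wd s) = rt d + wtw (wd s') \<Longrightarrow> bp s = bp s' + of_bool (d \<in> WP) \<Longrightarrow> bm s = bm s' + of_bool (d \<notin> WP) \<Longrightarrow> \<xi> s' \<in> K"
  shows "Lop d \<xi> s \<in> K"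
proof -
  obtain a1 a2 a3 b1 b2 b3 where s: "s = (a1, a2, a3, b1, b2, b3)" by (cases s) auto
  have W: "wtw (wd (a1, a2, a3, b1, b2, b3)) = (if a1 then rt x1 else 0) + (if a2 then rt x2 else 0) + (if a3 then rt x3 else 0)
     - (if b1 then rt x1 else 0) - (if b2 then rt x2 else 0) - (if b3 then rt x3 else 0)" for a1 a2 a3 b1 b2 b3
    by (simp add: wd_def rt_y)
  show ?thesis unfolding s
    by (rule ltr_cases[of d]; cases a1; cases a2; cases a3; cases b1; cases b2; cases b3; simp add: Lop_def K(1);
       ((rule K(2))?; (rule K(3))?; rule Z; simp add: s W rt_y bp_def bm_def WP_def)?)
qed

lemma Lop_weight:
  assumes "\<And>s. \<xi> s \<noteq> 0 \<Longrightarrow> wtw (wd s) = \<mu>" "Lop d \<xi> s \<noteq> 0"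
  shows "wtw (wd s) = rt d + \<mu>"
  using Lop_closed[of "{0}" s d \<xi>] assms by force

lemma cf_weight: "cf w s \<noteq> 0 \<Longrightarrow> wtw (wd s) = wtw w"
proof -
  have "rhoW w (ds e0 1) s \<noteq> 0 \<Longrightarrow> wtw (wd s) = wtw w" for s
  proof (induction w arbitrary: s)
    case Nil then show ?case by (auto simp: ds_def e0_def wd_def split: if_splits)
  next
    case (Cons d w)
    have e: "rhoV d (rhoW w (ds e0 1)) = Lop d (rhoW w (ds e0 1))"
      by (rule rhoV_scalar) (use rhoW_scalar[of w] in blast)
    show ?case using Lop_weight[of "rhoW w (ds e0 1)" "wtw w" d s] Cons e by simp
  qed
  then show "cf w s \<noteq> 0 \<Longrightarrow> wtw (wd s) = wtw w" by (simp add: rhoW_cf scC_eq_0)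
qed

definition idx :: "cot \<Rightarrow> nat" where
  "idx d = (if d = x1 then 0 else if d = x2 then 1 else if d = x3 then 2 else if d = y1 then 3 else if d = y2 then 4 else 5)"

lemma idx_simps [simp]: "idx x1 = 0" "idx x2 = 1" "idx x3 = 2" "idx y1 = 3" "idx y2 = 4" "idx y3 = 5"
  by (simp_all add: idx_def)

lemma idx_inj: "idx d = idx g \<Longrightarrow> d = g"
  by (rule ltr_cases[of d]; rule ltr_cases[of g]; simp)

lemma idx_lt: "idx d < 6" by (rule ltr_cases[of d]) simp_all

lemma sorted_wd: assumes "sorted_wrt (<) (map idx w)" shows "\<exists>s. w = wd s"
proof -
  define s where "s = (x1 \<in> set w, x2 \<in> set w, x3 \<in> set w, y1 \<in> set w, y2 \<in> set w, y3 \<in> set w)"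
  have "set w \<subseteq> {x1, x2, x3, y1, y2, y3}" using UNIV_ltr by blast
  then have "set (wd s) = set w" unfolding s_def wd_def by auto
  then have "set (map idx (wd s)) = set (map idx w)" by simp
  moreover have "sorted_wrt (<) (map idx (wd s))" unfolding s_def wd_def by auto
  ultimately have "map idx w = map idx (wd s)" using assms strict_sorted_equal by metis
  then have "w = wd s" using idx_inj by (metis inj_onI inj_map_eq_map)
  then show ?thesis by blast
qed

lemma not_sorted: "\<not> sorted_wrt (<) (map idx w) \<Longrightarrow> \<exists>u d g v. w = u @ d # g # v \<and> idx g \<le> idx d"
proof (induction w)
  case (Cons d w)
  show ?case
  proof (cases "sorted_wrt (<) (map idx w)")
    case False
    then obtain u e g v where "w = u @ e # g # v" "idx g \<le> idx e" using Cons by blast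
    then show ?thesis by (intro exI[of _ "d # u"] exI[of _ e] exI[of _ g] exI[of _ v]) simp
  next
    case True
    with Cons.prems obtain h where h: "h \<in> set w" "\<not> idx d < idx h" by auto
    then obtain g v where w: "w = g # v" by (cases w) auto
    have "idx g \<le> idx h" using True h w by (auto simp: less_imp_le)
    then show ?thesis using h w by (intro exI[of _ "[]"] exI[of _ d] exI[of _ g] exI[of _ v]) simp
  qed
qed simp

text \<open>The relation with leading product d g and leading coefficient 1. For d = g only the
  leading term remains, which is the relation d d = 0.\<close>

definition redc :: "cot \<Rightarrow> cot \<Rightarrow> cot \<Rightarrow> cot \<Rightarrow> complex" where
  "redc d g h k = (if (h, k) = (d, g) then 1 else if (h, k) = (g, d) then - cm d g
     else if (h, k) = (x3, y3) \<and> (d, g) = (y1, x1) then - k1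
     else if (h, k) = (x3, y3) \<and> (d, g) = (y2, x2) then - k2 else 0)"

lemma redc_RelF: "idx g \<le> idx d \<Longrightarrow> RelF (\<lambda>h k. redc d g h k *\<^sub>C 1)"
  unfolding RelF_def redc_def idx_def ltr_defs k1_def k2_def
  by (rule cot_cases[of d]; rule cot_cases[of g]; cases s1; cases s2; simp add: cm_def power_int_minus;
      (simp add: field_simps power2_eq_square power4_eq_xxxx flip: scC_distrib scC_simps(8))?;
      (rule dual_eqI, simp add: field_simps)?)

lemma redc_props: "redc d g d g = 1" "redc d g h k \<noteq> 0 \<Longrightarrow> rt h + rt k = rt d + rt g"
  "idx g \<le> idx d \<Longrightarrow> redc d g h k \<noteq> 0 \<Longrightarrow> (h, k) \<noteq> (d, g) \<Longrightarrow> 6 * idx h + idx k < 6 * idx d + idx g"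
proof -
  show "redc d g d g = 1" by (simp add: redc_def)
  show "redc d g h k \<noteq> 0 \<Longrightarrow> rt h + rt k = rt d + rt g"
    by (auto simp: redc_def rt_y add.commute split: if_splits)
  show "idx g \<le> idx d \<Longrightarrow> redc d g h k \<noteq> 0 \<Longrightarrow> (h, k) \<noteq> (d, g) \<Longrightarrow> 6 * idx h + idx k < 6 * idx d + idx g"
    using idx_inj[of d g] by (auto simp: redc_def split: if_splits) (metis le_neq_implies_less mult_less_cancel2 idx_inj nat_neq_iff linorder_not_less)
qed

text \<open>The word read as a numeral in base 6, so that replacing two adjacent letters by a
  lexicographically smaller pair decreases it.\<close>

primrec val :: "cot list \<Rightarrow> nat" where "val [] = 0" | "val (d # w) = idx d * 6 ^ length w + val w"

lemma val_less: fixes u v :: "cot list" shows "6 * idx h + idx k < 6 * idx d + idx g \<Longrightarrow> val (u @ h # k # v) < val (u @ d # g # v)"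
proof (induction u)
  case Nil
  have "val (h # k # v) = (6 * idx h + idx k) * 6 ^ length v + val v" "val (d # g # v) = (6 * idx d + idx g) * 6 ^ length v + val v"
    by (simp_all add: algebra_simps)
  then show ?case using Nil by simp
qed simp

text \<open>An adjacent pair that is not strictly increasing is rewritten by \<open>redc\<close>,
  which lowers \<open>val\<close>. The assignment \<Phi> is abstract because the argument is used
  twice: for lifts modulo \<open>NN\<close> and for the operators of the representation.\<close>

lemma straighten:
  fixes \<Phi> :: "dual \<Rightarrow> cot list \<Rightarrow> 'g::ab_group_add" and N :: "'g set"
  assumes N: "0 \<in> N" "\<And>x y. x \<in> N \<Longrightarrow> y \<in> N \<Longrightarrow> x + y \<in> N" "\<And>x. x \<in> N \<Longrightarrow> - x \<in> N"
    and D: "\<And>l. 0 \<in> D l" "\<And>l a b. a \<in> D l \<Longrightarrow> b \<in> D l \<Longrightarrow> a + b \<in> D l" "\<And>l c a. a \<in> D l \<Longrightarrow> c *\<^sub>C a \<in> D l"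
    and add: "\<And>a b w. a \<in> D (wtw w) \<Longrightarrow> b \<in> D (wtw w) \<Longrightarrow> \<Phi> (a + b) w - (\<Phi> a w + \<Phi> b w) \<in> N"
    and rel: "\<And>c \<mu> a u v. RelF (\<lambda>g d. c g d *\<^sub>C 1) \<Longrightarrow> (\<And>g d. c g d \<noteq> 0 \<Longrightarrow> rt g + rt d = \<mu>) \<Longrightarrow>
        a \<in> D (wtw u + \<mu> + wtw v) \<Longrightarrow> sl \<mu> \<Longrightarrow> (\<Sum>g\<in>UNIV. \<Sum>d\<in>UNIV. \<Phi> (c g d *\<^sub>C a) (u @ g # d # v)) \<in> N"
    and a: "a \<in> D (wtw w)"
  shows "\<Phi> a w - (\<Sum>s\<in>UNIV. \<Phi> (cf w s *\<^sub>C a) (wd s)) \<in> N"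
proof -
  define E where "E x y \<longleftrightarrow> x - y \<in> N" for x y :: 'g
  have Er: "E x x" for x using N by (simp add: E_def)
  have Es: "E y x" if "E x y" for x y using N(3)[of "x - y"] that by (simp add: E_def)
  have Et: "E x z" if "E x y" "E y z" for x y z using N(2)[of "x - y" "y - z"] that by (simp add: E_def)
  have Ea: "E (x + y) (x' + y')" if "E x x'" "E y y'" for x y x' y'
    using N(2)[of "x - x'" "y - y'"] that by (simp add: E_def algebra_simps)
  have Esum: "E (sum f I) (sum g I)" if "\<And>i. i \<in> I \<Longrightarrow> E (f i) (g i)" for f g and I :: "'i set"
    using that by (induction I rule: infinite_finite_induct) (auto simp: Er Ea)
  have z: "E (\<Phi> 0 w) 0" for w using N(3)[OF add[of 0 w 0]] D(1) by (simp add: E_def)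
  have sumD: "sum f I \<in> D l" if "finite I" "\<And>i. i \<in> I \<Longrightarrow> f i \<in> D l" for f l and I :: "'i set"
    using that by (induction I rule: finite_induct) (auto simp: D)
  have fs: "E (\<Phi> (sum f I) w) (\<Sum>i\<in>I. \<Phi> (f i) w)" if "finite I" "\<And>i. i \<in> I \<Longrightarrow> f i \<in> D (wtw w)" for f w and I :: "'i set"
    using that
  proof (induction I rule: finite_induct)
    case empty show ?case using z by simp
  next
    case (insert i I)
    have m: "sum f I \<in> D (wtw w)" using sumD[of I f "wtw w"] insert by blast
    have "E (\<Phi> (f i + sum f I) w) (\<Phi> (f i) w + \<Phi> (sum f I) w)" using add[of "f i" w "sum f I"] insert m by (simp add: E_def)
    moreover have "E (\<Phi> (f i) w + \<Phi> (sum f I) w) (\<Phi> (f i) w + (\<Sum>i\<in>I. \<Phi> (f i) w))" using insert by (intro Ea Er) auto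
    ultimately show ?case using insert Et by auto
  qed
  have cD: "(x * cf v s) *\<^sub>C a \<in> D (wtw (wd s))" if "a \<in> D (wtw v)" for v s a x
    using cf_weight[of v s] D that by (cases "cf v s = 0") auto
  have "E (\<Phi> a w) (\<Sum>s\<in>UNIV. \<Phi> (cf w s *\<^sub>C a) (wd s))"
    using a
  proof (induction "val w" arbitrary: w a rule: less_induct)
    case less
    show ?case
    proof (cases "sorted_wrt (<) (map idx w)")
      case True
      then obtain s0 where w: "w = wd s0" using sorted_wd by blast
      have "E (\<Sum>s\<in>UNIV. \<Phi> (cf w s *\<^sub>C a) (wd s)) (\<Sum>s\<in>UNIV. if s = s0 then \<Phi> a w else 0)"
        by (rule Esum) (auto simp: w cf_wd Er z)
      then show ?thesis using Es by simp
    next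
      case False
      then obtain u d g v where w: "w = u @ d # g # v" and dg: "idx g \<le> idx d" using not_sorted by blast
      define c where "c p = redc d g (fst p) (snd p)" for p
      define W where "W p = u @ fst p # snd p # v" for p :: "cot \<times> cot"
      have c0: "c (d, g) = 1" "W (d, g) = w" using redc_props(1) by (simp_all add: c_def W_def w)
      have wt: "wtw (W p) = wtw w" if "c p \<noteq> 0" for p
        using redc_props(2)[of d g "fst p" "snd p"] that by (simp add: c_def W_def w algebra_simps)
      have "(\<Sum>p\<in>UNIV. \<Phi> (c p *\<^sub>C a) (W p)) \<in> N"
        using rel[where c="redc d g" and \<mu>="rt d + rt g" and a=a and u=u and v=v, OF redc_RelF[OF dg] redc_props(2)] less.prems sl_add[OF sl_rt sl_rt, of d g]
        by (simp add: sum_pair c_def W_def w add.assoc)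
      then have r: "E (\<Sum>p\<in>UNIV. \<Phi> (c p *\<^sub>C a) (W p)) 0" by (simp add: E_def)
      have ih: "E (\<Phi> (c p *\<^sub>C a) (W p)) (\<Sum>s\<in>UNIV. \<Phi> ((c p * cf (W p) s) *\<^sub>C a) (wd s))" if "p \<noteq> (d, g)" for p
      proof (cases "c p = 0")
        case True
        have "E (\<Sum>s\<in>UNIV. \<Phi> ((c p * cf (W p) s) *\<^sub>C a) (wd s)) (\<Sum>s\<in>(UNIV::st set). 0)" by (rule Esum) (simp add: True z)
        then have 1: "E (\<Sum>s\<in>UNIV. \<Phi> ((c p * cf (W p) s) *\<^sub>C a) (wd s)) 0" by simp
        show ?thesis using Et[OF z[of "W p"] Es[OF 1]] by (simp add: True)
      next
        case False
        have "val (W p) < val w" unfolding W_def w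
          by (rule val_less) (use redc_props(3)[OF dg, of "fst p" "snd p"] False that in \<open>auto simp: c_def prod_eq_iff\<close>)
        from less.hyps[OF this, of "c p *\<^sub>C a"] less.prems wt[OF False] D(3) show ?thesis by (simp add: mult.commute)
      qed
      \<comment> \<open>The representation satisfies the same relation, so the constants
        \<open>cf\<close> obey the same recursion as \<Phi>.\<close>
      have cfr: "(\<Sum>p\<in>UNIV. c p * cf (W p) s) = 0" for s
      proof -
        have "(\<Sum>p\<in>UNIV. c p *\<^sub>C rhoW (W p) (ds e0 1) s) = 0"
          using rhoW_rel[OF redc_RelF[OF dg], of "ds e0 1" u v s] by (simp add: sum_pair c_def W_def ds_UU)
        from arg_cong[OF this, of "\<lambda>a. ap a []"] show ?thesis by (simp add: ap_sum cf_def)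
      qed
      let ?P = "UNIV - {(d, g)}"
      have cw: "cf w s = (\<Sum>p\<in>?P. - (c p * cf (W p) s))" for s
        using cfr[of s] sum.remove[of UNIV "(d, g)" "\<lambda>p. c p * cf (W p) s"] c0 by (simp add: sum_negf eq_neg_iff_add_eq_0)
      have m: "(- (c p * cf (W p) s)) *\<^sub>C a \<in> D (wtw (wd s))" for p s
        using cD[of a "W p" "- c p" s] wt[of p] less.prems D(1) by (cases "c p = 0") auto
      have h1: "E (\<Sum>s\<in>UNIV. \<Phi> (cf w s *\<^sub>C a) (wd s)) (\<Sum>s\<in>UNIV. \<Sum>p\<in>?P. \<Phi> ((- (c p * cf (W p) s)) *\<^sub>C a) (wd s))"
      proof (rule Esum)
        fix s
        have "cf w s *\<^sub>C a = (\<Sum>p\<in>?P. (- (c p * cf (W p) s)) *\<^sub>C a)" unfolding cw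
          by (rule dual_eqI) (simp add: ap_sum sum_distrib_right)
        then show "E (\<Phi> (cf w s *\<^sub>C a) (wd s)) (\<Sum>p\<in>?P. \<Phi> ((- (c p * cf (W p) s)) *\<^sub>C a) (wd s))"
          using fs[of ?P "\<lambda>p. (- (c p * cf (W p) s)) *\<^sub>C a" "wd s"] m by simp
      qed
      have h2: "E (\<Sum>s\<in>UNIV. \<Sum>p\<in>?P. \<Phi> ((- (c p * cf (W p) s)) *\<^sub>C a) (wd s)) (\<Sum>s\<in>UNIV. \<Sum>p\<in>?P. - \<Phi> ((c p * cf (W p) s) *\<^sub>C a) (wd s))"
      proof (intro Esum)
        fix s p
        have m': "(c p * cf (W p) s) *\<^sub>C a \<in> D (wtw (wd s))" using D(3)[OF m[of p s], of "-1"] by simp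
        have "E (\<Phi> ((- (c p * cf (W p) s)) *\<^sub>C a + (c p * cf (W p) s) *\<^sub>C a) (wd s))
           (\<Phi> ((- (c p * cf (W p) s)) *\<^sub>C a) (wd s) + \<Phi> ((c p * cf (W p) s) *\<^sub>C a) (wd s))"
          using add[OF m[of p s] m'] by (simp add: E_def)
        moreover have "(- (c p * cf (W p) s)) *\<^sub>C a + (c p * cf (W p) s) *\<^sub>C a = 0" by simp
        ultimately have "E (\<Phi> 0 (wd s)) (\<Phi> ((- (c p * cf (W p) s)) *\<^sub>C a) (wd s) + \<Phi> ((c p * cf (W p) s) *\<^sub>C a) (wd s))" by (simp only:)
        from Et[OF Es[OF this] z[of "wd s"]] have "E (\<Phi> ((- (c p * cf (W p) s)) *\<^sub>C a) (wd s) + \<Phi> ((c p * cf (W p) s) *\<^sub>C a) (wd s)) 0" .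
        then show "E (\<Phi> ((- (c p * cf (W p) s)) *\<^sub>C a) (wd s)) (- \<Phi> ((c p * cf (W p) s) *\<^sub>C a) (wd s))"
          by (simp add: E_def)
      qed
      have h3: "(\<Sum>s\<in>UNIV. \<Sum>p\<in>?P. - \<Phi> ((c p * cf (W p) s) *\<^sub>C a) (wd s)) = - (\<Sum>p\<in>?P. \<Sum>s\<in>UNIV. \<Phi> ((c p * cf (W p) s) *\<^sub>C a) (wd s))"
        by (subst sum.swap) (simp add: sum_negf)
      have h4: "E (- (\<Sum>p\<in>?P. \<Sum>s\<in>UNIV. \<Phi> ((c p * cf (W p) s) *\<^sub>C a) (wd s))) (- (\<Sum>p\<in>?P. \<Phi> (c p *\<^sub>C a) (W p)))"
      proof -
        have "E (\<Sum>p\<in>?P. \<Phi> (c p *\<^sub>C a) (W p)) (\<Sum>p\<in>?P. \<Sum>s\<in>UNIV. \<Phi> ((c p * cf (W p) s) *\<^sub>C a) (wd s))"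
          by (rule Esum) (use ih in auto)
        then show ?thesis using N(3) by (simp add: E_def)
      qed
      have h5: "E (- (\<Sum>p\<in>?P. \<Phi> (c p *\<^sub>C a) (W p))) (\<Phi> a w)"
        using Es[OF r] sum.remove[of UNIV "(d, g)" "\<lambda>p. \<Phi> (c p *\<^sub>C a) (W p)"] c0 by (simp add: E_def algebra_simps) (metis minus_diff_commute)
      show ?thesis by (rule Es[OF Et[OF h1 Et[OF h2[unfolded h3] Et[OF h4 h5]]]])
    qed
  qed
  then show ?thesis by (simp add: E_def)
qed
end

section \<open>Generators and bidegrees in the free ring\<close>

context qparam
begin

lemma mpc_simps:
  assumes "p \<in> CF"
  shows "mpc p \<in> carrier RR" "p' \<in> CF \<Longrightarrow> mpc (p + p') = mpc p \<oplus>\<^bsub>RR\<^esub> mpc p'" "p' \<in> CF \<Longrightarrow> mpc (p * p') = mpc p \<otimes>\<^bsub>RR\<^esub> mpc p'"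
    "mpc (- p) = \<ominus>\<^bsub>RR\<^esub> mpc p" "mpc 0 = \<zero>\<^bsub>RR\<^esub>" "mpc 1 = \<one>\<^bsub>RR\<^esub>"
proof -
  interpret h: ring_hom_ring FR RR mpc by (rule mpc_hom)
  have c: "p \<in> carrier FR" "- p \<in> carrier FR" using assms CF_intros(7)[OF assms] by (simp_all add: CF_def)
  show "mpc p \<in> carrier RR" using c by simp
  show "mpc (p + p') = mpc p \<oplus>\<^bsub>RR\<^esub> mpc p'" "mpc (p * p') = mpc p \<otimes>\<^bsub>RR\<^esub> mpc p'" if "p' \<in> CF"
    using h.hom_add[OF c(1), of p'] h.hom_mult[OF c(1), of p'] that by (simp_all add: CF_def free_alg_simps(1-4))
  show z: "mpc 0 = \<zero>\<^bsub>RR\<^esub>" "mpc 1 = \<one>\<^bsub>RR\<^esub>" using h.hom_zero h.hom_one by (simp_all add: free_alg_simps(1-4))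
  have "mpc (- p) \<oplus>\<^bsub>RR\<^esub> mpc p = \<zero>\<^bsub>RR\<^esub>" using h.hom_add[OF c(2,1)] z by (simp add: free_alg_simps(1-4))
  then show "mpc (- p) = \<ominus>\<^bsub>RR\<^esub> mpc p" using c h.S.minus_equality by simp
qed

lemma RR_ring: "ring RR" using mpc_hom by (simp add: ring_hom_ring_def)

lemma mpc_sum: assumes "finite I" "\<And>i. i \<in> I \<Longrightarrow> f i \<in> CF" shows "mpc (sum f I) = finsum RR (\<lambda>i. mpc (f i)) I"
proof -
  interpret ring RR by (rule RR_ring)
  show ?thesis using assms
  proof (induction I rule: finite_induct)
    case empty show ?case using mpc_simps(5)[of 0] by simp
  next
    case (insert i I)
    then show ?case using mpc_simps(2)[of "f i" "sum f I"] mpc_simps(1) by (simp add: CF_sum Pi_def)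
  qed
qed

definition LTR :: "(ufun + form1) set" where "LTR = Inl ` ev ` Aw 0 \<union> Inr ` evf ` MM"

lemma CF_iff: "p \<in> CF \<longleftrightarrow> (\<forall>w\<in>Poly_Mapping.keys p. set (letters w) \<subseteq> LTR)"
  unfolding CF_def free_alg_simps(5) cF_simps Plus_def LTR_def ..

lemma single_Cons: "Poly_Mapping.single (FMon (l # v)) 1 = letter l * (Poly_Mapping.single (FMon v) 1 :: fr)"
  by (simp add: letter_def mult_single plus_fmon_def)

lemma CF_words [consumes 1, case_names zero diff word]:
  assumes "p \<in> CF" "P 0" "\<And>x y. x \<in> CF \<Longrightarrow> y \<in> CF \<Longrightarrow> P x \<Longrightarrow> P y \<Longrightarrow> P (x - y)"
    "\<And>v. set v \<subseteq> LTR \<Longrightarrow> P (Poly_Mapping.single (FMon v) 1)"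
  shows "P p"
proof -
  have "Poly_Mapping.keys p \<subseteq> {w. set (letters w) \<subseteq> LTR}" using assms(1) by (auto simp: CF_iff)
  then have "p \<in> CF \<and> P p"
  proof (induction p rule: frag_induction)
    case (one x)
    then show ?case using assms(4)[of "letters x"] by (auto simp: CF_iff)
  qed (use assms in auto)
  then show ?thesis by blast
qed

lemma single_CF: "set v \<subseteq> LTR \<Longrightarrow> Poly_Mapping.single (FMon v) 1 \<in> CF" by (auto simp: CF_iff)

lemma CF_induct [consumes 1, case_names zero diff one LB LM]:
  assumes "p \<in> CF" "P 0" "\<And>x y. x \<in> CF \<Longrightarrow> y \<in> CF \<Longrightarrow> P x \<Longrightarrow> P y \<Longrightarrow> P (x - y)" "P 1"
    "\<And>b x. b \<in> Aw 0 \<Longrightarrow> x \<in> CF \<Longrightarrow> P x \<Longrightarrow> P (LB b * x)" "\<And>m x. m \<in> MM \<Longrightarrow> x \<in> CF \<Longrightarrow> P x \<Longrightarrow> P (LM m * x)"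
  shows "P p"
  using assms(1)
proof (induction rule: CF_words)
  case (word v)
  then show ?case
  proof (induction v)
    case Nil
    have "Poly_Mapping.single (FMon []) 1 = (1 :: fr)" using zero_fmon_def single_one by metis
    then show ?case using assms(4) by simp
  next
    case (Cons l v)
    have x: "Poly_Mapping.single (FMon v) 1 \<in> CF" using single_CF Cons by simp
    from Cons have l: "l \<in> LTR" and IH: "P (Poly_Mapping.single (FMon v) 1)" by auto
    show ?case unfolding single_Cons using l unfolding LTR_def
      by (auto simp flip: LB_def LM_def intro: assms(5,6)[OF _ x IH])
  qed
qed (use assms in auto)

text \<open>Bihomogeneous elements of the free ring, for the set \<open>W\<close> of letters of type $(1,0)$.\<close>

inductive HW :: "cot set \<Rightarrow> nat \<Rightarrow> nat \<Rightarrow> fr \<Rightarrow> bool" for W where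
  HW_0: "HW W a b 0"
| HW_1: "HW W 0 0 1"
| HW_B: "x \<in> Aw 0 \<Longrightarrow> HW W 0 0 (LB x)"
| HW_P: "m \<in> MM \<Longrightarrow> (\<And>d. d \<notin> W \<Longrightarrow> m d = 0) \<Longrightarrow> HW W (Suc 0) 0 (LM m)"
| HW_M: "m \<in> MM \<Longrightarrow> (\<And>d. d \<in> W \<Longrightarrow> m d = 0) \<Longrightarrow> HW W 0 (Suc 0) (LM m)"
| HW_add: "HW W a b p \<Longrightarrow> HW W a b p' \<Longrightarrow> HW W a b (p + p')"
| HW_neg: "HW W a b p \<Longrightarrow> HW W a b (- p)"
| HW_mult: "HW W a b p \<Longrightarrow> HW W a' b' p' \<Longrightarrow> HW W (a + a') (b + b') (p * p')"

lemma HW_CF: "HW W a b p \<Longrightarrow> p \<in> CF" by (induction rule: HW.induct) auto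

lemma HW_sum: "(\<And>i. i \<in> I \<Longrightarrow> HW W a b (f i)) \<Longrightarrow> HW W a b (sum f I)"
  by (induction I rule: infinite_finite_induct) (auto intro: HW_0 HW_add)

text \<open>The two types of letters enter symmetrically; this transports bidegrees to the order
  with exchanged halves.\<close>

lemma HW_swap: "HW W a b p \<Longrightarrow> HW (- W) b a p"
  by (induction rule: HW.induct) (auto intro: HW.intros)

definition dgw :: "(ufun + form1) fmon \<Rightarrow> nat" where "dgw w = length (filter (\<lambda>x. \<not> isl x) (letters w))"
definition DG :: "nat \<Rightarrow> fr \<Rightarrow> bool" where "DG k p \<longleftrightarrow> (\<forall>w\<in>Poly_Mapping.keys p. dgw w = k)"

lemma DG_simps: "DG k 0" "DG 0 1" "DG 0 (LB b)" "DG (Suc 0) (LM m)" "DG k p \<Longrightarrow> DG k p' \<Longrightarrow> DG k (p + p')"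
  "DG k p \<Longrightarrow> DG k (- p)" "DG k p \<Longrightarrow> DG l p' \<Longrightarrow> DG (k + l) (p * p')"
proof -
  show "DG k 0" "DG 0 1" "DG 0 (LB b)" "DG (Suc 0) (LM m)" "DG k p \<Longrightarrow> DG k (- p)"
    by (auto simp: DG_def dgw_def LB_def LM_def letter_def zero_fmon_def)
  show "DG k p \<Longrightarrow> DG k p' \<Longrightarrow> DG k (p + p')" using Poly_Mapping.keys_add[of p p'] by (auto simp: DG_def)
  show "DG k p \<Longrightarrow> DG l p' \<Longrightarrow> DG (k + l) (p * p')" using keys_mult[of p p']
    by (fastforce simp: DG_def dgw_def plus_fmon_def)
qed

lemma HW_DG: "HW W a b p \<Longrightarrow> DG (a + b) p"
proof (induction rule: HW.induct)
  case (HW_mult a b p a' b' p')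
  then show ?case using DG_simps(7)[of "a + b" p "a' + b'" p'] by (simp add: ac_simps)
qed (auto intro: DG_simps)

lemma mp_deg_eq: "mp_deg cF k = mpc ` {p \<in> CF. DG k p}"
  by (simp add: mp_deg_def CF_def DG_def dgw_def)

end

context qord
begin

section \<open>Normal forms in the maximal prolongation\<close>

lemma cf_Aw: "a \<in> Aw (wtw w) \<Longrightarrow> cf w s *\<^sub>C a \<in> Aw (wtw (wd s))"
  using cf_weight[of w s] by (cases "cf w s = 0") (auto simp: Aw_scale)

lemma LL_straight: assumes a: "a \<in> Aw (wtw w)" shows "LL a w \<doteq> (\<Sum>s\<in>UNIV. LL (cf w s *\<^sub>C a) (wd s))"
proof -
  have "LL a w - (\<Sum>s\<in>UNIV. LL (cf w s *\<^sub>C a) (wd s)) \<in> NN"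
  proof (rule straighten[where D=Aw and \<Phi>=LL and N=NN, OF NN_closed(1,2,3) Aw_0 Aw_add Aw_scale _ _ a])
    show "LL (a + b) w - (LL a w + LL b w) \<in> NN" if "a \<in> Aw (wtw w)" "b \<in> Aw (wtw w)" for a b w
      using LL_add[OF that] by (simp add: eqv_def)
    fix c \<mu> a and u v :: "cot list"
    assume "RelF (\<lambda>g d. c g d *\<^sub>C 1)" "\<And>g d. c g d \<noteq> 0 \<Longrightarrow> rt g + rt d = \<mu>" "a \<in> Aw (wtw u + \<mu> + wtw v)" "sl \<mu>"
    from LL_word_rel[OF this] show "(\<Sum>g\<in>UNIV. \<Sum>d\<in>UNIV. LL (c g d *\<^sub>C a) (u @ g # d # v)) \<in> NN" by (simp add: eqv_def)
  qed
  then show ?thesis using a cf_Aw[OF a] unfolding eqv_def by (blast intro: CF_sum)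
qed

text \<open>Straightening inside the representation, for arbitrary vectors and not only for the
  monomial 1; needed for right multiplication.\<close>

lemma rhoW_straight:
  assumes x: "\<And>s. \<xi> s \<in> UU"
  shows "rhoW w \<xi> t = (\<Sum>s\<in>UNIV. cf w s *\<^sub>C rhoW (wd s) \<xi> t)"
proof -
  have "1 * rhoW w \<xi> t - (\<Sum>s\<in>UNIV. (cf w s *\<^sub>C 1) * rhoW (wd s) \<xi> t) \<in> {0}"
  proof (rule straighten[where D="\<lambda>_. UU" and \<Phi>="\<lambda>a w. a * rhoW w \<xi> t" and N="{0}"])
    fix c \<mu> a and u v :: "cot list"
    assume "RelF (\<lambda>g d. c g d *\<^sub>C 1)"
    then have "a * (\<Sum>g\<in>UNIV. \<Sum>d\<in>UNIV. c g d *\<^sub>C rhoW (u @ g # d # v) \<xi> t) = 0" using rhoW_rel[of c \<xi> u v t] x by simp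
    then show "(\<Sum>g\<in>UNIV. \<Sum>d\<in>UNIV. (c g d *\<^sub>C a) * rhoW (u @ g # d # v) \<xi> t) \<in> {0}"
      by (simp add: sum_distrib_left del: foldr_append)
  qed (auto simp: distrib_right)
  then show ?thesis by simp
qed

lemma Lop_ds1: "Lop g (ds s 1) t = cf (g # wd s) t *\<^sub>C 1"
  using rhoW_scalar[of "g # wd s"] rhoW_cf[of "g # wd s" t] foldr_Lop_wd[of s 1] by simp

lemma Lop_cf: "Lop g \<eta> t = (\<Sum>s\<in>UNIV. cf (g # wd s) t *\<^sub>C \<eta> s)"
proof -
  have "\<eta> = (\<lambda>s'. \<Sum>s\<in>UNIV. ds s (\<eta> s) s')" by (rule ext) (simp add: ds_def)
  then have "Lop g \<eta> t = (\<Sum>s\<in>UNIV. Lop g (ds s (\<eta> s)) t)" using Lop_sum[of g "\<lambda>s. ds s (\<eta> s)" UNIV t] by simp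
  moreover have "Lop g (ds s c) t = cf (g # wd s) t *\<^sub>C c" for s c
  proof -
    have "Lop g (ds s 1) t * c = Lop g (\<lambda>s'. ds s 1 s' * c) t"
      by (rule Lop_map[of "\<lambda>a. a * c"]) (simp_all add: distrib_right)
    moreover have "(\<lambda>s'. ds s 1 s' * c) = ds s c" by (simp add: ds_def fun_eq_iff)
    ultimately show ?thesis by (simp add: Lop_ds1)
  qed
  ultimately show ?thesis by simp
qed

abbreviation "\<xi>0 \<equiv> ds e0 1"
text \<open>One weight space for each ordered monomial. By \<open>mk_nf\<close> and
  \<open>nf_mk\<close> this is a model of the maximal prolongation.\<close>

definition GG :: "(st \<Rightarrow> dual) set" where "GG = {f. \<forall>s. f s \<in> Aw (wtw (wd s))}"

lemma GG_D: "f \<in> GG \<Longrightarrow> f s \<in> Aw (wtw (wd s))" "f \<in> GG \<Longrightarrow> LL (f s) (wd s) \<in> CF" by (auto simp: GG_def)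

lemma wd_e0: "wd e0 = []" by (simp add: e0_def wd_def)

lemma sum3: "(\<Sum>s\<in>UNIV. \<Sum>d\<in>UNIV. \<Sum>g\<in>UNIV. f s d g) = (\<Sum>i\<in>UNIV. f (fst i) (fst (snd i)) (snd (snd i)))"
  for f :: "st \<Rightarrow> cot \<Rightarrow> cot \<Rightarrow> 'z::comm_monoid_add"
  by (simp add: sum.cartesian_product case_prod_unfold)

text \<open>The coefficients are found by letting p act on the monomial 1. Multiplication by a
  one-form produces words g followed by an ordered monomial; straightening them uses the same
  constants \<open>cf\<close> as the operators \<open>Lop\<close>.\<close>

lemma normal_form: assumes "p \<in> CF" shows "rho p \<xi>0 \<in> GG \<and> p \<doteq> (\<Sum>s\<in>UNIV. LL (rho p \<xi>0 s) (wd s))"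
  using assms
proof (induction rule: CF_induct)
  case zero
  have "(\<Sum>s\<in>UNIV. LL 0 (wd s)) \<doteq> (\<Sum>s\<in>(UNIV::st set). 0)" by (intro eqv_sum LL_zero)
  then show ?case by (simp add: GG_def rho_simps eqv_sym)
next
  case (diff x y)
  have g: "rho x \<xi>0 s - rho y \<xi>0 s \<in> Aw (wtw (wd s))" for s using diff by (auto simp: GG_def Aw_diff)
  have "x + - y \<doteq> (\<Sum>s\<in>UNIV. LL (rho x \<xi>0 s) (wd s)) + - (\<Sum>s\<in>UNIV. LL (rho y \<xi>0 s) (wd s))"
    using diff eqv_mult[OF eqv_refl[of "-1"], of y "\<Sum>s\<in>UNIV. LL (rho y \<xi>0 s) (wd s)"] by (intro eqv_add) auto
  also have "\<dots> = (\<Sum>s\<in>UNIV. LL (rho x \<xi>0 s) (wd s) + - LL (rho y \<xi>0 s) (wd s))" by (simp add: sum_subtractf)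
  also have "\<dots> \<doteq> (\<Sum>s\<in>UNIV. LL (rho x \<xi>0 s + - rho y \<xi>0 s) (wd s))"
  proof (rule eqv_sum)
    fix s
    have xy: "rho x \<xi>0 s \<in> Aw (wtw (wd s))" "rho y \<xi>0 s \<in> Aw (wtw (wd s))" using diff by (auto simp: GG_def)
    have "LL (rho x \<xi>0 s) (wd s) + - LL (rho y \<xi>0 s) (wd s) \<doteq> LL (rho x \<xi>0 s) (wd s) + LL (- rho y \<xi>0 s) (wd s)"
      using xy by (intro eqv_add eqv_refl LL_CF eqv_sym[OF LL_uminus])
    also have "\<dots> \<doteq> LL (rho x \<xi>0 s + - rho y \<xi>0 s) (wd s)" using xy by (intro eqv_sym[OF LL_add] Aw_uminus)
    finally show "LL (rho x \<xi>0 s) (wd s) + - LL (rho y \<xi>0 s) (wd s) \<doteq> LL (rho x \<xi>0 s + - rho y \<xi>0 s) (wd s)" .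
  qed
  finally show ?case using g by (simp add: GG_def rho_neg)
next
  case one
  have "(\<Sum>s\<in>UNIV. LL (\<xi>0 s) (wd s)) \<doteq> (\<Sum>s\<in>UNIV. if s = e0 then LL 1 [] else 0)"
    by (rule eqv_sum) (auto simp: ds_def wd_e0 LL_zero)
  then have "(\<Sum>s\<in>UNIV. LL (\<xi>0 s) (wd s)) \<doteq> LL 1 []" by simp
  then have "(\<Sum>s\<in>UNIV. LL (\<xi>0 s) (wd s)) \<doteq> 1" using LL_one by (rule eqv_trans)
  then show ?case by (simp add: rho_1 eqv_sym GG_def ds_def wd_e0)
next
  case (LB b x)
  have g: "b * rho x \<xi>0 s \<in> Aw (wtw (wd s))" for s using LB Aw_mult'[of b 0 "rho x \<xi>0 s"] by (auto simp: GG_def)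
  have "LB b * x \<doteq> LB b * (\<Sum>s\<in>UNIV. LL (rho x \<xi>0 s) (wd s))" using LB by (intro eqv_mult eqv_refl) auto
  also have "\<dots> = (\<Sum>s\<in>UNIV. LB b * LL (rho x \<xi>0 s) (wd s))" by (simp add: sum_distrib_left)
  also have "\<dots> \<doteq> (\<Sum>s\<in>UNIV. LL (b * rho x \<xi>0 s) (wd s))" using LB by (intro eqv_sum eqv_sym[OF LL_lact]) (auto simp: GG_def)
  finally show ?case using g by (simp add: GG_def rho_mult rho_LB)
next
  case (LM m x)
  define f where "f = rho x \<xi>0"
  have f: "f s \<in> Aw (wtw (wd s))" for s using LM by (auto simp: GG_def f_def)
  define T where "T i = m (fst (snd i)) * Th (fst (snd i)) (snd (snd i)) (f (fst i))" for i
  define V where "V i = snd (snd i) # wd (fst i)" for i :: "st \<times> cot \<times> cot"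
  have T: "T i \<in> Aw (wtw (V i))" for i unfolding T_def V_def using Th_term_Aw[OF LM(1) f] by simp
  have r: "rho (LM m * x) \<xi>0 t = (\<Sum>i\<in>UNIV. cf (V i) t *\<^sub>C T i)" for t
  proof -
    have "rho (LM m * x) \<xi>0 t = (\<Sum>d\<in>UNIV. \<Sum>g\<in>UNIV. \<Sum>s\<in>UNIV. cf (g # wd s) t *\<^sub>C (m d * Th d g (f s)))"
      unfolding rho_mult rho_LM f_def[symmetric] rhoV_def by (simp add: Lop_cf sum_distrib_left)
    also have "\<dots> = (\<Sum>d\<in>UNIV. \<Sum>s\<in>UNIV. \<Sum>g\<in>UNIV. cf (g # wd s) t *\<^sub>C (m d * Th d g (f s)))"
      by (rule sum.cong[OF refl], rule sum.swap)
    also have "\<dots> = (\<Sum>s\<in>UNIV. \<Sum>d\<in>UNIV. \<Sum>g\<in>UNIV. cf (g # wd s) t *\<^sub>C (m d * Th d g (f s)))" by (rule sum.swap)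
    finally show ?thesis by (simp only: sum3 T_def V_def)
  qed
  have "LM m * x \<doteq> LM m * (\<Sum>s\<in>UNIV. LL (f s) (wd s))" using LM unfolding f_def by (intro eqv_mult eqv_refl) auto
  also have "\<dots> = (\<Sum>s\<in>UNIV. LM m * LL (f s) (wd s))" by (simp add: sum_distrib_left)
  also have "\<dots> \<doteq> (\<Sum>s\<in>UNIV. \<Sum>d\<in>UNIV. \<Sum>g\<in>UNIV. LL (m d * Th d g (f s)) (g # wd s))"
    by (intro eqv_sum LM_LL LM(1) f)
  also have "\<dots> = (\<Sum>i\<in>UNIV. LL (T i) (V i))" by (simp only: sum3 T_def V_def)
  also have "\<dots> \<doteq> (\<Sum>i\<in>UNIV. \<Sum>t\<in>UNIV. LL (cf (V i) t *\<^sub>C T i) (wd t))" by (intro eqv_sum LL_straight T)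
  also have "\<dots> = (\<Sum>t\<in>UNIV. \<Sum>i\<in>UNIV. LL (cf (V i) t *\<^sub>C T i) (wd t))" by (rule sum.swap)
  also have "\<dots> \<doteq> (\<Sum>t\<in>UNIV. LL (\<Sum>i\<in>UNIV. cf (V i) t *\<^sub>C T i) (wd t))"
    by (intro eqv_sum eqv_sym[OF LL_sum] cf_Aw T)
  finally show ?case using T by (simp add: r GG_def Aw_sum cf_Aw)
qed

text \<open>Independent of the representative, since the representation kills \<open>NN\<close> by
  \<open>rho_NN\<close>.\<close>

definition nf :: "fr set set \<Rightarrow> st \<Rightarrow> dual" where "nf \<omega> = rho (SOME p. p \<in> CF \<and> mpc p = \<omega>) \<xi>0"
definition mk :: "(st \<Rightarrow> dual) \<Rightarrow> fr set set" where "mk f = mpc (\<Sum>s\<in>UNIV. LL (f s) (wd s))"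

lemma nf_mpc: assumes "p \<in> CF" shows "nf (mpc p) = rho p \<xi>0"
proof -
  define r where "r = (SOME r. r \<in> CF \<and> mpc r = mpc p)"
  have "r \<in> CF \<and> mpc r = mpc p" unfolding r_def by (rule someI[of _ p]) (simp add: assms)
  then have "r \<doteq> p" using assms by (simp add: eqv_mpc)
  from rho_eqv[OF this, of \<xi>0] show ?thesis unfolding nf_def r_def[symmetric] by (simp add: fun_eq_iff ds_UU)
qed

lemma RR_cases: assumes "\<omega> \<in> carrier RR" obtains p where "p \<in> CF" "\<omega> = mpc p" "nf \<omega> = rho p \<xi>0"
  using assms nf_mpc unfolding carrier_RR by blast

lemma nf_GG: "\<omega> \<in> carrier RR \<Longrightarrow> nf \<omega> \<in> GG" by (erule RR_cases) (simp add: normal_form)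

lemma mk_nf: "\<omega> \<in> carrier RR \<Longrightarrow> mk (nf \<omega>) = \<omega>" 
proof (erule RR_cases)
  fix p assume "p \<in> CF" "\<omega> = mpc p" "nf \<omega> = rho p \<xi>0"
  then show "mk (nf \<omega>) = \<omega>" using normal_form[of p] unfolding mk_def eqv_mpc by simp
qed

lemma nf_inj: "\<omega> \<in> carrier RR \<Longrightarrow> \<eta> \<in> carrier RR \<Longrightarrow> (\<And>s. nf \<omega> s = nf \<eta> s) \<Longrightarrow> \<omega> = \<eta>"
proof -
  assume a: "\<omega> \<in> carrier RR" and b: "\<eta> \<in> carrier RR" and e: "\<And>s. nf \<omega> s = nf \<eta> s"
  have "nf \<omega> = nf \<eta>" by (rule ext) (rule e)
  then have "mk (nf \<omega>) = mk (nf \<eta>)" by (rule arg_cong)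
  then show ?thesis unfolding mk_nf[OF a] mk_nf[OF b] .
qed

lemma GG_CF: "f \<in> GG \<Longrightarrow> (\<Sum>s\<in>UNIV. LL (f s) (wd s)) \<in> CF" by (auto intro!: CF_sum GG_D)

lemma mk_carrier: "f \<in> GG \<Longrightarrow> mk f \<in> carrier RR" unfolding mk_def by (intro mpc_simps(1) GG_CF)

lemma rho_LL_wd: "a \<in> Aw (wtw (wd s)) \<Longrightarrow> rho (LL a (wd s)) \<xi>0 = ds s a"
  by (rule ext) (simp add: rho_LL ds_UU rhoW_cf cf_wd, simp add: ds_def)

lemma nf_mk: assumes "f \<in> GG" shows "nf (mk f) = f"
  unfolding mk_def nf_mpc[OF GG_CF[OF assms]]
  by (rule ext) (simp add: rho_sum rho_LL_wd[OF GG_D(1)[OF assms]], simp add: ds_def)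

lemma nf_0: "nf \<zero>\<^bsub>RR\<^esub> s = 0"
  unfolding mpc_simps(5)[OF CF_intros(3), symmetric] nf_mpc[OF CF_intros(3)] by (rule rho_simps)

lemma nf_hom: assumes "\<omega> \<in> carrier RR" "\<eta> \<in> carrier RR"
  shows "nf (\<omega> \<oplus>\<^bsub>RR\<^esub> \<eta>) s = nf \<omega> s + nf \<eta> s" "nf (\<ominus>\<^bsub>RR\<^esub> \<omega>) s = - nf \<omega> s"
proof -
  obtain p p' where p: "p \<in> CF" "\<omega> = mpc p" "p' \<in> CF" "\<eta> = mpc p'" using assms unfolding carrier_RR by blast
  show "nf (\<omega> \<oplus>\<^bsub>RR\<^esub> \<eta>) s = nf \<omega> s + nf \<eta> s" "nf (\<ominus>\<^bsub>RR\<^esub> \<omega>) s = - nf \<omega> s"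
    using p by (simp_all add: nf_mpc rho_simps rho_neg flip: mpc_simps(2,4))
qed

lemma nf_finsum: assumes "finite I" "\<And>i. i \<in> I \<Longrightarrow> x i \<in> carrier RR" shows "nf (finsum RR x I) s = (\<Sum>i\<in>I. nf (x i) s)"
proof -
  interpret ring RR by (rule RR_ring)
  show ?thesis using assms
    by (induction I rule: finite_induct) (auto simp: nf_hom nf_0 Pi_def)
qed

text \<open>The only off-diagonal entries lead from e_1 to e_12 and from f_1 to f_12, and
  \<open>s1\<close> puts the letters of each of these pairs into the same half. So both halves are
  stable, in case (I) as in case (II).\<close>

lemma Th_WP: "d \<in> WP \<Longrightarrow> g \<notin> WP \<Longrightarrow> Th d g a = 0" "d \<notin> WP \<Longrightarrow> g \<in> WP \<Longrightarrow> Th d g a = 0"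
  unfolding WP_def ltr_defs
  by (rule cot_cases[of d]; rule cot_cases[of g]; cases s1; cases s2; simp)+

lemma rhoV_deg:
  assumes x: "\<And>s. \<xi> s \<noteq> 0 \<Longrightarrow> bp s = i \<and> bm s = j" and n: "rhoV d \<xi> s \<noteq> 0"
  shows "bp s = i + of_bool (d \<in> WP)" "bm s = j + of_bool (d \<notin> WP)"
proof -
  from n obtain g where g: "Lop g (\<lambda>s. Th d g (\<xi> s)) s \<noteq> 0" unfolding rhoV_def by (meson sum.neutral)
  have T0: "Th d g 0 = 0" for g using Th_sum[of d g "\<lambda>_. 0" "{}"] by simp
  have dg: "g \<in> WP \<longleftrightarrow> d \<in> WP"
  proof (rule ccontr)
    assume "(g \<in> WP) \<noteq> (d \<in> WP)"
    then have "(\<lambda>s. Th d g (\<xi> s)) = (\<lambda>s. 0)" using Th_WP by blast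
    then show False using g by simp
  qed
  have "\<exists>s'. bp s = bp s' + of_bool (g \<in> WP) \<and> bm s = bm s' + of_bool (g \<notin> WP) \<and> \<xi> s' \<noteq> 0"
    using Lop_closed[of "{0}" s g "\<lambda>s. Th d g (\<xi> s)"] g T0 by fastforce
  then show "bp s = i + of_bool (d \<in> WP)" "bm s = j + of_bool (d \<notin> WP)" using x dg by auto
qed

lemma rho_LM_nz: "rho (LM m) \<xi> s \<noteq> 0 \<Longrightarrow> \<exists>d. m d \<noteq> 0 \<and> rhoV d \<xi> s \<noteq> 0"
proof (rule ccontr)
  assume n: "rho (LM m) \<xi> s \<noteq> 0" "\<not> (\<exists>d. m d \<noteq> 0 \<and> rhoV d \<xi> s \<noteq> 0)"
  have "m d * rhoV d \<xi> s = 0" for d using n(2) by (cases "m d = 0") auto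
  then show False using n(1) unfolding rho_LM by simp
qed

text \<open>Together with \<open>mk_CC\<close> this makes the bidegree a property of the support of
  the normal form.\<close>

lemma rho_HW:
  assumes "HW WP a b p" "\<And>s. \<xi> s \<noteq> 0 \<Longrightarrow> bp s = i \<and> bm s = j" "rho p \<xi> s \<noteq> 0"
  shows "bp s = a + i \<and> bm s = b + j"
  using assms
proof (induction arbitrary: \<xi> i j s rule: HW.induct)
  case (HW_B x)
  then have "\<xi> s \<noteq> 0" by (metis rho_LB mult_zero_right)
  then show ?case using HW_B(2)[of s] by simp
next
  case (HW_P m)
  then obtain d where "m d \<noteq> 0" "rhoV d \<xi> s \<noteq> 0" using rho_LM_nz by blast
  then show ?case using rhoV_deg[of \<xi> i j d s, OF HW_P(3)] HW_P(2)[of d] by auto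
next
  case (HW_M m)
  then obtain d where "m d \<noteq> 0" "rhoV d \<xi> s \<noteq> 0" using rho_LM_nz by blast
  then show ?case using rhoV_deg[of \<xi> i j d s, OF HW_M(3)] HW_M(2)[of d] by auto
next
  case (HW_add a b p p')
  have "rho p \<xi> s \<noteq> 0 \<or> rho p' \<xi> s \<noteq> 0" using HW_add.prems(2) by (auto simp: rho_simps)
  then show ?case using HW_add by blast
next
  case (HW_mult a b p a' b' p')
  have "bp s = a' + i \<and> bm s = b' + j" if "rho p' \<xi> s \<noteq> 0" for s using HW_mult.IH(2)[of \<xi> i j s] HW_mult.prems(1) that by blast
  from HW_mult.IH(1)[of "rho p' \<xi>" "a' + i" "b' + j" s, OF this] HW_mult.prems(2) show ?case by (simp add: rho_mult)
next
  case HW_0 then show ?case by (simp add: rho_simps)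
next
  case HW_1 show ?case using HW_1(1)[of s] HW_1(2) by (simp add: rho_1)
next
  case (HW_neg a b p)
  have "rho p \<xi> s \<noteq> 0" using HW_neg.prems(2) by (simp add: rho_neg)
  from HW_neg.IH[OF HW_neg.prems(1) this] show ?case .
qed

lemma foldr_rl_deg: "(foldr rl v \<xi>0 s \<noteq> 0) \<Longrightarrow> bp s + bm s = length (filter (\<lambda>x. \<not> isl x) v)"
proof (induction v arbitrary: s)
  case Nil then show ?case by (auto simp: ds_def e0_def bp_def bm_def split: if_splits)
next
  case (Cons l v)
  show ?case
  proof (cases l)
    case (Inl b)
    have "foldr rl v \<xi>0 s \<noteq> 0" using Cons(2) unfolding Inl by (simp, metis mult_zero_right)
    then show ?thesis using Cons(1)[of s] by (simp add: Inl)
  next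
    case (Inr w)
    have "(\<Sum>d\<in>UNIV. dv (w d) * rhoV d (foldr rl v \<xi>0) s) \<noteq> 0" using Cons(2) by (simp add: Inr)
    then obtain d where d: "dv (w d) * rhoV d (foldr rl v \<xi>0) s \<noteq> 0" by (rule sum.not_neutral_contains_not_neutral)
    then have "rhoV d (foldr rl v \<xi>0) s \<noteq> 0" by (rule contrapos_nn) simp
    then obtain g where g: "Lop g (\<lambda>s. Th d g (foldr rl v \<xi>0 s)) s \<noteq> 0" unfolding rhoV_def by (rule sum.not_neutral_contains_not_neutral)
    have "\<exists>s'. bp s = bp s' + of_bool (g \<in> WP) \<and> bm s = bm s' + of_bool (g \<notin> WP) \<and> foldr rl v \<xi>0 s' \<noteq> 0"
    proof (rule ccontr)
      assume n: "\<not> ?thesis"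
      have "Lop g (\<lambda>s. Th d g (foldr rl v \<xi>0 s)) s \<in> {0}"
      proof (rule Lop_closed)
        fix s' assume "bp s = bp s' + of_bool (g \<in> WP)" "bm s = bm s' + of_bool (g \<notin> WP)"
        then have "foldr rl v \<xi>0 s' = 0" using n by blast
        then show "Th d g (foldr rl v \<xi>0 s') \<in> {0}" by simp
      qed auto
      then show False using g by simp
    qed
    then obtain s' where "bp s = bp s' + of_bool (g \<in> WP)" "bm s = bm s' + of_bool (g \<notin> WP)" "foldr rl v \<xi>0 s' \<noteq> 0" by blast
    then show ?thesis using Cons.IH[of s'] by (cases "g \<in> WP") (simp_all add: Inr)
  qed
qed

lemma rho_DG: assumes "DG k p" "rho p \<xi>0 s \<noteq> 0" shows "bp s + bm s = k"
proof -
  from assms(2) obtain w where w: "w \<in> Poly_Mapping.keys p" "of_int (Poly_Mapping.lookup p w) *\<^sub>C foldr rl (letters w) \<xi>0 s \<noteq> 0"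
    unfolding rho_def lx_def by (rule sum.not_neutral_contains_not_neutral)
  from w(2) have "foldr rl (letters w) \<xi>0 s \<noteq> 0" by (rule contrapos_nn) simp
  with w(1) show ?thesis using foldr_rl_deg assms(1) by (auto simp: DG_def dgw_def)
qed

lemma HW_LL: "a \<in> Aw (wtw w) \<Longrightarrow> HW WP (length (filter (\<lambda>d. d \<in> WP) w)) (length (filter (\<lambda>d. d \<notin> WP) w)) (LL a w)"
proof (induction w arbitrary: a)
  case (Cons d w)
  show ?case unfolding LL.simps
  proof (rule HW_sum)
    fix i assume i: "i \<in> {..<nX (wtw w)}"
    have m: "me a d (Xl (wtw w) i) \<in> MM" using me_MM'[OF Cons.prems] i by simp
    have y: "HW WP (length (filter (\<lambda>d. d \<in> WP) w)) (length (filter (\<lambda>d. d \<notin> WP) w)) (LL (Yl (wtw w) i) w)"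
      using Cons.IH Yl[OF sl_wtw] i by simp
    show "HW WP (length (filter (\<lambda>d. d \<in> WP) (d # w))) (length (filter (\<lambda>d. d \<notin> WP) (d # w))) (LM (me a d (Xl (wtw w) i)) * LL (Yl (wtw w) i) w)"
    proof (cases "d \<in> WP")
      case True
      then have "HW WP (Suc 0) 0 (LM (me a d (Xl (wtw w) i)))" by (intro HW_P m) (simp add: me_def Th_WP)
      from HW_mult[OF this y] True show ?thesis by simp
    next
      case False
      then have "HW WP 0 (Suc 0) (LM (me a d (Xl (wtw w) i)))" by (intro HW_M m) (simp add: me_def Th_WP)
      from HW_mult[OF this y] False show ?thesis by simp
    qed
  qed
qed (auto intro: HW_B)

section \<open>The bigraded components\<close>

lemma wd_count: "length (filter (\<lambda>d. d \<in> WP) (wd s)) = bp s" "length (filter (\<lambda>d. d \<notin> WP) (wd s)) = bm s"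
  by (auto simp: wd_def bp_def bm_def WP_def split: prod.split)

lemma HW_wd: "a \<in> Aw (wtw (wd s)) \<Longrightarrow> HW WP (bp s) (bm s) (LL a (wd s))" using HW_LL[of a "wd s"] unfolding wd_count .

text \<open>Defined by homogeneous representatives, which makes products and the exchange of the
  halves transparent; \<open>CC_eq\<close> adds the description by normal forms.\<close>

definition CC :: "nat \<times> nat \<Rightarrow> fr set set set" where "CC = (\<lambda>(a, b). mpc ` {p. HW WP a b p})"

lemma xi0_deg: "\<xi>0 s \<noteq> 0 \<Longrightarrow> bp s = 0 \<and> bm s = 0"
  by (auto simp: ds_def e0_def bp_def bm_def split: if_splits)

lemma mk_CC: assumes f: "f \<in> GG" "\<And>s. f s \<noteq> 0 \<Longrightarrow> bp s = a \<and> bm s = b" shows "mk f \<in> CC (a, b)"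
proof -
  have e: "(\<Sum>s\<in>UNIV. LL (f s) (wd s)) \<doteq> (\<Sum>s\<in>UNIV. if bp s = a \<and> bm s = b then LL (f s) (wd s) else 0)"
  proof (rule eqv_sum)
    fix s show "LL (f s) (wd s) \<doteq> (if bp s = a \<and> bm s = b then LL (f s) (wd s) else 0)"
      using f(2)[of s] LL_zero[of "wd s"] GG_D(2)[OF f(1), of s] by (cases "f s = 0") auto
  qed
  have "HW WP a b (\<Sum>s\<in>UNIV. if bp s = a \<and> bm s = b then LL (f s) (wd s) else 0)"
    using HW_wd[OF GG_D(1)[OF f(1)]] by (intro HW_sum) (auto intro: HW_0)
  then show ?thesis using e unfolding CC_def mk_def eqv_mpc by auto
qed

lemma CC_eq: "CC (a, b) = {\<omega> \<in> carrier RR. \<forall>s. nf \<omega> s \<noteq> 0 \<longrightarrow> bp s = a \<and> bm s = b}"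
proof (intro equalityI subsetI)
  fix \<omega> assume "\<omega> \<in> CC (a, b)"
  then obtain p where p: "HW WP a b p" "\<omega> = mpc p" by (auto simp: CC_def)
  have "bp s = a \<and> bm s = b" if "nf \<omega> s \<noteq> 0" for s
    using rho_HW[of a b p \<xi>0 0 0 s, OF p(1) xi0_deg] that unfolding p(2) nf_mpc[OF HW_CF[OF p(1)]] by simp
  then show "\<omega> \<in> {\<omega> \<in> carrier RR. \<forall>s. nf \<omega> s \<noteq> 0 \<longrightarrow> bp s = a \<and> bm s = b}" using p HW_CF mpc_simps(1) by auto
next
  fix \<omega> assume "\<omega> \<in> {\<omega> \<in> carrier RR. \<forall>s. nf \<omega> s \<noteq> 0 \<longrightarrow> bp s = a \<and> bm s = b}"
  then show "\<omega> \<in> CC (a, b)" using mk_CC[OF nf_GG[of \<omega>], of a b] mk_nf[of \<omega>] by auto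
qed

lemma Om_eq: "mp_deg cF k = {\<omega> \<in> carrier RR. \<forall>s. nf \<omega> s \<noteq> 0 \<longrightarrow> bp s + bm s = k}"
proof (intro equalityI subsetI)
  fix \<omega> assume "\<omega> \<in> mp_deg cF k"
  then obtain p where p: "p \<in> CF" "DG k p" "\<omega> = mpc p" unfolding mp_deg_eq by blast
  then show "\<omega> \<in> {\<omega> \<in> carrier RR. \<forall>s. nf \<omega> s \<noteq> 0 \<longrightarrow> bp s + bm s = k}"
    using rho_DG[OF p(2)] mpc_simps(1)[OF p(1)] unfolding p(3) mem_Collect_eq nf_mpc[OF p(1)] by blast
next
  fix \<omega> assume w: "\<omega> \<in> {\<omega> \<in> carrier RR. \<forall>s. nf \<omega> s \<noteq> 0 \<longrightarrow> bp s + bm s = k}"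
  then have f: "nf \<omega> \<in> GG" using nf_GG by blast
  let ?p = "\<Sum>s\<in>UNIV. if bp s + bm s = k then LL (nf \<omega> s) (wd s) else 0"
  have e: "(\<Sum>s\<in>UNIV. LL (nf \<omega> s) (wd s)) \<doteq> ?p"
  proof (rule eqv_sum)
    fix s show "LL (nf \<omega> s) (wd s) \<doteq> (if bp s + bm s = k then LL (nf \<omega> s) (wd s) else 0)"
      using w LL_zero[of "wd s"] GG_D(2)[OF f, of s] by (cases "nf \<omega> s = 0") auto
  qed
  have DS: "DG k (sum h I)" if "\<And>i. i \<in> I \<Longrightarrow> DG k (h i)" for h and I :: "st set"
    using that by (induction I rule: infinite_finite_induct) (auto intro: DG_simps)
  have "DG k ?p" using HW_DG[OF HW_wd[OF GG_D(1)[OF f]]] by (intro DS) (auto simp: DG_simps)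
  then have "mpc ?p \<in> mp_deg cF k" using e unfolding mp_deg_eq eqv_mpc by blast
  moreover have "\<omega> = mpc ?p" using e mk_nf[of \<omega>] w unfolding mk_def eqv_mpc by simp
  ultimately show "\<omega> \<in> mp_deg cF k" by simp
qed

text \<open>Different bidegrees have normal forms supported on disjoint sets of states, which gives
  uniqueness; restricting a normal form to one such set gives the components.\<close>

lemma is_direct_sum_CC: "is_direct_sum RR {(a, b). a + b = k} CC (mp_deg cF k)"
proof -
  interpret ring RR by (rule RR_ring)
  let ?I = "{(a, b). a + b = k} :: (nat \<times> nat) set"
  have fin: "finite ?I" by (rule finite_subset[of _ "{..k} \<times> {..k}"]) auto
  have sub: "CC i \<subseteq> carrier RR" for i by (cases i) (auto simp: CC_eq)
  have add: "additive_subgroup (CC i) RR" for i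
  proof (cases i)
    case (Pair a b)
    show ?thesis unfolding Pair
    proof (intro additive_subgroup.intro add.subgroupI)
      show "CC (a, b) \<noteq> {}" using nf_0 by (auto simp: CC_eq)
      show "\<ominus>\<^bsub>RR\<^esub> x \<in> CC (a, b)" if "x \<in> CC (a, b)" for x
        using that nf_hom(2)[of x x] by (auto simp: CC_eq)
      show "x \<oplus>\<^bsub>RR\<^esub> y \<in> CC (a, b)" if "x \<in> CC (a, b)" "y \<in> CC (a, b)" for x y
      proof -
        have c: "x \<in> carrier RR" "y \<in> carrier RR" "x \<oplus>\<^bsub>RR\<^esub> y \<in> carrier RR" using that by (auto simp: CC_eq)
        have "nf x s \<noteq> 0 \<or> nf y s \<noteq> 0" if "nf (x \<oplus>\<^bsub>RR\<^esub> y) s \<noteq> 0" for s using that unfolding nf_hom(1)[OF c(1,2)] by auto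
        then show ?thesis using c(3) that unfolding CC_eq by blast
      qed
    qed (use sub in auto)
  qed
  have val: "nf (finsum RR x ?I) s = (if bp s + bm s = k then nf (x (bp s, bm s)) s else 0)" if x: "x \<in> Pi\<^sub>E ?I CC" for x s
  proof -
    have xi: "x i \<in> CC i" if "i \<in> ?I" for i using x that by (rule PiE_mem)
    have "nf (finsum RR x ?I) s = (\<Sum>i\<in>?I. nf (x i) s)" by (rule nf_finsum[OF fin]) (use xi sub in blast)
    also have "\<dots> = (\<Sum>i\<in>?I. if i = (bp s, bm s) then nf (x i) s else 0)"
    proof (rule sum.cong[OF refl])
      fix i assume "i \<in> ?I"
      then have "x i \<in> CC (fst i, snd i)" using xi[of i] by simp
      then show "nf (x i) s = (if i = (bp s, bm s) then nf (x i) s else 0)" unfolding CC_eq by (auto simp: prod_eq_iff)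
    qed
    also have "\<dots> = (if bp s + bm s = k then nf (x (bp s, bm s)) s else 0)" using fin by (simp add: sum.delta)
    finally show ?thesis .
  qed
  have fc: "finsum RR x ?I \<in> carrier RR" if x: "x \<in> Pi\<^sub>E ?I CC" for x
    using PiE_mem[OF x] sub by (intro finsum_closed) blast
  have "bij_betw (\<lambda>x. finsum RR x ?I) (Pi\<^sub>E ?I CC) (mp_deg cF k)"
  proof (intro bij_betwI')
    fix x y assume x: "x \<in> Pi\<^sub>E ?I CC" and y: "y \<in> Pi\<^sub>E ?I CC"
    show "finsum RR x ?I = finsum RR y ?I \<longleftrightarrow> x = y"
    proof
      assume e: "finsum RR x ?I = finsum RR y ?I"
      show "x = y"
      proof (rule PiE_ext[OF x y])
        fix i assume i: "i \<in> ?I"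
        have c: "x i \<in> CC (fst i, snd i)" "y i \<in> CC (fst i, snd i)" using PiE_mem[OF x i] PiE_mem[OF y i] by simp_all
        show "x i = y i"
        proof (rule nf_inj)
          fix s show "nf (x i) s = nf (y i) s"
          proof (cases "i = (bp s, bm s)")
            case True
            then show ?thesis using val[OF x, of s] val[OF y, of s] e i by simp
          next
            case False
            then have "nf (x i) s = 0" "nf (y i) s = 0" using c unfolding CC_eq by (auto simp: prod_eq_iff)
            then show ?thesis by simp
          qed
        qed (use c sub in blast)+
      qed
    qed simp
  next
    fix x assume x: "x \<in> Pi\<^sub>E ?I CC"
    show "finsum RR x ?I \<in> mp_deg cF k" unfolding Om_eq using fc[OF x] val[OF x] by auto
  next
    fix \<omega> assume w: "\<omega> \<in> mp_deg cF k"
    then have wc: "\<omega> \<in> carrier RR" "\<And>s. nf \<omega> s \<noteq> 0 \<Longrightarrow> bp s + bm s = k" unfolding Om_eq by blast+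
    \<comment> \<open>The part of the normal form in bidegree i.\<close>
    define h where "h i = (\<lambda>s. if (bp s, bm s) = i then nf \<omega> s else 0)" for i
    have hG: "h i \<in> GG" for i using GG_D(1)[OF nf_GG[OF wc(1)]] by (auto simp: h_def GG_def)
    define x where "x = restrict (\<lambda>i. mk (h i)) ?I"
    have x: "x \<in> Pi\<^sub>E ?I CC" unfolding x_def
    proof (rule restrict_PiE_iff[THEN iffD2], rule ballI)
      fix i assume "i \<in> ?I"
      have "mk (h i) \<in> CC (fst i, snd i)" by (rule mk_CC[OF hG]) (auto simp: h_def split: if_splits)
      then show "mk (h i) \<in> CC i" by simp
    qed
    have "\<omega> = finsum RR x ?I"
    proof (rule nf_inj[OF wc(1) fc[OF x]])
      fix s show "nf \<omega> s = nf (finsum RR x ?I) s"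
      proof (cases "bp s + bm s = k")
        case True
        then have "nf (x (bp s, bm s)) s = h (bp s, bm s) s" by (simp add: x_def nf_mk[OF hG])
        then show ?thesis unfolding val[OF x] using True by (simp add: h_def)
      next
        case False
        then show ?thesis unfolding val[OF x] using wc(2)[of s] by auto
      qed
    qed
    then show "\<exists>x\<in>Pi\<^sub>E ?I CC. \<omega> = finsum RR x ?I" using x by blast
  qed
  then show ?thesis unfolding is_direct_sum_def using add by blast
qed

lemma CC_one: "\<one>\<^bsub>RR\<^esub> \<in> CC (0, 0)"
  using mpc_simps(6)[of 0] HW_1[of WP] unfolding CC_def by auto

lemma CC_mult: "\<omega> \<in> CC (a, b) \<Longrightarrow> \<eta> \<in> CC (a', b') \<Longrightarrow> \<omega> \<otimes>\<^bsub>RR\<^esub> \<eta> \<in> CC (a + a', b + b')"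
  unfolding CC_def by (auto simp: mpc_simps(3)[OF HW_CF HW_CF, symmetric] intro!: imageI HW_mult)

text \<open>The ordered monomials of length 1 are the letters, so a form of degree 1 is a one-form
  whose coefficients are read off from its normal form.\<close>

lemma CC_10: "CC (1, 0) = mp1 cF ` cotensor q WP" "CC (0, 1) = mp1 cF ` cotensor q (- WP)"
proof -
  have L: "mp1 cF (evf m) = mpc (LM m)" for m by (simp add: mp1_def LM_def)
  have 1: "\<exists>m\<in>MM. \<omega> = mpc (LM m) \<and> (\<forall>d. (d \<in> WP \<longrightarrow> b = 1 \<longrightarrow> m d = 0) \<and> (d \<notin> WP \<longrightarrow> b = 0 \<longrightarrow> m d = 0))"
    if w: "\<omega> \<in> CC (a, b)" and ab: "a + b = 1" for \<omega> a b
  proof -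
    have wc: "\<omega> \<in> carrier RR" using w by (simp add: CC_eq)
    have f: "nf \<omega> \<in> GG" by (rule nf_GG[OF wc])
    \<comment> \<open>The state whose ordered monomial is the single letter d.\<close>
    define S :: "cot \<Rightarrow> st" where "S d = (d = x1, d = x2, d = x3, d = y1, d = y2, d = y3)" for d
    have wdS: "wd (S d) = [d]" for d unfolding S_def wd_def by (rule ltr_cases[of d]) auto
    have inj: "inj S" by (rule injI) (metis wdS list.inject)
    have nS: "nf \<omega> s = 0" if "s \<notin> range S" for s
    proof (rule ccontr)
      assume "nf \<omega> s \<noteq> 0"
      then have "bp s + bm s = 1" using w ab by (auto simp: CC_eq)
      then have "length (wd s) = 1" using wd_count[of s] sum_length_filter_compl[of "\<lambda>d. d \<in> WP" "wd s"] by simp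
      then obtain d where "wd s = [d]" by (cases "wd s") auto
      then have "cf (wd s) s = cf (wd (S d)) s" by (simp add: wdS)
      then have "s = S d" unfolding cf_wd by (auto split: if_splits)
      then show False using that by blast
    qed
    define m where "m d = nf \<omega> (S d)" for d
    have m: "m \<in> MM" using GG_D(1)[OF f, of "S _"] by (auto simp: MM_def m_def wdS)
    have "LM m \<doteq> (\<Sum>d\<in>UNIV. LL (nf \<omega> (S d)) (wd (S d)))" using LM_LL1[OF m] by (simp add: m_def wdS)
    also have "\<dots> = (\<Sum>s\<in>range S. LL (nf \<omega> s) (wd s))" by (subst sum.reindex[OF inj]) simp
    also have "\<dots> = (\<Sum>s\<in>UNIV. if s \<in> range S then LL (nf \<omega> s) (wd s) else 0)"
      by (rule sum.mono_neutral_cong_left) auto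
    also have "\<dots> \<doteq> (\<Sum>s\<in>UNIV. LL (nf \<omega> s) (wd s))"
    proof (rule eqv_sum)
      fix s show "(if s \<in> range S then LL (nf \<omega> s) (wd s) else 0) \<doteq> LL (nf \<omega> s) (wd s)"
        using nS[of s] LL_zero[of "wd s"] GG_D(2)[OF f, of s] by (auto intro: eqv_sym)
    qed
    finally have "\<omega> = mpc (LM m)" using mk_nf[OF wc] unfolding mk_def eqv_mpc by simp
    moreover have "m d = 0" if "(d \<in> WP \<and> b = 1) \<or> (d \<notin> WP \<and> b = 0)" for d
    proof (rule ccontr)
      assume "m d \<noteq> 0"
      then have "bp (S d) = a" "bm (S d) = b" using w by (auto simp: CC_eq m_def)
      then show False using that wd_count[of "S d"] ab by (auto simp: wdS split: if_splits)
    qed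
    ultimately show ?thesis using m by blast
  qed
  show "CC (1, 0) = mp1 cF ` cotensor q WP"
  proof
    show "CC (1, 0) \<subseteq> mp1 cF ` cotensor q WP"
    proof
      fix \<omega> assume "\<omega> \<in> CC (1, 0)"
      from 1[OF this] obtain m where "m \<in> MM" "\<omega> = mpc (LM m)" "\<forall>d. d \<notin> WP \<longrightarrow> m d = 0" by auto
      then show "\<omega> \<in> mp1 cF ` cotensor q WP" unfolding cotensor_eq image_image L by blast
    qed
    show "mp1 cF ` cotensor q WP \<subseteq> CC (1, 0)"
      unfolding cotensor_eq image_image L CC_def by (auto intro!: imageI HW_P)
  qed
  show "CC (0, 1) = mp1 cF ` cotensor q (- WP)"
  proof
    show "CC (0, 1) \<subseteq> mp1 cF ` cotensor q (- WP)"
    proof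
      fix \<omega> assume "\<omega> \<in> CC (0, 1)"
      from 1[OF this] obtain m where "m \<in> MM" "\<omega> = mpc (LM m)" "\<forall>d. d \<in> WP \<longrightarrow> m d = 0" by auto
      then show "\<omega> \<in> mp1 cF ` cotensor q (- WP)" unfolding cotensor_eq image_image L by blast
    qed
    show "mp1 cF ` cotensor q (- WP) \<subseteq> CC (0, 1)"
      unfolding cotensor_eq image_image L CC_def by (auto intro!: imageI HW_M)
  qed
qed
end

section \<open>The $*$-structure\<close>

context qparam
begin

lemma d_Leib: assumes "r \<in> Aw 0" "c \<in> Aw 0" shows "Xo d (r * c) = r * Xo d c + mr (dd r) c d"
  using Leib[OF Aw_UU[OF assms(1)] Aw_UU[OF assms(2)], of d] Aw_TT[OF assms(2), of d]
  by (cases d; rename_tac x; case_tac x; simp add: mr_def dd_def)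

lemma ms_sum: "ms (\<lambda>d. \<Sum>i\<in>I. w i d) = (\<lambda>d. \<Sum>i\<in>I. ms (w i) d)"
proof (induction I rule: infinite_finite_induct)
  case (insert x F)
  then show ?case using ms_add[of "w x" "\<lambda>d. \<Sum>i\<in>F. w i d"] by simp
qed (simp_all add: ms_def)

lemma ms_neg: "ms (\<lambda>d. - w d) = (\<lambda>d. - ms w d)"
  by (simp add: ms_def sum_negf)

lemma mr_lin: "mr (\<lambda>d. w d + w' d) c = (\<lambda>d. mr w c d + mr w' c d)" "mr (\<lambda>d. - w d) c = (\<lambda>d. - mr w c d)"
  "mr (\<lambda>d. b * w d) c = (\<lambda>d. b * mr w c d)" "mr w (c + c') = (\<lambda>d. mr w c d + mr w c' d)"
  by (simp_all add: mr_def distrib_left distrib_right sum.distrib sum_negf sum_distrib_left mult.assoc)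

lemma mr_sum: "mr (\<lambda>d. \<Sum>i\<in>I. w i d) c = (\<lambda>d. \<Sum>i\<in>I. mr (w i) c d)"
  unfolding mr_def by (rule ext) (simp add: sum_distrib_right sum.swap[of _ I])

lemma mr_mr: assumes "b \<in> Aw 0" "c \<in> Aw 0" shows "mr (mr w b) c = mr w (b * c)"
proof
  fix d
  have "mr (mr w b) c d = (\<Sum>g\<in>UNIV. \<Sum>h\<in>UNIV. w h * Th h g b * Th g d c)" by (simp add: mr_def sum_distrib_right)
  also have "\<dots> = (\<Sum>h\<in>UNIV. \<Sum>g\<in>UNIV. w h * Th h g b * Th g d c)" by (rule sum.swap)
  also have "\<dots> = mr w (b * c) d" by (simp add: mr_def Th_mult Aw_UU[OF assms(1)] Aw_UU[OF assms(2)] sum_distrib_left mult.assoc)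
  finally show "mr (mr w b) c d = mr w (b * c) d" .
qed

lemma Aw0_sd [simp]: "b \<in> Aw 0 \<Longrightarrow> sd b \<in> Aw 0" using Aw_sd[of b 0] by simp
lemma Aw0_mult [simp]: "b \<in> Aw 0 \<Longrightarrow> c \<in> Aw 0 \<Longrightarrow> b * c \<in> Aw 0" using Aw_mult[of b 0 c 0] by simp
lemma ms_dd: "b \<in> Aw 0 \<Longrightarrow> ms (dd b) = dd (sd b)" unfolding dd_def by (rule ms_d)

lemma mr_dd: "r \<in> Aw 0 \<Longrightarrow> c \<in> Aw 0 \<Longrightarrow> mr (dd r) c = (\<lambda>d. dd (r * c) d + - (r * dd c d))"
  by (rule ext) (simp add: dd_def d_Leib)

text \<open>Write (dr) c = d(rc) - r dc; the involution is known on exact forms by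
  \<open>ms_d\<close> and on left multiples by \<open>ms_lact\<close>. The general case
  \<open>ms_mr\<close> follows because such forms span.\<close>

lemma ms_mr_dd: assumes "r \<in> Aw 0" "c \<in> Aw 0" shows "ms (mr (dd r) c) = (\<lambda>d. sd c * ms (dd r) d)"
proof -
  have l: "ms (\<lambda>d. r * dd c d) = mr (dd (sd c)) (sd r)"
    using ms_lact[OF MM_dd[OF assms(2)] AwD(1)[OF assms(1)]] by (simp only: ms_dd[OF assms(2)])
  have "ms (mr (dd r) c) = (\<lambda>d. ms (dd (r * c)) d + - ms (\<lambda>d. r * dd c d) d)"
    unfolding mr_dd[OF assms] ms_add[of "dd (r * c)" "\<lambda>d. - (r * dd c d)"] ms_neg[of "\<lambda>d. r * dd c d"] ..
  also have "\<dots> = (\<lambda>d. sd c * ms (dd r) d)"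
    unfolding l ms_dd[OF assms(1)] ms_dd[OF Aw0_mult[OF assms]] mr_dd[OF Aw0_sd[OF assms(2)] Aw0_sd[OF assms(1)]] by simp
  finally show ?thesis .
qed

lemma ms_mr: assumes m: "m \<in> MM" and c: "c \<in> Aw 0" shows "ms (mr m c) = (\<lambda>d. sd c * ms m d)"
proof -
  obtain n b r where h: "\<And>k. k < (n::nat) \<Longrightarrow> b k \<in> Aw 0 \<and> r k \<in> Aw 0" "m = (\<lambda>d. \<Sum>k<n. b k * dd (r k) d)"
    using MM_span[OF m] unfolding dd_def by metis
  have e: "ms (\<lambda>d. b k * mr (dd (r k)) c d) = (\<lambda>d. sd c * ms (\<lambda>d. b k * dd (r k) d) d)" if "k < n" for k
  proof -
    have bk: "b k \<in> Aw 0" "r k \<in> Aw 0" using h(1)[OF that] by auto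
    have "ms (\<lambda>d. b k * mr (dd (r k)) c d) = mr (ms (mr (dd (r k)) c)) (sd (b k))"
      by (rule ms_lact[OF MM_mr[OF MM_dd[OF bk(2)] c] AwD(1)[OF bk(1)]])
    also have "\<dots> = (\<lambda>d. sd c * mr (ms (dd (r k))) (sd (b k)) d)" unfolding ms_mr_dd[OF bk(2) c] by (rule mr_lin(3))
    also have "\<dots> = (\<lambda>d. sd c * ms (\<lambda>d. b k * dd (r k) d) d)" unfolding ms_lact[OF MM_dd[OF bk(2)] AwD(1)[OF bk(1)]] ..
    finally show ?thesis .
  qed
  show ?thesis unfolding h(2) mr_sum mr_lin(3) ms_sum sum_distrib_left
    by (rule ext, rule sum.cong[OF refl]) (simp add: e)
qed

lemma ms_ms: assumes m: "m \<in> MM" shows "ms (ms m) = m"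
proof -
  obtain n b r where h: "\<And>k. k < (n::nat) \<Longrightarrow> b k \<in> Aw 0 \<and> r k \<in> Aw 0" "m = (\<lambda>d. \<Sum>k<n. b k * dd (r k) d)"
    using MM_span[OF m] unfolding dd_def by metis
  have e: "ms (ms (\<lambda>d. b k * dd (r k) d)) = (\<lambda>d. b k * dd (r k) d)" if "k < n" for k
  proof -
    have bk: "b k \<in> Aw 0" "r k \<in> Aw 0" using h(1)[OF that] by auto
    show ?thesis
      unfolding ms_lact[OF MM_dd[OF bk(2)] AwD(1)[OF bk(1)]] ms_dd[OF bk(2)] ms_mr[OF MM_dd[OF Aw0_sd[OF bk(2)]] Aw0_sd[OF bk(1)]]
        ms_dd[OF Aw0_sd[OF bk(2)]] by simp
  qed
  show ?thesis unfolding h(2) ms_sum by (rule ext, rule sum.cong[OF refl]) (simp add: e)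
qed

primrec lst :: "ufun + form1 \<Rightarrow> ufun + form1" where
  "lst (Inl b) = Inl (ev (sd (dv b)))"
| "lst (Inr w) = Inr (evf (ms (\<lambda>d. dv (w d))))"

text \<open>The star without its signs, an anti-automorphism of the free ring. The signs are
  supplied by \<open>ta\<close>, which depends on the degree only.\<close>

definition sg :: "fr \<Rightarrow> fr" where "sg = lx (\<lambda>w c. Poly_Mapping.single (FMon (rev (map lst (letters w)))) c)"

lemma sg_simps: "sg 0 = 0" "sg (p + p') = sg p + sg p'"
  "sg (Poly_Mapping.single w c) = Poly_Mapping.single (FMon (rev (map lst (letters w)))) c"
  unfolding sg_def by (subst lx_simps; simp add: single_add)+

lemma sg_neg: "sg (- p) = - sg p" "sg (p - p') = sg p - sg p'"
proof -
  show 1: "sg (- p) = - sg p" for p using sg_simps(2)[of p "- p"] by (simp add: sg_simps(1) eq_neg_iff_add_eq_0 add.commute)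
  show "sg (p - p') = sg p - sg p'" using sg_simps(2)[of p "- p'"] by (simp add: 1)
qed

lemma sg_sum: "sg (sum f I) = (\<Sum>i\<in>I. sg (f i))"
  by (induction I rule: infinite_finite_induct) (auto simp: sg_simps)

lemma sg_mult: "sg (p * p') = sg p' * sg p"
proof (induction p' rule: pm_induct)
  case (single w c)
  show ?case
  proof (induction p rule: pm_induct)
    case (single v d) show ?case by (simp add: mult_single sg_simps plus_fmon_def mult.commute)
  qed (simp_all add: sg_simps distrib_right distrib_left)
qed (simp_all add: sg_simps distrib_right distrib_left)

lemma sg_gens: "sg 1 = 1" "sg (LB b) = LB (sd b)" "sg (LM m) = LM (ms m)"
proof -
  have "(1 :: fr) = Poly_Mapping.single (FMon []) 1" using zero_fmon_def single_one by metis
  then show "sg 1 = 1" by (metis sg_simps(3) fmon.sel list.map(1) rev.simps(1))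
  show "sg (LB b) = LB (sd b)" "sg (LM m) = LM (ms m)" by (simp_all add: LB_def LM_def letter_def sg_simps evf_def)
qed

lemma sg_CF: "p \<in> CF \<Longrightarrow> sg p \<in> CF"
  by (induction rule: CF_induct) (simp_all add: sg_simps sg_neg sg_gens sg_mult MM_ms)

lemma sg_sg: "p \<in> CF \<Longrightarrow> sg (sg p) = p"
  by (induction rule: CF_induct) (simp_all add: sg_simps sg_neg sg_gens sg_mult ms_ms)

lemma LM_0: "LM (\<lambda>d. 0) \<doteq> 0" using LM_sum[of "{}" "\<lambda>i d. 0"] by simp

lemma eqv_0: "p \<doteq> 0 \<longleftrightarrow> p \<in> NN" using NN_CF by (auto simp: eqv_def)

text \<open>Applying the involution to \<Sum> b_i dc_i = 0 and the Leibniz rule gives \<Sum> c_i^*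
  db_i^* = dx with x = \<Sum> c_i^* b_i^*. This is not yet of the form required for a prolongation
  relation, but becomes so after adding the pair -1, x.\<close>

lemma sg_PS: assumes "p \<in> PS" shows "sg p \<in> NN"
proof -
  from assms obtain n b c where p: "p = (\<Sum>i<n. LM (dd (b i)) * LM (dd (c i)))" and b: "\<And>i. i < (n::nat) \<Longrightarrow> b i \<in> Aw 0"
    and c: "\<And>i. i < n \<Longrightarrow> c i \<in> Aw 0" and z: "\<And>d. (\<Sum>i<n. b i * Xo d (c i)) = 0" unfolding PS_def by blast
  define x where "x = (\<Sum>i<n. sd (c i) * sd (b i))"
  have x: "x \<in> Aw 0" unfolding x_def using b c by (intro Aw_sum) simp
  have z0: "ms (\<lambda>d. \<Sum>i<n. b i * dd (c i) d) = (\<lambda>d. 0)" using z by (simp add: dd_def ms_def)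
  have e: "ms (\<lambda>d. b i * dd (c i) d) d = dd (sd (c i) * sd (b i)) d - sd (c i) * dd (sd (b i)) d" if "i < n" for i d
    unfolding ms_lact[OF MM_dd[OF c[OF that]] AwD(1)[OF b[OF that]]] ms_dd[OF c[OF that]] mr_dd[OF Aw0_sd[OF c[OF that]] Aw0_sd[OF b[OF that]]] by simp
  have y: "(\<Sum>i<n. sd (c i) * dd (sd (b i)) d) = dd x d" for d
  proof -
    have "0 = (\<Sum>i<n. ms (\<lambda>d. b i * dd (c i) d) d)" using fun_cong[OF z0[unfolded ms_sum], of d] by simp
    also have "\<dots> = (\<Sum>i<n. dd (sd (c i) * sd (b i)) d - sd (c i) * dd (sd (b i)) d)" by (rule sum.cong[OF refl]) (simp add: e)
    also have "\<dots> = dd x d - (\<Sum>i<n. sd (c i) * dd (sd (b i)) d)" unfolding sum_subtractf by (simp add: x_def dd_def Xo_sum)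
    finally show ?thesis by simp
  qed
  \<comment> \<open>The extra pair at index n contributes -dx to the sum, and d(-1) = 0 makes its
    product of differentials vanish.\<close>
  define x' where "x' i = (if i < n then sd (c i) else - 1)" for i
  define y' where "y' i = (if i < n then sd (b i) else x)" for i
  have s1: "(\<Sum>i<n. x' i * Xo d (y' i)) = (\<Sum>i<n. sd (c i) * dd (sd (b i)) d)" for d
    by (rule sum.cong) (auto simp: x'_def y'_def dd_def)
  have s2: "(\<Sum>i<n. LM (dd (x' i)) * LM (dd (y' i))) = (\<Sum>i<n. LM (dd (sd (c i))) * LM (dd (sd (b i))))"
    by (rule sum.cong) (auto simp: x'_def y'_def)
  have A: "\<forall>i<Suc n. x' i \<in> Aw 0 \<and> y' i \<in> Aw 0" using b c x by (auto simp: x'_def y'_def Aw_uminus)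
  have B: "\<forall>d. (\<Sum>i<Suc n. x' i * Xo d (y' i)) = 0"
    unfolding sum.lessThan_Suc s1 y by (simp add: x'_def y'_def dd_def)
  have "(\<Sum>i<Suc n. LM (dd (x' i)) * LM (dd (y' i))) \<in> PS" unfolding PS_def
    by (intro CollectI exI[of _ "Suc n"] exI[of _ x'] exI[of _ y'] conjI refl A B)
  then have 1: "(\<Sum>i<n. LM (dd (sd (c i))) * LM (dd (sd (b i)))) + LM (dd (- 1)) * LM (dd x) \<doteq> 0"
    using PS_NN unfolding sum.lessThan_Suc s2 eqv_0 by (auto simp: x'_def y'_def)
  have "Xo d 1 = 0" for d by (rule cot_cases[of d]) simp_all
  then have "Xo d (- 1) = 0" for d by simp
  then have "LM (dd (- 1)) \<doteq> 0" using LM_0 by (simp add: dd_def)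
  from eqv_mult[OF this eqv_refl[of "LM (dd x)"]] have 2: "LM (dd (- 1)) * LM (dd x) \<doteq> 0" using x by simp
  have "sg p = (\<Sum>i<n. LM (dd (sd (c i))) * LM (dd (sd (b i))))"
    unfolding p sg_sum by (rule sum.cong[OF refl]) (use b c in \<open>simp add: sg_mult sg_gens ms_dd\<close>)
  moreover have "(\<Sum>i<n. LM (dd (sd (c i))) * LM (dd (sd (b i)))) \<in> NN"
    using NN_closed(2)[OF 1[unfolded eqv_0] NN_closed(3)[OF 2[unfolded eqv_0]]] by simp
  ultimately show ?thesis by simp
qed

lemma sg_NN: assumes "p \<in> NN" shows "sg p \<in> NN"
proof -
  have "NN \<subseteq> {p \<in> CF. sg p \<in> NN}"
  proof (rule NN_minimal)
    show "x * y \<in> {p \<in> CF. sg p \<in> NN} \<and> y * x \<in> {p \<in> CF. sg p \<in> NN}" if "x \<in> {p \<in> CF. sg p \<in> NN}" "y \<in> CF" for x y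
      using that by (auto simp: sg_mult sg_CF NN_closed)
    show "TR \<subseteq> {p \<in> CF. sg p \<in> NN}"
    proof
      fix t assume t: "t \<in> TR"
      have D: "p \<doteq> p' \<Longrightarrow> p - p' \<in> NN" for p p' by (simp add: eqv_def)
      have "sg t \<in> NN" using t unfolding TR_def
      proof (elim UnE CollectE exE conjE)
        assume "t \<in> {LB 1 - 1}"
        then have "t = LB 1 - 1" by simp
        then show ?thesis unfolding \<open>t = LB 1 - 1\<close> sg_neg sg_gens sd_one by (intro D eqv_LB(1))
      next
        fix x y assume h: "t = LB (x + y) - (LB x + LB y)" "x \<in> Aw 0" "y \<in> Aw 0"
        show ?thesis unfolding h(1) sg_neg sg_simps(2) sg_gens sd_lin by (rule D[OF eqv_LB(2)[OF Aw0_sd Aw0_sd]]) (use h in auto)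
      next
        fix x y assume h: "t = LB (x * y) - LB x * LB y" "x \<in> Aw 0" "y \<in> Aw 0"
        show ?thesis unfolding h(1) sg_neg sg_mult sg_gens sd_times by (rule D[OF eqv_LB(3)[OF Aw0_sd Aw0_sd]]) (use h in auto)
      next
        fix m n assume h: "t = LM (\<lambda>d. m d + n d) - (LM m + LM n)" "m \<in> MM" "n \<in> MM"
        show ?thesis unfolding h(1) sg_neg sg_simps(2) sg_gens ms_add by (rule D[OF eqv_LM(1)[OF MM_ms MM_ms]]) (use h in auto)
      next
        fix x m assume h: "t = LM (\<lambda>d. x * m d) - LB x * LM m" "x \<in> Aw 0" "m \<in> MM"
        show ?thesis unfolding h(1) sg_neg sg_mult sg_gens ms_lact[OF h(3) AwD(1)[OF h(2)]] by (rule D[OF eqv_LM(3)[OF Aw0_sd MM_ms]]) (use h in auto)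
      next
        fix x m assume h: "t = LM (mr m x) - LM m * LB x" "x \<in> Aw 0" "m \<in> MM"
        show ?thesis unfolding h(1) sg_neg sg_mult sg_gens ms_mr[OF h(3,2)] by (rule D[OF eqv_LM(2)[OF Aw0_sd MM_ms]]) (use h in auto)
      qed
      then show "t \<in> {p \<in> CF. sg p \<in> NN}" using t TR_CF by auto
    qed
    show "PS \<subseteq> {p \<in> CF. sg p \<in> NN}" using sg_PS PS_CF by auto
  qed (auto simp: sg_simps sg_neg NN_closed)
  then show ?thesis using assms by blast
qed

text \<open>Reversing k one-forms costs the sign (-1)^(k choose 2), and (k + l choose 2) exceeds the
  sum of the two parts by kl.\<close>

definition sb :: "nat \<Rightarrow> bool" where "sb k \<longleftrightarrow> even (k choose 2)"

lemma sb_add: "sb (k + l) \<longleftrightarrow> ((sb k = sb l) = even (k * l))"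
proof -
  have "(k + l) choose 2 = (k choose 2) + (l choose 2) + k * l"
    by (induction l) (simp_all add: numeral_2_eq_2 algebra_simps)
  then show ?thesis by (auto simp: sb_def)
qed

definition ta :: "fr \<Rightarrow> fr" where "ta = lx (\<lambda>w c. Poly_Mapping.single w (if sb (dgw w) then c else - c))"

lemma ta_simps: "ta 0 = 0" "ta (p + p') = ta p + ta p'"
  "ta (Poly_Mapping.single w c) = Poly_Mapping.single w (if sb (dgw w) then c else - c)"
  unfolding ta_def by (subst lx_simps; simp add: single_add[symmetric])+

lemma ta_neg: "ta (- p) = - ta p" "ta (p - p') = ta p - ta p'"
proof -
  show 1: "ta (- p) = - ta p" for p using ta_simps(2)[of p "- p"] by (simp add: ta_simps(1) eq_neg_iff_add_eq_0 add.commute)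
  show "ta (p - p') = ta p - ta p'" using ta_simps(2)[of p "- p'"] by (simp add: 1)
qed

lemma ta_DG: assumes "DG k p" shows "ta p = (if sb k then p else - p)"
proof -
  have "Poly_Mapping.keys p \<subseteq> {w. dgw w = k}" using assms by (auto simp: DG_def)
  then show ?thesis
    by (induction p rule: frag_induction) (auto simp: ta_simps ta_neg single_uminus)
qed

lemma ta_CF: "p \<in> CF \<Longrightarrow> ta p \<in> CF"
  by (induction rule: CF_words) (auto simp: ta_simps ta_neg single_CF single_uminus)

lemma DG_sg: assumes "DG k p" shows "DG k (sg p)"
proof -
  have i: "isl (lst x) = isl x" for x by (cases x) auto
  have f: "length (filter (\<lambda>x. \<not> isl x) (rev (map lst v))) = length (filter (\<lambda>x. \<not> isl x) v)" for v
    by (simp add: rev_filter[symmetric] filter_map comp_def i)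
  have "Poly_Mapping.keys p \<subseteq> {w. dgw w = k}" using assms by (auto simp: DG_def)
  then show ?thesis
  proof (induction p rule: frag_induction)
    case (one x) then show ?case using f[of "letters x"] by (simp add: sg_simps DG_def dgw_def)
  next
    case (diff a b)
    then show ?case using DG_simps(5)[of k "sg a" "- sg b"] DG_simps(6)[of k "sg b"] by (simp add: sg_neg)
  qed (simp add: sg_simps DG_simps)
qed

definition fs :: "fr \<Rightarrow> fr" where "fs p = ta (sg p)"

lemma fs_simps: "fs 0 = 0" "fs (p + p') = fs p + fs p'" "fs (- p) = - fs p" "fs (p - p') = fs p - fs p'"
  by (simp_all add: fs_def sg_simps sg_neg ta_simps ta_neg)

lemma fs_CF: "p \<in> CF \<Longrightarrow> fs p \<in> CF" by (simp add: fs_def sg_CF ta_CF)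

lemma fs_DG: "DG k p \<Longrightarrow> fs p = (if sb k then sg p else - sg p)" unfolding fs_def by (rule ta_DG[OF DG_sg])

lemma fs_fs: assumes "DG k p" "p \<in> CF" shows "fs (fs p) = p"
  using fs_DG[OF assms(1)] fs_DG[OF DG_sg[OF assms(1)]] sg_sg[OF assms(2)] by (auto simp: fs_simps)

lemma fs_mult: assumes "DG k p" "DG l p'" shows "fs (p * p') = (if even (k * l) then fs p' * fs p else - (fs p' * fs p))"
  using sb_add[of k l] by (simp add: fs_DG[OF DG_simps(7)[OF assms]] fs_DG[OF assms(1)] fs_DG[OF assms(2)] sg_mult)

lemma fs_gens: "fs (LB b) = LB (sd b)" "fs (LM m) = LM (ms m)"
  by (simp_all add: fs_DG[OF DG_simps(3)] fs_DG[OF DG_simps(4)] sg_gens sb_def numeral_2_eq_2)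

end

section \<open>Descent of the star to the maximal prolongation\<close>

context qord
begin

lemma rho_ta: "rho (ta p) \<xi>0 s = (if sb (bp s + bm s) then rho p \<xi>0 s else - rho p \<xi>0 s)"
proof (induction p rule: pm_induct)
  case (single w c)
  show ?case
  proof (cases "foldr rl (letters w) \<xi>0 s = 0")
    case False
    then have "bp s + bm s = dgw w" using foldr_rl_deg by (simp add: dgw_def)
    then show ?thesis by (simp add: ta_simps rho_simps)
  qed (simp add: ta_simps rho_simps)
qed (simp_all add: ta_simps rho_simps)

text \<open>On normal forms \<open>ta\<close> is multiplication by a sign depending on the degree,
  so it cannot make a vanishing normal form non-zero.\<close>

lemma fs_NN: assumes "p \<in> NN" shows "fs p \<in> NN"
proof -
  have s: "sg p \<in> NN" "sg p \<in> CF" using sg_NN[OF assms] NN_CF by auto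
  have "rho (sg p) \<xi>0 t = 0" for t using rho_NN[OF s(1), of \<xi>0 t] by (simp add: ds_UU)
  then have "nf (mpc (fs p)) t = nf \<zero>\<^bsub>RR\<^esub> t" for t
    using nf_0 nf_mpc[OF ta_CF[OF s(2)]] by (simp add: fs_def rho_ta)
  moreover have "\<zero>\<^bsub>RR\<^esub> \<in> carrier RR" using ring.ring_simprules(2)[OF RR_ring] .
  ultimately have "mpc (fs p) = \<zero>\<^bsub>RR\<^esub>" using nf_inj mpc_simps(1)[OF ta_CF[OF s(2)]] by (simp add: fs_def)
  then show ?thesis using mpc_zero ta_CF[OF s(2)] by (simp add: fs_def)
qed

definition Sta :: "fr set set \<Rightarrow> fr set set" where
  "Sta = restrict (\<lambda>\<omega>. mpc (fs (SOME p. p \<in> CF \<and> mpc p = \<omega>))) (carrier RR)"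

lemma fs_eqv: "p \<doteq> p' \<Longrightarrow> fs p \<doteq> fs p'"
  unfolding eqv_def using fs_NN[of "p - p'"] by (auto simp: fs_simps fs_CF)

lemma Sta_mpc: assumes "p \<in> CF" shows "Sta (mpc p) = mpc (fs p)"
proof -
  define r where "r = (SOME r. r \<in> CF \<and> mpc r = mpc p)"
  have "r \<in> CF \<and> mpc r = mpc p" unfolding r_def by (rule someI[of _ p]) (simp add: assms)
  then have "r \<doteq> p" using assms by (simp add: eqv_mpc)
  from fs_eqv[OF this] show ?thesis using mpc_simps(1)[OF assms] unfolding Sta_def r_def[symmetric] by (simp add: eqv_mpc r_def)
qed

lemma add_pow_sign: assumes "\<omega> \<in> carrier RR"
  shows "add_pow RR ((-1) ^ n :: int) \<omega> = (if even n then \<omega> else \<ominus>\<^bsub>RR\<^esub> \<omega>)"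
proof -
  interpret ring RR by (rule RR_ring)
  show ?thesis using assms add.int_pow_neg[of \<omega> 1] by simp
qed

definition starP :: "(fr set set \<Rightarrow> fr set set) \<Rightarrow> bool" where
  "starP s \<longleftrightarrow> s \<in> extensional (carrier RR) \<and> s \<in> carrier RR \<rightarrow> carrier RR \<and>
     (\<forall>\<omega>\<in>carrier RR. \<forall>\<eta>\<in>carrier RR. s (\<omega> \<oplus>\<^bsub>RR\<^esub> \<eta>) = s \<omega> \<oplus>\<^bsub>RR\<^esub> s \<eta>) \<and>
     (\<forall>k l. \<forall>\<omega>\<in>mp_deg cF k. \<forall>\<eta>\<in>mp_deg cF l.
        s (\<omega> \<otimes>\<^bsub>RR\<^esub> \<eta>) = add_pow RR ((-1) ^ (k * l) :: int) (s \<eta> \<otimes>\<^bsub>RR\<^esub> s \<omega>)) \<and>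
     (\<forall>x\<in>carrier (base cF). s (mp0 cF x) = mp0 cF (OSU3_star q x) \<and>
        s (mp1 cF (diff cF x)) = mp1 cF (diff cF (OSU3_star q x)))"

lemma mp_LB_LM: "mp0 cF (ev b) = mpc (LB b)" "mp1 cF (diff cF (ev b)) = mpc (LM (dd b))"
  by (simp_all add: mp0_def mp1_def LB_def LM_def cF_simps form_d_ev dd_def)

lemma starP_Sta: "starP Sta"
  unfolding starP_def
proof (intro conjI ballI allI)
  show "Sta \<in> extensional (carrier RR)" by (simp add: Sta_def)
  show "Sta \<in> carrier RR \<rightarrow> carrier RR"
    unfolding carrier_RR using Sta_mpc fs_CF by auto
next
  fix \<omega> \<eta> assume "\<omega> \<in> carrier RR" "\<eta> \<in> carrier RR"
  then obtain p p' where p: "p \<in> CF" "\<omega> = mpc p" "p' \<in> CF" "\<eta> = mpc p'" unfolding carrier_RR by blast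
  then show "Sta (\<omega> \<oplus>\<^bsub>RR\<^esub> \<eta>) = Sta \<omega> \<oplus>\<^bsub>RR\<^esub> Sta \<eta>"
    by (simp add: Sta_mpc fs_simps fs_CF mpc_simps(2)[symmetric])
next
  fix k l \<omega> \<eta> assume "\<omega> \<in> mp_deg cF k" "\<eta> \<in> mp_deg cF l"
  then obtain p p' where p: "p \<in> CF" "DG k p" "\<omega> = mpc p" "p' \<in> CF" "DG l p'" "\<eta> = mpc p'" unfolding mp_deg_eq by blast
  have "add_pow RR ((-1) ^ (k * l) :: int) (mpc (fs p' * fs p)) = mpc (fs (p * p'))"
    using p by (simp only: add_pow_sign[OF mpc_simps(1)] fs_mult[OF p(2,5)] fs_CF CF_intros) (simp add: mpc_simps(4) fs_CF)
  then show "Sta (\<omega> \<otimes>\<^bsub>RR\<^esub> \<eta>) = add_pow RR ((-1) ^ (k * l) :: int) (Sta \<eta> \<otimes>\<^bsub>RR\<^esub> Sta \<omega>)"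
    using p by (simp add: Sta_mpc fs_CF mpc_simps(3)[symmetric])
next
  fix x assume "x \<in> carrier (base cF)"
  then obtain b where b: "b \<in> Aw 0" "x = ev b" by (auto simp: cF_simps)
  then show "Sta (mp0 cF x) = mp0 cF (OSU3_star q x)" "Sta (mp1 cF (diff cF x)) = mp1 cF (diff cF (OSU3_star q x))"
    by (simp_all only: mp_LB_LM OSU3_star_ev[OF AwD(1)[OF b(1)]] Sta_mpc CF_intros MM_dd fs_gens ms_dd)
qed

text \<open>By \<open>MM_span\<close> the values on B and dB determine those on one-forms; words in
  these generators are then reached through graded anti-multiplicativity.\<close>

lemma starP_unique: assumes S: "starP S" shows "S = Sta"
proof -
  interpret ring RR by (rule RR_ring)
  define R where "R p \<longleftrightarrow> S (mpc p) = mpc (fs p)" for p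
  have cl: "S \<omega> \<in> carrier RR" if "\<omega> \<in> carrier RR" for \<omega> using S that unfolding starP_def by blast
  have add: "S (\<omega> \<oplus>\<^bsub>RR\<^esub> \<eta>) = S \<omega> \<oplus>\<^bsub>RR\<^esub> S \<eta>" if "\<omega> \<in> carrier RR" "\<eta> \<in> carrier RR" for \<omega> \<eta>
    using S that unfolding starP_def by blast
  have mul: "S (\<omega> \<otimes>\<^bsub>RR\<^esub> \<eta>) = add_pow RR ((-1) ^ (k * l) :: int) (S \<eta> \<otimes>\<^bsub>RR\<^esub> S \<omega>)"
    if "\<omega> \<in> mp_deg cF k" "\<eta> \<in> mp_deg cF l" for \<omega> \<eta> k l using S that unfolding starP_def by blast
  have gen: "R (LB b)" "R (LM (dd b))" if "b \<in> Aw 0" for b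
  proof -
    have "ev b \<in> carrier (base cF)" using that by (simp add: cF_simps)
    then have "S (mp0 cF (ev b)) = mp0 cF (OSU3_star q (ev b))" "S (mp1 cF (diff cF (ev b))) = mp1 cF (diff cF (OSU3_star q (ev b)))"
      using S unfolding starP_def by blast+
    then show "R (LB b)" "R (LM (dd b))"
      unfolding R_def mp_LB_LM OSU3_star_ev[OF AwD(1)[OF that]] by (simp_all add: fs_gens ms_dd that)
  qed
  have c: "mpc p \<in> carrier RR" if "p \<in> CF" for p using mpc_simps(1)[OF that] .
  have Radd: "R (x + y)" if "x \<in> CF" "y \<in> CF" "R x" "R y" for x y
    using that add[OF c c, of x y] by (simp add: R_def mpc_simps(2) fs_simps fs_CF)
  have R0: "R 0"
  proof -
    have "S (mpc 0) = S (mpc 0) \<oplus>\<^bsub>RR\<^esub> S (mpc 0)" using add[OF c c, of 0 0] mpc_simps(2)[of 0 0] by simp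
    then have "S (mpc 0) = \<zero>\<^bsub>RR\<^esub>" using cl[OF c[of 0]] add.l_cancel_one' by auto
    then show ?thesis by (simp add: R_def fs_simps mpc_simps(5)[OF CF_intros(3)])
  qed
  have Rdiff: "R (x - y)" if "x \<in> CF" "y \<in> CF" "R x" "R y" for x y
  proof -
    have "S (mpc (x - y)) \<oplus>\<^bsub>RR\<^esub> S (mpc y) = S (mpc x)"
      using add[OF c c, of "x - y" y] mpc_simps(2)[of "x - y" y] that by simp
    moreover have "mpc (fs (x - y)) \<oplus>\<^bsub>RR\<^esub> mpc (fs y) = mpc (fs x)"
      using mpc_simps(2)[of "fs (x - y)" "fs y"] that by (simp add: fs_CF fs_simps)
    ultimately have e: "S (mpc (x - y)) \<oplus>\<^bsub>RR\<^esub> mpc (fs y) = mpc (fs (x - y)) \<oplus>\<^bsub>RR\<^esub> mpc (fs y)"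
      using that unfolding R_def by simp
    have xy: "x - y \<in> CF" by (rule CF_intros(8)[OF that(1,2)])
    note k = c[OF fs_CF[OF that(2)]] cl[OF c[OF xy]] c[OF fs_CF[OF xy]]
    show ?thesis unfolding R_def using e add.right_cancel[OF k] by blast
  qed
  have Rmul: "R (x * y)" if "x \<in> CF" "y \<in> CF" "DG k x" "DG l y" "R x" "R y" for x y k l
  proof -
    have m: "mpc x \<in> mp_deg cF k" "mpc y \<in> mp_deg cF l" using that unfolding mp_deg_eq by blast+
    have "S (mpc (x * y)) = add_pow RR ((-1) ^ (k * l) :: int) (mpc (fs y * fs x))"
      using mul[OF m] that by (simp add: R_def mpc_simps(3) fs_CF)
    also have "\<dots> = mpc (fs (x * y))"
      using that by (simp only: add_pow_sign[OF mpc_simps(1)] fs_mult[OF that(3,4)] fs_CF CF_intros) (simp add: mpc_simps(4) fs_CF)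
    finally show ?thesis by (simp add: R_def)
  qed
  have Reqv: "R y" if "x \<doteq> y" "R x" for x y using that fs_eqv[OF that(1)] by (simp add: R_def eqv_mpc)
  have RLM: "R (LM m)" if m: "m \<in> MM" for m
  proof -
    obtain n b r where h: "\<And>k. k < (n::nat) \<Longrightarrow> b k \<in> Aw 0 \<and> r k \<in> Aw 0" "m = (\<lambda>d. \<Sum>k<n. b k * dd (r k) d)"
      using MM_span[OF m] unfolding dd_def by metis
    have "LM m \<doteq> (\<Sum>k<n. LM (\<lambda>d. b k * dd (r k) d))" unfolding h(2) by (rule LM_sum) (use h(1) in \<open>auto intro!: MM_lact\<close>)
    also have "\<dots> \<doteq> (\<Sum>k<n. LB (b k) * LM (dd (r k)))" by (intro eqv_sum eqv_LM(2)) (use h(1) in auto)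
    finally have e: "LM m \<doteq> (\<Sum>k<n. LB (b k) * LM (dd (r k)))" .
    have "R (\<Sum>k<j. LB (b k) * LM (dd (r k)))" if "j \<le> n" for j
      using that
    proof (induction j)
      case (Suc j)
      then have bj: "b j \<in> Aw 0" "r j \<in> Aw 0" using h(1)[of j] by auto
      have "R (LB (b j) * LM (dd (r j)))" 
        by (rule Rmul[OF CF_intros(1)[OF bj(1)] CF_intros(2)[OF MM_dd[OF bj(2)]] DG_simps(3) DG_simps(4) gen(1)[OF bj(1)] gen(2)[OF bj(2)]])
      moreover have "(\<Sum>k<j. LB (b k) * LM (dd (r k))) \<in> CF" using h(1) Suc.prems by (intro CF_sum) auto
      ultimately show ?case using Suc bj by (simp add: Radd)
    qed (simp add: R0)
    then show ?thesis using Reqv[OF eqv_sym[OF e]] by blast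
  qed
  have "R p" if "p \<in> CF" for p
    using that
  proof (induction rule: CF_words)
    case (word v)
    then show ?case
    proof (induction v)
      case Nil
      have "Poly_Mapping.single (FMon []) 1 = (1 :: fr)" using zero_fmon_def single_one by metis
      then show ?case using Reqv[OF eqv_LB(1) gen(1)] by simp
    next
      case (Cons l v)
      have x: "Poly_Mapping.single (FMon v) 1 \<in> CF" using single_CF Cons by simp
      have D: "DG (dgw (FMon v)) (Poly_Mapping.single (FMon v) 1)" by (simp add: DG_def)
      from Cons have l: "l \<in> LTR" and IH: "R (Poly_Mapping.single (FMon v) 1)" by auto
      have "R (letter l * Poly_Mapping.single (FMon v) 1)"
      proof (cases "l \<in> Inl ` ev ` Aw 0")
        case True
        then obtain b where b: "b \<in> Aw 0" "l = Inl (ev b)" by blast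
        have e: "letter l = LB b" unfolding b(2) LB_def ..
        show ?thesis unfolding e by (rule Rmul[OF CF_intros(1)[OF b(1)] x DG_simps(3) D gen(1)[OF b(1)] IH])
      next
        case False
        then obtain m where m: "m \<in> MM" "l = Inr (evf m)" using l unfolding LTR_def by blast
        have e: "letter l = LM m" unfolding m(2) LM_def ..
        show ?thesis unfolding e by (rule Rmul[OF CF_intros(2)[OF m(1)] x DG_simps(4) D RLM[OF m(1)] IH])
      qed
      then show ?case unfolding single_Cons .
    qed
  qed (auto simp: R0 Rdiff)
  then have R: "S (mpc p) = mpc (fs p)" if "p \<in> CF" for p using that unfolding R_def by blast
  have 1: "S \<omega> = Sta \<omega>" if w: "\<omega> \<in> carrier RR" for \<omega>
  proof -
    obtain p where p: "p \<in> CF" "\<omega> = mpc p" using w unfolding carrier_RR by blast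
    show ?thesis unfolding p(2) R[OF p(1)] Sta_mpc[OF p(1)] ..
  qed
  have 2: "S \<in> extensional (carrier RR)" using S unfolding starP_def by (rule conjunct1)
  have 3: "Sta \<in> extensional (carrier RR)" using starP_Sta unfolding starP_def by (rule conjunct1)
  show ?thesis by (rule extensionalityI[OF 2 3 1])
qed

lemma mp_star_eq: "mp_star cF (OSU3_star q) = Sta"
  unfolding mp_star_def starP_def[symmetric] using starP_Sta starP_unique by (rule the_equality)

lemma cc_WP: "cc g \<in> WP \<longleftrightarrow> g \<notin> WP"
  unfolding WP_def ltr_defs by (rule cot_cases[of g]; cases s1; cases s2; simp)

text \<open>The involution replaces e_\<gamma> by f_\<gamma> and conversely, which exchanges the
  halves, and \<open>Th\<close> does not mix them.\<close>

lemma HW_sg: "HW WP a b p \<Longrightarrow> HW WP b a (sg p)"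
proof (induction rule: HW.induct)
  case (HW_P m)
  have "ms m d = 0" if "d \<in> WP" for d unfolding ms_def
  proof (rule sum.neutral, rule ballI)
    fix g show "mg g *\<^sub>C Th (cc g) d (sd (m g)) = 0"
      using HW_P(2)[of g] Th_WP(2)[of "cc g" d] cc_WP[of g] that by (cases "g \<in> WP") auto
  qed
  then show ?case using HW_P(1) by (auto simp: sg_gens intro!: HW_M MM_ms)
next
  case (HW_M m)
  have "ms m d = 0" if "d \<notin> WP" for d unfolding ms_def
  proof (rule sum.neutral, rule ballI)
    fix g show "mg g *\<^sub>C Th (cc g) d (sd (m g)) = 0"
      using HW_M(2)[of g] Th_WP(1)[of "cc g" d] cc_WP[of g] that by (cases "g \<in> WP") auto
  qed
  then show ?case using HW_M(1) by (auto simp: sg_gens intro!: HW_P MM_ms)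
next
  case (HW_mult a b p a' b' p')
  from HW.HW_mult[OF HW_mult.IH(2,1)] show ?case by (simp add: sg_mult add.commute)
qed (auto simp: sg_simps sg_neg sg_gens intro: HW_0 HW_1 HW_B HW_add HW_neg)

lemma HW_fs: "HW WP a b p \<Longrightarrow> HW WP b a (fs p)"
  using fs_DG[OF HW_DG, of WP a b p] HW_sg[of a b p] HW_neg[of WP b a "sg p"] by auto

lemma Sta_CC: "Sta ` CC (a, b) = CC (b, a)"
proof
  have 1: "Sta ` CC (a, b) \<subseteq> CC (b, a)" for a b unfolding CC_def by (auto simp: Sta_mpc[OF HW_CF] intro!: imageI HW_fs)
  then show "Sta ` CC (a, b) \<subseteq> CC (b, a)" .
  show "CC (b, a) \<subseteq> Sta ` CC (a, b)"
  proof
    fix \<omega> assume w: "\<omega> \<in> CC (b, a)"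
    then obtain p where p: "HW WP b a p" "\<omega> = mpc p" by (auto simp: CC_def)
    then have "Sta (Sta \<omega>) = \<omega>" using fs_fs[OF HW_DG[OF p(1)] HW_CF[OF p(1)]] HW_CF[OF p(1)] by (simp add: Sta_mpc fs_CF)
    then show "\<omega> \<in> Sta ` CC (a, b)" using 1[of b a] w by (metis image_eqI image_subset_iff)
  qed
qed

lemma almost_complex_CC: "almost_complex RR (mp_deg cF) (mp_star cF (OSU3_star q)) CC"
  unfolding almost_complex_def mp_star_eq using is_direct_sum_CC CC_one CC_mult Sta_CC by blast

end

section \<open>Balanced tensor products\<close>

locale bal_prod = ring R for R (structure) +
  fixes S P Q
  assumes P: "additive_subgroup P R" and Q: "additive_subgroup Q R" and S: "S \<subseteq> carrier R"
    and PS: "\<And>x s. x \<in> P \<Longrightarrow> s \<in> S \<Longrightarrow> x \<otimes> s \<in> P" and SQ: "\<And>s y. s \<in> S \<Longrightarrow> y \<in> Q \<Longrightarrow> s \<otimes> y \<in> Q"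
begin

abbreviation "FG \<equiv> free_Abelian_group (P \<times> Q)"
definition "NB = generate FG (bal_rels R S P Q)"
definition E :: "('a \<times> 'a \<Rightarrow>\<^sub>0 int) \<Rightarrow> ('a \<times> 'a \<Rightarrow>\<^sub>0 int) \<Rightarrow> bool" where "E x y \<longleftrightarrow> x - y \<in> NB"
definition mm :: "('a \<times> 'a \<Rightarrow>\<^sub>0 int) \<Rightarrow> 'a" where
  "mm z = finsum R (\<lambda>p. add_pow R (Poly_Mapping.lookup z p) (fst p \<otimes> snd p)) (Poly_Mapping.keys z)"

lemma P_closed: "x \<in> P \<Longrightarrow> x \<in> carrier R" "x \<in> P \<Longrightarrow> x' \<in> P \<Longrightarrow> x \<oplus> x' \<in> P" "\<zero> \<in> P"
  using additive_subgroup.a_subset[OF P] additive_subgroup.a_closed[OF P] additive_subgroup.zero_closed[OF P] by auto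

lemma Q_closed: "x \<in> Q \<Longrightarrow> x \<in> carrier R" "x \<in> Q \<Longrightarrow> x' \<in> Q \<Longrightarrow> x \<oplus> x' \<in> Q" "\<zero> \<in> Q"
  using additive_subgroup.a_subset[OF Q] additive_subgroup.a_closed[OF Q] additive_subgroup.zero_closed[OF Q] by auto

lemma rels_keys: "r \<in> bal_rels R S P Q \<Longrightarrow> Poly_Mapping.keys r \<subseteq> P \<times> Q"
proof -
  have d: "Poly_Mapping.keys (a - b) \<subseteq> P \<times> Q" if "Poly_Mapping.keys a \<subseteq> P \<times> Q" "Poly_Mapping.keys b \<subseteq> P \<times> Q" for a b :: "'a \<times> 'a \<Rightarrow>\<^sub>0 int"
    using keys_diff[of a b] that by blast
  have a: "Poly_Mapping.keys (a + b) \<subseteq> P \<times> Q" if "Poly_Mapping.keys a \<subseteq> P \<times> Q" "Poly_Mapping.keys b \<subseteq> P \<times> Q" for a b :: "'a \<times> 'a \<Rightarrow>\<^sub>0 int"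
    using Poly_Mapping.keys_add[of a b] that by blast
  assume "r \<in> bal_rels R S P Q"
  then show ?thesis unfolding bal_rels_def
  proof (elim UnE CollectE exE conjE)
    fix x x' y assume h: "r = frag_of (x \<oplus> x', y) - (frag_of (x, y) + frag_of (x', y))" "x \<in> P" "x' \<in> P" "y \<in> Q"
    show ?thesis unfolding h(1) by (intro d a) (use h in \<open>simp_all add: P_closed\<close>)
  next
    fix x y y' assume h: "r = frag_of (x, y \<oplus> y') - (frag_of (x, y) + frag_of (x, y'))" "x \<in> P" "y \<in> Q" "y' \<in> Q"
    show ?thesis unfolding h(1) by (intro d a) (use h in \<open>simp_all add: Q_closed\<close>)
  next
    fix x s y assume h: "r = frag_of (x \<otimes> s, y) - frag_of (x, s \<otimes> y)" "x \<in> P" "s \<in> S" "y \<in> Q"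
    show ?thesis unfolding h(1) by (intro d) (use h in \<open>simp_all add: PS SQ\<close>)
  qed
qed

lemma rels_sub: "bal_rels R S P Q \<subseteq> carrier FG" using rels_keys unfolding subset_iff carrier_free_Abelian_group_iff by blast

lemma NB_sub: "subgroup NB FG" unfolding NB_def by (rule group.generate_is_subgroup[OF group_free_Abelian_group rels_sub])

lemma NB_keys: "x \<in> NB \<Longrightarrow> Poly_Mapping.keys x \<subseteq> P \<times> Q" using subsetD[OF subgroup.subset[OF NB_sub], of x] unfolding carrier_free_Abelian_group_iff .

lemma NB_closed: "0 \<in> NB" "x \<in> NB \<Longrightarrow> y \<in> NB \<Longrightarrow> x + y \<in> NB" "x \<in> NB \<Longrightarrow> - x \<in> NB"
  using subgroup.one_closed[OF NB_sub] subgroup.m_closed[OF NB_sub, of x y] subgroup.m_inv_closed[OF NB_sub, of x] NB_keys[of x] by auto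

lemma E_refl [simp]: "E x x" by (simp add: E_def NB_closed)
lemma E_sym: "E x y \<Longrightarrow> E y x" using NB_closed(3)[of "x - y"] by (simp add: E_def)
lemma E_trans [trans]: "E x y \<Longrightarrow> E y z \<Longrightarrow> E x z" using NB_closed(2)[of "x - y" "y - z"] by (simp add: E_def)
lemma E_add: "E x y \<Longrightarrow> E x' y' \<Longrightarrow> E (x + x') (y + y')" using NB_closed(2)[of "x - y" "x' - y'"] by (simp add: E_def algebra_simps)
lemma E_sum: "(\<And>i. i \<in> I \<Longrightarrow> E (f i) (g i)) \<Longrightarrow> E (sum f I) (sum g I)"
  by (induction I rule: infinite_finite_induct) (auto simp: E_add)
lemma E_double: "E x (x + x) \<Longrightarrow> E x 0" using NB_closed(3)[of "x - (x + x)"] by (simp add: E_def)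

lemma E1: "x \<in> P \<Longrightarrow> x' \<in> P \<Longrightarrow> y \<in> Q \<Longrightarrow> E (frag_of (x \<oplus> x', y)) (frag_of (x, y) + frag_of (x', y))"
  unfolding E_def NB_def by (rule generate.incl) (unfold bal_rels_def, blast)

lemma E2: "x \<in> P \<Longrightarrow> y \<in> Q \<Longrightarrow> y' \<in> Q \<Longrightarrow> E (frag_of (x, y \<oplus> y')) (frag_of (x, y) + frag_of (x, y'))"
  unfolding E_def NB_def by (rule generate.incl) (unfold bal_rels_def, blast)

lemma E3: "x \<in> P \<Longrightarrow> s \<in> S \<Longrightarrow> y \<in> Q \<Longrightarrow> E (frag_of (x \<otimes> s, y)) (frag_of (x, s \<otimes> y))"
  unfolding E_def NB_def by (rule generate.incl) (unfold bal_rels_def, blast)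

lemma E1_sum:
  assumes "finite I" "\<And>i. i \<in> I \<Longrightarrow> x i \<in> P" "y \<in> Q"
  shows "finsum R x I \<in> P \<and> E (frag_of (finsum R x I, y)) (\<Sum>i\<in>I. frag_of (x i, y))"
  using assms
proof (induction I rule: finite_induct)
  case empty
  show ?case using E1[OF P_closed(3) P_closed(3) assms(3)] P_closed(3) by (auto intro: E_double)
next
  case (insert i I)
  then have i: "finsum R x I \<in> P" and j: "E (frag_of (finsum R x I, y)) (\<Sum>i\<in>I. frag_of (x i, y))" by auto
  have k: "finsum R x (insert i I) = x i \<oplus> finsum R x I" using insert P_closed by (intro finsum_insert) auto
  have l: "E (frag_of (x i \<oplus> finsum R x I, y)) (frag_of (x i, y) + frag_of (finsum R x I, y))" using insert i by (intro E1) auto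
  show ?case using insert P_closed(2)[of "x i", OF _ i] E_trans[OF l E_add[OF E_refl j]] unfolding k by simp
qed

lemma E2_sum:
  assumes "finite I" "\<And>i. i \<in> I \<Longrightarrow> y i \<in> Q" "x \<in> P"
  shows "finsum R y I \<in> Q \<and> E (frag_of (x, finsum R y I)) (\<Sum>i\<in>I. frag_of (x, y i))"
  using assms
proof (induction I rule: finite_induct)
  case empty
  show ?case using E2[OF assms(3) Q_closed(3) Q_closed(3)] Q_closed(3) by (auto intro: E_double)
next
  case (insert i I)
  then have i: "finsum R y I \<in> Q" and j: "E (frag_of (x, finsum R y I)) (\<Sum>i\<in>I. frag_of (x, y i))" by auto
  have k: "finsum R y (insert i I) = y i \<oplus> finsum R y I" using insert Q_closed by (intro finsum_insert) auto
  have l: "E (frag_of (x, y i \<oplus> finsum R y I)) (frag_of (x, y i) + frag_of (x, finsum R y I))" using insert i by (intro E2) auto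
  show ?case using insert Q_closed(2)[of "y i", OF _ i] E_trans[OF l E_add[OF E_refl j]] unfolding k by simp
qed

lemma mm_over:
  assumes "finite K" "Poly_Mapping.keys z \<subseteq> K" "K \<subseteq> P \<times> Q"
  shows "mm z = finsum R (\<lambda>p. add_pow R (Poly_Mapping.lookup z p) (fst p \<otimes> snd p)) K"
proof -
  have c: "fst p \<otimes> snd p \<in> carrier R" if "p \<in> K" for p using that assms(3) P_closed Q_closed by (cases p) auto
  have z0: "add_pow R (0::int) x = \<zero>" for x by (simp add: add_pow_def)
  show ?thesis unfolding mm_def finsum_def
    by (rule add.finprod_mono_neutral_cong_left[OF assms(1,2), unfolded finsum_def])
       (use c in \<open>auto simp: in_keys_iff z0\<close>)
qed

lemma mm_add:
  assumes "Poly_Mapping.keys x \<subseteq> P \<times> Q" "Poly_Mapping.keys y \<subseteq> P \<times> Q"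
  shows "mm (x + y) = mm x \<oplus> mm y"
proof -
  let ?K = "Poly_Mapping.keys x \<union> Poly_Mapping.keys y"
  have K: "finite ?K" "?K \<subseteq> P \<times> Q" "Poly_Mapping.keys (x + y) \<subseteq> ?K" using assms Poly_Mapping.keys_add[of x y] by auto
  have c: "fst p \<otimes> snd p \<in> carrier R" if "p \<in> ?K" for p using that K(2) P_closed Q_closed by (cases p) auto
  have "mm (x + y) = finsum R (\<lambda>p. add_pow R (Poly_Mapping.lookup x p) (fst p \<otimes> snd p) \<oplus> add_pow R (Poly_Mapping.lookup y p) (fst p \<otimes> snd p)) ?K"
    unfolding mm_over[OF K(1,3,2)]
    by (rule finsum_cong') (use c in \<open>auto simp: lookup_add add.int_pow_mult\<close>)
  also have "\<dots> = finsum R (\<lambda>p. add_pow R (Poly_Mapping.lookup x p) (fst p \<otimes> snd p)) ?K \<oplus> finsum R (\<lambda>p. add_pow R (Poly_Mapping.lookup y p) (fst p \<otimes> snd p)) ?K"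
    by (rule finsum_addf) (use c in auto)
  finally show ?thesis using mm_over[OF K(1) _ K(2), of x] mm_over[OF K(1) _ K(2), of y] by simp
qed

lemma mm_frag: "x \<in> P \<Longrightarrow> y \<in> Q \<Longrightarrow> mm (frag_of (x, y)) = x \<otimes> y"
  using P_closed Q_closed by (simp add: mm_def)

lemma mm_0: "mm 0 = \<zero>" by (simp add: mm_def)

lemma mm_diff: 
  assumes "Poly_Mapping.keys x \<subseteq> P \<times> Q" "Poly_Mapping.keys y \<subseteq> P \<times> Q"
  shows "mm x = mm (x - y) \<oplus> mm y"
proof -
  have "Poly_Mapping.keys (x - y) \<subseteq> P \<times> Q" using keys_diff[of x y] assms by blast
  from mm_add[OF this assms(2)] show ?thesis by simp
qed

text \<open>The map \<psi> is an inverse up to the balancing relations: additivity modulo these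
  relations and x \<otimes> y ~ \<psi>(xy) give z ~ \<psi>(mm z) for every z, so the kernel of
  \<open>mm\<close> consists of balancing relations.\<close>

lemma mult_map_iso:
  assumes C: "additive_subgroup C R" and PQ: "\<And>x y. x \<in> P \<Longrightarrow> y \<in> Q \<Longrightarrow> x \<otimes> y \<in> C"
    and surj: "\<And>c. c \<in> C \<Longrightarrow> \<exists>z. Poly_Mapping.keys z \<subseteq> P \<times> Q \<and> mm z = c"
    and \<psi>: "\<And>c c'. c \<in> C \<Longrightarrow> c' \<in> C \<Longrightarrow> E (\<psi> (c \<oplus> c')) (\<psi> c + \<psi> c')"
      "\<And>x y. x \<in> P \<Longrightarrow> y \<in> Q \<Longrightarrow> E (frag_of (x, y)) (\<psi> (x \<otimes> y))"
  shows "mult_map R \<in> iso (bal_tensor R S P Q) ((add_monoid R)\<lparr>carrier := C\<rparr>)"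
proof -
  let ?H = "(add_monoid R)\<lparr>carrier := C\<rparr>"
  have Cc: "C \<subseteq> carrier R" "\<zero> \<in> C" "\<And>x y. x \<in> C \<Longrightarrow> y \<in> C \<Longrightarrow> x \<oplus> y \<in> C" "\<And>x. x \<in> C \<Longrightarrow> \<ominus> x \<in> C"
    using additive_subgroup.a_subset[OF C] additive_subgroup.zero_closed[OF C] additive_subgroup.a_closed[OF C] additive_subgroup.a_inv_closed[OF C] by auto
  have H: "group ?H" using subgroup.subgroup_is_group[OF additive_subgroup.a_subgroup[OF C] add.group_axioms] by simp
  have key: "mm z \<in> C \<and> E z (\<psi> (mm z))" if "Poly_Mapping.keys z \<subseteq> P \<times> Q" for z
  proof -
    have "Poly_Mapping.keys z \<subseteq> P \<times> Q \<and> mm z \<in> C \<and> E z (\<psi> (mm z))"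
      using that
    proof (induction z rule: frag_induction)
      case zero
      have "E (\<psi> \<zero>) 0" using \<psi>(1)[OF Cc(2) Cc(2)] by (simp add: E_double)
      then show ?case using Cc(2) by (simp add: mm_0 E_sym)
    next
      case (one p)
      then show ?case using PQ \<psi>(2) mm_frag by (cases p) auto
    next
      case (diff a b)
      have k: "Poly_Mapping.keys (a - b) \<subseteq> P \<times> Q" using keys_diff[of a b] diff by blast
      have c: "mm (a - b) \<in> carrier R" unfolding mm_def
        by (rule finsum_closed) (use k P_closed Q_closed in \<open>auto intro!: add.int_pow_closed m_closed\<close>)
      have e: "mm a = mm (a - b) \<oplus> mm b" using mm_diff diff by blast
      have "mm (a - b) = mm a \<oplus> \<ominus> mm b" unfolding e using c diff Cc(1) by (simp add: a_assoc r_neg subsetD)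
      then have m: "mm (a - b) \<in> C" using diff Cc by simp
      have "E (\<psi> (mm a)) (\<psi> (mm (a - b)) + \<psi> (mm b))" unfolding e by (rule \<psi>(1)) (use m diff in auto)
      then have "E a (\<psi> (mm (a - b)) + \<psi> (mm b))" using diff by (blast intro: E_trans)
      moreover have "E (- b) (- \<psi> (mm b))" using diff NB_closed(3)[of "b - \<psi> (mm b)"] by (simp add: E_def)
      ultimately have "E (a + - b) (\<psi> (mm (a - b)) + \<psi> (mm b) + - \<psi> (mm b))" by (rule E_add)
      then show ?case using k m by simp
    qed
    then show ?thesis by blast
  qed
  interpret h: group_hom FG ?H mm
  proof (rule group_hom.intro[OF group_free_Abelian_group H], rule group_hom_axioms.intro, rule homI)
    show "mm x \<in> carrier ?H" if "x \<in> carrier FG" for x using key that by simp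
    show "mm (x \<otimes>\<^bsub>FG\<^esub> y) = mm x \<otimes>\<^bsub>?H\<^esub> mm y" if "x \<in> carrier FG" "y \<in> carrier FG" for x y
      using mm_add[of x y] that by simp
  qed
  have "kernel FG ?H mm = NB"
  proof
    show "kernel FG ?H mm \<subseteq> NB"
    proof
      fix z assume "z \<in> kernel FG ?H mm"
      then have z: "Poly_Mapping.keys z \<subseteq> P \<times> Q" "mm z = \<zero>" by (auto simp: kernel_def)
      have "E (\<psi> \<zero>) 0" using \<psi>(1)[OF Cc(2) Cc(2)] by (simp add: E_double)
      then have "E z 0" using key[OF z(1)] z(2) E_trans by metis
      then show "z \<in> NB" by (simp add: E_def)
    qed
    have "bal_rels R S P Q \<subseteq> kernel FG ?H mm"
    proof
      fix r assume r: "r \<in> bal_rels R S P Q"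
      have D: "mm (a - b) = \<zero>" if "mm a = mm b" "Poly_Mapping.keys a \<subseteq> P \<times> Q" "Poly_Mapping.keys b \<subseteq> P \<times> Q" for a b
      proof -
        have "Poly_Mapping.keys (a - b) \<subseteq> P \<times> Q" using keys_diff[of a b] that by blast
        then have "mm (a - b) \<in> carrier R" "mm b \<in> carrier R" using key Cc(1) that by blast+
        then show ?thesis using mm_diff[OF that(2,3)] that(1) add.r_cancel_one' by metis
      qed
      have K: "Poly_Mapping.keys (frag_of (x, y) + frag_of (x', y')) \<subseteq> P \<times> Q" if "x \<in> P" "x' \<in> P" "y \<in> Q" "y' \<in> Q" for x x' y y'
        using Poly_Mapping.keys_add[of "frag_of (x, y)" "frag_of (x', y')"] that by auto
      have A: "mm (frag_of (x, y) + frag_of (x', y')) = x \<otimes> y \<oplus> x' \<otimes> y'" if "x \<in> P" "x' \<in> P" "y \<in> Q" "y' \<in> Q" for x x' y y'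
        using mm_add[of "frag_of (x, y)" "frag_of (x', y')"] that by (simp add: mm_frag)
      have "mm r = \<zero>" using r unfolding bal_rels_def
      proof (elim UnE CollectE exE conjE)
        fix x x' y assume h: "r = frag_of (x \<oplus> x', y) - (frag_of (x, y) + frag_of (x', y))" "x \<in> P" "x' \<in> P" "y \<in> Q"
        show ?thesis unfolding h(1)
          by (rule D[OF _ _ K]) (use h in \<open>simp_all add: A mm_frag P_closed Q_closed l_distr\<close>)
      next
        fix x y y' assume h: "r = frag_of (x, y \<oplus> y') - (frag_of (x, y) + frag_of (x, y'))" "x \<in> P" "y \<in> Q" "y' \<in> Q"
        show ?thesis unfolding h(1)
          by (rule D[OF _ _ K]) (use h in \<open>simp_all add: A mm_frag P_closed Q_closed r_distr\<close>)
      next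
        fix x s y assume h: "r = frag_of (x \<otimes> s, y) - frag_of (x, s \<otimes> y)" "x \<in> P" "s \<in> S" "y \<in> Q"
        have "s \<in> carrier R" using h S by blast
        then show ?thesis unfolding h(1)
          by (intro D) (use h in \<open>simp_all add: mm_frag PS SQ P_closed Q_closed m_assoc\<close>)
      qed
      then show "r \<in> kernel FG ?H mm" using rels_keys[OF r] by (simp add: kernel_def)
    qed
    then show "NB \<subseteq> kernel FG ?H mm" unfolding NB_def
      by (rule group.generate_subgroup_incl[OF group_free_Abelian_group _ h.subgroup_kernel])
  qed
  moreover have "mm ` carrier FG = carrier ?H" 
  proof (intro equalityI subsetI)
    fix c assume "c \<in> carrier ?H"
    then obtain z where "Poly_Mapping.keys z \<subseteq> P \<times> Q" "mm z = c" using surj by auto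
    then show "c \<in> mm ` carrier FG" unfolding image_iff Bex_def carrier_free_Abelian_group_iff by blast
  next
    fix c assume "c \<in> mm ` carrier FG"
    then obtain z where "c = mm z" "z \<in> carrier FG" by blast
    then show "c \<in> carrier ?H" using key[of z] by simp
  qed
  ultimately have "(\<lambda>X. the_elem (mm ` X)) \<in> iso (FG Mod NB) ?H" using h.FactGroup_iso_set by simp
  moreover have "mult_map R = (\<lambda>X. the_elem (mm ` X))" by (rule ext) (simp add: mult_map_def mm_def[abs_def])
  ultimately show ?thesis by (simp add: bal_tensor_def NB_def)
qed

end

section \<open>Factorisability\<close>

context qord
begin

text \<open>Right multiplication by \<open>x\<close> on normal forms; it commutes with the left action \<open>rho\<close>.\<close>

definition RX :: "dual \<Rightarrow> (st \<Rightarrow> dual) \<Rightarrow> st \<Rightarrow> dual" where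
  "RX x \<xi> = (\<lambda>s. \<Sum>t\<in>UNIV. \<xi> t * rhoW (wd t) (ds e0 x) s)"

text \<open>Left and right multiplication commute; by \<open>rhoW_straight\<close> both sides expand
  in the same constants \<open>cf\<close>.\<close>

lemma rhoV_RX:
  assumes x: "x \<in> UU" and \<xi>: "\<And>s. \<xi> s \<in> UU"
  shows "rhoV d (RX x \<xi>) s = RX x (rhoV d \<xi>) s"
proof -
  let ?r = "\<lambda>t. rhoW (wd t) (ds e0 x)"
  have U: "?r t s \<in> UU" for t s by (rule rhoW_UU) (rule ds_UU[OF x])
  have st: "rhoV e (?r t) s = (\<Sum>t'\<in>UNIV. cf (e # wd t) t' *\<^sub>C ?r t' s)" for e t
    using rhoW_straight[of "ds e0 x" "e # wd t" s] ds_UU[OF x] by simp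
  have "rhoV d (RX x \<xi>) s = (\<Sum>t\<in>UNIV. \<Sum>e\<in>UNIV. Th d e (\<xi> t) * rhoV e (?r t) s)"
    unfolding RX_def rhoV_sum by (simp only: rhoV_mult[OF \<xi> U])
  also have "\<dots> = (\<Sum>t\<in>UNIV. \<Sum>e\<in>UNIV. \<Sum>t'\<in>UNIV. (cf (e # wd t) t' *\<^sub>C Th d e (\<xi> t)) * ?r t' s)"
    unfolding st by (simp add: sum_distrib_left)
  also have "\<dots> = (\<Sum>t\<in>UNIV. \<Sum>t'\<in>UNIV. \<Sum>e\<in>UNIV. (cf (e # wd t) t' *\<^sub>C Th d e (\<xi> t)) * ?r t' s)"
    by (rule sum.cong[OF refl], rule sum.swap)
  also have "\<dots> = (\<Sum>t'\<in>UNIV. \<Sum>t\<in>UNIV. \<Sum>e\<in>UNIV. (cf (e # wd t) t' *\<^sub>C Th d e (\<xi> t)) * ?r t' s)" by (rule sum.swap)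
  also have "\<dots> = (\<Sum>t'\<in>UNIV. \<Sum>e\<in>UNIV. \<Sum>t\<in>UNIV. (cf (e # wd t) t' *\<^sub>C Th d e (\<xi> t)) * ?r t' s)"
    by (rule sum.cong[OF refl], rule sum.swap)
  also have "\<dots> = RX x (rhoV d \<xi>) s" by (simp add: RX_def rhoV_def Lop_cf sum_distrib_right)
  finally show ?thesis .
qed

lemma rho_RX:
  assumes p: "p \<in> CF" and x: "x \<in> UU" and \<xi>: "\<And>s. \<xi> s \<in> UU"
  shows "rho p (RX x \<xi>) s = RX x (rho p \<xi>) s"
  using p
proof (induction arbitrary: s rule: CF_induct)
  case zero show ?case by (simp add: rho_simps, simp add: RX_def rho_simps)
next
  case (diff y z)
  have 1: "RX x (rho (y - z) \<xi>) s = RX x (rho y \<xi>) s - RX x (rho z \<xi>) s"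
    by (simp add: RX_def rho_neg sum_subtractf left_diff_distrib)
  have 2: "rho (y - z) (RX x \<xi>) s = rho y (RX x \<xi>) s - rho z (RX x \<xi>) s" by (rule rho_neg)
  show ?case unfolding 1 2 diff(3) diff(4) ..
next
  case one show ?case by (simp add: rho_1)
next
  case (LB b y)
  have 1: "RX x (rho (LB b * y) \<xi>) s = b * RX x (rho y \<xi>) s"
    by (simp add: RX_def rho_mult rho_LB sum_distrib_left mult.assoc)
  have 2: "rho (LB b * y) (RX x \<xi>) s = b * rho y (RX x \<xi>) s" by (simp only: rho_mult rho_LB)
  show ?case unfolding 1 2 LB(3) ..
next
  case (LM m y)
  have e: "rho y (RX x \<xi>) = RX x (rho y \<xi>)" by (rule ext) (rule LM)
  have "rho (LM m * y) (RX x \<xi>) s = (\<Sum>d\<in>UNIV. m d * RX x (rhoV d (rho y \<xi>)) s)"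
    unfolding rho_mult rho_LM e using rhoV_RX[OF x rho_UU[OF LM(2) \<xi>]] by simp
  also have "\<dots> = (\<Sum>d\<in>UNIV. \<Sum>t\<in>UNIV. m d * rhoV d (rho y \<xi>) t * rhoW (wd t) (ds e0 x) s)"
    by (simp add: RX_def sum_distrib_left mult.assoc)
  also have "\<dots> = (\<Sum>t\<in>UNIV. \<Sum>d\<in>UNIV. m d * rhoV d (rho y \<xi>) t * rhoW (wd t) (ds e0 x) s)" by (rule sum.swap)
  also have "\<dots> = RX x (rho (LM m * y) \<xi>) s" by (simp add: RX_def rho_mult rho_LM sum_distrib_right)
  finally show ?case .
qed

lemma RX_e0: "RX x (ds e0 g) = ds e0 (g * x)"
proof
  fix s
  have "RX x (ds e0 g) s = (\<Sum>t\<in>UNIV. if t = e0 then g * ds e0 x s else 0)"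
    unfolding RX_def by (rule sum.cong) (auto simp: ds_def wd_e0)
  then show "RX x (ds e0 g) s = ds e0 (g * x) s" by (simp add: ds_def)
qed

lemma rhoW_Aw: "x \<in> Aw l \<Longrightarrow> rhoW w (ds e0 x) s \<in> Aw (wtw (wd s) - wtw w + l)"
proof (induction w arbitrary: s)
  case Nil then show ?case by (simp add: ds_def wd_e0)
next
  case (Cons d w)
  have "Lop g (\<lambda>s. Th d g (rhoW w (ds e0 x) s)) s \<in> Aw (wtw (wd s) - wtw (d # w) + l)" for g
  proof (rule Lop_closed)
    fix s' assume "wtw (wd s) = rt g + wtw (wd s')"
    then show "Th d g (rhoW w (ds e0 x) s') \<in> Aw (wtw (wd s) - wtw (d # w) + l)"
      using Th_Aw[OF Cons.IH[OF Cons.prems, of s'], of d g] by (simp add: algebra_simps)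
  qed (auto simp: Aw_add Aw_scale)
  then have "rhoV d (rhoW w (ds e0 x)) s \<in> Aw (wtw (wd s) - wtw (d # w) + l)"
    unfolding rhoV_def[of d "rhoW w (ds e0 x)"] by (rule Aw_sum)
  then show ?case by simp
qed

lemma ds_e0_deg: "ds e0 x s \<noteq> 0 \<Longrightarrow> bp s = 0 \<and> bm s = 0"
  by (auto simp: ds_def e0_def bp_def bm_def split: if_splits)

lemma rhoW_deg: "rhoW w (ds e0 x) s \<noteq> 0 \<Longrightarrow> bp s = length (filter (\<lambda>d. d \<in> WP) w) \<and> bm s = length (filter (\<lambda>d. d \<notin> WP) w)"
proof (induction w arbitrary: s)
  case Nil then show ?case using ds_e0_deg[of x s] by simp
next
  case (Cons d w)
  have "rhoV d (rhoW w (ds e0 x)) s \<noteq> 0" using Cons.prems by simp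
  from rhoV_deg[of "rhoW w (ds e0 x)", OF Cons.IH this] show ?case by simp
qed

section \<open>The two halves of an ordered monomial\<close>

definition sp :: "st \<Rightarrow> st" where "sp = (\<lambda>(a1, a2, a3, b1, b2, b3). (a1, a2, a3, False, False, False))"
definition sm :: "st \<Rightarrow> st" where "sm = (\<lambda>(a1, a2, a3, b1, b2, b3). (False, False, False, b1, b2, b3))"
definition jn :: "st \<Rightarrow> st \<Rightarrow> st" where
  "jn = (\<lambda>(a1, a2, a3, _, _, _) (_, _, _, b1, b2, b3). (a1, a2, a3, b1, b2, b3))"

lemma jn_simps:
  assumes "bm S = 0" "bp T = 0"
  shows "sp (jn S T) = S" "sm (jn S T) = T" "wd (jn S T) = wd S @ wd T"
  using assms by (cases S; cases T; auto simp: jn_def sp_def sm_def bp_def bm_def wd_def)+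

lemma wd_split: "wd s = wd (sp s) @ wd (sm s)" "bp (sp s) = bp s" "bm (sp s) = 0" "bp (sm s) = 0" "bm (sm s) = bm s"
  by (cases s; simp add: sp_def sm_def wd_def bp_def bm_def)+

text \<open>Attaches the monomial T of the second half to every monomial of the first half.\<close>

definition sh :: "st \<Rightarrow> (st \<Rightarrow> dual) \<Rightarrow> st \<Rightarrow> dual" where "sh T \<xi> = (\<lambda>s. if sm s = T then \<xi> (sp s) else 0)"

lemma Lop_sh: "d \<in> WP \<Longrightarrow> Lop d (sh T \<xi>) s = sh T (Lop d \<xi>) s"
  by (cases s) (auto simp: WP_def Lop_def sh_def sp_def sm_def)

lemma rhoV_sh: assumes "d \<in> WP" shows "rhoV d (sh T \<xi>) s = sh T (rhoV d \<xi>) s"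
proof -
  have "Lop g (\<lambda>s. Th d g (sh T \<xi> s)) s = sh T (Lop g (\<lambda>s. Th d g (\<xi> s))) s" for g
  proof (cases "g \<in> WP")
    case True
    have "(\<lambda>s. Th d g (sh T \<xi> s)) = sh T (\<lambda>s. Th d g (\<xi> s))" by (rule ext) (simp add: sh_def)
    then show ?thesis using Lop_sh[OF True] by simp
  next
    case False
    then show ?thesis using Th_WP(1)[OF assms False] by (simp add: sh_def)
  qed
  then show ?thesis by (simp add: rhoV_def sh_def)
qed

text \<open>An element of bidegree (a, 0) is built from letters of the first half, which act on an
  ordered monomial without touching its second half.\<close>

lemma rho_sh: assumes "HW WP a b p" "b = 0" shows "rho p (sh T \<xi>) s = sh T (rho p \<xi>) s"
  using assms
proof (induction arbitrary: \<xi> s rule: HW.induct)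
  case (HW_P m)
  have "m d * rhoV d (sh T \<xi>) s = m d * sh T (rhoV d \<xi>) s" for d using rhoV_sh[of d] HW_P(2)[of d] by (cases "d \<in> WP") auto
  then show ?case by (simp add: rho_LM, simp add: sh_def rho_LM)
next
  case (HW_mult a b p a' b' p')
  have e: "rho p' (sh T \<xi>) = sh T (rho p' \<xi>)" by (rule ext) (use HW_mult in simp)
  have "rho (p * p') \<xi> = rho p (rho p' \<xi>)" by (rule ext) (rule rho_mult)
  then show ?case using HW_mult by (simp add: rho_mult e)
next
  case (HW_add a b p p')
  then show ?case by (simp add: rho_simps, simp add: sh_def rho_simps)
next
  case (HW_neg a b p)
  then show ?case by (simp add: rho_neg, simp add: sh_def rho_neg)
next
  case (HW_B x)
  show ?case by (simp add: rho_LB, simp add: sh_def rho_LB)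
next
  case (HW_0 a b)
  show ?case by (simp add: rho_simps, simp add: sh_def rho_simps)
qed (simp_all add: rho_1)

lemma ds_sh: assumes "bp T = 0" shows "ds T g = sh T (ds e0 g)"
proof
  fix s show "ds T g s = sh T (ds e0 g) s" using assms
    by (cases T; cases s; auto simp: ds_def sh_def sm_def sp_def e0_def bp_def)
qed

text \<open>Representatives on which surjectivity of the multiplication map is visible.\<close>

inductive SP :: "nat \<Rightarrow> nat \<Rightarrow> fr \<Rightarrow> bool" for a b where
  SP_0: "SP a b 0"
| SP_add: "SP a b x \<Longrightarrow> SP a b y \<Longrightarrow> SP a b (x + y)"
| SP_mult: "HW WP a 0 p \<Longrightarrow> HW WP 0 b r \<Longrightarrow> SP a b (p * r)"

lemma SP_sum: "(\<And>i. i \<in> I \<Longrightarrow> SP a b (f i)) \<Longrightarrow> SP a b (sum f I)"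
  by (induction I rule: infinite_finite_induct) (auto intro: SP_0 SP_add)

lemma SP_left: "SP a b x \<Longrightarrow> HW WP c 0 p \<Longrightarrow> SP (c + a) b (p * x)"
proof (induction rule: SP.induct)
  case (SP_mult p' r)
  from SP.SP_mult[of "c + a" "p * p'" b r] HW_mult[OF SP_mult(3,1)] SP_mult(2) show ?case by (simp add: mult.assoc)
qed (auto simp: distrib_left intro: SP_0 SP_add)

lemma LL_SP:
  fixes u v :: "cot list"
  shows "c \<in> Aw (wtw (u @ v)) \<Longrightarrow> set u \<subseteq> WP \<Longrightarrow> set v \<inter> WP = {} \<Longrightarrow> SP (length u) (length v) (LL c (u @ v))"
proof (induction u arbitrary: c)
  case Nil
  have "filter (\<lambda>d. d \<in> WP) v = []" "filter (\<lambda>d. d \<notin> WP) v = v" using Nil by (auto simp: filter_empty_conv filter_id_conv)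
  then have "HW WP 0 (length v) (LL c v)" using HW_LL[of c v] Nil by simp
  from SP_mult[OF HW_1 this] show ?case by simp
next
  case (Cons d u)
  let ?l = "wtw (u @ v)"
  show ?case unfolding append_Cons LL.simps
  proof (rule SP_sum)
    fix i assume i: "i \<in> {..<nX ?l}"
    have m: "me c d (Xl ?l i) \<in> MM" using me_MM'[of c d "u @ v" i] Cons.prems(1) i by simp
    have "HW WP (Suc 0) 0 (LM (me c d (Xl ?l i)))" using Cons.prems by (intro HW_P m) (simp add: me_def Th_WP)
    moreover have "SP (length u) (length v) (LL (Yl ?l i) (u @ v))" using Cons Yl[OF sl_wtw, of i "u @ v"] i by simp
    ultimately show "SP (length (d # u)) (length v) (LM (me c d (Xl ?l i)) * LL (Yl ?l i) (u @ v))"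
      using SP_left[of "length u" "length v"] by fastforce
  qed
qed

lemma wd_WP: "bm S = 0 \<Longrightarrow> set (wd S) \<subseteq> WP" "bp T = 0 \<Longrightarrow> set (wd T) \<inter> WP = {}" "length (wd s) = bp s + bm s"
  by (cases S, auto simp: bm_def wd_def WP_def) (cases T, auto simp: bp_def wd_def WP_def, cases s, simp add: bp_def bm_def wd_def)

lemma CC_SP: assumes "\<omega> \<in> CC (a, b)" shows "\<exists>x \<in> CF. SP a b x \<and> \<omega> = mpc x"
proof -
  let ?x = "\<Sum>s\<in>UNIV. if bp s = a \<and> bm s = b then LL (nf \<omega> s) (wd s) else 0"
  have w: "\<omega> \<in> carrier RR" "\<And>s. nf \<omega> s \<noteq> 0 \<Longrightarrow> bp s = a \<and> bm s = b" using assms by (auto simp: CC_eq)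
  have f: "nf \<omega> \<in> GG" by (rule nf_GG[OF w(1)])
  have e: "(\<Sum>s\<in>UNIV. LL (nf \<omega> s) (wd s)) \<doteq> ?x"
  proof (rule eqv_sum)
    fix s show "LL (nf \<omega> s) (wd s) \<doteq> (if bp s = a \<and> bm s = b then LL (nf \<omega> s) (wd s) else 0)"
      using w(2)[of s] LL_zero[of "wd s"] GG_D(2)[OF f, of s] by (cases "nf \<omega> s = 0") auto
  qed
  have "SP a b ?x"
  proof (rule SP_sum)
    fix s
    have "nf \<omega> s \<in> Aw (wtw (wd (sp s) @ wd (sm s)))" using GG_D(1)[OF f, of s] unfolding wd_split(1)[of s] .
    from LL_SP[OF this wd_WP(1)[OF wd_split(3)] wd_WP(2)[OF wd_split(4)]]
    have "SP (bp s) (bm s) (LL (nf \<omega> s) (wd s))" unfolding wd_split(1)[of s] wd_WP(3) wd_split(2-5) by simp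
    then show "SP a b (if bp s = a \<and> bm s = b then LL (nf \<omega> s) (wd s) else 0)" by (auto intro: SP_0)
  qed
  then show ?thesis using e mk_nf[OF w(1)] unfolding mk_def eqv_mpc by auto
qed

lemma CC_additive: "additive_subgroup (CC i) RR"
proof -
  have "i \<in> {(a, b). a + b = fst i + snd i}" by auto
  then show ?thesis using is_direct_sum_CC[of "fst i + snd i"] unfolding is_direct_sum_def by blast
qed

text \<open>An element of bidegree (a, b) is a sum of c e_S e_T, with S from the first and T from
  the second half. Inserting a partition of unity for the weight of T splits it as \<Sum>_i (c e_S
  x_i)(y_i e_T) with factors over B. This choice inverts multiplication: for y = \<Sum>_T g_T e_T,
  the terms of the splitting of py combine to p g_T x_i \<otimes> y_i e_T, and g_T x_i lies in B, so
  it may cross the tensor sign.\<close>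

lemma mult_map_CC:
  "mult_map RR \<in> iso (bal_tensor RR (mp0 cF ` OF3 q) (CC (a, 0)) (CC (0, b))) ((add_monoid RR)\<lparr>carrier := CC (a, b)\<rparr>)"
proof -
  have S: "mp0 cF ` OF3 q = (\<lambda>b. mpc (LB b)) ` Aw 0" by (simp add: OF3_eq image_image mp_LB_LM)
  have SC: "mp0 cF ` OF3 q \<subseteq> CC (0, 0)" unfolding S CC_def by (auto intro!: imageI HW_B)
  interpret B: bal_prod RR "mp0 cF ` OF3 q" "CC (a, 0)" "CC (0, b)"
  proof (rule bal_prod.intro[OF RR_ring], rule bal_prod_axioms.intro)
    show "mp0 cF ` OF3 q \<subseteq> carrier RR" using SC by (auto simp: CC_eq)
    show "x \<otimes>\<^bsub>RR\<^esub> s \<in> CC (a, 0)" if "x \<in> CC (a, 0)" "s \<in> mp0 cF ` OF3 q" for x s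
      using CC_mult[of x a 0 s 0 0] that SC by auto
    show "s \<otimes>\<^bsub>RR\<^esub> y \<in> CC (0, b)" if "s \<in> mp0 cF ` OF3 q" "y \<in> CC (0, b)" for s y
      using CC_mult[of s 0 0 y 0 b] that SC by auto
  qed (rule CC_additive)+
  define n where "n T = nX (wtw (wd T))" for T
  define X where "X T i = Xl (wtw (wd T)) i" for T i
  define Y where "Y T i = Yl (wtw (wd T)) i" for T i
  have XA: "X T i \<in> Aw (- wtw (wd T))" and YA: "Y T i \<in> Aw (wtw (wd T))" if "i < n T" for T i
    using Xl[OF sl_wtw, of i "wd T"] Yl[OF sl_wtw, of i "wd T"] that by (simp_all add: n_def X_def Y_def)
  have XY1: "(\<Sum>i<n T. X T i * Y T i) = 1" for T using XlYl[OF sl_wtw, of "wd T"] by (simp add: n_def X_def Y_def)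
  define MS where "MS = {T. bp T = 0 \<and> bm T = b}"
  define PT where "PT = {S. bp S = a \<and> bm S = 0}"
  have fin: "finite MS" "finite PT" by auto
  \<comment> \<open>The coefficients of the normal form of c e_S x_i; the vector
    \<open>ds e0 (X T i)\<close> is x_i times the monomial 1.\<close>
  define k where "k c S T i = (\<lambda>s. c * rhoW (wd S) (ds e0 (X T i)) s)" for c S T i
  define U where "U c S T i = mk (k c S T i)" for c S T i
  define L where "L T i = mpc (LL (Y T i) (wd T))" for T i
  have kG: "k c S T i \<in> GG" if "c \<in> Aw (wtw (wd S) + wtw (wd T))" "i < n T" for c S T i
    unfolding GG_def k_def
  proof (intro CollectI allI)
    fix s show "c * rhoW (wd S) (ds e0 (X T i)) s \<in> Aw (wtw (wd s))"
      by (rule Aw_mult'[OF that(1) rhoW_Aw[OF XA[OF that(2)]]]) (simp add: algebra_simps)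
  qed
  have UP: "U c S T i \<in> CC (a, 0)" if "c \<in> Aw (wtw (wd S) + wtw (wd T))" "i < n T" "S \<in> PT" for c S T i
    unfolding U_def
  proof (rule mk_CC[OF kG[OF that(1,2)]])
    fix s assume "k c S T i s \<noteq> 0"
    then have "rhoW (wd S) (ds e0 (X T i)) s \<noteq> 0" unfolding k_def by (metis mult_zero_right)
    from rhoW_deg[OF this] show "bp s = a \<and> bm s = 0" using that(3) by (simp add: wd_count PT_def)
  qed
  have Uc: "U c S T i \<in> carrier RR" if "c \<in> Aw (wtw (wd S) + wtw (wd T))" "i < n T" for c S T i
    unfolding U_def by (rule mk_carrier[OF kG[OF that]])
  have LQ: "L T i \<in> CC (0, b)" if "i < n T" "T \<in> MS" for T i
    using HW_wd[OF YA[OF that(1)]] that(2) unfolding L_def CC_def MS_def by auto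
  have U_add: "U (c + c') S T i = U c S T i \<oplus>\<^bsub>RR\<^esub> U c' S T i"
    if "c \<in> Aw (wtw (wd S) + wtw (wd T))" "c' \<in> Aw (wtw (wd S) + wtw (wd T))" "i < n T" for c c' S T i
  proof (rule nf_inj)
    fix s show "nf (U (c + c') S T i) s = nf (U c S T i \<oplus>\<^bsub>RR\<^esub> U c' S T i) s"
      unfolding nf_hom[OF Uc[OF that(1,3)] Uc[OF that(2,3)]] unfolding U_def nf_mk[OF kG[OF Aw_add[OF that(1,2)] that(3)]]
        nf_mk[OF kG[OF that(1,3)]] nf_mk[OF kG[OF that(2,3)]] by (simp add: k_def distrib_right)
  qed (use Uc[OF Aw_add[OF that(1,2)] that(3)] Uc[OF that(1,3)] Uc[OF that(2,3)] in auto)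
  have nfA: "nf c (jn S T) \<in> Aw (wtw (wd S) + wtw (wd T))" if "c \<in> carrier RR" "S \<in> PT" "T \<in> MS" for c S T
    using GG_D(1)[OF nf_GG[OF that(1)], of "jn S T"] jn_simps(3)[of S T] that(2,3) by (simp add: PT_def MS_def)
  \<comment> \<open>The candidate inverse, sending c e_S e_T to the sum of the tensors c e_S x_i
    \<otimes> y_i e_T.\<close>
  define \<psi> where "\<psi> c = (\<Sum>T\<in>MS. \<Sum>i<n T. \<Sum>S\<in>PT. frag_of (U (nf c (jn S T)) S T i, L T i))" for c
  show ?thesis
  proof (rule B.mult_map_iso[where \<psi>=\<psi>, OF CC_additive])
    show "x \<otimes>\<^bsub>RR\<^esub> y \<in> CC (a, b)" if "x \<in> CC (a, 0)" "y \<in> CC (0, b)" for x y using CC_mult[OF that] by simp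
  next
    fix c assume "c \<in> CC (a, b)"
    then obtain x where x: "x \<in> CF" "SP a b x" "c = mpc x" using CC_SP by blast
    from x(2) have "x \<in> CF \<and> (\<exists>z. Poly_Mapping.keys z \<subseteq> CC (a, 0) \<times> CC (0, b) \<and> B.mm z = mpc x)"
    proof (induction rule: SP.induct)
      case SP_0
      have "\<exists>z. Poly_Mapping.keys z \<subseteq> CC (a, 0) \<times> CC (0, b) \<and> B.mm z = mpc 0"
        using B.mm_0 mpc_simps(5)[OF CF_intros(3)] by (intro exI[of _ 0]) simp
      then show ?case by simp
    next
      case (SP_add x x')
      then obtain z z' where z: "Poly_Mapping.keys z \<subseteq> CC (a, 0) \<times> CC (0, b)" "B.mm z = mpc x"
        "Poly_Mapping.keys z' \<subseteq> CC (a, 0) \<times> CC (0, b)" "B.mm z' = mpc x'" "x \<in> CF" "x' \<in> CF" by blast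
      have "Poly_Mapping.keys (z + z') \<subseteq> CC (a, 0) \<times> CC (0, b)" using Poly_Mapping.keys_add[of z z'] z by blast
      moreover have "B.mm (z + z') = mpc (x + x')" using B.mm_add[OF z(1,3)] z mpc_simps(2)[OF z(5,6)] by simp
      ultimately show ?case using z(5,6) CF_intros(5) by blast
    next
      case (SP_mult p r)
      then have c: "p \<in> CF" "r \<in> CF" "mpc p \<in> CC (a, 0)" "mpc r \<in> CC (0, b)" using HW_CF by (auto simp: CC_def)
      have "Poly_Mapping.keys (frag_of (mpc p, mpc r)) \<subseteq> CC (a, 0) \<times> CC (0, b)" using c by simp
      moreover have "B.mm (frag_of (mpc p, mpc r)) = mpc (p * r)" using B.mm_frag[OF c(3,4)] mpc_simps(3)[OF c(1,2)] by simp
      ultimately show ?case using c CF_intros(6) by blast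
    qed
    then show "\<exists>z. Poly_Mapping.keys z \<subseteq> CC (a, 0) \<times> CC (0, b) \<and> B.mm z = c" using x(3) by blast
  next
    fix c c' assume c: "c \<in> CC (a, b)" "c' \<in> CC (a, b)"
    then have cc: "c \<in> carrier RR" "c' \<in> carrier RR" by (auto simp: CC_eq)
    have "B.E (\<psi> (c \<oplus>\<^bsub>RR\<^esub> c')) (\<Sum>T\<in>MS. \<Sum>i<n T. \<Sum>S\<in>PT. frag_of (U (nf c (jn S T)) S T i, L T i) + frag_of (U (nf c' (jn S T)) S T i, L T i))"
      unfolding \<psi>_def
    proof (intro B.E_sum)
      fix T i S assume h: "T \<in> MS" "i \<in> {..<n T}" "S \<in> PT"
      then have i: "i < n T" by simp
      note A = nfA[OF cc(1) h(3,1)] nfA[OF cc(2) h(3,1)]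
      show "B.E (frag_of (U (nf (c \<oplus>\<^bsub>RR\<^esub> c') (jn S T)) S T i, L T i)) (frag_of (U (nf c (jn S T)) S T i, L T i) + frag_of (U (nf c' (jn S T)) S T i, L T i))"
        unfolding nf_hom[OF cc] U_add[OF A i] by (intro B.E1 UP A i h LQ)
    qed
    then show "B.E (\<psi> (c \<oplus>\<^bsub>RR\<^esub> c')) (\<psi> c + \<psi> c')" by (simp add: \<psi>_def sum.distrib)
  next
    fix p y assume p: "p \<in> CC (a, 0)" and y: "y \<in> CC (0, b)"
    obtain p0 where p0: "HW WP a 0 p0" "p = mpc p0" using p by (auto simp: CC_def)
    have pc: "p0 \<in> CF" by (rule HW_CF[OF p0(1)])
    have yc: "y \<in> carrier RR" using y by (simp add: CC_eq)
    then obtain y0 where y0: "y0 \<in> CF" "y = mpc y0" "nf y = rho y0 \<xi>0" by (rule RR_cases)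
    define g where "g = nf y"
    have gG: "g \<in> GG" unfolding g_def by (rule nf_GG[OF yc])
    have gA: "g T \<in> Aw (wtw (wd T))" for T by (rule GG_D(1)[OF gG])
    have gM: "T \<in> MS" if "g T \<noteq> 0" for T using y that by (auto simp: CC_eq g_def MS_def)
    have g_sum: "g = (\<lambda>s. \<Sum>T\<in>MS. ds T (g T) s)"
    proof
      fix s
      have "(\<Sum>T\<in>MS. ds T (g T) s) = (\<Sum>T\<in>MS. if T = s then g T else 0)" by (rule sum.cong) (auto simp: ds_def)
      also have "\<dots> = g s" using gM[of s] fin(1) by (auto simp: sum.delta)
      finally show "g s = (\<Sum>T\<in>MS. ds T (g T) s)" by simp
    qed
    \<comment> \<open>Since p does not see the second half, the coefficient of py at e_S e_T equals
      that of p g_T at e_S.\<close>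
    define F where "F T = rho p0 (ds e0 (g T))" for T
    have nfp: "nf (p \<otimes>\<^bsub>RR\<^esub> y) (jn S T) = F T S" if "S \<in> PT" "T \<in> MS" for S T
    proof -
      have "nf (p \<otimes>\<^bsub>RR\<^esub> y) (jn S T) = rho p0 g (jn S T)"
        unfolding p0(2) y0(2) mpc_simps(3)[OF pc y0(1), symmetric] nf_mpc[OF CF_intros(6)[OF pc y0(1)]] rho_mult
        using y0 g_def by simp
      also have "\<dots> = (\<Sum>T'\<in>MS. rho p0 (ds T' (g T')) (jn S T))" by (subst g_sum) (rule rho_sum_arg)
      also have "\<dots> = (\<Sum>T'\<in>MS. if T' = T then F T S else 0)"
      proof (rule sum.cong[OF refl])
        fix T' assume "T' \<in> MS"
        then have "rho p0 (ds T' (g T')) (jn S T) = sh T' (F T') (jn S T)"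
          using ds_sh[of T'] rho_sh[OF p0(1) refl] by (simp add: F_def MS_def)
        then show "rho p0 (ds T' (g T')) (jn S T) = (if T' = T then F T S else 0)"
          using jn_simps[of S T] that by (auto simp: sh_def PT_def MS_def)
      qed
      also have "\<dots> = F T S" using that(2) fin by simp
      finally show ?thesis .
    qed
    have pyc: "p \<otimes>\<^bsub>RR\<^esub> y \<in> carrier RR" using CC_mult[OF p y] by (simp add: CC_eq)
    have FA: "F T S \<in> Aw (wtw (wd S) + wtw (wd T))" if "S \<in> PT" "T \<in> MS" for S T
      using nfA[OF pyc that] nfp[OF that] by simp
    have F0: "F T S = 0" if "S \<notin> PT" for S T
    proof (rule ccontr)
      assume "F T S \<noteq> 0"
      from rho_HW[OF p0(1) ds_e0_deg this[unfolded F_def]] show False using that by (simp add: PT_def)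
    qed
    have gX: "g T * X T i \<in> Aw 0" if "i < n T" for T i by (rule Aw_mult'[OF gA XA[OF that]]) simp
    \<comment> \<open>The sum over S of F_{T,S} e_S x_i is p g_T multiplied by x_i from the right,
      and right multiplication commutes with the action of p.\<close>
    have fU: "finsum RR (\<lambda>S. U (F T S) S T i) PT = p \<otimes>\<^bsub>RR\<^esub> mpc (LB (g T * X T i))" if "T \<in> MS" "i < n T" for T i
    proof (rule nf_inj)
      have m: "p0 * LB (g T * X T i) \<in> CF" using pc gX[OF that(2)] by auto
      have e: "p \<otimes>\<^bsub>RR\<^esub> mpc (LB (g T * X T i)) = mpc (p0 * LB (g T * X T i))"
        unfolding p0(2) using mpc_simps(3)[OF pc] gX[OF that(2)] by auto
      have c: "U (F T S) S T i \<in> carrier RR" if "S \<in> PT" for S using Uc[OF FA[OF that \<open>T \<in> MS\<close>] \<open>i < n T\<close>] .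
      show "finsum RR (\<lambda>S. U (F T S) S T i) PT \<in> carrier RR" using c by (intro B.finsum_closed) auto
      show "p \<otimes>\<^bsub>RR\<^esub> mpc (LB (g T * X T i)) \<in> carrier RR" unfolding e by (rule mpc_simps(1)[OF m])
      fix s
      have "nf (finsum RR (\<lambda>S. U (F T S) S T i) PT) s = (\<Sum>S\<in>PT. nf (U (F T S) S T i) s)" by (rule nf_finsum[OF fin(2) c])
      also have "\<dots> = (\<Sum>S\<in>PT. F T S * rhoW (wd S) (ds e0 (X T i)) s)"
        unfolding U_def by (rule sum.cong[OF refl]) (simp add: nf_mk[OF kG[OF FA[OF _ that(1)] that(2)]], simp add: k_def)
      also have "\<dots> = RX (X T i) (F T) s" unfolding RX_def by (rule sum.mono_neutral_left) (auto simp: F0)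
      also have "\<dots> = rho p0 (ds e0 (g T * X T i)) s" unfolding F_def
        using rho_RX[OF pc, of "X T i" "ds e0 (g T)" s] Aw_UU[OF XA[OF that(2)]] Aw_UU[OF gA[of T]] by (simp add: RX_e0 ds_UU)
      also have "\<dots> = nf (p \<otimes>\<^bsub>RR\<^esub> mpc (LB (g T * X T i))) s"
      proof -
        have "rho (LB (g T * X T i)) \<xi>0 = ds e0 (g T * X T i)" by (rule ext) (simp add: rho_LB ds_def)
        then show ?thesis unfolding e nf_mpc[OF m] rho_mult by simp
      qed
      finally show "nf (finsum RR (\<lambda>S. U (F T S) S T i) PT) s = nf (p \<otimes>\<^bsub>RR\<^esub> mpc (LB (g T * X T i))) s" .
    qed
    define s' where "s' T i = mpc (LB (g T * X T i))" for T i
    have s'S: "s' T i \<in> mp0 cF ` OF3 q" if "i < n T" for T i unfolding s'_def S using gX[OF that] by blast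
    define M where "M T = mpc (LL (g T) (wd T))" for T
    have MQ: "M T \<in> CC (0, b)" if "T \<in> MS" for T
      using HW_wd[OF gA[of T]] that unfolding M_def CC_def MS_def by auto
    have fL: "finsum RR (\<lambda>i. s' T i \<otimes>\<^bsub>RR\<^esub> L T i) {..<n T} = M T" for T
    proof -
      have c: "LB (g T * X T i) \<in> CF" "LL (Y T i) (wd T) \<in> CF" if "i < n T" for i using gX[OF that] YA[OF that] by auto
      have "finsum RR (\<lambda>i. s' T i \<otimes>\<^bsub>RR\<^esub> L T i) {..<n T} = finsum RR (\<lambda>i. mpc (LB (g T * X T i) * LL (Y T i) (wd T))) {..<n T}"
        by (rule B.finsum_cong') (use c in \<open>auto simp: s'_def L_def mpc_simps(3) mpc_simps(1)\<close>)
      also have "\<dots> = mpc (\<Sum>i<n T. LB (g T * X T i) * LL (Y T i) (wd T))" using c by (intro mpc_sum[symmetric]) auto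
      also have "\<dots> = mpc (LL (g T) (wd T))"
      proof -
        have "(\<Sum>i<n T. LB (g T * X T i) * LL (Y T i) (wd T)) \<doteq> (\<Sum>i<n T. LL (g T * X T i * Y T i) (wd T))"
          by (intro eqv_sum eqv_sym[OF LL_lact] gX YA) auto
        also have "\<dots> \<doteq> LL (\<Sum>i<n T. g T * X T i * Y T i) (wd T)"
        proof (rule eqv_sym[OF LL_sum])
          fix i assume "i \<in> {..<n T}"
          then show "g T * X T i * Y T i \<in> Aw (wtw (wd T))" using Aw_mult'[OF gX YA, of i T i T] by simp
        qed
        also have "(\<Sum>i<n T. g T * X T i * Y T i) = g T" using XY1[of T] by (simp add: mult.assoc flip: sum_distrib_left)
        finally show ?thesis by (simp add: eqv_mpc)
      qed
      finally show ?thesis by (simp add: M_def)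
    qed
    have fM: "finsum RR M MS = y"
    proof (rule nf_inj)
      have c: "M T \<in> carrier RR" for T unfolding M_def by (rule mpc_simps(1)[OF LL_CF[OF gA]])
      show "finsum RR M MS \<in> carrier RR" using c by (intro B.finsum_closed) auto
      fix s
      have "nf (finsum RR M MS) s = (\<Sum>T\<in>MS. nf (M T) s)" by (rule nf_finsum[OF fin(1) c])
      also have "\<dots> = (\<Sum>T\<in>MS. ds T (g T) s)" unfolding M_def nf_mpc[OF LL_CF[OF gA]] rho_LL_wd[OF gA] ..
      also have "\<dots> = nf y s" using fun_cong[OF g_sum, of s] by (simp add: g_def)
      finally show "nf (finsum RR M MS) s = nf y s" .
    qed (rule yc)
    have "\<psi> (p \<otimes>\<^bsub>RR\<^esub> y) = (\<Sum>T\<in>MS. \<Sum>i<n T. \<Sum>S\<in>PT. frag_of (U (F T S) S T i, L T i))"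
      unfolding \<psi>_def by (intro sum.cong refl) (simp add: nfp)
    also have "B.E \<dots> (\<Sum>T\<in>MS. \<Sum>i<n T. frag_of (p \<otimes>\<^bsub>RR\<^esub> s' T i, L T i))"
    proof (intro B.E_sum)
      fix T i assume h: "T \<in> MS" "i \<in> {..<n T}"
      then have i: "i < n T" by simp
      have u: "U (F T S) S T i \<in> CC (a, 0)" if "S \<in> PT" for S by (rule UP[OF FA[OF that h(1)] i that])
      have "B.E (frag_of (finsum RR (\<lambda>S. U (F T S) S T i) PT, L T i)) (\<Sum>S\<in>PT. frag_of (U (F T S) S T i, L T i))"
        using B.E1_sum[of PT "\<lambda>S. U (F T S) S T i" "L T i", OF fin(2) u LQ[OF i h(1)]] by blast
      then show "B.E (\<Sum>S\<in>PT. frag_of (U (F T S) S T i, L T i)) (frag_of (p \<otimes>\<^bsub>RR\<^esub> s' T i, L T i))"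
        unfolding fU[OF h(1) i] s'_def by (rule B.E_sym)
    qed
    \<comment> \<open>The balancing relation moves g_T x_i, an element of B, from the left factor to
      the right one.\<close>
    also have "B.E \<dots> (\<Sum>T\<in>MS. \<Sum>i<n T. frag_of (p, s' T i \<otimes>\<^bsub>RR\<^esub> L T i))"
      by (intro B.E_sum B.E3 p s'S LQ) auto
    also have "B.E \<dots> (\<Sum>T\<in>MS. frag_of (p, M T))"
    proof (rule B.E_sum)
      fix T assume T: "T \<in> MS"
      have w: "s' T i \<otimes>\<^bsub>RR\<^esub> L T i \<in> CC (0, b)" if "i \<in> {..<n T}" for i
      proof -
        have i: "i < n T" using that by simp
        show ?thesis by (rule B.SQ[OF s'S[OF i] LQ[OF i T]])
      qed
      have "B.E (frag_of (p, finsum RR (\<lambda>i. s' T i \<otimes>\<^bsub>RR\<^esub> L T i) {..<n T})) (\<Sum>i<n T. frag_of (p, s' T i \<otimes>\<^bsub>RR\<^esub> L T i))"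
        using B.E2_sum[of "{..<n T}" "\<lambda>i. s' T i \<otimes>\<^bsub>RR\<^esub> L T i" p, OF finite_lessThan w p] by blast
      then show "B.E (\<Sum>i<n T. frag_of (p, s' T i \<otimes>\<^bsub>RR\<^esub> L T i)) (frag_of (p, M T))" unfolding fL by (rule B.E_sym)
    qed
    also have "B.E \<dots> (frag_of (p, y))"
      using B.E_sym[OF conjunct2[OF B.E2_sum[of MS M p, OF fin(1) MQ p]]] unfolding fM .
    finally show "B.E (frag_of (p, y)) (\<psi> (p \<otimes>\<^bsub>RR\<^esub> y))" by (rule B.E_sym)
  qed
qed

end

section \<open>Both factorisations\<close>

context qord
begin

text \<open>Negating \<open>s1\<close> and \<open>s2\<close> exchanges the halves, so its components
  are those of the given order with the indices swapped. Its factorisation, first half on the left,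
  is the second isomorphism required here.\<close>

lemma extends_WP: "extends_to_factorisable q WP (- WP)"
proof -
  interpret O: qord q "\<not> s1" "\<not> s2" by unfold_locales
  have W: "O.WP = - WP"
  proof -
    have "d \<in> O.WP \<longleftrightarrow> d \<notin> WP" for d
      unfolding O.WP_def O.ltr_defs WP_def ltr_defs by (rule cot_cases[of d]; cases s1; cases s2; simp)
    then show ?thesis by blast
  qed
  have "HW (- WP) b a p \<longleftrightarrow> HW WP a b p" for a b p using HW_swap[of WP a b p] HW_swap[of "- WP" b a p] by auto
  then have C: "O.CC (b, a) = CC (a, b)" for a b by (simp add: O.CC_def CC_def W)
  have "factorisable RR (mp0 cF ` OF3 q) CC"
    unfolding factorisable_def using mult_map_CC O.mult_map_CC unfolding C by blast
  then show ?thesis unfolding extends_to_factorisable_def using almost_complex_CC CC_10 by blast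
qed

end

theorem corollary5p4:
  fixes q :: real
  assumes "q \<notin> {-1, 0, 1}"
  shows "extends_to_factorisable q {ec R1, ec R2, ec R12} {fc R1, fc R2, fc R12} \<and>
         extends_to_factorisable q {ec R1, fc R2, ec R12} {fc R1, ec R2, fc R12}"
proof -
  \<comment> \<open>In (I) the first half is e_1, e_2, e_12; (II) differs only by exchanging e_2 and
    f_2, the choice recorded by \<open>s2\<close>.\<close>
  interpret I: qord q True True by unfold_locales (use assms in auto)
  interpret II: qord q True False by unfold_locales
  have c: "d \<in> {ec R1, ec R2, ec R12, fc R1, fc R2, fc R12}" for d using UNIV_I[of d] unfolding I.UNIV_cot .
  have 1: "I.WP = {ec R1, ec R2, ec R12}" "- I.WP = {fc R1, fc R2, fc R12}"
    using c by (auto simp: I.WP_def I.ltr_defs)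
  have 2: "II.WP = {ec R1, fc R2, ec R12}" "- II.WP = {fc R1, ec R2, fc R12}"
    using c by (auto simp: II.WP_def II.ltr_defs)
  show ?thesis
    by (rule conjI[OF I.extends_WP[unfolded 1(2), unfolded 1(1)] II.extends_WP[unfolded 2(2), unfolded 2(1)]])
qed

end
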